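(* Let $D=\sum_{i=1}^n\beta_ip_i$ be a supercritical divisor on $S^2$ with $-1<\beta_1\le\cdots\le\beta_n\le0$, and let $(S^2,D,g)$ be a conic sphere. Let $\beta:=\beta_1=\min_i\beta_i$ and $\alpha:=|D|-\min_i\beta_i$, where $|D|=\sum_i\beta_i$. Suppose the Gaussian curvature of $g$ satisfies $0<a\le K_g\le b$. Then $$\frac ab\le\frac{(\beta+1)^2}{(\alpha+1)^2}.$$ Equality holds if and only if $(S^2,D,g)$ is isometric to $(\mathbb{C}\cup\{\infty\},\ \alpha\,0+\beta\,\infty,\ e^{2u}g_0)$, where $g_0=|dz|^2$ and $$e^{2u}=\begin{cases}\dfrac1b\,\dfrac{4(1+\alpha)^2|z|^{2\alpha}}{(1+|z|^{2(1+\alpha)})^2}, & |z|\le1,\\[3mm] \dfrac1a\,\dfrac{4(1+\beta)^2}{\left(1+\frac1{|z|^{2+2\beta}}\right)^2|z|^{4+2\beta}}, & |z|\ge1.\end{cases}$$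
   Context: A metric $g$ on a closed Riemann surface has a conic singularity of order $\beta>-1$ at $p$ if, in a local holomorphic coordinate $z$ centered at $p$, $g=e^{2u}|z|^{2\beta}|dz|^2$ with $u$ continuous and $C^2$ away from $p$. A metric represents the divisor $D=\sum\beta_ip_i$ if it has conic singularities of order $\beta_i$ at $p_i$ and is smooth elsewhere; $(S^2,D,g)$ is then a conic sphere. $D$ is supercritical if $|D|>2\min_i\beta_i$. $K_g$ is the Gaussian curvature away from the conic points. An order-$0$ point is a smooth point. The model metric is of class $C^{1,1}$ across $|z|=1$ when $a/b=(\beta+1)^2/(\alpha+1)^2$. *)

theory Defs
  imports "HOL-Analysis.Analysis"
begin

section \<open>The Riemann sphere\<close>

text \<open>
  \<open>S\<^sup>2\<close> is the Riemann sphere \<open>\<complex> \<union> {\<infinity>}\<close>, with \<open>\<infinity> = None\<close>.  \<open>coord p\<close> is the standard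
  holomorphic coordinate around \<open>p\<close> and \<open>param p\<close> is its inverse: the coordinate is \<open>z\<close> if
  \<open>p\<close> is finite and \<open>w = 1/z\<close> if \<open>p = \<infinity>\<close>.  The value of \<open>coord p\<close> at the one point outside
  the domain of the coordinate is irrelevant.
\<close>

type_synonym sphere = "complex option"

definition sphere_top :: "sphere topology" where
  "sphere_top = Alexandroff_compactification (euclidean :: complex topology)"

definition coord :: "sphere \<Rightarrow> sphere \<Rightarrow> complex" where
  "coord p q =
     (case p of
        Some _ \<Rightarrow> (case q of Some z \<Rightarrow> z | None \<Rightarrow> 0)
      | None \<Rightarrow> (case q of Some z \<Rightarrow> 1 / z | None \<Rightarrow> 0))"

definition param :: "sphere \<Rightarrow> complex \<Rightarrow> sphere" where
  "param p z =
     (case p of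
        Some _ \<Rightarrow> Some z
      | None \<Rightarrow> (if z = 0 then None else Some (1 / z)))"


section \<open>Conformal metrics with conic singularities\<close>

text \<open>
  A conformal metric is represented by a function \<open>g\<close> on the sphere: \<open>g (Some z)\<close> is the
  coefficient of \<open>|dz|\<^sup>2\<close> at \<open>z\<close>, and \<open>g None\<close> is the coefficient of \<open>|dw|\<^sup>2\<close> at \<open>\<infinity>\<close>,
  where \<open>w = 1/z\<close>.  The values of \<open>g\<close> at conic points play no role.  \<open>density g p\<close> is the
  coefficient of the metric in the coordinate around \<open>p\<close>; for \<open>p = \<infinity>\<close> it comes from
  \<open>|dz|\<^sup>2 = |w|\<^sup>-\<^sup>4 |dw|\<^sup>2\<close>.
\<close>

type_synonym metric_coeff = "sphere \<Rightarrow> real"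

definition density :: "metric_coeff \<Rightarrow> sphere \<Rightarrow> complex \<Rightarrow> real" where
  "density g p z =
     (case p of
        Some _ \<Rightarrow> g (Some z)
      | None \<Rightarrow> (if z = 0 then g None else g (Some (1 / z)) / cmod z ^ 4))"

text \<open>
  Metrics are required to be of class \<open>C\<^sup>1\<^sup>,\<^sup>1\<close> (locally) away from the conic points.  This
  includes all metrics that are smooth, or \<open>C\<^sup>2\<close>, there (see \<open>C2_imp_C11_on\<close> below), and it
  is the class that contains the extremal metric \<open>model_metric\<close>, whose curvature jumps from
  \<open>b\<close> to \<open>a\<close> across \<open>|z| = 1\<close>.  Among \<open>C\<^sup>2\<close> metrics equality would never be attained.
\<close>

definition C11_on :: "complex set \<Rightarrow> (complex \<Rightarrow> real) \<Rightarrow> bool" where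
  "C11_on U f \<longleftrightarrow>
     (\<exists>G. (\<forall>z\<in>U. GDERIV f z :> G z) \<and>
          (\<forall>z\<in>U. \<exists>r>0. \<exists>L. L-lipschitz_on (cball z r \<inter> U) G))"

lemma C2_imp_C11_on:
  fixes f :: "complex \<Rightarrow> real" and H :: "complex \<Rightarrow> complex \<Rightarrow>\<^sub>L complex"
  assumes "open U"
    and "\<And>z. z \<in> U \<Longrightarrow> GDERIV f z :> G z"
    and "\<And>z. z \<in> U \<Longrightarrow> (G has_derivative blinfun_apply (H z)) (at z)"
    and "continuous_on U H"
  shows "C11_on U f"
proof -
  have "continuous_on (UNIV \<times> U) (\<lambda>x :: real \<times> complex. H (snd x))"
    by (rule continuous_on_compose2[OF assms(4)]) (auto intro: continuous_intros)
  then have "local_lipschitz (UNIV :: real set) U (\<lambda>_. G)"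
    using assms by (intro c1_implies_local_lipschitz[where f' = "\<lambda>x. H (snd x)"]) auto
  then have "\<forall>z\<in>U. \<exists>r>0. \<exists>L. L-lipschitz_on (cball z r \<inter> U) G"
    unfolding local_lipschitz_def by (metis UNIV_I Int_UNIV_right centre_in_cball less_imp_le)
  then show ?thesis
    unfolding C11_on_def using assms(2) by blast
qed

definition regular_at :: "(complex \<Rightarrow> real) \<Rightarrow> complex \<Rightarrow> bool" where
  "regular_at \<rho> c \<longleftrightarrow>
     (\<exists>U. open U \<and> c \<in> U \<and> (\<forall>z\<in>U. \<rho> z > 0) \<and> C11_on U (\<lambda>z. ln (\<rho> z)))"

text \<open>
  \<open>\<zeta>\<close> is a local holomorphic coordinate centered at \<open>c\<close>, and the metric is
  \<open>e\<^sup>2\<^sup>u |\<zeta>|\<^sup>2\<^sup>\<beta> |d\<zeta>|\<^sup>2\<close> with \<open>d\<zeta> = \<zeta>' dz\<close>.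
\<close>

definition conic_at :: "(complex \<Rightarrow> real) \<Rightarrow> complex \<Rightarrow> real \<Rightarrow> bool" where
  "conic_at \<rho> c \<beta> \<longleftrightarrow> \<beta> > -1 \<and>
     (\<exists>U \<zeta> u. open U \<and> c \<in> U \<and> \<zeta> holomorphic_on U \<and> inj_on \<zeta> U \<and> \<zeta> c = 0 \<and>
        continuous_on U u \<and> C11_on (U - {c}) u \<and>
        (\<forall>z\<in>U - {c}. \<rho> z = exp (2 * u z) * cmod (\<zeta> z) powr (2 * \<beta>) * (cmod (deriv \<zeta> z))\<^sup>2))"

text \<open>
  A divisor is given by the function assigning to each point its order; a point of order \<open>0\<close>
  is a regular point of the metric.
\<close>

definition divisor :: "nat \<Rightarrow> (nat \<Rightarrow> real) \<Rightarrow> (nat \<Rightarrow> sphere) \<Rightarrow> sphere \<Rightarrow> real" where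
  "divisor n \<beta> p q = (\<Sum>i\<in>{1..n}. if p i = q then \<beta> i else 0)"

definition conic_sphere :: "(sphere \<Rightarrow> real) \<Rightarrow> metric_coeff \<Rightarrow> bool" where
  "conic_sphere D g \<longleftrightarrow>
     (\<forall>p. (D p = 0 \<longrightarrow> regular_at (density g p) (coord p p)) \<and>
          (D p \<noteq> 0 \<longrightarrow> conic_at (density g p) (coord p p) (D p)))"

definition supercritical :: "nat \<Rightarrow> (nat \<Rightarrow> real) \<Rightarrow> bool" where
  "supercritical n \<beta> \<longleftrightarrow> (\<Sum>i\<in>{1..n}. \<beta> i) > 2 * Min (\<beta> ` {1..n})"


section \<open>Gaussian curvature\<close>

definition laplacian :: "(complex \<Rightarrow> real) \<Rightarrow> complex \<Rightarrow> real" where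
  "laplacian f z =
     (deriv ^^ 2) (\<lambda>t. f (z + of_real t)) 0 + (deriv ^^ 2) (\<lambda>t. f (z + \<i> * of_real t)) 0"

text \<open>
  With \<open>\<rho> = g (Some z)\<close>, i.e. \<open>g = \<rho> |dz|\<^sup>2\<close>, the curvature is \<open>K = - \<Delta> (ln \<rho>) / (2 \<rho>)\<close>.
  For a \<open>C\<^sup>1\<^sup>,\<^sup>1\<close> metric the second derivatives exist almost everywhere (Rademacher), so bounds
  on \<open>K\<close> are to be imposed almost everywhere; for a \<open>C\<^sup>2\<close> metric \<open>K\<close> is continuous and this
  is the same as imposing them at all non-conic points.
\<close>

definition gauss_curvature :: "metric_coeff \<Rightarrow> complex \<Rightarrow> real" where
  "gauss_curvature g z = - laplacian (\<lambda>z. ln (g (Some z))) z / (2 * g (Some z))"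


section \<open>Isometries and the model metric\<close>

text \<open>
  An isometry of conic spheres is a homeomorphism that respects the divisors and is, off the
  conic points, a \<open>C\<^sup>1\<close> diffeomorphism pulling back one Riemannian metric to the other.
  It may preserve or reverse orientation.  The metrics at \<open>q\<close> and \<open>F q\<close> in the coordinates
  around these points are \<open>g q\<close> and \<open>g' (F q)\<close> times the Euclidean metric.
\<close>

definition conic_isometry ::
    "(sphere \<Rightarrow> real) \<Rightarrow> metric_coeff \<Rightarrow> (sphere \<Rightarrow> real) \<Rightarrow> metric_coeff \<Rightarrow> (sphere \<Rightarrow> sphere) \<Rightarrow> bool"
  where
  "conic_isometry D g D' g' F \<longleftrightarrow>
     homeomorphic_map sphere_top sphere_top F \<and>
     (\<forall>q. D' (F q) = D q) \<and>
     (\<forall>q. D q = 0 \<longrightarrow>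
        (\<exists>U L. open U \<and> coord q q \<in> U \<and>
           (\<forall>z\<in>U. ((\<lambda>z. coord (F q) (F (param q z))) has_derivative blinfun_apply (L z)) (at z)) \<and>
           continuous_on U L \<and>
           (\<forall>v. g' (F q) * (cmod (blinfun_apply (L (coord q q)) v))\<^sup>2 = g q * (cmod v)\<^sup>2)))"

definition isometric ::
    "(sphere \<Rightarrow> real) \<Rightarrow> metric_coeff \<Rightarrow> (sphere \<Rightarrow> real) \<Rightarrow> metric_coeff \<Rightarrow> bool" where
  "isometric D g D' g' \<longleftrightarrow> (\<exists>F. conic_isometry D g D' g' F)"

definition model_divisor :: "real \<Rightarrow> real \<Rightarrow> sphere \<Rightarrow> real" where
  "model_divisor \<alpha> \<beta> q = (if q = Some 0 then \<alpha> else if q = None then \<beta> else 0)"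

text \<open>
  In Isabelle \<open>0 powr 0 = 0\<close>, so \<open>|z|\<^sup>2\<^sup>\<alpha> = 1\<close> for \<open>\<alpha> = 0\<close> is treated separately: then
  \<open>z = 0\<close> is a regular point.  The point \<open>\<infinity>\<close> is conic whenever \<open>\<beta> \<noteq> 0\<close>, and the value there
  is a dummy.
\<close>

definition model_metric :: "real \<Rightarrow> real \<Rightarrow> real \<Rightarrow> real \<Rightarrow> metric_coeff" where
  "model_metric a b \<alpha> \<beta> q =
     (case q of
        None \<Rightarrow> 0
      | Some z \<Rightarrow>
          if cmod z \<le> 1 then
            1 / b * (4 * (1 + \<alpha>)\<^sup>2 * (if \<alpha> = 0 then 1 else cmod z powr (2 * \<alpha>)) /
                     (1 + cmod z powr (2 * (1 + \<alpha>)))\<^sup>2)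
          else
            1 / a * (4 * (1 + \<beta>)\<^sup>2 /
                     ((1 + 1 / cmod z powr (2 + 2 * \<beta>))\<^sup>2 * cmod z powr (4 + 2 * \<beta>))))"

end

theory Submission
  imports Defs "HOL-Complex_Analysis.Complex_Analysis"
begin

text \<open>
  In a coordinate that puts the point of least order at \<open>\<infinity>\<close> the metric is \<open>exp(2V) |dz|\<^sup>2\<close> and
  \<open>- \<Delta>V = k exp(2V)\<close> weakly, with \<open>a \<le> k \<le> b\<close>. Let \<open>\<pi> A(t)\<close> be the area of \<open>{V > t}\<close> and
  \<open>2\<pi> (f(t) + \<alpha>)\<close> the integral of \<open>k exp(2V)\<close> over this set, so that \<open>2\<pi> f(t)\<close> is the flux of the
  gradient through its boundary; \<open>f\<close> runs from \<open>-\<alpha>\<close> to \<open>2 + \<beta>\<close>. The isoperimetric inequality gives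
  \<open>- f A' \<ge> 2A\<close>, and the curvature bounds compare \<open>df\<close> with \<open>exp(2t) dA\<close>, with the better constant \<open>b\<close> for
  \<open>f \<le> 1\<close> and \<open>a\<close> for \<open>f \<ge> 1\<close>. Hence \<open>exp(2t) A - \<Gamma>(f)\<close> is nonincreasing for
  \<open>\<Gamma>(f) = ((1+\<alpha>)\<^sup>2 - (1-f)\<^sup>2)/b\<close> resp. \<open>(1+\<alpha>)\<^sup>2/b - (f-1)\<^sup>2/a\<close>, it tends to \<open>0\<close> as \<open>t\<close> tends to \<open>\<infinity>\<close>,
  and its limit at \<open>-\<infinity>\<close> is \<open>(1+\<beta>)\<^sup>2/a - (1+\<alpha>)\<^sup>2/b\<close>. In the equality case all inequalities are equalities:
  \<open>A\<close> is explicit and \<open>|grad V| = f/sqrt A\<close>, so \<open>sqrt (A(V))\<close> is \<open>1\<close>-Lipschitz with sublevel sets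
  of area \<open>\<pi> r\<^sup>2\<close>; these must be concentric discs, and \<open>V\<close> is the model.
\<close>

section \<open>Lipschitz functions of one variable\<close>

text \<open>The metric is only of class C^{1,1}, and at a cone point its regular factor is only
  continuous. So the curvature equation holds almost everywhere, and no gradient bound is available
  near the cone points. Hence the weak form: Rademacher's theorem for the Lipschitz gradient,
  integration by parts through difference quotients, and cut-offs whose Laplacian has
  scale-invariant L^1 norm, which yield the fluxes at the poles. The isoperimetric step avoids
  coarea arguments: it is the inequality \<open>4 * pi * int phi^2 \<le> (int |grad phi|)^2\<close>,
  whose sharp constant comes from an identity for the Cauchy kernel and a second kernel of modulus
  at most 1. \<open>A\<close> and \<open>f\<close> might jump a priori, so all differential
  inequalities are stated as increments, and the errors telescope. Formally, \<open>isop\<close>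
  gives d(e^{2t} A) \<le> (1 - f) e^{2t} dA; the sign of 1 - f decides which curvature bound turns
  the right side into d(\<Gamma>(f)), and this is the origin of \<Gamma>. Nonpositive orders make V
  tend to infinity at the cone points, so truncated functions of V are constant there and can be
  used as test functions.\<close>

lemma real_density_of_expanding_lipschitz:
  fixes F :: "real \<Rightarrow> real"
  assumes lip: "L-lipschitz_on UNIV F"
    and expand: "\<And>x y. x \<le> y \<Longrightarrow> y - x \<le> F y - F x"
  obtains g where "\<And>x y. x \<le> y \<Longrightarrow> (g has_integral (F y - F x)) {x..y}"
proof -
  have cont: "continuous_on A F" for A
    using lipschitz_on_continuous_on[OF lip] continuous_on_subset by blast
  have smono: "x < y \<Longrightarrow> F x < F y" for x y
    using expand[of x y] by simp
  then have le_iff: "F x \<le> F y \<longleftrightarrow> x \<le> y" for x y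
    using linorder_le_less_linear[of x y] smono[of y x] by (metis linorder_not_le order_le_less)
  have inj: "inj F"
    by (rule injI) (metis le_iff order_antisym order_refl)
  have surj: "surj F"
  proof -
    have "\<exists>x. F x = y" for y
    proof -
      define r where "r = \<bar>y - F 0\<bar>"
      have "F (-r) \<le> y" "y \<le> F r" "-r \<le> r"
        using expand[of "-r" 0] expand[of 0 r] by (auto simp: r_def)
      then show ?thesis
        using IVT'[of F "-r" y r] cont by blast
    qed
    then show ?thesis by (metis surjI)
  qed
  define Fi where "Fi = inv F"
  have FFi: "F (Fi y) = y" for y by (simp add: Fi_def surj surj_f_inv_f)
  have FiF: "Fi (F x) = x" for x by (simp add: Fi_def inj)
  have Fi_mono: "x \<le> y \<Longrightarrow> Fi x \<le> Fi y" for x y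
    using le_iff[of "Fi x" "Fi y"] by (simp add: FFi)
  have Fi_lip: "1-lipschitz_on UNIV Fi"
  proof (rule lipschitz_onI)
    fix x y
    have *: "dist (Fi x) (Fi y) \<le> dist x y" if "x \<le> y" for x y
      using expand[OF Fi_mono[OF that]] Fi_mono[OF that] that by (simp add: dist_real_def FFi)
    show "dist (Fi x) (Fi y) \<le> 1 * dist x y"
      using *[of x y] *[of y x] by (cases "x \<le> y") (auto simp: dist_commute)
  qed simp
  have Fi_meas [measurable]: "Fi \<in> borel_measurable borel"
    by (intro borel_measurable_continuous_onI lipschitz_on_continuous_on[OF Fi_lip])
  \<comment> \<open>Pushing Lebesgue measure forward along the inverse gives each set the length of
    its image under \<open>F\<close>: the Stieltjes measure of \<open>F\<close>. Lipschitz images of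
    null sets are null, so it has a Radon-Nikodym density, whose integrals are the increments of
    \<open>F\<close>.\<close>
  define \<mu> where "\<mu> = distr lborel borel Fi"
  have mu_Icc: "emeasure \<mu> {x..y} = ennreal (F y - F x)" if "x \<le> y" for x y
  proof -
    have "Fi -` {x..y} = {F x..F y}"
    proof -
      have "Fi z \<in> {x..y} \<longleftrightarrow> z \<in> {F x..F y}" for z
        using le_iff[of x "Fi z"] le_iff[of "Fi z" y] by (simp add: FFi)
      then show ?thesis by blast
    qed
    then show ?thesis
      using le_iff[of x y] that by (simp add: \<mu>_def emeasure_distr)
  qed
  have ac: "absolutely_continuous lborel \<mu>"
    unfolding absolutely_continuous_def
  proof
    fix A assume A: "A \<in> null_sets (lborel :: real measure)"
    then have Ab: "A \<in> sets borel" by auto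
    have "Fi -` A = F ` A"
    proof (intro set_eqI iffI)
      fix z assume "z \<in> Fi -` A"
      then show "z \<in> F ` A" by (intro image_eqI[of _ _ "Fi z"]) (auto simp: FFi)
    qed (auto simp: FiF)
    have "negligible A" using A by (simp add: negligible_iff_null_sets null_sets_completionI)
    then have "negligible (F ` A)"
    proof (rule negligible_locally_Lipschitz_image[rotated])
      show "\<exists>T B. open T \<and> x \<in> T \<and> (\<forall>y \<in> A \<inter> T. norm (F y - F x) \<le> B * norm (y - x))" for x
        by (rule exI[of _ UNIV], rule exI[of _ L])
          (use lipschitz_onD[OF lip] in \<open>auto simp: dist_norm\<close>)
    qed simp
    then have "F ` A \<in> null_sets lebesgue" by (simp add: negligible_iff_null_sets)
    moreover have "F ` A \<in> sets borel"
      using \<open>Fi -` A = F ` A\<close> measurable_sets[OF Fi_meas Ab] by simp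
    ultimately have "emeasure lborel (F ` A) = 0"
      by (simp add: null_sets_completion_iff null_setsD1)
    then show "A \<in> null_sets \<mu>"
      using Ab \<open>Fi -` A = F ` A\<close> by (simp add: null_sets_def \<mu>_def emeasure_distr)
  qed
  obtain g where g [measurable]: "g \<in> borel_measurable lborel" and dens: "Nonnegative_Lebesgue_Integration.density lborel g = \<mu>"
    using sigma_finite_measure.Radon_Nikodym[OF lborel.sigma_finite_measure_axioms ac] by (auto simp: \<mu>_def)
  show thesis
  proof (rule that)
    fix x y :: real assume xy: "x \<le> y"
    have nn: "(\<integral>\<^sup>+z. g z * indicator {x..y} z \<partial>lborel) = ennreal (F y - F x)"
      using mu_Icc[OF xy] by (simp add: dens[symmetric] emeasure_density)
    then have "AE z in lborel. g z * indicator {x..y} z \<noteq> \<infinity>"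
      by (intro nn_integral_PInf_AE) (auto simp: ennreal_neq_top)
    then have "AE z in lborel. g z * indicator {x..y} z = ennreal (enn2real (g z) * indicator {x..y} z)"
      by eventually_elim (auto simp: indicator_def less_top)
    then have "(\<integral>\<^sup>+z. ennreal (enn2real (g z) * indicator {x..y} z) \<partial>lborel) = ennreal (F y - F x)"
      using nn nn_integral_cong_AE by fastforce
    then have "((\<lambda>z. enn2real (g z) * indicator {x..y} z) has_integral (F y - F x)) UNIV"
      by (intro nn_integral_has_integral) (use expand[OF xy] xy in auto)
    moreover have "(\<lambda>z. enn2real (g z) * indicator {x..y} z) = (\<lambda>z. if z \<in> {x..y} then enn2real (g z) else 0)"
      by (auto simp: indicator_def)
    ultimately show "((\<lambda>z. enn2real (g z)) has_integral (F y - F x)) {x..y}"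
      by (simp only: has_integral_restrict_UNIV)
  qed
qed

text \<open>Rademacher's theorem in one variable: up to a linear term the function is an indefinite
  integral, so Lebesgue's differentiation theorem applies.\<close>

lemma lipschitz_real_differentiable_AE:
  fixes f :: "real \<Rightarrow> real"
  assumes lip: "L-lipschitz_on UNIV f"
  obtains N where "negligible N" "\<And>x. x \<notin> N \<Longrightarrow> f differentiable (at x)"
proof -
  \<comment> \<open>The added slope \<open>L + 1\<close> beats the largest possible decrease of
    \<open>f\<close> and leaves increments of at least y - x.\<close>
  define F where "F x = f x + (L + 1) * x" for x
  have L0: "L \<ge> 0" using lip by (rule lipschitz_on_nonneg)
  have "(L + (L + 1))-lipschitz_on UNIV F"
    unfolding F_def
  proof (rule lipschitz_on_add[OF lip])
    show "(L + 1)-lipschitz_on UNIV (\<lambda>x. (L + 1) * x)"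
      using L0 by (intro lipschitz_onI) (auto simp: dist_real_def abs_mult simp flip: right_diff_distrib)
  qed
  moreover have "y - x \<le> F y - F x" if "x \<le> y" for x y
    using lipschitz_onD[OF lip, of x y] that by (auto simp: F_def dist_real_def algebra_simps)
  ultimately obtain g where g: "\<And>x y. x \<le> y \<Longrightarrow> (g has_integral (F y - F x)) {x..y}"
    using real_density_of_expanding_lipschitz by metis
  \<comment> \<open>The differentiation theorem is used for intervals to the right of a point; the
    reflected density supplies the left derivative.\<close>
  have gr: "((\<lambda>z. g (-z)) has_integral (F (-x) - F (-y))) {x..y}" if "x \<le> y" for x y
    using g[of "-y" "-x"] that has_integral_reflect_real[of g "F (-x) - F (-y)" "-x" "-y"] by simp
  have int_g: "g integrable_on cbox x y" for x y
    using g[of x y] by (cases "x \<le> y") (auto simp: integrable_on_def)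
  have int_gr: "(\<lambda>z. g (-z)) integrable_on cbox x y" for x y
    using gr[of x y] by (cases "x \<le> y") (auto simp: integrable_on_def)
  obtain N1 where N1: "negligible N1" "\<And>x e. x \<notin> N1 \<Longrightarrow> 0 < e \<Longrightarrow>
      \<exists>d>0. \<forall>h. 0 < h \<and> h < d \<longrightarrow> \<bar>integral {x..x + h} g / h - g x\<bar> < e"
    using integrable_ccontinuous_explicit[OF int_g] by (auto simp: divide_inverse mult.commute)
  obtain N2 where N2: "negligible N2" "\<And>x e. x \<notin> N2 \<Longrightarrow> 0 < e \<Longrightarrow>
      \<exists>d>0. \<forall>h. 0 < h \<and> h < d \<longrightarrow> \<bar>integral {x..x + h} (\<lambda>z. g (-z)) / h - g (-x)\<bar> < e"
    using integrable_ccontinuous_explicit[OF int_gr] by (auto simp: divide_inverse mult.commute)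
  show thesis
  proof (rule that)
    show "negligible (N1 \<union> uminus ` N2)"
      using N1(1) N2(1) by (intro negligible_Un negligible_differentiable_image_negligible)
        (auto intro!: derivative_intros simp: differentiable_on_def)
    fix x assume x: "x \<notin> N1 \<union> uminus ` N2"
    then have x1: "x \<notin> N1" and x2: "-x \<notin> N2" by force+
    have "((\<lambda>h. (F (x + h) - F x) / h) \<longlongrightarrow> g x) (at 0)"
    proof (rule LIM_I)
      fix e :: real assume e: "e > 0"
      from N1(2)[OF x1 e] obtain d1 where d1: "d1 > 0"
        "\<And>h. 0 < h \<Longrightarrow> h < d1 \<Longrightarrow> \<bar>integral {x..x + h} g / h - g x\<bar> < e" by blast
      from N2(2)[OF x2 e] obtain d2 where d2: "d2 > 0"
        "\<And>h. 0 < h \<Longrightarrow> h < d2 \<Longrightarrow> \<bar>integral {-x..-x + h} (\<lambda>z. g (-z)) / h - g x\<bar> < e" by auto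
      show "\<exists>s>0. \<forall>h. h \<noteq> 0 \<and> norm (h - 0) < s \<longrightarrow> norm ((F (x + h) - F x) / h - g x) < e"
      proof (intro exI[of _ "min d1 d2"] conjI allI impI)
        show "min d1 d2 > 0" using d1 d2 by simp
        fix h :: real assume h: "h \<noteq> 0 \<and> norm (h - 0) < min d1 d2"
        show "norm ((F (x + h) - F x) / h - g x) < e"
        proof (cases "h > 0")
          case True
          have "integral {x..x + h} g = F (x + h) - F x"
            using g[of x "x+h"] True by (simp add: integral_unique)
          then show ?thesis using d1(2)[of h] h True by auto
        next
          case False
          have "integral {-x..-x + (-h)} (\<lambda>z. g (-z)) = F x - F (x + h)"
            using gr[of "-x" "-x + (-h)"] False by (simp add: integral_unique add.commute)
          then have "integral {-x..-x + (-h)} (\<lambda>z. g (-z)) / (-h) = (F (x + h) - F x) / h"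
            using False h by (simp add: field_simps)
          then show ?thesis using d2(2)[of "-h"] h False by auto
        qed
      qed
    qed
    then have "DERIV F x :> g x" by (simp add: DERIV_def)
    then have "DERIV (\<lambda>y. F y - (L + 1) * y) x :> g x - (L + 1)"
      by (auto intro!: derivative_eq_intros)
    then show "f differentiable (at x)"
      unfolding real_differentiable_def by (auto simp: F_def)
  qed
qed

section \<open>Directional derivatives and integration by parts\<close>

text \<open>By translation invariance the measure of \<open>S\<close> equals its average over the
  shifts by t d with 0 \<le> t \<le> 1. After exchanging the integrals, the inner one measures a
  slice and vanishes. No coordinates adapted to \<open>d\<close> have to be chosen.\<close>

lemma null_set_if_null_slices:
  fixes S :: "'a::euclidean_space set"
  assumes [measurable]: "S \<in> sets borel"
    and slices: "\<And>z. negligible {t::real. z + t *\<^sub>R d \<in> S}"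
  shows "S \<in> null_sets lborel"
proof -
  have "(\<lambda>(t::real, z). z + t *\<^sub>R d) \<in> borel_measurable (lborel \<Otimes>\<^sub>M lborel)"
    by measurable
  from measurable_compose[OF this borel_measurable_indicator[OF assms(1)]]
  have meas: "(\<lambda>(t::real, z). indicator S (z + t *\<^sub>R d) :: ennreal) \<in> borel_measurable (lborel \<Otimes>\<^sub>M lborel)"
    by (simp add: case_prod_unfold)
  have meas': "(\<lambda>(t::real, z). indicator S (z + t *\<^sub>R d) * indicator {0..1::real} t :: ennreal)
      \<in> borel_measurable (lborel \<Otimes>\<^sub>M lborel)"
    using borel_measurable_times_ennreal[OF meas, of "\<lambda>(t, z). indicator {0..1::real} t"]
    by (simp add: case_prod_unfold)
  have shift: "(\<integral>\<^sup>+z. indicator S (z + t *\<^sub>R d) \<partial>lborel) = emeasure lborel S" for t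
  proof -
    have "(\<integral>\<^sup>+z. indicator S (z + t *\<^sub>R d) \<partial>lborel) = (\<integral>\<^sup>+z. indicator S z \<partial>distr lborel borel ((+) (t *\<^sub>R d)))"
      by (subst nn_integral_distr) (auto simp: add.commute)
    then show ?thesis by (simp add: lborel_distr_plus)
  qed
  have shift_meas: "(\<lambda>z. indicator S (z + t *\<^sub>R d) :: ennreal) \<in> borel_measurable borel" for t
    by (rule measurable_compose[OF _ borel_measurable_indicator[OF assms(1)]]) measurable
  have "emeasure lborel S = (\<integral>\<^sup>+t. emeasure lborel S * indicator {0..1::real} t \<partial>lborel)"
    by (simp add: nn_integral_cmult_indicator)
  also have "\<dots> = (\<integral>\<^sup>+t. (\<integral>\<^sup>+z. indicator S (z + t *\<^sub>R d) * indicator {0..1::real} t \<partial>lborel) \<partial>lborel)"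
    using shift_meas by (simp add: nn_integral_multc shift)
  also have "\<dots> = (\<integral>\<^sup>+z. (\<integral>\<^sup>+t. indicator S (z + t *\<^sub>R d) * indicator {0..1::real} t \<partial>lborel) \<partial>lborel)"
    by (rule lborel_pair.Fubini'[symmetric, OF meas'])
  also have "\<dots> = (\<integral>\<^sup>+z. 0 \<partial>(lborel :: 'a measure))"
  proof (rule nn_integral_cong)
    fix z
    have "{t::real. z + t *\<^sub>R d \<in> S} = (\<lambda>t. z + t *\<^sub>R d) -` S" by blast
    also have "\<dots> \<in> sets borel"
      using measurable_sets_borel[OF _ assms(1), of "\<lambda>t::real. z + t *\<^sub>R d"] by measurable
    finally have "{t::real. z + t *\<^sub>R d \<in> S} \<in> null_sets lborel"
      using slices[of z] by (simp add: negligible_iff_null_sets null_sets_completion_iff)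
    then have "AE t in lborel. t \<notin> {t::real. z + t *\<^sub>R d \<in> S}"
      by (rule AE_not_in)
    then have "AE t in lborel. indicator S (z + t *\<^sub>R d) * indicator {0..1::real} t = (0::ennreal)"
      by eventually_elim (simp add: indicator_def)
    then have "(\<integral>\<^sup>+t. indicator S (z + t *\<^sub>R d) * indicator {0..1::real} t \<partial>lborel) = (\<integral>\<^sup>+t. 0 \<partial>(lborel :: real measure))"
      by (rule nn_integral_cong_AE)
    then show "(\<integral>\<^sup>+t. indicator S (z + t *\<^sub>R d) * indicator {0..1::real} t \<partial>lborel) = 0"
      by simp
  qed
  also have "\<dots> = 0" by simp
  finally show ?thesis using assms(1) by (simp add: null_sets_def)
qed

text \<open>Cauchy's criterion with countable quantifiers \<open>n\<close> and \<open>m\<close>.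
  With a further parameter, the condition for fixed \<open>n\<close> and \<open>m\<close> becomes a
  closed set, so the set of points of nondifferentiability is Borel.\<close>

lemma differentiable_iff_cauchy_quotients:
  fixes u :: "real \<Rightarrow> real"
  shows "u differentiable (at 0) \<longleftrightarrow>
    (\<forall>n::nat. \<exists>m::nat. \<forall>s t. 0 < \<bar>s\<bar> \<and> \<bar>s\<bar> < 1 / Suc m \<and> 0 < \<bar>t\<bar> \<and> \<bar>t\<bar> < 1 / Suc m \<longrightarrow>
       \<bar>(u s - u 0) / s - (u t - u 0) / t\<bar> \<le> 1 / Suc n)"
    (is "_ \<longleftrightarrow> ?C")
proof
  define q where "q h = (u h - u 0) / h" for h
  assume "u differentiable (at 0)"
  then obtain D where lim: "(q \<longlongrightarrow> D) (at 0)"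
    unfolding real_differentiable_def DERIV_def q_def[abs_def] by auto
  show ?C
  proof
    fix n
    define e where "e = 1 / real (Suc n)"
    have "e > 0" by (simp add: e_def)
    then obtain d where d: "d > 0" "\<And>h. h \<noteq> 0 \<Longrightarrow> \<bar>h\<bar> < d \<Longrightarrow> \<bar>q h - D\<bar> < e / 2"
      using LIM_D[OF lim, of "e / 2"] by auto
    obtain m where m: "1 / Suc m < d" using nat_approx_posE[OF d(1)] by auto
    have "\<bar>q s - q t\<bar> \<le> e" if "0 < \<bar>s\<bar> \<and> \<bar>s\<bar> < 1 / Suc m \<and> 0 < \<bar>t\<bar> \<and> \<bar>t\<bar> < 1 / Suc m" for s t
      using d(2)[of s] d(2)[of t] m that by linarith
    then show "\<exists>m::nat. \<forall>s t. 0 < \<bar>s\<bar> \<and> \<bar>s\<bar> < 1 / Suc m \<and> 0 < \<bar>t\<bar> \<and> \<bar>t\<bar> < 1 / Suc m \<longrightarrow>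
       \<bar>(u s - u 0) / s - (u t - u 0) / t\<bar> \<le> 1 / Suc n"
      unfolding q_def e_def by blast
  qed
next
  assume C: ?C
  define q where "q h = (u h - u 0) / h" for h
  have cauchy: "\<exists>m::nat. \<forall>s t. 0 < \<bar>s\<bar> \<longrightarrow> \<bar>s\<bar> < 1 / Suc m \<longrightarrow> 0 < \<bar>t\<bar> \<longrightarrow> \<bar>t\<bar> < 1 / Suc m \<longrightarrow> \<bar>q s - q t\<bar> < e"
    if e: "e > 0" for e
  proof -
    obtain n where n: "1 / Suc n < e" using nat_approx_posE[OF e] by auto
    show ?thesis using spec[OF C, of n, folded q_def] n by (meson le_less_trans)
  qed
  define a where "a i = q (1 / Suc i)" for i :: nat
  have small: "1 / Suc i < 1 / Suc m" if "i > m" for i m :: nat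
    using that by (simp add: field_simps)
  have "Cauchy a"
  proof (rule CauchyI')
    fix e :: real assume "e > 0"
    then obtain m :: nat where m: "\<And>s t. 0 < \<bar>s\<bar> \<Longrightarrow> \<bar>s\<bar> < 1 / Suc m \<Longrightarrow> 0 < \<bar>t\<bar> \<Longrightarrow> \<bar>t\<bar> < 1 / Suc m \<Longrightarrow> \<bar>q s - q t\<bar> < e"
      using cauchy[of e] by blast
    show "\<exists>M. \<forall>i\<ge>M. \<forall>j>i. dist (a i) (a j) < e"
    proof (intro exI[of _ "Suc m"] allI impI)
      fix i j assume "Suc m \<le> i" "i < j"
      then show "dist (a i) (a j) < e"
        unfolding a_def dist_real_def by (intro m) (use small[of m i] small[of m j] in \<open>auto simp del: of_nat_Suc\<close>)
    qed
  qed
  then obtain D where D: "a \<longlonglongrightarrow> D" using Cauchy_convergent convergent_def by blast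
  have "(q \<longlongrightarrow> D) (at 0)"
  proof (rule LIM_I)
    fix e :: real assume e: "e > 0"
    then have e2: "e / 2 > 0" by simp
    obtain m :: nat where m: "\<And>s t. 0 < \<bar>s\<bar> \<Longrightarrow> \<bar>s\<bar> < 1 / Suc m \<Longrightarrow> 0 < \<bar>t\<bar> \<Longrightarrow> \<bar>t\<bar> < 1 / Suc m \<Longrightarrow> \<bar>q s - q t\<bar> < e / 2"
      using cauchy[of "e / 2"] e2 by blast
    show "\<exists>s>0. \<forall>x. x \<noteq> 0 \<and> norm (x - 0) < s \<longrightarrow> norm (q x - D) < e"
    proof (intro exI[of _ "1 / Suc m"] conjI allI impI)
      fix x :: real assume x: "x \<noteq> 0 \<and> norm (x - 0) < 1 / Suc m"
      have "(\<lambda>i. \<bar>q x - a i\<bar>) \<longlonglongrightarrow> \<bar>q x - D\<bar>" by (intro tendsto_intros D)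
      moreover have "\<bar>q x - a i\<bar> \<le> e / 2" if "i \<ge> Suc m" for i
        unfolding a_def by (intro less_imp_le m) (use small[of m i] that x in \<open>auto simp del: of_nat_Suc\<close>)
      ultimately have "\<bar>q x - D\<bar> \<le> e / 2" by (intro LIMSEQ_le_const2) blast+
      then show "norm (q x - D) < e" using e by simp
    qed auto
  qed
  then have "DERIV u 0 :> D" by (simp add: DERIV_def q_def[abs_def])
  then show "u differentiable (at 0)" unfolding real_differentiable_def by blast
qed

text \<open>The exceptional set is Borel by the Cauchy criterion and meets every line in direction
  \<open>d\<close> in a null set by the one-variable theorem.\<close>

lemma lipschitz_directional_differentiable_AE:
  fixes h :: "'a::euclidean_space \<Rightarrow> real"
  assumes lip: "L-lipschitz_on UNIV h"
  shows "AE z in lborel. (\<lambda>t::real. h (z + t *\<^sub>R d)) differentiable (at 0)"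
proof -
  have cont: "continuous_on UNIV h" by (rule lipschitz_on_continuous_on[OF lip])
  then have [measurable]: "h \<in> borel_measurable borel" by (rule borel_measurable_continuous_onI)
  have contz: "continuous_on UNIV (\<lambda>z. h (z + t *\<^sub>R d))" for t
    by (intro continuous_on_compose2[OF cont] continuous_intros) auto
  have contq: "continuous_on UNIV (\<lambda>z. (h (z + t *\<^sub>R d) - h (z + 0 *\<^sub>R d)) / t)" for t
    unfolding divide_inverse by (intro continuous_on_mult continuous_on_diff contz continuous_on_const)
  \<comment> \<open>For fixed \<open>s\<close> and \<open>t\<close> the inequality is closed in
    \<open>z\<close>, so \<open>C n m\<close> is an intersection of closed sets.\<close>
  define C where "C n m = {z. \<forall>s t. 0 < \<bar>s\<bar> \<and> \<bar>s\<bar> < 1 / Suc m \<and> 0 < \<bar>t\<bar> \<and> \<bar>t\<bar> < 1 / Suc m \<longrightarrow>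
    \<bar>(h (z + s *\<^sub>R d) - h (z + 0 *\<^sub>R d)) / s - (h (z + t *\<^sub>R d) - h (z + 0 *\<^sub>R d)) / t\<bar> \<le> 1 / Suc n}" for n m :: nat
  have "closed (C n m)" for n m
    unfolding C_def
    by (intro closed_Collect_all closed_Collect_imp open_Collect_const closed_Collect_le continuous_on_const
        continuous_on_rabs continuous_on_diff contq)
  then have [measurable]: "C n m \<in> sets borel" for n m by simp
  define S where "S = {z. \<not> (\<lambda>t::real. h (z + t *\<^sub>R d)) differentiable (at 0)}"
  have "{z \<in> space borel. \<not> (\<forall>n. \<exists>m. z \<in> C n m)} \<in> sets borel" by measurable
  then have S: "S \<in> sets borel" unfolding S_def differentiable_iff_cauchy_quotients by (simp add: C_def)
  have "S \<in> null_sets lborel"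
  proof (rule null_set_if_null_slices[OF S, where d = d])
    fix z
    have "(L * norm d)-lipschitz_on UNIV (\<lambda>t::real. h (z + t *\<^sub>R d))"
    proof (rule lipschitz_onI)
      fix s t :: real
      have "dist (h (z + s *\<^sub>R d)) (h (z + t *\<^sub>R d)) \<le> L * dist (z + s *\<^sub>R d) (z + t *\<^sub>R d)"
        using lip by (rule lipschitz_onD) auto
      also have "dist (z + s *\<^sub>R d) (z + t *\<^sub>R d) = norm d * dist s t"
        by (simp add: dist_norm mult.commute flip: scaleR_diff_left)
      finally show "dist (h (z + s *\<^sub>R d)) (h (z + t *\<^sub>R d)) \<le> L * norm d * dist s t"
        by (simp add: mult.assoc)
    qed (use lipschitz_on_nonneg[OF lip] in simp)
    then obtain N where N: "negligible N"
      "\<And>t. t \<notin> N \<Longrightarrow> (\<lambda>t::real. h (z + t *\<^sub>R d)) differentiable (at t)"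
      using lipschitz_real_differentiable_AE by metis
    have "t \<in> N" if "z + t *\<^sub>R d \<in> S" for t
    proof (rule ccontr)
      assume "t \<notin> N"
      then obtain D where "DERIV (\<lambda>t::real. h (z + t *\<^sub>R d)) t :> D"
        using N(2) by (auto simp: real_differentiable_def)
      then have "DERIV (\<lambda>s::real. h (z + (s + t) *\<^sub>R d)) 0 :> D"
        using DERIV_shift[of "\<lambda>t. h (z + t *\<^sub>R d)" D 0 t] by simp
      then have "(\<lambda>s::real. h (z + t *\<^sub>R d + s *\<^sub>R d)) differentiable (at 0)"
        unfolding real_differentiable_def by (auto simp: algebra_simps)
      with that show False by (simp add: S_def)
    qed
    then show "negligible {t. z + t *\<^sub>R d \<in> S}"
      by (intro negligible_subset[OF N(1)]) auto
  qed
  then show ?thesis by (rule AE_I') (auto simp: S_def)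
qed

lemma integrable_bounded_support:
  fixes f :: "'a::euclidean_space \<Rightarrow> 'b::euclidean_space"
  assumes [measurable]: "f \<in> borel_measurable borel"
    and bd: "\<And>z. norm (f z) \<le> C" and supp: "\<And>z. norm z > R \<Longrightarrow> f z = 0"
  shows "integrable lborel f"
proof (rule Bochner_Integration.integrable_bound)
  show "integrable lborel (\<lambda>z::'a. C * indicator (cball 0 R) z)"
    by (intro integrable_mult_right integrable_real_indicator) (use emeasure_bounded_finite[OF bounded_cball] in auto)
  show "AE z in lborel. norm (f z) \<le> norm (C * indicator (cball 0 R) z)"
    using bd supp by (auto simp: indicator_def not_le intro!: AE_I2 order_trans[OF bd])
qed measurable

lemma integral_lborel_shift:
  fixes f :: "'a::euclidean_space \<Rightarrow> 'b::euclidean_space"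
  assumes [measurable]: "f \<in> borel_measurable borel"
  shows "(LINT z|lborel. f (z + c)) = (LINT z|lborel. f z)"
proof -
  have "(LINT z|lborel. f z) = (LINT z|distr lborel borel ((+) c). f z)"
    by (simp add: lborel_distr_plus)
  also have "\<dots> = (LINT z|lborel. f (c + z))"
    by (subst integral_distr) auto
  finally show ?thesis by (simp add: add.commute)
qed

lemma integrable_lborel_shift:
  fixes f :: "'a::euclidean_space \<Rightarrow> 'b::euclidean_space"
  assumes "integrable lborel f"
  shows "integrable lborel (\<lambda>z. f (z + c))"
proof -
  have "integrable (distr lborel borel ((+) c)) f"
    using assms by (simp add: lborel_distr_plus)
  then show ?thesis
    by (subst (asm) integrable_distr_eq) (use assms in \<open>auto simp: add.commute\<close>)
qed

text \<open>Each difference quotient has integral 0 by translation invariance. The Lipschitz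
  constant and the compact support dominate all quotients by one integrable function, so the limit
  inherits the integral.\<close>

lemma has_integral_directional_derivative_zero:
  fixes h h' :: "'a::euclidean_space \<Rightarrow> 'b::euclidean_space"
  assumes lip: "L-lipschitz_on UNIV h"
    and supp: "\<And>z. norm z > R \<Longrightarrow> h z = 0"
    and deriv: "AE z in lborel. ((\<lambda>t. h (z + t *\<^sub>R d)) has_vector_derivative h' z) (at 0)"
    and [measurable]: "h' \<in> borel_measurable borel"
  shows "has_bochner_integral lborel h' 0"
proof -
  have cont: "continuous_on UNIV h" by (rule lipschitz_on_continuous_on[OF lip])
  then have [measurable]: "h \<in> borel_measurable borel" by (rule borel_measurable_continuous_onI)
  have "compact (cball 0 R :: 'a set)" by simp
  then have "bounded (h ` cball 0 R)"
    by (intro compact_imp_bounded compact_continuous_image continuous_on_subset[OF cont]) auto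
  then obtain C where "\<forall>y\<in>h ` cball 0 R. norm y \<le> C" unfolding bounded_iff by blast
  then have C: "norm (h z) \<le> C" if "z \<in> cball 0 R" for z using that by blast
  have "norm (h z) \<le> max C 0" for z
    using C[of z] supp[of z] by (cases "norm z > R") auto
  then have inth: "integrable lborel h"
    by (intro integrable_bounded_support[of h "max C 0" R] supp) auto
  define s where "s n z = real (Suc n) *\<^sub>R (h (z + (1 / Suc n) *\<^sub>R d) - h z)" for n :: nat and z
  have [measurable]: "s n \<in> borel_measurable borel" for n unfolding s_def by measurable
  have s_bound: "norm (s n z) \<le> L * norm d" for n z
  proof -
    have "norm (h (z + (1 / Suc n) *\<^sub>R d) - h z) \<le> L * norm ((1 / Suc n) *\<^sub>R d)"
      using lipschitz_onD[OF lip, of "z + (1 / Suc n) *\<^sub>R d" z] by (simp add: dist_norm)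
    also have "\<dots> = L * norm d / Suc n" by simp
    finally have "real (Suc n) * norm (h (z + (1 / Suc n) *\<^sub>R d) - h z) \<le> real (Suc n) * (L * norm d / Suc n)"
      by (intro mult_left_mono) auto
    then show ?thesis by (simp add: s_def)
  qed
  have s_supp: "s n z = 0" if "norm z > R + norm d" for n z
  proof -
    have "norm (z + (1 / Suc n) *\<^sub>R d) \<ge> norm z - norm ((1 / Suc n) *\<^sub>R d)"
      by (metis norm_diff_ineq)
    moreover have "norm ((1 / Suc n) *\<^sub>R d) \<le> norm d" by (simp add: field_simps mult_le_cancel_left1)
    moreover have "norm z > R" using that by (smt (verit) norm_ge_zero)
    ultimately show ?thesis using that by (simp add: s_def supp)
  qed
  have s_lim: "AE z in lborel. (\<lambda>n. s n z) \<longlonglongrightarrow> h' z"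
    using deriv
  proof eventually_elim
    fix z assume "((\<lambda>t. h (z + t *\<^sub>R d)) has_vector_derivative h' z) (at 0)"
    then have lim: "((\<lambda>t. norm (h (z + t *\<^sub>R d) - h z - t *\<^sub>R h' z) / norm t) \<longlongrightarrow> 0) (at 0)"
      by (simp add: has_vector_derivative_def has_derivative_at)
    have "(\<lambda>n. 1 / real (Suc n)) \<longlonglongrightarrow> 0" by (rule LIMSEQ_Suc[OF lim_1_over_n])
    then have "filterlim (\<lambda>n. 1 / real (Suc n)) (at 0) sequentially"
      by (simp add: filterlim_at)
    from filterlim_compose[OF lim this]
    have "(\<lambda>n. norm (h (z + (1 / Suc n) *\<^sub>R d) - h z - (1 / Suc n) *\<^sub>R h' z) / norm (1 / real (Suc n))) \<longlonglongrightarrow> 0" .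
    moreover have "norm (h (z + (1 / Suc n) *\<^sub>R d) - h z - (1 / Suc n) *\<^sub>R h' z) / norm (1 / real (Suc n)) = norm (s n z - h' z)" for n
    proof -
      have "s n z - h' z = real (Suc n) *\<^sub>R (h (z + (1 / Suc n) *\<^sub>R d) - h z - (1 / Suc n) *\<^sub>R h' z)"
        by (simp add: s_def scaleR_diff_right)
      then show ?thesis by simp
    qed
    ultimately have "(\<lambda>n. norm (s n z - h' z)) \<longlonglongrightarrow> 0" by simp
    then show "(\<lambda>n. s n z) \<longlonglongrightarrow> h' z" by (simp add: tendsto_norm_zero_iff LIM_zero_iff)
  qed
  define w where "w z = L * norm d * indicator (cball 0 (R + norm d)) z" for z :: 'a
  have w: "integrable lborel w"
    unfolding w_def by (intro integrable_mult_right integrable_real_indicator) (use emeasure_bounded_finite[OF bounded_cball] in auto)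
  have w_bound: "norm (s n z) \<le> w z" for n z
    using s_bound[of n z] s_supp[of z n] by (auto simp: w_def indicator_def)
  have s_int: "(LINT z|lborel. s n z) = 0" for n
    unfolding s_def
    by (simp add: integral_lborel_shift inth integrable_lborel_shift)
  have "integrable lborel h'"
    by (rule integrable_dominated_convergence[where s = s and w = w])
       (use w s_lim w_bound in auto)
  moreover have "(\<lambda>n. LINT z|lborel. s n z) \<longlonglongrightarrow> (LINT z|lborel. h' z)"
    by (rule integral_dominated_convergence[where w = w])
       (use w s_lim w_bound in auto)
  ultimately show ?thesis
    using s_int LIMSEQ_unique[OF _ tendsto_const] by (auto simp: has_bochner_integral_iff)
qed

section \<open>A planar Sobolev inequality\<close>

text \<open>The gradient is a complex number paired with directions by the real inner product; it is
  then twice the Wirtinger derivative in the conjugate variable, and the Cauchy kernel identities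
  rest on this reading.\<close>

definition C1c :: "(complex \<Rightarrow> real) \<Rightarrow> (complex \<Rightarrow> complex) \<Rightarrow> bool" where
  "C1c \<phi> G \<longleftrightarrow> (\<forall>z. GDERIV \<phi> z :> G z) \<and> continuous_on UNIV G \<and> (\<exists>R. \<forall>z. norm z > R \<longrightarrow> \<phi> z = 0)"

lemma GDERIV_unique: "GDERIV f z :> D \<Longrightarrow> GDERIV f z :> D' \<Longrightarrow> D = D'"
  for D D' :: "'a::real_inner"
proof -
  assume "GDERIV f z :> D" "GDERIV f z :> D'"
  then have "(\<lambda>h. inner h D) = (\<lambda>h. inner h D')"
    unfolding gderiv_def by (rule has_derivative_unique)
  then show ?thesis by (metis inner_commute vector_eq_rdot)
qed

lemma GDERIV_cong_open:
  assumes "GDERIV f z :> D" "open U" "z \<in> U" "\<And>w. w \<in> U \<Longrightarrow> f w = g w"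
  shows "GDERIV g z :> D"
  using assms unfolding gderiv_def by (rule has_derivative_transform_within_open)

lemma GDERIV_locally_const:
  assumes "GDERIV f z :> D" "open U" "z \<in> U" "\<And>w. w \<in> U \<Longrightarrow> f w = c"
  shows "D = 0"
  using GDERIV_unique[OF GDERIV_cong_open[OF assms(1-3), of "\<lambda>_. c"] GDERIV_const] assms(4) by simp

lemma C1cE:
  assumes "C1c \<phi> G"
  obtains R where "R > 0" "\<And>z. norm z > R \<Longrightarrow> \<phi> z = 0" "\<And>z. norm z > R \<Longrightarrow> G z = 0"
proof -
  from assms obtain R where R: "\<And>z. norm z > R \<Longrightarrow> \<phi> z = 0" unfolding C1c_def by blast
  have "G z = 0" if "norm z > R" for z
  proof (rule GDERIV_locally_const)
    show "GDERIV \<phi> z :> G z" using assms by (simp add: C1c_def)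
    show "open {z::complex. R < norm z}" by (intro open_Collect_less continuous_intros)
    show "z \<in> {z. R < norm z}" using that by simp
    show "\<And>w. w \<in> {z. R < norm z} \<Longrightarrow> \<phi> w = 0" using R by simp
  qed
  note G = this
  show thesis
    by (rule that[of "max R 1"]) (use R G in simp_all)
qed

lemma C1c_continuous:
  assumes "C1c \<phi> G"
  shows "continuous_on UNIV \<phi>"
proof (rule has_derivative_continuous_on)
  show "(\<phi> has_derivative (\<lambda>h. inner h (G z))) (at z within UNIV)" for z
    using assms by (simp add: C1c_def gderiv_def)
qed

lemma C1c_borel:
  assumes "C1c \<phi> G"
  shows "\<phi> \<in> borel_measurable borel" "G \<in> borel_measurable borel"
  using assms C1c_continuous[OF assms]
  by (auto intro!: borel_measurable_continuous_onI simp: C1c_def)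

lemma continuous_compact_support_bounded:
  fixes f :: "'a::euclidean_space \<Rightarrow> 'b::real_normed_vector"
  assumes "continuous_on UNIV f" "\<And>z. norm z > R \<Longrightarrow> f z = 0"
  obtains C where "C \<ge> 0" "\<And>z. norm (f z) \<le> C"
proof -
  have "compact (cball 0 R :: 'a set)" by simp
  then have "bounded (f ` cball 0 R)"
    by (intro compact_imp_bounded compact_continuous_image continuous_on_subset[OF assms(1)]) auto
  then obtain C where "\<forall>y\<in>f ` cball 0 R. norm y \<le> C" unfolding bounded_iff by blast
  then have C: "norm (f z) \<le> C" if "z \<in> cball 0 R" for z using that by blast
  have "norm (f z) \<le> max C 0" for z
    using C[of z] assms(2)[of z] by (cases "norm z > R") auto
  then show thesis using that[of "max C 0"] by simp
qed

lemma C1c_bounded: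
  assumes "C1c \<phi> G"
  obtains C where "C \<ge> 0" "\<And>z. \<bar>\<phi> z\<bar> \<le> C" "\<And>z. norm (G z) \<le> C"
proof -
  obtain R where R0: "R > 0" and R: "\<And>z. norm z > R \<Longrightarrow> \<phi> z = 0" "\<And>z. norm z > R \<Longrightarrow> G z = 0" by (rule C1cE[OF assms]) (rule that)
  obtain C1 where C1: "C1 \<ge> 0" "\<And>z. norm (\<phi> z) \<le> C1"
    using continuous_compact_support_bounded[OF C1c_continuous[OF assms] R(1)] by blast
  have "continuous_on UNIV G" using assms by (simp add: C1c_def)
  then obtain C2 where C2: "C2 \<ge> 0" "\<And>z. norm (G z) \<le> C2"
    using continuous_compact_support_bounded[of G R] R(2) by blast
  show thesis
    by (rule that[of "max C1 C2"]) (use C1 C2 in \<open>auto simp: le_max_iff_disj\<close>)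
qed

lemma C1c_lipschitz:
  assumes "C1c \<phi> G"
  obtains L where "L-lipschitz_on UNIV \<phi>"
proof -
  obtain C where C: "C \<ge> 0" "\<And>z. \<bar>\<phi> z\<bar> \<le> C" "\<And>z. norm (G z) \<le> C" by (rule C1c_bounded[OF assms]) (rule that)
  have "C-lipschitz_on UNIV \<phi>"
  proof (rule bounded_derivative_imp_lipschitz)
    show "(\<phi> has_derivative (\<lambda>h. inner h (G x))) (at x within UNIV)" for x
      using assms by (simp add: C1c_def gderiv_def)
    show "onorm (\<lambda>h. inner h (G x)) \<le> C" for x
    proof (rule onorm_bound[OF C(1)])
      fix h
      have "\<bar>inner h (G x)\<bar> \<le> norm h * norm (G x)" by (rule Cauchy_Schwarz_ineq2)
      also have "\<dots> \<le> norm h * C" by (intro mult_left_mono C(3)) auto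
      finally show "norm (inner h (G x)) \<le> C * norm h" by (simp add: mult.commute)
    qed
  qed (use C in auto)
  then show thesis by (rule that)
qed

lemma C1c_integrable:
  assumes "C1c \<phi> G"
  shows "integrable lborel \<phi>" "integrable lborel G"
proof -
  obtain R where R0: "R > 0" and R: "\<And>z. norm z > R \<Longrightarrow> \<phi> z = 0" "\<And>z. norm z > R \<Longrightarrow> G z = 0" by (rule C1cE[OF assms]) (rule that)
  obtain C where C: "C \<ge> 0" "\<And>z. \<bar>\<phi> z\<bar> \<le> C" "\<And>z. norm (G z) \<le> C" by (rule C1c_bounded[OF assms]) (rule that)
  show "integrable lborel \<phi>"
    by (rule integrable_bounded_support[of _ C R]) (use R C C1c_borel[OF assms] in auto)
  show "integrable lborel G"
    by (rule integrable_bounded_support[of _ C R]) (use R C C1c_borel[OF assms] in auto)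
qed

lemma GDERIV_directional:
  assumes "GDERIV f z :> D"
  shows "((\<lambda>t. f (z + t *\<^sub>R d)) has_real_derivative inner d D) (at 0)"
proof -
  have "((\<lambda>t::real. z + t *\<^sub>R d) has_derivative (\<lambda>t. t *\<^sub>R d)) (at 0)"
    by (auto intro!: derivative_eq_intros)
  moreover have "(f has_derivative (\<lambda>h. inner h D)) (at (z + 0 *\<^sub>R d))"
    using assms by (simp add: gderiv_def)
  ultimately have "((\<lambda>t. f (z + t *\<^sub>R d)) has_derivative (\<lambda>t. inner (t *\<^sub>R d) D)) (at 0)"
    by (rule has_derivative_compose)
  then show ?thesis
    by (rule has_derivative_imp_has_field_derivative) (simp add: mult.commute)
qed

text \<open>Boundedness is included so that the class is closed under products; the kernels below
  are then treated factor by factor.\<close>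

definition blip :: "('a::metric_space \<Rightarrow> 'b::real_normed_vector) \<Rightarrow> bool" where
  "blip f \<longleftrightarrow> (\<exists>L. L-lipschitz_on UNIV f) \<and> (\<exists>C. \<forall>x. norm (f x) \<le> C)"

lemma blipI: "L-lipschitz_on UNIV f \<Longrightarrow> (\<And>x. norm (f x) \<le> C) \<Longrightarrow> blip f"
  unfolding blip_def by blast

lemma blip_const [simp]: "blip (\<lambda>_. c)"
  by (rule blipI[of 0 _ "norm c"]) (auto intro: lipschitz_on_constant)

lemma blip_mult:
  fixes f g :: "'a::metric_space \<Rightarrow> 'b::real_normed_algebra"
  assumes "blip f" "blip g"
  shows "blip (\<lambda>x. f x * g x)"
proof -
  obtain L1 C1 where 1: "L1-lipschitz_on UNIV f" "\<And>x. norm (f x) \<le> C1" using assms(1) unfolding blip_def by metis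
  obtain L2 C2 where 2: "L2-lipschitz_on UNIV g" "\<And>x. norm (g x) \<le> C2" using assms(2) unfolding blip_def by metis
  have C: "C1 \<ge> 0" "C2 \<ge> 0" using order_trans[OF norm_ge_zero 1(2)] order_trans[OF norm_ge_zero 2(2)] by blast+
  show ?thesis
  proof (rule blipI)
    show "norm (f x * g x) \<le> C1 * C2" for x
      by (rule order_trans[OF norm_mult_ineq mult_mono]) (use 1 2 C in auto)
    show "(C1 * L2 + L1 * C2)-lipschitz_on UNIV (\<lambda>x. f x * g x)"
    proof (rule lipschitz_onI)
      fix x y
      have "f x * g x - f y * g y = f x * (g x - g y) + (f x - f y) * g y" by (simp add: algebra_simps)
      then have "norm (f x * g x - f y * g y) \<le> norm (f x * (g x - g y)) + norm ((f x - f y) * g y)"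
        by (metis norm_triangle_ineq)
      also have "\<dots> \<le> norm (f x) * norm (g x - g y) + norm (f x - f y) * norm (g y)"
        by (intro add_mono norm_mult_ineq)
      also have "\<dots> \<le> C1 * (L2 * dist x y) + (L1 * dist x y) * C2"
        using lipschitz_onD[OF 1(1), of x y] lipschitz_onD[OF 2(1), of x y] C
        by (intro add_mono mult_mono 1 2) (auto simp: dist_norm intro: order_trans[OF norm_ge_zero])
      finally show "dist (f x * g x) (f y * g y) \<le> (C1 * L2 + L1 * C2) * dist x y"
        by (simp add: dist_norm algebra_simps)
    qed (use C lipschitz_on_nonneg[OF 1(1)] lipschitz_on_nonneg[OF 2(1)] in simp)
  qed
qed

lemma blip_diff:
  assumes "blip f" "blip g"
  shows "blip (\<lambda>x. f x - g x)"
proof -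
  obtain L1 C1 where 1: "L1-lipschitz_on UNIV f" "\<And>x. norm (f x) \<le> C1" using assms(1) unfolding blip_def by metis
  obtain L2 C2 where 2: "L2-lipschitz_on UNIV g" "\<And>x. norm (g x) \<le> C2" using assms(2) unfolding blip_def by metis
  show ?thesis
    by (rule blipI[OF lipschitz_on_diff[OF 1(1) 2(1)], of "C1 + C2"])
      (rule order_trans[OF norm_triangle_ineq4 add_mono[OF 1(2) 2(2)]])
qed

lemma blip_of_real:
  assumes "blip f"
  shows "blip (\<lambda>x. complex_of_real (f x))"
proof -
  obtain L1 C1 where 1: "L1-lipschitz_on UNIV f" "\<And>x. norm (f x) \<le> C1" using assms(1) unfolding blip_def by metis
  have "L1-lipschitz_on UNIV (\<lambda>x. complex_of_real (f x))"
    using 1(1) by (auto simp: lipschitz_on_def)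
  then show ?thesis by (rule blipI[of L1 _ C1]) (use 1(2) in simp)
qed

lemma blip_shift:
  fixes f :: "'a::real_normed_vector \<Rightarrow> 'b::real_normed_vector"
  assumes "blip f"
  shows "blip (\<lambda>x. f (x - q))"
proof -
  obtain L1 C1 where 1: "L1-lipschitz_on UNIV f" "\<And>x. norm (f x) \<le> C1" using assms(1) unfolding blip_def by metis
  have "L1-lipschitz_on UNIV (\<lambda>x. f (x - q))"
  proof (rule lipschitz_onI)
    show "dist (f (x - q)) (f (y - q)) \<le> L1 * dist x y" for x y
      using lipschitz_onD[OF 1(1), of "x - q" "y - q"] by (simp add: dist_norm)
  qed (rule lipschitz_on_nonneg[OF 1(1)])
  then show ?thesis by (rule blipI) (rule 1(2))
qed

lemma blip_continuous: "blip f \<Longrightarrow> continuous_on UNIV f"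
  unfolding blip_def using lipschitz_on_continuous_on by blast

lemma C1c_blip:
  assumes "C1c \<phi> G"
  shows "blip \<phi>"
proof -
  obtain L where L: "L-lipschitz_on UNIV \<phi>" using C1c_lipschitz[OF assms] .
  obtain C where C: "C \<ge> 0" "\<And>z. \<bar>\<phi> z\<bar> \<le> C" "\<And>z. norm (G z) \<le> C" by (rule C1c_bounded[OF assms]) (rule that)
  show ?thesis by (rule blipI[OF L, of C]) (use C(2) in simp)
qed

text \<open>The product of test function and kernel is Lipschitz with compact support. The kernel
  needs a directional derivative only almost everywhere, which admits kernels with a corner along a
  circle.\<close>

lemma C1c_kernel_integral_zero:
  fixes \<kappa> \<kappa>' :: "complex \<Rightarrow> complex"
  assumes phi: "C1c \<phi> G" and k: "blip \<kappa>" and k'[measurable]: "\<kappa>' \<in> borel_measurable borel"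
    and der: "AE z in lborel. ((\<lambda>t. \<kappa> (z - q + t *\<^sub>R d)) has_vector_derivative \<kappa>' (z - q)) (at 0)"
  shows "has_bochner_integral lborel (\<lambda>z. of_real (inner d (G z)) * \<kappa> (z - q) + of_real (\<phi> z) * \<kappa>' (z - q)) 0"
proof -
  note [measurable] = C1c_borel[OF phi]
  have [measurable]: "\<kappa> \<in> borel_measurable borel"
    by (intro borel_measurable_continuous_onI blip_continuous k)
  obtain R where R0: "R > 0" and R: "\<And>z. norm z > R \<Longrightarrow> \<phi> z = 0" "\<And>z. norm z > R \<Longrightarrow> G z = 0" by (rule C1cE[OF phi]) (rule that)
  have "blip (\<lambda>z. of_real (\<phi> z) * \<kappa> (z - q))"
    by (intro blip_mult blip_of_real C1c_blip[OF phi] blip_shift[OF k])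
  then obtain L where L: "L-lipschitz_on UNIV (\<lambda>z. of_real (\<phi> z) * \<kappa> (z - q))" unfolding blip_def by blast
  show ?thesis
  proof (rule has_integral_directional_derivative_zero[OF L, where R = R and d = d])
    show "AE z in lborel. ((\<lambda>t. complex_of_real (\<phi> (z + t *\<^sub>R d)) * \<kappa> (z + t *\<^sub>R d - q)) has_vector_derivative
         of_real (inner d (G z)) * \<kappa> (z - q) + of_real (\<phi> z) * \<kappa>' (z - q)) (at 0)"
      using der
    proof eventually_elim
      fix z assume *: "((\<lambda>t. \<kappa> (z - q + t *\<^sub>R d)) has_vector_derivative \<kappa>' (z - q)) (at 0)"
      have "GDERIV \<phi> z :> G z" using phi by (simp add: C1c_def)
      then have "((\<lambda>t. \<phi> (z + t *\<^sub>R d)) has_real_derivative inner d (G z)) (at 0)"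
        by (rule GDERIV_directional)
      then have "((\<lambda>t. complex_of_real (\<phi> (z + t *\<^sub>R d))) has_vector_derivative of_real (inner d (G z))) (at 0)"
        by (intro has_vector_derivative_of_real) (simp add: has_real_derivative_iff_has_vector_derivative)
      from has_vector_derivative_mult[OF this *]
      show "((\<lambda>t. complex_of_real (\<phi> (z + t *\<^sub>R d)) * \<kappa> (z + t *\<^sub>R d - q)) has_vector_derivative
         of_real (inner d (G z)) * \<kappa> (z - q) + of_real (\<phi> z) * \<kappa>' (z - q)) (at 0)"
        by (simp add: algebra_simps)
    qed
  qed (use R in auto)
qed

lemma C1c_integral_gradient_zero:
  assumes "C1c \<phi> G"
  shows "(LINT z|lborel. G z) = 0"
proof -
  have 1: "has_bochner_integral lborel (\<lambda>z. complex_of_real (inner 1 (G z))) 0"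
    using C1c_kernel_integral_zero[OF assms blip_const[of 1], of "\<lambda>_. 0" 0 1] by simp
  have 2: "has_bochner_integral lborel (\<lambda>z. complex_of_real (inner \<i> (G z))) 0"
    using C1c_kernel_integral_zero[OF assms blip_const[of 1], of "\<lambda>_. 0" 0 \<i>] by simp
  have "has_bochner_integral lborel (\<lambda>z. complex_of_real (inner 1 (G z)) + \<i> * complex_of_real (inner \<i> (G z))) (0 + \<i> * 0)"
    by (intro has_bochner_integral_add has_bochner_integral_mult_right 1 2)
  moreover have "complex_of_real (inner 1 (G z)) + \<i> * complex_of_real (inner \<i> (G z)) = G z" for z
    by (simp add: complex_eq_iff inner_complex_def)
  ultimately show ?thesis by (simp add: has_bochner_integral_iff)
qed

text \<open>
  \<open>kern e\<close> is \<open>1/y\<close> cut off inside the disc of radius \<open>e\<close>; the kernel \<open>kern2 e\<close> is chosen such that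
  \<open>\<partial>kern2/\<partial>cnj y = kern\<close> while \<open>|kern2| \<le> 1\<close>.
\<close>

definition kern :: "real \<Rightarrow> complex \<Rightarrow> complex" where
  "kern e y = (cnj y / of_real (max e (cmod y))) * of_real (1 / max e (cmod y))"

definition kern2 :: "real \<Rightarrow> complex \<Rightarrow> complex" where
  "kern2 e y = (cnj y / of_real (max e (cmod y))) * (cnj y / of_real (max e (cmod y))) *
     of_real (1 - (e * (1 / max e (cmod y))) * (e * (1 / max e (cmod y))) * (1 / 2))"

lemma kern_factors_blip:
  assumes e: "e > 0"
  shows "blip (\<lambda>y. cnj y / of_real (max e (cmod y)))" "blip (\<lambda>y::complex. 1 / max e (cmod y))"
proof -
  define r where "r y = max e (cmod y)" for y
  have r: "r y \<ge> e" "r y > 0" "cmod y \<le> r y" for y using e by (auto simp: r_def)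
  have rl: "\<bar>r x - r y\<bar> \<le> cmod (x - y)" for x y
    unfolding r_def using norm_triangle_ineq3[of x y] by (auto simp: max_def)
  have inv: "\<bar>1 / r x - 1 / r y\<bar> \<le> cmod (x - y) / (r x * e)" for x y
  proof -
    have "1 / r x - 1 / r y = (r y - r x) / (r x * r y)" using r(2)[of x] r(2)[of y] by (simp add: field_simps)
    then have "\<bar>1 / r x - 1 / r y\<bar> = \<bar>r y - r x\<bar> / (r x * r y)" using r(2)[of x] r(2)[of y] by (simp add: abs_mult)
    also have "\<dots> \<le> cmod (x - y) / (r x * e)"
      using r[of x] r[of y] rl[of x y] e by (intro frac_le mult_left_mono) (auto simp: abs_minus_commute)
    finally show ?thesis .
  qed
  have "blip (\<lambda>y. cnj y / of_real (r y))"
  proof (rule blipI)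
    show "norm (cnj y / of_real (r y)) \<le> 1" for y
      using r[of y] by (simp add: norm_divide)
    show "(2 / e)-lipschitz_on UNIV (\<lambda>y. cnj y / of_real (r y))"
    proof (rule lipschitz_onI)
      fix x y
      have "cnj y / of_real (r y) - cnj x / of_real (r x) = (cnj y - cnj x) / of_real (r y) - cnj x * of_real (1 / r x - 1 / r y)"
        by (simp add: field_simps diff_divide_distrib)
      then have "norm (cnj y / of_real (r y) - cnj x / of_real (r x)) \<le>
          norm ((cnj y - cnj x) / of_real (r y)) + norm (cnj x * of_real (1 / r x - 1 / r y))"
        by (metis norm_triangle_ineq4)
      also have "\<dots> = cmod (x - y) / r y + cmod x * \<bar>1 / r x - 1 / r y\<bar>"
      proof -
        have "cmod ((cnj y - cnj x) / of_real (r y)) = cmod (x - y) / r y"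
          using r(2)[of y] by (simp add: norm_divide norm_minus_commute[of x y] flip: complex_cnj_diff)
        moreover have "cmod (cnj x * of_real (1 / r x - 1 / r y)) = cmod x * \<bar>1 / r x - 1 / r y\<bar>"
          by (simp only: norm_mult complex_mod_cnj norm_of_real)
        ultimately show ?thesis by simp
      qed
      also have "\<dots> \<le> cmod (x - y) / e + r x * (cmod (x - y) / (r x * e))"
        using r[of x] r[of y] e by (intro add_mono mult_mono inv divide_left_mono) auto
      also have "\<dots> = (2 / e) * cmod (x - y)" using r(2)[of x] e by (simp add: field_simps)
      finally show "dist (cnj x / of_real (r x)) (cnj y / of_real (r y)) \<le> (2 / e) * dist x y"
        by (simp add: dist_norm norm_minus_commute)
    qed (use e in simp)
  qed
  then show "blip (\<lambda>y. cnj y / of_real (max e (cmod y)))" by (simp add: r_def)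
  have "blip (\<lambda>y. 1 / r y)"
  proof (rule blipI)
    show "norm (1 / r y) \<le> 1 / e" for y
      using r[of y] e by (simp add: frac_le)
    show "(1 / (e * e))-lipschitz_on UNIV (\<lambda>y. 1 / r y)"
    proof (rule lipschitz_onI)
      fix x y
      have "\<bar>1 / r x - 1 / r y\<bar> \<le> cmod (x - y) / (r x * e)" by (rule inv)
      also have "\<dots> \<le> cmod (x - y) / (e * e)" using r[of x] e by (intro divide_left_mono mult_right_mono) auto
      finally show "dist (1 / r x) (1 / r y) \<le> 1 / (e * e) * dist x y"
        by (simp add: dist_norm)
    qed (use e in simp)
  qed
  then show "blip (\<lambda>y::complex. 1 / max e (cmod y))" by (simp add: r_def)
qed

lemma kern_blip: "e > 0 \<Longrightarrow> blip (kern e)"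
  unfolding kern_def[abs_def] by (intro blip_mult blip_of_real kern_factors_blip)

lemma kern2_blip: "e > 0 \<Longrightarrow> blip (kern2 e)"
  unfolding kern2_def[abs_def] by (intro blip_mult blip_of_real blip_diff blip_const kern_factors_blip)

lemma kern_inside: "cmod y \<le> e \<Longrightarrow> kern e y = cnj y / of_real (e^2)"
  by (simp add: kern_def max_absorb1 power2_eq_square)

lemma cnj_over_norm_square: "y \<noteq> 0 \<Longrightarrow> cnj y / of_real ((cmod y)^2) = 1 / y"
  using complex_norm_square[of y] by (simp add: field_simps)

lemma kern_outside: "e \<le> cmod y \<Longrightarrow> e > 0 \<Longrightarrow> kern e y = 1 / y"
  using cnj_over_norm_square[of y] by (cases "y = 0") (simp_all add: kern_def max_absorb2 power2_eq_square)

lemma kern2_inside: "cmod y \<le> e \<Longrightarrow> e > 0 \<Longrightarrow> kern2 e y = (cnj y)^2 / of_real (2 * e^2)"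
  by (simp add: kern2_def max_absorb1 power2_eq_square)

lemma kern2_outside:
  assumes "e \<le> cmod y" "e > 0"
  shows "kern2 e y = cnj y / y - of_real (e^2) / (2 * y^2)"
proof -
  have y: "y \<noteq> 0" using assms by auto
  define c where "c = cmod y"
  have c: "c > 0" "max e (cmod y) = c" "cnj y / of_real (c^2) = 1 / y"
    using assms cnj_over_norm_square[OF y] by (auto simp: c_def)
  have "kern2 e y = (cnj y / of_real c) * (cnj y / of_real c) * (1 - of_real e * of_real e / (of_real c * of_real c) / 2)"
    by (simp add: kern2_def c(2))
  also have "\<dots> = cnj y * (cnj y / of_real (c^2)) - of_real (e^2) / 2 * (cnj y / of_real (c^2))^2"
    using c(1) by (simp add: power2_eq_square field_simps)
  also have "\<dots> = cnj y / y - of_real (e^2) / (2 * y^2)"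
    by (simp only: c(3)) (simp add: power2_eq_square)
  finally show ?thesis .
qed

text \<open>This bound carries the sharp constant of the Sobolev inequality: the main term of
  \<open>kern2\<close> outside the disc is cnj y / y, of modulus exactly 1.\<close>

lemma kern2_le_1:
  assumes e: "e > 0"
  shows "cmod (kern2 e y) \<le> 1"
proof -
  define r where "r = max e (cmod y)"
  have r: "r \<ge> e" "r > 0" "cmod y \<le> r" using e by (auto simp: r_def)
  have a: "cmod (cnj y / of_real r) \<le> 1" using r by (simp add: norm_divide)
  have "0 \<le> e * (1 / r)" "e * (1 / r) \<le> 1" using r e by (auto simp: field_simps)
  then have "0 \<le> (e * (1 / r)) * (e * (1 / r)) * (1 / 2)" "(e * (1 / r)) * (e * (1 / r)) * (1 / 2) \<le> 1"
    using mult_mono[of "e * (1 / r)" 1 "e * (1 / r)" 1] by auto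
  then have b: "\<bar>1 - (e * (1 / r)) * (e * (1 / r)) * (1 / 2)\<bar> \<le> 1" by simp
  have "cmod (kern2 e y) = cmod (cnj y / of_real r) * cmod (cnj y / of_real r) * \<bar>1 - (e * (1 / r)) * (e * (1 / r)) * (1 / 2)\<bar>"
    unfolding kern2_def r_def[symmetric] norm_mult norm_of_real by simp
  also have "\<dots> \<le> 1 * 1 * 1" by (intro mult_mono a b) auto
  finally show ?thesis by simp
qed

text \<open>Directional derivatives away from the circle of radius \<open>e\<close>; on the circle,
  a null set, the value is a convention.\<close>

definition kern_d :: "real \<Rightarrow> complex \<Rightarrow> complex \<Rightarrow> complex" where
  "kern_d e d y = (if cmod y < e then cnj d / of_real (e^2) else - d / y^2)"

definition kern2_d :: "real \<Rightarrow> complex \<Rightarrow> complex \<Rightarrow> complex" where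
  "kern2_d e d y = (if cmod y < e then cnj y * cnj d / of_real (e^2)
     else cnj d / y - cnj y * d / y^2 + of_real (e^2) * d / y^3)"

lemma borel_measurable_cnj [measurable]: "cnj \<in> borel_measurable borel"
  by (intro borel_measurable_continuous_onI continuous_intros)

lemma kern_d_borel [measurable]: "kern_d e d \<in> borel_measurable borel"
  unfolding kern_d_def[abs_def] by measurable

lemma kern2_d_borel [measurable]: "kern2_d e d \<in> borel_measurable borel"
  unfolding kern2_d_def[abs_def] by measurable

lemma has_vector_derivative_line [derivative_intros]:
  "((\<lambda>t. y + t *\<^sub>R d) has_vector_derivative d) (at t)"
  by (auto intro!: derivative_eq_intros)

lemma has_vector_derivative_line_cnj:
  "((\<lambda>t. cnj (y + t *\<^sub>R d)) has_vector_derivative cnj d) (at t)"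
  using bounded_linear.has_vector_derivative[OF bounded_linear_cnj has_vector_derivative_line] .

lemma line_eventually:
  fixes y d :: "'a::real_normed_vector"
  assumes "open U" "y \<in> U"
  shows "\<forall>\<^sub>F t in nhds (0::real). y + t *\<^sub>R d \<in> U"
proof -
  have "open ((\<lambda>t::real. y + t *\<^sub>R d) -` U)"
    by (intro open_vimage assms continuous_intros)
  then show ?thesis
    unfolding eventually_nhds using assms(2) by (intro exI[of _ "(\<lambda>t. y + t *\<^sub>R d) -` U"]) simp
qed

lemma has_vector_derivative_line_cong:
  fixes f g :: "'a::real_normed_vector \<Rightarrow> 'b::real_normed_vector"
  assumes "((\<lambda>t. g (y + t *\<^sub>R d)) has_vector_derivative D) (at 0)"
    and "open U" "y \<in> U" "\<And>w. w \<in> U \<Longrightarrow> f w = g w"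
  shows "((\<lambda>t. f (y + t *\<^sub>R d)) has_vector_derivative D) (at 0)"
proof -
  have "\<forall>\<^sub>F t in nhds 0. g (y + t *\<^sub>R d) = f (y + t *\<^sub>R d)"
    using line_eventually[OF assms(2,3), of d] by eventually_elim (simp add: assms(4))
  then obtain S where S: "open S" "0 \<in> S" "\<forall>t\<in>S. g (y + t *\<^sub>R d) = f (y + t *\<^sub>R d)"
    unfolding eventually_nhds by blast
  show ?thesis
    by (rule has_vector_derivative_transform_within_open[OF assms(1) S(1,2)]) (use S(3) in simp)
qed

lemma kern_directional:
  assumes e: "e > 0" and y: "cmod y \<noteq> e"
  shows "((\<lambda>t. kern e (y + t *\<^sub>R d)) has_vector_derivative kern_d e d y) (at 0)"
proof (cases "cmod y < e")
  case True
  have "((\<lambda>t. cnj (y + t *\<^sub>R d) / of_real (e^2)) has_vector_derivative cnj d / of_real (e^2)) (at 0)"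
    by (intro has_vector_derivative_divide has_vector_derivative_line_cnj)
  then have "((\<lambda>t. kern e (y + t *\<^sub>R d)) has_vector_derivative cnj d / of_real (e^2)) (at 0)"
    by (rule has_vector_derivative_line_cong[where U = "ball 0 e"]) (use True in \<open>auto simp: kern_inside\<close>)
  then show ?thesis using True by (simp add: kern_d_def)
next
  case False
  then have y: "cmod y > e" "y \<noteq> 0" using e assms(2) by auto
  have "((\<lambda>z. 1 / z) has_field_derivative (- 1 / y^2)) (at (y + 0 *\<^sub>R d))"
    using y(2) by (auto intro!: derivative_eq_intros simp: power2_eq_square field_simps)
  from field_vector_diff_chain_at[OF has_vector_derivative_line this]
  have "((\<lambda>t. 1 / (y + t *\<^sub>R d)) has_vector_derivative - d / y^2) (at 0)" by (simp add: o_def)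
  then have "((\<lambda>t. kern e (y + t *\<^sub>R d)) has_vector_derivative - d / y^2) (at 0)"
  proof (rule has_vector_derivative_line_cong[where U = "- cball 0 e"])
    show "kern e w = 1 / w" if "w \<in> - cball 0 e" for w using that e by (intro kern_outside) auto
  qed (use y in auto)
  then show ?thesis using False by (simp add: kern_d_def)
qed

lemma kern2_directional:
  assumes e: "e > 0" and y: "cmod y \<noteq> e"
  shows "((\<lambda>t. kern2 e (y + t *\<^sub>R d)) has_vector_derivative kern2_d e d y) (at 0)"
proof (cases "cmod y < e")
  case True
  have "((\<lambda>t. cnj (y + t *\<^sub>R d) * cnj (y + t *\<^sub>R d) / of_real (2 * e^2)) has_vector_derivative
      (cnj (y + 0 *\<^sub>R d) * cnj d + cnj d * cnj (y + 0 *\<^sub>R d)) / of_real (2 * e^2)) (at 0)"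
    by (intro has_vector_derivative_divide has_vector_derivative_mult has_vector_derivative_line_cnj)
  then have "((\<lambda>t. kern2 e (y + t *\<^sub>R d)) has_vector_derivative
      (cnj (y + 0 *\<^sub>R d) * cnj d + cnj d * cnj (y + 0 *\<^sub>R d)) / of_real (2 * e^2)) (at 0)"
    by (rule has_vector_derivative_line_cong[where U = "ball 0 e" and g = "\<lambda>w. cnj w * cnj w / of_real (2 * e^2)"])
       (use True e in \<open>auto simp: kern2_inside power2_eq_square\<close>)
  moreover have "(cnj (y + 0 *\<^sub>R d) * cnj d + cnj d * cnj (y + 0 *\<^sub>R d)) / of_real (2 * e^2) = kern2_d e d y"
    using True by (simp add: kern2_d_def field_simps)
  ultimately show ?thesis by simp
next
  case False
  then have y: "cmod y > e" "y \<noteq> 0" using e assms(2) by auto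
  have "((\<lambda>z. 1 / z) has_field_derivative (- 1 / y^2)) (at (y + 0 *\<^sub>R d))"
    using y(2) by (auto intro!: derivative_eq_intros simp: power2_eq_square field_simps)
  from field_vector_diff_chain_at[OF has_vector_derivative_line this]
  have inv: "((\<lambda>t. 1 / (y + t *\<^sub>R d)) has_vector_derivative d * (- 1 / y^2)) (at 0)" by (simp add: o_def)
  have "((\<lambda>z. of_real (e^2) / (2 * z^2)) has_field_derivative (- of_real (e^2) / y^3)) (at (y + 0 *\<^sub>R d))"
    using y(2) by (auto intro!: derivative_eq_intros simp: power2_eq_square power3_eq_cube field_simps)
  from field_vector_diff_chain_at[OF has_vector_derivative_line this]
  have inv2: "((\<lambda>t. of_real (e^2) / (2 * (y + t *\<^sub>R d)^2)) has_vector_derivative d * (- of_real (e^2) / y^3)) (at 0)" by (simp add: o_def)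
  have "((\<lambda>t. cnj (y + t *\<^sub>R d) * (1 / (y + t *\<^sub>R d)) - of_real (e^2) / (2 * (y + t *\<^sub>R d)^2)) has_vector_derivative
     (cnj (y + 0 *\<^sub>R d) * (d * (- 1 / y^2)) + cnj d * (1 / (y + 0 *\<^sub>R d))) - d * (- of_real (e^2) / y^3)) (at 0)"
    by (intro has_vector_derivative_diff has_vector_derivative_mult has_vector_derivative_line_cnj inv inv2)
  moreover have "(cnj (y + 0 *\<^sub>R d) * (d * (- 1 / y^2)) + cnj d * (1 / (y + 0 *\<^sub>R d))) - d * (- of_real (e^2) / y^3) = kern2_d e d y"
    using False by (simp add: kern2_d_def algebra_simps)
  ultimately have "((\<lambda>t. cnj (y + t *\<^sub>R d) * (1 / (y + t *\<^sub>R d)) - of_real (e^2) / (2 * (y + t *\<^sub>R d)^2)) has_vector_derivative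
     kern2_d e d y) (at 0)" by simp
  then show ?thesis
  proof (rule has_vector_derivative_line_cong[where U = "- cball 0 e" and g = "\<lambda>w. cnj w * (1 / w) - of_real (e^2) / (2 * w^2)"])
    show "kern2 e w = cnj w * (1 / w) - of_real (e^2) / (2 * w^2)" if "w \<in> - cball 0 e" for w
      using that e by (simp add: kern2_outside)
  qed (use y in auto)
qed

lemma AE_not_circle: "AE z in lborel. cmod (z - q) \<noteq> e"
proof -
  have "sphere q e \<in> null_sets lebesgue"
    using negligible_sphere[of q e] by (simp add: negligible_iff_null_sets)
  then have "sphere q e \<in> null_sets lborel"
    using null_sets_completion_iff[of "sphere q e" lborel] by (simp add: borel_closed)
  from AE_not_in[OF this] show ?thesis by (simp add: dist_norm norm_minus_commute)
qed

text \<open>Regularised Cauchy-Pompeiu formulas. The identity for direction 1 plus \<i> times the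
  one for direction \<i> is twice the derivative in the conjugate variable: it turns
  \<open>\<phi>\<close> into \<open>G\<close>, turns \<open>kern\<close> into 2/e^2 on the disc and
  0 outside, and turns \<open>kern2\<close> into \<open>2 * kern\<close>.\<close>

lemma integral_gradient_kern:
  assumes phi: "C1c \<phi> G" and e: "e > 0"
  shows "(LINT z|lborel. G z * kern e (z - q)) = - of_real (2 / e^2 * (LINT z|lborel. \<phi> z * indicator (ball q e) z))"
    and "(LINT z|lborel. of_real (\<phi> z) * kern e (z - q)) = - (LINT z|lborel. G z * kern2 e (z - q)) / 2"
proof -
  note [measurable] = C1c_borel[OF phi]
  obtain R where R0: "R > 0" and R: "\<And>z. norm z > R \<Longrightarrow> \<phi> z = 0" "\<And>z. norm z > R \<Longrightarrow> G z = 0" by (rule C1cE[OF phi]) (rule that)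
  obtain C where C: "C \<ge> 0" "\<And>z. \<bar>\<phi> z\<bar> \<le> C" "\<And>z. norm (G z) \<le> C" by (rule C1c_bounded[OF phi]) (rule that)
  have [measurable]: "kern e \<in> borel_measurable borel" "kern2 e \<in> borel_measurable borel"
    by (intro borel_measurable_continuous_onI blip_continuous kern_blip kern2_blip e)+
  obtain K where K: "\<And>y. norm (kern e y) \<le> K" using kern_blip[OF e] unfolding blip_def by blast
  have int1: "integrable lborel (\<lambda>z. G z * kern e (z - q))"
    by (rule integrable_bounded_support[of _ "C * K" R]) (auto simp: norm_mult R intro!: mult_mono C K)
  have int2: "integrable lborel (\<lambda>z. of_real (\<phi> z) * kern e (z - q))"
    by (rule integrable_bounded_support[of _ "C * K" R]) (auto simp: norm_mult R intro!: mult_mono C K)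
  have int3: "integrable lborel (\<lambda>z. G z * kern2 e (z - q))"
    by (rule integrable_bounded_support[of _ "C * 1" R]) (auto simp: norm_mult R intro!: mult_mono C kern2_le_1 e simp del: mult_1_right)
  have "integrable lborel (\<lambda>z. \<phi> z * indicator (ball q e) z)"
    by (rule Bochner_Integration.integrable_bound[OF C1c_integrable(1)[OF phi]])
       (auto simp: abs_mult indicator_def)
  then have int4: "integrable lborel (\<lambda>z. complex_of_real (\<phi> z * indicator (ball q e) z))"
    by (rule integrable_of_real)
  have comb: "complex_of_real (inner 1 (G z)) + \<i> * complex_of_real (inner \<i> (G z)) = G z" for z
    by (simp add: complex_eq_iff inner_complex_def)
  have d1: "has_bochner_integral lborel (\<lambda>z. of_real (inner d (G z)) * kern e (z - q) + of_real (\<phi> z) * kern_d e d (z - q)) 0" for d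
    by (rule C1c_kernel_integral_zero[OF phi kern_blip[OF e]])
       (use AE_not_circle[of q e] in \<open>auto elim!: eventually_mono intro!: kern_directional[OF e]\<close>)
  have d2: "has_bochner_integral lborel (\<lambda>z. of_real (inner d (G z)) * kern2 e (z - q) + of_real (\<phi> z) * kern2_d e d (z - q)) 0" for d
    by (rule C1c_kernel_integral_zero[OF phi kern2_blip[OF e]])
       (use AE_not_circle[of q e] in \<open>auto elim!: eventually_mono intro!: kern2_directional[OF e]\<close>)
  have k1: "kern_d e 1 y + \<i> * kern_d e \<i> y = of_real (2 / e^2 * indicator (ball 0 e) y)" for y
    by (simp add: kern_d_def indicator_def)
  have i1: "\<i> * (x * \<i> / w) = - (x / w)" "\<i> * (\<i> / w) = - (1 / w)" "\<i> * (x * \<i>) = - x" for x w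
  proof -
    have "\<i> * (x * \<i> / w) = (\<i> * \<i>) * (x / w)" "\<i> * (\<i> / w) = (\<i> * \<i>) * (1 / w)" "\<i> * (x * \<i>) = (\<i> * \<i>) * x"
      by (simp_all only: divide_inverse mult_ac mult_1_left)
    then show "\<i> * (x * \<i> / w) = - (x / w)" "\<i> * (\<i> / w) = - (1 / w)" "\<i> * (x * \<i>) = - x" by simp_all
  qed
  have k2: "kern2_d e 1 y + \<i> * kern2_d e \<i> y = 2 * kern e y" for y
    using e by (simp add: kern2_d_def kern_inside kern_outside right_diff_distrib distrib_left i1)
  have "has_bochner_integral lborel (\<lambda>z. (of_real (inner 1 (G z)) * kern e (z - q) + of_real (\<phi> z) * kern_d e 1 (z - q)) +
      \<i> * (of_real (inner \<i> (G z)) * kern e (z - q) + of_real (\<phi> z) * kern_d e \<i> (z - q))) (0 + \<i> * 0)"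
    by (intro has_bochner_integral_add has_bochner_integral_mult_right d1)
  moreover have "(of_real (inner 1 (G z)) * kern e (z - q) + of_real (\<phi> z) * kern_d e 1 (z - q)) +
      \<i> * (of_real (inner \<i> (G z)) * kern e (z - q) + of_real (\<phi> z) * kern_d e \<i> (z - q))
      = G z * kern e (z - q) + of_real (2 / e^2) * of_real (\<phi> z * indicator (ball q e) z)" (is "?l = _") for z
  proof -
    have "?l = (of_real (inner 1 (G z)) + \<i> * of_real (inner \<i> (G z))) * kern e (z - q) + of_real (\<phi> z) * (kern_d e 1 (z - q) + \<i> * kern_d e \<i> (z - q))"
      by (simp add: algebra_simps)
    also have "\<dots> = G z * kern e (z - q) + of_real (\<phi> z) * of_real (2 / e^2 * indicator (ball 0 e) (z - q))"
      by (simp only: comb k1)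
    also have "indicator (ball 0 e) (z - q) = (indicator (ball q e) z :: real)"
      by (simp add: indicator_def dist_norm norm_minus_commute)
    finally show ?thesis by (simp add: mult_ac)
  qed
  ultimately have "has_bochner_integral lborel (\<lambda>z. G z * kern e (z - q) + of_real (2 / e^2) * of_real (\<phi> z * indicator (ball q e) z)) 0"
    by simp
  then have "(LINT z|lborel. G z * kern e (z - q)) + of_real (2 / e^2) * (LINT z|lborel. complex_of_real (\<phi> z * indicator (ball q e) z)) = 0"
    using int1 int4 by (simp add: has_bochner_integral_iff del: of_real_mult)
  then have "(LINT z|lborel. G z * kern e (z - q)) = - (of_real (2 / e^2) * (LINT z|lborel. complex_of_real (\<phi> z * indicator (ball q e) z)))"
    by (simp only: eq_neg_iff_add_eq_0)
  then show "(LINT z|lborel. G z * kern e (z - q)) = - of_real (2 / e^2 * (LINT z|lborel. \<phi> z * indicator (ball q e) z))"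
    unfolding integral_complex_of_real of_real_mult[of "2 / e^2"] .
  have "has_bochner_integral lborel (\<lambda>z. (of_real (inner 1 (G z)) * kern2 e (z - q) + of_real (\<phi> z) * kern2_d e 1 (z - q)) +
      \<i> * (of_real (inner \<i> (G z)) * kern2 e (z - q) + of_real (\<phi> z) * kern2_d e \<i> (z - q))) (0 + \<i> * 0)"
    by (intro has_bochner_integral_add has_bochner_integral_mult_right d2)
  moreover have "(of_real (inner 1 (G z)) * kern2 e (z - q) + of_real (\<phi> z) * kern2_d e 1 (z - q)) +
      \<i> * (of_real (inner \<i> (G z)) * kern2 e (z - q) + of_real (\<phi> z) * kern2_d e \<i> (z - q))
      = G z * kern2 e (z - q) + 2 * (of_real (\<phi> z) * kern e (z - q))" (is "?l = _") for z
  proof -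
    have "?l = (of_real (inner 1 (G z)) + \<i> * of_real (inner \<i> (G z))) * kern2 e (z - q) + of_real (\<phi> z) * (kern2_d e 1 (z - q) + \<i> * kern2_d e \<i> (z - q))"
      by (simp add: algebra_simps)
    also have "\<dots> = G z * kern2 e (z - q) + 2 * (of_real (\<phi> z) * kern e (z - q))"
      by (simp only: comb k2) simp
    finally show ?thesis .
  qed
  ultimately have "has_bochner_integral lborel (\<lambda>z. G z * kern2 e (z - q) + 2 * (of_real (\<phi> z) * kern e (z - q))) 0"
    by simp
  then have "(LINT z|lborel. G z * kern2 e (z - q)) + 2 * (LINT z|lborel. of_real (\<phi> z) * kern e (z - q)) = 0"
    using int2 int3 by (simp add: has_bochner_integral_iff)
  then show "(LINT z|lborel. of_real (\<phi> z) * kern e (z - q)) = - (LINT z|lborel. G z * kern2 e (z - q)) / 2"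
    by (simp add: field_simps eq_neg_iff_add_eq_0 add.commute)
qed

text \<open>
  In the interior of the support of the gradient the cut-off kernel is \<open>1/(z - q)\<close>, the conjugate of the gradient of
  \<open>ln |z - q|\<close>; so this is the flux of a logarithmic pole.
\<close>

lemma integral_gradient_log_pole:
  assumes phi: "C1c \<phi> G" and e: "e > 0" and const: "\<And>z. z \<in> ball q e \<Longrightarrow> \<phi> z = \<phi> q"
  shows "(LINT z|lborel. G z / (z - q)) = - of_real (2 * pi * \<phi> q)"
proof -
  have "G z / (z - q) = G z * kern e (z - q)" for z
  proof (cases "z \<in> ball q e")
    case True
    have "G z = 0"
      by (rule GDERIV_locally_const[of \<phi> z _ "ball q e"]) (use phi True const in \<open>auto simp: C1c_def\<close>)
    then show ?thesis by simp
  next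
    case False
    then have "kern e (z - q) = 1 / (z - q)"
      using e by (intro kern_outside) (auto simp: dist_norm norm_minus_commute)
    then show ?thesis by simp
  qed
  then have "(LINT z|lborel. G z / (z - q)) = (LINT z|lborel. G z * kern e (z - q))" by simp
  also have "\<dots> = - of_real (2 / e^2 * (LINT z|lborel. \<phi> z * indicator (ball q e) z))"
    by (rule integral_gradient_kern(1)[OF phi e])
  also have "(LINT z|lborel. \<phi> z * indicator (ball q e) z) = (LINT z|lborel. \<phi> q * indicator (ball q e) z)"
    by (intro Bochner_Integration.integral_cong) (auto simp: const split: split_indicator)
  also have "\<dots> = \<phi> q * (pi * e^2)"
    using e by (simp add: content_ball unit_ball_vol_2)
  finally show ?thesis using e by (simp add: field_simps)
qed

text \<open>Fubini for \<phi>(z) G(w) kern(w - z). Integrating first in \<open>w\<close> leaves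
  -2/e^2 times \<phi>(z) times the integral of \<phi> over the disc around \<open>z\<close>.
  Integrating first in \<open>z\<close> leaves half the double integral of G(w) G(z) kern2(z - w),
  which is bounded by half the square of the L^1 norm of \<open>G\<close>.\<close>

lemma double_integral_kern:
  assumes phi: "C1c \<phi> G" and e: "e > 0"
  shows "integrable lborel (\<lambda>z. \<phi> z * (LINT w|lborel. \<phi> w * indicator (ball z e) w))"
    and "4 / e^2 * (LINT z|lborel. \<phi> z * (LINT w|lborel. \<phi> w * indicator (ball z e) w)) \<le> (LINT z|lborel. norm (G z))^2"
proof -
  note [measurable] = C1c_borel[OF phi]
  obtain R where R0: "R > 0" and R: "\<And>z. norm z > R \<Longrightarrow> \<phi> z = 0" "\<And>z. norm z > R \<Longrightarrow> G z = 0" by (rule C1cE[OF phi]) (rule that)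
  obtain C where C: "C \<ge> 0" "\<And>z. \<bar>\<phi> z\<bar> \<le> C" "\<And>z. norm (G z) \<le> C" by (rule C1c_bounded[OF phi]) (rule that)
  obtain K where K: "\<And>y. norm (kern e y) \<le> K" using kern_blip[OF e] unfolding blip_def by blast
  have [measurable]: "kern e \<in> borel_measurable borel" "kern2 e \<in> borel_measurable borel"
    by (intro borel_measurable_continuous_onI blip_continuous kern_blip kern2_blip e)+
  have K0: "K \<ge> 0" using order_trans[OF norm_ge_zero K] .
  define I where "I z = (LINT w|lborel. \<phi> w * indicator (ball z e) w)" for z
  define f where "f = (\<lambda>z w. of_real (\<phi> z) * (G w * kern e (w - z)))"
  have "integrable lborel (\<lambda>(z, w). f z w)"
  proof (rule integrable_bounded_support[of _ "C * (C * K)" "R + R"])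
    show "(\<lambda>(z, w). f z w) \<in> borel_measurable borel"
      unfolding f_def borel_prod[symmetric] by measurable
    show "norm (case x of (z, w) \<Rightarrow> f z w) \<le> C * (C * K)" for x
      unfolding f_def using C(1) K0 by (cases x) (auto simp: norm_mult intro!: mult_mono C K)
    show "(case x of (z, w) \<Rightarrow> f z w) = 0" if "R + R < norm x" for x
    proof (cases x)
      case (Pair z w)
      then have "norm z > R \<or> norm w > R" using that norm_Pair_le[of z w] by auto
      then show ?thesis using Pair R by (auto simp: f_def)
    qed
  qed
  then have int: "integrable (lborel \<Otimes>\<^sub>M lborel) (\<lambda>(z, w). f z w)"
    by (simp only: lborel_prod)
  have z_first: "(LINT w|lborel. f z w) = of_real (- (2 / e^2) * (\<phi> z * I z))" for z
    unfolding f_def I_def using integral_gradient_kern(1)[OF phi e, of z] by simp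
  \<comment> \<open>Oddness brings the inner integral over \<open>z\<close> into the form of the
    second kernel formula, now centred at \<open>w\<close>.\<close>
  have kern_odd: "kern e (w - z) = - kern e (z - w)" for z w
  proof -
    have "cnj (w - z) = - cnj (z - w)" by simp
    then show ?thesis
      by (simp only: kern_def norm_minus_commute[of w z] minus_divide_left[symmetric] mult_minus_left)
  qed
  have w_first: "(LINT z|lborel. f z w) = G w * ((LINT z|lborel. G z * kern2 e (z - w)) / 2)" for w
  proof -
    have "(LINT z|lborel. f z w) = (LINT z|lborel. - G w * (of_real (\<phi> z) * kern e (z - w)))"
      unfolding f_def by (intro Bochner_Integration.integral_cong) (auto simp: kern_odd[of w])
    also have "\<dots> = - G w * (LINT z|lborel. of_real (\<phi> z) * kern e (z - w))" by simp
    finally show ?thesis by (simp add: integral_gradient_kern(2)[OF phi e])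
  qed
  have "integrable lborel (\<lambda>z. LINT w|lborel. f z w)"
    using lborel_pair.integrable_fst'[OF int] by simp
  then have "integrable lborel (\<lambda>z. Re (of_real (- (2 / e^2) * (\<phi> z * I z))))"
    unfolding z_first by (rule integrable_Re)
  then have "integrable lborel (\<lambda>z. - (e^2 / 2) * (- (2 / e^2) * (\<phi> z * I z)))"
    unfolding Re_complex_of_real by (rule integrable_mult_right)
  then have intI: "integrable lborel (\<lambda>z. \<phi> z * I z)" using e by simp
  then show "integrable lborel (\<lambda>z. \<phi> z * (LINT w|lborel. \<phi> w * indicator (ball z e) w))"
    by (simp add: I_def)
  define N where "N = (LINT z|lborel. norm (G z))"
  have N: "N \<ge> 0" by (simp add: N_def)
  have bd: "norm (LINT z|lborel. G z * kern2 e (z - w)) \<le> N" for w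
  proof -
    have "norm (LINT z|lborel. G z * kern2 e (z - w)) \<le> (LINT z|lborel. norm (G z * kern2 e (z - w)))"
      by (rule integral_norm_bound)
    also have "\<dots> \<le> N"
      unfolding N_def
    proof (rule integral_mono')
      show "integrable lborel (\<lambda>x. cmod (G x))" using C1c_integrable(2)[OF phi] by simp
      show "norm (G z * kern2 e (z - w)) \<le> norm (G z)" for z
        using mult_left_mono[OF kern2_le_1[OF e, of "z - w"] norm_ge_zero[of "G z"]] by (simp add: norm_mult)
    qed simp
    finally show ?thesis .
  qed
  have "(LINT z|lborel. of_real (- (2 / e^2) * (\<phi> z * I z))) = (LINT w|lborel. G w * ((LINT z|lborel. G z * kern2 e (z - w)) / 2))"
    using lborel_pair.Fubini_integral[OF int] unfolding z_first w_first by simp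
  then have "complex_of_real (- (2 / e^2) * (LINT z|lborel. \<phi> z * I z)) = (LINT w|lborel. G w * ((LINT z|lborel. G z * kern2 e (z - w)) / 2))"
    unfolding integral_complex_of_real by simp
  then have "norm (complex_of_real (- (2 / e^2) * (LINT z|lborel. \<phi> z * I z))) = norm (LINT w|lborel. G w * ((LINT z|lborel. G z * kern2 e (z - w)) / 2))"
    by (rule arg_cong)
  also have "\<dots> \<le> (LINT w|lborel. norm (G w * ((LINT z|lborel. G z * kern2 e (z - w)) / 2)))"
    by (rule integral_norm_bound)
  also have "\<dots> \<le> (LINT w|lborel. norm (G w) * (N / 2))"
  proof (rule integral_mono')
    show "integrable lborel (\<lambda>x. cmod (G x) * (N / 2))"
      by (intro integrable_mult_left integrable_norm C1c_integrable(2)[OF phi])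
    show "norm (G w * ((LINT z|lborel. G z * kern2 e (z - w)) / 2)) \<le> norm (G w) * (N / 2)" for w
      using mult_left_mono[OF bd[of w] norm_ge_zero[of "G w"]] by (simp add: norm_mult norm_divide)
    show "0 \<le> cmod (G w) * (N / 2)" for w using N by simp
  qed
  also have "\<dots> = N^2 / 2" by (simp add: N_def power2_eq_square)
  finally have "2 / e^2 * \<bar>LINT z|lborel. \<phi> z * I z\<bar> \<le> N^2 / 2"
    unfolding norm_of_real by (simp add: abs_mult)
  then have "2 / e^2 * (LINT z|lborel. \<phi> z * I z) \<le> N^2 / 2"
    by (rule order_trans[rotated]) (intro mult_left_mono abs_ge_self, simp)
  then show "4 / e^2 * (LINT z|lborel. \<phi> z * (LINT w|lborel. \<phi> w * indicator (ball z e) w)) \<le> (LINT z|lborel. norm (G z))^2"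
    by (simp add: I_def N_def)
qed

text \<open>As \<open>e\<close> tends to 0, the integral of \<phi> over the disc of radius
  \<open>e\<close> around \<open>z\<close>, divided by e^2, tends to pi times \<phi>(z). The
  Lipschitz constant controls the error, and nonnegativity allows multiplying the pointwise lower
  bound by \<phi>(z). The constant is the isoperimetric one: for smoothed indicators of discs both
  sides agree in the limit.\<close>

theorem sobolev_plane:
  assumes phi: "C1c \<phi> G" and nonneg: "\<And>z. \<phi> z \<ge> 0"
  shows "4 * pi * (LINT z|lborel. (\<phi> z)^2) \<le> (LINT z|lborel. norm (G z))^2"
proof -
  note [measurable] = C1c_borel[OF phi]
  obtain R where R0: "R > 0" and R: "\<And>z. norm z > R \<Longrightarrow> \<phi> z = 0" "\<And>z. norm z > R \<Longrightarrow> G z = 0" by (rule C1cE[OF phi]) (rule that)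
  obtain C where C: "C \<ge> 0" "\<And>z. \<bar>\<phi> z\<bar> \<le> C" "\<And>z. norm (G z) \<le> C" by (rule C1c_bounded[OF phi]) (rule that)
  obtain L where L: "L-lipschitz_on UNIV \<phi>" using C1c_lipschitz[OF phi] .
  have int_phi: "integrable lborel \<phi>" by (rule C1c_integrable(1)[OF phi])
  have int_sq: "integrable lborel (\<lambda>z. (\<phi> z)^2)"
  proof (rule integrable_bounded_support[of _ "C^2" R])
    show "norm ((\<phi> z)^2) \<le> C^2" for z using power_mono[OF C(2)[of z], of 2] by simp
  qed (auto simp: R)
  have main: "4 * pi * ((LINT z|lborel. (\<phi> z)^2) - L * e * (LINT z|lborel. \<phi> z)) \<le> (LINT z|lborel. norm (G z))^2" if e: "e > 0" for e
  proof -
    define I where "I z = (LINT w|lborel. \<phi> w * indicator (ball z e) w)" for z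
    have I: "I z \<ge> (\<phi> z - L * e) * (pi * e^2)" for z
    proof -
      have "(\<phi> z - L * e) * (pi * e^2) = (LINT w|lborel. (\<phi> z - L * e) * indicator (ball z e) w)"
        using e by (simp add: content_ball unit_ball_vol_2)
      also have "\<dots> \<le> I z"
        unfolding I_def
      proof (rule integral_mono)
        show "integrable lborel (\<lambda>w. (\<phi> z - L * e) * indicator (ball z e) w)"
          by (intro integrable_mult_right integrable_real_indicator) (use emeasure_bounded_finite[OF bounded_ball] in auto)
        show "integrable lborel (\<lambda>w. \<phi> w * indicator (ball z e) w)"
          by (rule Bochner_Integration.integrable_bound[OF int_phi]) (auto simp: abs_mult indicator_def)
        show "(\<phi> z - L * e) * indicator (ball z e) w \<le> \<phi> w * indicator (ball z e) w" for w
        proof (cases "w \<in> ball z e")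
          case True
          have "\<bar>\<phi> z - \<phi> w\<bar> \<le> L * dist z w" using lipschitz_onD[OF L, of z w] by (simp add: dist_real_def)
          also have "\<dots> \<le> L * e" using True lipschitz_on_nonneg[OF L] by (intro mult_left_mono) auto
          finally show ?thesis using True by simp
        qed simp
      qed
      finally show ?thesis .
    qed
    have "pi * e^2 * ((LINT z|lborel. (\<phi> z)^2) - L * e * (LINT z|lborel. \<phi> z)) = (LINT z|lborel. pi * e^2 * ((\<phi> z)^2 - L * e * \<phi> z))"
      using int_sq int_phi by simp
    also have "\<dots> \<le> (LINT z|lborel. \<phi> z * I z)"
    proof (rule integral_mono)
      show "integrable lborel (\<lambda>z. pi * e^2 * ((\<phi> z)^2 - L * e * \<phi> z))"
        by (intro integrable_mult_right Bochner_Integration.integrable_diff int_sq int_phi)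
      show "integrable lborel (\<lambda>z. \<phi> z * I z)" unfolding I_def by (rule double_integral_kern(1)[OF phi e])
      show "pi * e^2 * ((\<phi> z)^2 - L * e * \<phi> z) \<le> \<phi> z * I z" for z
        using mult_left_mono[OF I[of z] nonneg[of z]] by (simp add: power2_eq_square algebra_simps)
    qed
    finally have "4 / e^2 * (pi * e^2 * ((LINT z|lborel. (\<phi> z)^2) - L * e * (LINT z|lborel. \<phi> z))) \<le> 4 / e^2 * (LINT z|lborel. \<phi> z * I z)"
      by (rule mult_left_mono) simp
    also have "\<dots> \<le> (LINT z|lborel. norm (G z))^2"
      unfolding I_def by (rule double_integral_kern(2)[OF phi e])
    finally show ?thesis using e by simp
  qed
  have "((\<lambda>e. 4 * pi * ((LINT z|lborel. (\<phi> z)^2) - L * e * (LINT z|lborel. \<phi> z))) \<longlongrightarrow>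
      4 * pi * ((LINT z|lborel. (\<phi> z)^2) - L * 0 * (LINT z|lborel. \<phi> z))) (at_right 0)"
    by (intro tendsto_intros)
  moreover have "\<forall>\<^sub>F e in at_right 0. 4 * pi * ((LINT z|lborel. (\<phi> z)^2) - L * e * (LINT z|lborel. \<phi> z)) \<le> (LINT z|lborel. norm (G z))^2"
    using eventually_at_right_less[of "0::real"] by eventually_elim (rule main)
  ultimately have "4 * pi * ((LINT z|lborel. (\<phi> z)^2) - L * 0 * (LINT z|lborel. \<phi> z)) \<le> (LINT z|lborel. norm (G z))^2"
    by (rule tendsto_upperbound) simp
  then show ?thesis by simp
qed

section \<open>The comparison argument for the level set profile\<close>

text \<open>Only increments over s < t are assumed, since a level set of positive area would make
  \<open>A\<close> and \<open>f\<close> jump and this is not excluded in advance. Area is divided by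
  pi and flux by 2 pi, whence the factors 2.\<close>

locale bol_profile =
  fixes A f :: "real \<Rightarrow> real" and a b \<alpha> \<beta> :: real
  assumes ab: "0 < a" "a \<le> b" and al: "-1 < \<alpha>" "\<alpha> \<le> 0" and be: "-1 < \<beta>"
    and A_nonneg: "\<And>t. 0 \<le> A t" and A_antimono: "\<And>s t. s \<le> t \<Longrightarrow> A t \<le> A s"
    and f_lower: "\<And>t. - \<alpha> \<le> f t" and f_upper: "\<And>t. f t \<le> 2 + \<beta>"
    and mass_lower: "\<And>s t. s < t \<Longrightarrow> a * exp (2 * s) * (A s - A t) \<le> 2 * (f s - f t)"
    and mass_upper: "\<And>s t. s < t \<Longrightarrow> 2 * (f s - f t) \<le> b * exp (2 * t) * (A s - A t)"
    and isop: "\<And>s t. s < t \<Longrightarrow> 2 * (t - s) * A t \<le> f s * (A s - A t)"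
    and lim_A_top: "((\<lambda>t. exp (2 * t) * A t) \<longlongrightarrow> 0) at_top"
    and lim_A_bot: "((\<lambda>t. exp (2 * t) * A t) \<longlongrightarrow> 0) at_bot"
    and lim_f_top: "(f \<longlongrightarrow> - \<alpha>) at_top"
    and lim_f_bot: "(f \<longlongrightarrow> 2 + \<beta>) at_bot"
begin

text \<open>The derivative is 2 (1 - x) / b for x < 1 and 2 (1 - x) / a for x > 1. Formally,
  \<open>isop\<close> bounds d(e^{2t} A) by (1 - f) e^{2t} dA. For f < 1 the bound \<open>b\<close>
  and for f > 1 the bound \<open>a\<close> replaces e^{2t} dA by 2 df / b or 2 df / a in the right
  direction, giving d(\<Gamma>(f)).\<close>

definition \<Gamma> :: "real \<Rightarrow> real" where
  "\<Gamma> x = ((1 + \<alpha>)\<^sup>2 - (max 0 (1 - x))\<^sup>2) / b - (max 0 (x - 1))\<^sup>2 / a"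

definition H :: "real \<Rightarrow> real" where
  "H t = exp (2 * t) * A t - \<Gamma> (f t)"

lemma b_pos: "b > 0" using ab by simp

lemma f_nonneg: "0 \<le> f t" using f_lower[of t] al by simp

lemma f_antimono: "s \<le> t \<Longrightarrow> f t \<le> f s"
proof (cases "s = t")
  assume "s \<le> t" "s \<noteq> t"
  then have "a * exp (2 * s) * (A s - A t) \<le> 2 * (f s - f t)" by (intro mass_lower) simp
  moreover have "0 \<le> a * exp (2 * s) * (A s - A t)"
    using A_antimono[OF \<open>s \<le> t\<close>] ab by simp
  ultimately show ?thesis by simp
qed simp

lemma Gam_low: "x \<le> 1 \<Longrightarrow> \<Gamma> x = ((1 + \<alpha>)\<^sup>2 - (1 - x)\<^sup>2) / b"
  by (simp add: \<Gamma>_def max_absorb2)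

lemma Gam_high: "1 \<le> x \<Longrightarrow> \<Gamma> x = (1 + \<alpha>)\<^sup>2 / b - (x - 1)\<^sup>2 / a"
  by (simp add: \<Gamma>_def max_absorb2 max_absorb1)

text \<open>The larger argument may lie beyond the switch at 1: there \<Gamma> falls at the rate
  1/a, which is at least 1/b, so the formula of the lower branch remains an upper bound.\<close>

lemma Gam_decr_low:
  assumes "x \<le> y" "x \<le> 1"
  shows "\<Gamma> y - \<Gamma> x \<le> (y - x) * (2 - x - y) / b"
proof (cases "y \<le> 1")
  case True
  have "\<Gamma> y - \<Gamma> x = ((1 - x)\<^sup>2 - (1 - y)\<^sup>2) / b"
    using True assms by (simp add: Gam_low diff_divide_distrib)
  also have "(1 - x)\<^sup>2 - (1 - y)\<^sup>2 = (y - x) * (2 - x - y)" by (simp add: power2_eq_square algebra_simps)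
  finally show ?thesis by simp
next
  case False
  have "\<Gamma> y - \<Gamma> x = (1 - x)\<^sup>2 / b - (y - 1)\<^sup>2 / a"
    using False assms by (simp add: Gam_low Gam_high diff_divide_distrib)
  also have "\<dots> \<le> (1 - x)\<^sup>2 / b - (y - 1)\<^sup>2 / b"
    using ab by (intro diff_left_mono divide_left_mono) auto
  also have "\<dots> = ((1 - x)\<^sup>2 - (1 - y)\<^sup>2) / b"
    by (simp add: diff_divide_distrib power2_commute)
  also have "(1 - x)\<^sup>2 - (1 - y)\<^sup>2 = (y - x) * (2 - x - y)" by (simp add: power2_eq_square algebra_simps)
  finally show ?thesis by simp
qed

lemma Gam_decr_high:
  assumes "x \<le> y" "1 \<le> x"
  shows "\<Gamma> y - \<Gamma> x = - ((y - x) / a * (x + y - 2))"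
proof -
  have "\<Gamma> y - \<Gamma> x = ((x - 1)\<^sup>2 - (y - 1)\<^sup>2) / a"
    using assms by (simp add: Gam_high diff_divide_distrib)
  also have "(x - 1)\<^sup>2 - (y - 1)\<^sup>2 = - ((y - x) * (x + y - 2))" by (simp add: power2_eq_square algebra_simps)
  finally show ?thesis by simp
qed

lemma exp_diff_bound: "exp (2 * t) - exp (2 * s) \<le> 2 * (t - s) * exp (2 * t)" for s t :: real
proof -
  have "1 + (2 * s - 2 * t) \<le> exp (2 * s - 2 * t)" by (rule exp_ge_add_one_self)
  then have "exp (2 * t) * (1 + (2 * s - 2 * t)) \<le> exp (2 * t) * exp (2 * s - 2 * t)"
    by (intro mult_left_mono) auto
  also have "\<dots> = exp (2 * s)" by (simp flip: exp_add)
  finally show ?thesis by (simp add: algebra_simps)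
qed

text \<open>A discrete product rule for exp(2t) A(t); convexity of the exponential gives its error a
  sign.\<close>

lemma X_step:
  assumes "s < t"
  shows "exp (2 * t) * A t - exp (2 * s) * A s \<le> 2 * (t - s) * exp (2 * t) * A t - exp (2 * s) * (A s - A t)"
  using mult_right_mono[OF exp_diff_bound[of t s] A_nonneg[of t]] by (simp add: algebra_simps)

lemma mass_half_upper: "s < t \<Longrightarrow> (f s - f t) / b \<le> exp (2 * t) * (A s - A t) / 2"
  using mass_upper[of s t] b_pos by (simp add: field_simps)

lemma mass_half_lower: "s < t \<Longrightarrow> exp (2 * s) * (A s - A t) / 2 \<le> (f s - f t) / a"
  using mass_lower[of s t] ab by (simp add: field_simps)

text \<open>The discrete form of the formal computation. The error is the drop of \<open>A\<close>
  times the sum of a drop of \<open>f\<close> and a drop of the exponential, so it is of second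
  order as long as \<open>f\<close> does not fall much in the step.\<close>

lemma H_step_fine:
  assumes st: "s < t"
  shows "H t - H s \<le> (A s - A t) * (exp (2 * t) * (f s - f t) + (exp (2 * t) - exp (2 * s)) * (3 + \<beta>))"
proof -
  define d where "d = A s - A t"
  have d: "d \<ge> 0" using A_antimono[of s t] st by (simp add: d_def)
  have ff: "f t \<le> f s" using f_antimono[of s t] st by simp
  define E1 where "E1 = exp (2 * s)"
  define E2 where "E2 = exp (2 * t)"
  have E: "0 < E1" "E1 \<le> E2" using st by (auto simp: E1_def E2_def)
  have "2 * (t - s) * E2 * A t = E2 * (2 * (t - s) * A t)" by simp
  also have "\<dots> \<le> E2 * (f s * d)" using isop[OF st] E by (intro mult_left_mono) (auto simp: d_def)
  finally have "E2 * A t - E1 * A s \<le> E2 * f s * d - E1 * d"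
    using X_step[OF st, folded E1_def E2_def d_def] by (simp only: mult.assoc)
  moreover have "\<Gamma> (f s) - \<Gamma> (f t) \<le> (E2 * (1 - f t) * d) + (E2 - E1) * d * (2 + \<beta>)"
  proof (cases "f t \<le> 1")
    case True
    have "\<Gamma> (f s) - \<Gamma> (f t) \<le> (f s - f t) * (2 - f t - f s) / b"
      by (rule Gam_decr_low[OF ff True])
    also have "\<dots> \<le> (f s - f t) / b * (2 * (1 - f t))"
      using ff b_pos by (simp add: divide_right_mono mult_left_mono)
    also have "\<dots> \<le> E2 * d / 2 * (2 * (1 - f t))"
      using mass_half_upper[OF st] True by (intro mult_right_mono) (auto simp: E2_def d_def)
    also have "\<dots> = E2 * (1 - f t) * d" by (simp add: field_simps)
    also have "\<dots> \<le> E2 * (1 - f t) * d + (E2 - E1) * d * (2 + \<beta>)"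
      using d E be mult_nonneg_nonneg[of "(E2 - E1) * d" "2 + \<beta>"] by simp
    finally show ?thesis .
  next
    case False
    have "\<Gamma> (f s) - \<Gamma> (f t) = - ((f s - f t) / a * (f t + f s - 2))"
      using Gam_decr_high[OF ff] False by simp
    also have "\<dots> \<le> - (E1 * d / 2 * (2 * (f t - 1)))"
      using mass_half_lower[OF st] False ff E d ab
      by (intro le_imp_neg_le mult_mono) (auto simp: E1_def d_def intro!: divide_nonneg_pos)
    also have "\<dots> = E2 * (1 - f t) * d + (E2 - E1) * d * (f t - 1)"
      by (simp add: algebra_simps)
    also have "\<dots> \<le> E2 * (1 - f t) * d + (E2 - E1) * d * (2 + \<beta>)"
      using f_upper[of t] d E by (intro add_left_mono mult_left_mono) auto
    finally show ?thesis .
  qed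
  ultimately have "H t - H s \<le> E2 * f s * d - E1 * d + ((E2 * (1 - f t) * d) + (E2 - E1) * d * (2 + \<beta>))"
    unfolding H_def E1_def E2_def by linarith
  also have "\<dots> = d * (E2 * (f s - f t) + (E2 - E1) * (3 + \<beta>))" by (simp add: algebra_simps)
  finally show ?thesis by (simp add: d_def E1_def E2_def)
qed

text \<open>For steps in which \<open>f\<close> falls a lot. A sudden drop of \<open>A\<close> and
  \<open>f\<close> by itself does not raise \<open>H\<close> except through the change of the
  exponential, so the error is still proportional to the step length.\<close>

lemma H_step_coarse:
  assumes st: "s < t"
  shows "H t - H s \<le> 2 * (t - s) * exp (2 * t) * A t + (exp (2 * t) - exp (2 * s)) * (A s - A t)"
proof -
  define d where "d = A s - A t"
  have d: "d \<ge> 0" using A_antimono[of s t] st by (simp add: d_def)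
  have ff: "f t \<le> f s" using f_antimono[of s t] st by simp
  have "\<Gamma> (f s) - \<Gamma> (f t) \<le> exp (2 * t) * d"
  proof (cases "f t \<le> 1")
    case True
    have "\<Gamma> (f s) - \<Gamma> (f t) \<le> (f s - f t) * (2 - f t - f s) / b"
      by (rule Gam_decr_low[OF ff True])
    also have "\<dots> \<le> (f s - f t) * 2 / b"
      using ff b_pos f_nonneg[of t] f_nonneg[of s] by (intro divide_right_mono mult_left_mono) auto
    also have "\<dots> = (f s - f t) / b * 2" by simp
    also have "\<dots> \<le> exp (2 * t) * d / 2 * 2"
      using mass_half_upper[OF st] by (intro mult_right_mono) (auto simp: d_def)
    finally show ?thesis by simp
  next
    case False
    have "\<Gamma> (f s) - \<Gamma> (f t) = - ((f s - f t) / a * (f t + f s - 2))"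
      using Gam_decr_high[OF ff] False by simp
    also have "\<dots> \<le> 0" using ff False ab by (simp add: divide_nonneg_pos)
    also have "\<dots> \<le> exp (2 * t) * d" using d by simp
    finally show ?thesis .
  qed
  then show ?thesis using X_step[OF st] unfolding H_def d_def by (simp add: algebra_simps)
qed

text \<open>Steps with a drop of \<open>f\<close> up to \<delta> use the fine estimate. In the
  others the drop divided by \<delta> exceeds 1 and pays for the coarse error. Either way the bound
  is linear in the drops of \<open>A\<close> and \<open>f\<close>, so it telescopes over a
  partition.\<close>

lemma H_step:
  assumes st: "s < t" "p \<le> s" "t \<le> q" and e: "\<delta> > 0"
  shows "H t - H s \<le> 2 * exp (2 * q) * (3 + \<beta> + A p) * ((t - s + \<delta>) * (A s - A t) + (t - s) / \<delta> * (f s - f t))"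
proof -
  define d where "d = A s - A t"
  have d: "d \<ge> 0" using A_antimono[of s t] st by (simp add: d_def)
  have ff: "f t \<le> f s" using f_antimono[of s t] st by simp
  define E where "E = exp (2 * q)"
  have E: "exp (2 * t) \<le> E" "E > 0" using st by (auto simp: E_def)
  define M where "M = 3 + \<beta>"
  have M: "M \<ge> 1" using be by (simp add: M_def)
  define A0 where "A0 = A p"
  have A0: "A0 \<ge> 0" "A t \<le> A0" using A_nonneg A_antimono[of p t] st by (auto simp: A0_def)
  have Ed: "exp (2 * t) - exp (2 * s) \<le> 2 * (t - s) * E"
    by (rule order_trans[OF exp_diff_bound mult_left_mono[OF E(1)]]) (use st in simp)
  have "H t - H s \<le> 2 * E * (M + A0) * ((t - s + \<delta>) * d + (t - s) / \<delta> * (f s - f t))"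
  proof (cases "f s - f t \<le> \<delta>")
    case True
    have "H t - H s \<le> d * (exp (2 * t) * (f s - f t) + (exp (2 * t) - exp (2 * s)) * M)"
      using H_step_fine[OF st(1)] by (simp add: d_def M_def)
    also have "\<dots> \<le> d * (E * \<delta> + 2 * (t - s) * E * M)"
      using d E M True Ed ff by (intro mult_left_mono add_mono mult_mono mult_right_mono) auto
    also have "\<dots> \<le> d * (2 * E * M * (t - s + \<delta>))"
    proof (rule mult_left_mono[OF _ d])
      have "E * \<delta> \<le> 2 * E * M * \<delta>" using E M e by simp
      then show "E * \<delta> + 2 * (t - s) * E * M \<le> 2 * E * M * (t - s + \<delta>)" by (simp add: algebra_simps)
    qed
    also have "\<dots> \<le> d * (2 * E * (M + A0) * (t - s + \<delta>))"
      using d E A0 st e by (intro mult_left_mono mult_right_mono) auto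
    also have "\<dots> \<le> 2 * E * (M + A0) * ((t - s + \<delta>) * d + (t - s) / \<delta> * (f s - f t))"
    proof -
      have "0 \<le> 2 * E * (M + A0) * ((t - s) / \<delta> * (f s - f t))"
        using E M A0 st e ff by (intro mult_nonneg_nonneg divide_nonneg_nonneg) auto
      then show ?thesis by (simp add: algebra_simps)
    qed
    finally show ?thesis .
  next
    case False
    have "H t - H s \<le> 2 * (t - s) * exp (2 * t) * A t + (exp (2 * t) - exp (2 * s)) * d"
      using H_step_coarse[OF st(1)] by (simp add: d_def)
    also have "\<dots> \<le> 2 * (t - s) * E * A0 + 2 * (t - s) * E * d"
      using d E A0 Ed st A_nonneg[of t] by (intro add_mono mult_mono mult_right_mono) auto
    also have "\<dots> \<le> 2 * E * (M + A0) * ((t - s) / \<delta> * (f s - f t)) + 2 * E * (M + A0) * ((t - s + \<delta>) * d)"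
    proof (rule add_mono)
      have "(t - s) * 1 \<le> (t - s) * ((f s - f t) / \<delta>)"
        using False e st by (intro mult_left_mono) (auto simp: field_simps)
      then have "2 * E * A0 * (t - s) \<le> 2 * E * A0 * ((t - s) / \<delta> * (f s - f t))"
        using E A0 by (intro mult_left_mono) auto
      also have "\<dots> \<le> 2 * E * (M + A0) * ((t - s) / \<delta> * (f s - f t))"
        using E A0 M st e ff by (intro mult_right_mono mult_left_mono mult_nonneg_nonneg divide_nonneg_nonneg) auto
      finally show "2 * (t - s) * E * A0 \<le> 2 * E * (M + A0) * ((t - s) / \<delta> * (f s - f t))"
        by (simp add: mult_ac)
      have "2 * E * 1 * ((t - s) * d) \<le> 2 * E * (M + A0) * ((t - s + \<delta>) * d)"
        using E A0 M st e d by (intro mult_mono mult_right_mono mult_left_mono mult_nonneg_nonneg) auto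
      then show "2 * (t - s) * E * d \<le> 2 * E * (M + A0) * ((t - s + \<delta>) * d)" by (simp add: mult_ac)
    qed
    finally show ?thesis by (simp add: distrib_left add.commute)
  qed
  then show ?thesis by (simp add: E_def M_def A0_def d_def)
qed

text \<open>Summing the step bound over a uniform partition leaves the total drops of
  \<open>A\<close> and \<open>f\<close> with the small factors e + \<delta> and e /
  \<delta>.\<close>

lemma H_antimono:
  assumes "p < q"
  shows "H q \<le> H p"
proof -
  define K where "K = 2 * exp (2 * q) * (3 + \<beta> + A p)"
  have K: "K \<ge> 0" using be A_nonneg[of p] by (simp add: K_def)
  have tele: "H (p + n * e) - H p \<le> K * ((e + \<delta>) * (A p - A (p + n * e)) + e / \<delta> * (f p - f (p + n * e)))"
    if "e > 0" "\<delta> > 0" "p + n * e \<le> q" for n :: nat and e \<delta> :: real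
    using that(3)
  proof (induction n)
    case (Suc n)
    have eq: "p + Suc n * e = (p + n * e) + e" by (simp add: algebra_simps)
    define s where "s = p + n * e"
    have s: "p \<le> s" "s + e \<le> q" "s \<le> q" using Suc.prems that by (auto simp: s_def algebra_simps)
    have "H (s + e) - H s \<le> K * ((s + e - s + \<delta>) * (A s - A (s + e)) + (s + e - s) / \<delta> * (f s - f (s + e)))"
      unfolding K_def by (rule H_step) (use s that in auto)
    moreover have "H s - H p \<le> K * ((e + \<delta>) * (A p - A s) + e / \<delta> * (f p - f s))"
      unfolding s_def by (rule Suc.IH) (use s(3) in \<open>simp add: s_def\<close>)
    ultimately have "H (s + e) - H p \<le> K * ((e + \<delta>) * (A p - A s) + e / \<delta> * (f p - f s)) + K * ((e + \<delta>) * (A s - A (s + e)) + e / \<delta> * (f s - f (s + e)))"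
      by simp
    also have "\<dots> = K * ((e + \<delta>) * (A p - A (s + e)) + e / \<delta> * (f p - f (s + e)))"
      by (simp add: algebra_simps)
    finally show ?case unfolding eq s_def .
  qed simp
  define c where "c = q - p"
  have c: "c > 0" using assms by (simp add: c_def)
  have bound: "H q - H p \<le> K * ((c / (Suc m) + 1) * (A p - A q) + c * (f p - f q)) * (1 / Suc m)" for m :: nat
  proof -
    define M where "M = real (Suc m)"
    have M: "M > 0" by (simp add: M_def)
    \<comment> \<open>There are M^2 steps of length e = c / M^2 and the threshold is \<delta> = 1 /
      M, so that e + \<delta> and e / \<delta> = c / M both tend to 0.\<close>
    have "H (p + real (Suc m ^ 2) * (c / M^2)) - H p \<le> K * ((c / M^2 + 1 / M) * (A p - A (p + real (Suc m ^ 2) * (c / M^2))) + c / M^2 / (1 / M) * (f p - f (p + real (Suc m ^ 2) * (c / M^2))))"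
      using M c by (intro tele) (auto simp: M_def c_def)
    moreover have "p + real (Suc m ^ 2) * (c / M^2) = q"
      using M by (simp add: M_def c_def)
    ultimately have "H q - H p \<le> K * ((c / M^2 + 1 / M) * (A p - A q) + c / M^2 / (1 / M) * (f p - f q))"
      by simp
    also have "\<dots> = K * ((c / M + 1) * (A p - A q) + c * (f p - f q)) * (1 / M)"
      using M by (simp add: field_simps power2_eq_square)
    finally show ?thesis by (simp add: M_def)
  qed
  have "(\<lambda>m. K * ((c * (1 / Suc m) + 1) * (A p - A q) + c * (f p - f q)) * (1 / Suc m)) \<longlonglongrightarrow> K * ((c * 0 + 1) * (A p - A q) + c * (f p - f q)) * 0"
    by (intro tendsto_intros LIMSEQ_Suc[OF lim_1_over_n])
  then have "H q - H p \<le> K * ((c * 0 + 1) * (A p - A q) + c * (f p - f q)) * 0"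
    by (rule LIMSEQ_le_const) (use bound in \<open>auto simp del: of_nat_Suc\<close>)
  then show ?thesis by simp
qed

lemma Gam_continuous: "continuous_on UNIV \<Gamma>"
  unfolding \<Gamma>_def[abs_def] using ab by (intro continuous_intros) auto

lemma Gam_tendsto: "(g \<longlongrightarrow> l) F \<Longrightarrow> ((\<lambda>x. \<Gamma> (g x)) \<longlongrightarrow> \<Gamma> l) F"
  using Gam_continuous continuous_on_tendsto_compose[of UNIV \<Gamma> g l F] by simp

lemma H_lim_top: "(H \<longlongrightarrow> 0) at_top"
proof -
  \<comment> \<open>The additive constant in \<Gamma> is chosen for this value, the starting flux at
    height infinity.\<close>
  have "\<Gamma> (- \<alpha>) = 0" using al by (simp add: Gam_low)
  then show ?thesis
    using tendsto_diff[OF lim_A_top Gam_tendsto[OF lim_f_top]] by (simp add: H_def[abs_def])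
qed

lemma H_lim_bot: "(H \<longlongrightarrow> (1 + \<beta>)\<^sup>2 / a - (1 + \<alpha>)\<^sup>2 / b) at_bot"
proof -
  have "\<Gamma> (2 + \<beta>) = (1 + \<alpha>)\<^sup>2 / b - (1 + \<beta>)\<^sup>2 / a" using be by (simp add: Gam_high add.commute)
  then show ?thesis
    using tendsto_diff[OF lim_A_bot Gam_tendsto[OF lim_f_bot]] by (simp add: H_def[abs_def])
qed

lemma H_nonneg: "0 \<le> H t"
  by (rule tendsto_upperbound[OF H_lim_top])
     (use eventually_mono[OF eventually_gt_at_top[of t]] H_antimono in auto)

lemma H_le: "H t \<le> (1 + \<beta>)\<^sup>2 / a - (1 + \<alpha>)\<^sup>2 / b"
  by (rule tendsto_lowerbound[OF H_lim_bot])
     (use eventually_gt_at_bot[of t] H_antimono in \<open>auto simp: eventually_at_bot_dense intro!: exI[of _ t]\<close>)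

theorem pinching: "(1 + \<alpha>)\<^sup>2 / b \<le> (1 + \<beta>)\<^sup>2 / a"
  using H_nonneg[of 0] H_le[of 0] by simp

end

section \<open>The equality case of the profile comparison\<close>

locale bol_profile_eq = bol_profile +
  assumes equality: "(1 + \<alpha>)\<^sup>2 / b = (1 + \<beta>)\<^sup>2 / a"
begin

text \<open>\<open>H\<close> lies between 0 and its limit at minus infinity, which the equality
  makes 0.\<close>

lemma X_eq: "exp (2 * t) * A t = \<Gamma> (f t)"
  using H_nonneg[of t] H_le[of t] equality by (simp add: H_def)

text \<open>The converse of \<open>isop\<close>. With exp(2t) A = \<Gamma>(f) the product rule
  bounds the drop of \<open>A\<close> by the drop of \<Gamma>, which the curvature bounds express
  through the mean of f(s) and f(t). Estimating this mean from below by f(s)/2 gives a bound usable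
  before continuity of \<open>f\<close> is known; estimating it by f(t) keeps the sharp constant for
  the derivative.\<close>

lemma eq_step:
  assumes st: "s < t"
  shows "exp (2 * s) * min 1 (f s / 2) * (A s - A t) \<le> 2 * (t - s) * exp (2 * t) * A t + (exp (2 * t) - exp (2 * s)) * (A s - A t)"
    and "exp (2 * s) * f t * (A s - A t) \<le> 2 * (t - s) * exp (2 * t) * A t + (exp (2 * t) - exp (2 * s)) * (A s - A t)"
proof -
  define d where "d = A s - A t"
  have d: "d \<ge> 0" using A_antimono[of s t] st by (simp add: d_def)
  have ff: "f t \<le> f s" using f_antimono[of s t] st by simp
  define E1 where "E1 = exp (2 * s)"
  define E2 where "E2 = exp (2 * t)"
  have E: "0 < E1" "E1 \<le> E2" using st by (auto simp: E1_def E2_def)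
  define R where "R = 2 * (t - s) * E2 * A t"
  have R: "R \<ge> 0" using st E A_nonneg[of t] by (simp add: R_def)
  have key: "E1 * d \<le> R + (\<Gamma> (f s) - \<Gamma> (f t))"
    using X_step[OF st] unfolding X_eq by (simp add: R_def E1_def E2_def d_def)
  have "E1 * d * min 1 (f s / 2) \<le> R + (E2 - E1) * d \<and> E1 * d * f t \<le> R + (E2 - E1) * d"
  proof (cases "f t \<le> 1")
    case False
    have "\<Gamma> (f s) - \<Gamma> (f t) = - ((f s - f t) / a * (f t + f s - 2))"
      using Gam_decr_high[OF ff] False by simp
    also have "\<dots> \<le> - (E1 * d / 2 * (f t + f s - 2))"
      using mass_half_lower[OF st] False ff
      by (intro le_imp_neg_le mult_right_mono) (auto simp: E1_def d_def)
    finally have "E1 * d * ((f t + f s) / 2) \<le> R" using key by (simp add: field_simps)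
    moreover have "E1 * d * f t \<le> E1 * d * ((f t + f s) / 2)" "E1 * d * min 1 (f s / 2) \<le> E1 * d * ((f t + f s) / 2)"
      using ff f_nonneg[of t] f_nonneg[of s] E d by (auto intro!: mult_left_mono)
    moreover have "0 \<le> (E2 - E1) * d" using E d by simp
    ultimately show ?thesis by (intro conjI; linarith)
  next
    case True
    have low: "\<Gamma> (f s) - \<Gamma> (f t) \<le> (f s - f t) * (2 - f t - f s) / b"
      by (rule Gam_decr_low[OF ff True])
    show ?thesis
    proof (cases "f t + f s \<le> 2")
      case sum: True
      have "\<Gamma> (f s) - \<Gamma> (f t) \<le> (f s - f t) / b * (2 - f t - f s)" using low by simp
      also have "\<dots> \<le> E2 * d / 2 * (2 - f t - f s)"
        using mass_half_upper[OF st] sum by (intro mult_right_mono) (auto simp: E2_def d_def)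
      finally have "E2 * d * ((f t + f s) / 2) \<le> R + (E2 - E1) * d" using key by (simp add: algebra_simps)
      moreover have "E1 * d * f t \<le> E2 * d * ((f t + f s) / 2)" "E1 * d * min 1 (f s / 2) \<le> E2 * d * ((f t + f s) / 2)"
        by (rule mult_mono[OF mult_right_mono[OF E(2) d]]; use ff f_nonneg[of t] f_nonneg[of s] E d in auto)+
      ultimately show ?thesis by (intro conjI; linarith)
    next
      case sum: False
      have "(f s - f t) * (2 - f t - f s) / b \<le> 0"
        using sum ff b_pos by (intro divide_nonpos_pos mult_nonneg_nonpos) auto
      then have "E1 * d \<le> R" using low key by linarith
      moreover have "E1 * d * f t \<le> E1 * d * 1" "E1 * d * min 1 (f s / 2) \<le> E1 * d * 1"
        using True E d by (intro mult_left_mono; auto)+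
      moreover have "0 \<le> (E2 - E1) * d" using E d by simp
      ultimately show ?thesis by (intro conjI; linarith)
    qed
  qed
  then show "exp (2 * s) * min 1 (f s / 2) * (A s - A t) \<le> 2 * (t - s) * exp (2 * t) * A t + (exp (2 * t) - exp (2 * s)) * (A s - A t)"
    and "exp (2 * s) * f t * (A s - A t) \<le> 2 * (t - s) * exp (2 * t) * A t + (exp (2 * t) - exp (2 * s)) * (A s - A t)"
    by (simp_all add: E1_def E2_def R_def d_def mult_ac)
qed

lemma f_zero: "f t = 0 \<Longrightarrow> A t = 0 \<and> \<alpha> = 0"
proof
  assume f0: "f t = 0"
  show al0: "\<alpha> = 0" using f_lower[of t] al f0 by simp
  have "\<Gamma> 0 = ((1 + \<alpha>)\<^sup>2 - 1) / b" by (simp add: Gam_low)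
  also have "\<dots> = 0" using al0 by simp
  finally have "exp (2 * t) * A t = 0" using X_eq[of t] f0 by simp
  then show "A t = 0" by simp
qed

text \<open>The interval starts at or before \<open>r\<close>, so f(s) is at least f(r) and the
  first part of \<open>eq_step\<close> has a positive coefficient.\<close>

lemma A_lipschitz_at:
  assumes fr: "f r > 0" and st: "s < t" "s \<le> r" "r - 1 \<le> s" "t \<le> s + 1"
  shows "A s - A t \<le> (2 * exp 2 * A (r - 1) / min 1 (f r / 2)) * (t - s)"
proof -
  define m where "m = min 1 (f r / 2)"
  have m: "m > 0" using fr by (simp add: m_def)
  define d where "d = A s - A t"
  have d: "d \<ge> 0" using A_antimono[of s t] st by (simp add: d_def)
  have "m \<le> min 1 (f s / 2)" using f_antimono[OF st(2)] by (auto simp: m_def)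
  then have "exp (2 * s) * m * d \<le> exp (2 * s) * min 1 (f s / 2) * d"
    using d by (intro mult_right_mono mult_left_mono) auto
  also have "\<dots> \<le> 2 * (t - s) * exp (2 * t) * A t + (exp (2 * t) - exp (2 * s)) * d"
    using eq_step(1)[OF st(1)] by (simp add: d_def)
  also have "\<dots> \<le> 2 * (t - s) * exp (2 * t) * A t + 2 * (t - s) * exp (2 * t) * d"
    using exp_diff_bound d by (intro add_left_mono mult_right_mono)
  also have "\<dots> = exp (2 * s) * (exp (2 * (t - s)) * (2 * (t - s)) * A s)"
    by (simp add: d_def algebra_simps flip: exp_add)
  also have "\<dots> \<le> exp (2 * s) * (exp 2 * (2 * (t - s)) * A (r - 1))"
    using st A_nonneg A_antimono[OF st(3)] by (intro mult_left_mono mult_mono) auto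
  finally have "m * d \<le> exp 2 * (2 * (t - s)) * A (r - 1)" by simp
  then show ?thesis using m by (simp add: d_def[symmetric] m_def[symmetric] field_simps)
qed

lemma A_isCont: "isCont A r"
proof (cases "f r > 0")
  case True
  define K where "K = 2 * exp 2 * A (r - 1) / min 1 (f r / 2)"
  have bound: "\<bar>A x - A r\<bar> \<le> K * \<bar>x - r\<bar>" if "\<bar>x - r\<bar> < 1" for x
  proof (cases x r rule: linorder_cases)
    case less
    then show ?thesis using A_lipschitz_at[OF True, of x r] A_antimono[of x r] that by (simp add: K_def abs_if)
  next
    case greater
    then show ?thesis using A_lipschitz_at[OF True, of r x] A_antimono[of r x] that by (simp add: K_def abs_if)
  qed simp
  have "((\<lambda>x. K * \<bar>x - r\<bar>) \<longlongrightarrow> K * \<bar>r - r\<bar>) (at r)" by (intro tendsto_intros)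
  then have lim0: "((\<lambda>x. K * \<bar>x - r\<bar>) \<longlongrightarrow> 0) (at r)" by simp
  have "\<forall>\<^sub>F x in at r. norm (A x - A r) \<le> K * \<bar>x - r\<bar>"
    unfolding eventually_at by (rule exI[of _ 1]) (use bound in \<open>simp add: dist_real_def\<close>)
  then have "((\<lambda>x. A x - A r) \<longlongrightarrow> 0) (at r)"
    by (rule Lim_null_comparison) (rule lim0)
  then show ?thesis by (simp add: isCont_def LIM_zero_iff)
next
  case False
  \<comment> \<open>This is the top level when \<alpha> = 0, where \<open>A\<close> already
    vanishes, so only points to the left matter. There \<open>eq_step\<close> forces
    \<open>f\<close> to be small, and A follows through \<Gamma>(f) \<le> 2 f / b.\<close>
  then have f0: "f r = 0" using f_nonneg[of r] by simp
  have A0: "A r = 0" "\<alpha> = 0" using f_zero[OF f0] by auto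
  define h where "h x = exp (- 2 * x) * (4 * \<bar>exp (2 * (r - x)) - 1\<bar>) / b" for x
  have bound: "\<bar>A x\<bar> \<le> h x" if x: "\<bar>exp (2 * (r - x)) - 1\<bar> < 1" for x
  proof (cases "x < r \<and> A x > 0")
    case True
    define m where "m = exp (2 * (r - x)) - 1"
    have "exp (2 * x) * min 1 (f x / 2) * A x \<le> (exp (2 * r) - exp (2 * x)) * A x"
      using eq_step(1)[of x r] True A0 by simp
    then have "exp (2 * x) * min 1 (f x / 2) \<le> exp (2 * r) - exp (2 * x)" using True by simp
    also have "\<dots> = exp (2 * x) * m" by (simp add: m_def algebra_simps flip: exp_add)
    finally have "min 1 (f x / 2) \<le> m" by simp
    then have fx: "f x \<le> 2 * m" using x by (auto simp: m_def min_def split: if_splits)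
    have fx1: "0 \<le> f x" by (rule f_nonneg)
    have "\<Gamma> (f x) \<le> 2 * f x / b"
    proof -
      have "\<Gamma> (f x) - \<Gamma> 0 \<le> (f x - 0) * (2 - 0 - f x) / b" by (rule Gam_decr_low) (use fx1 in auto)
      also have "\<dots> \<le> f x * 2 / b"
        unfolding diff_0_right using fx1 b_pos by (intro divide_right_mono mult_left_mono) linarith+
      finally have "\<Gamma> (f x) \<le> f x * 2 / b + \<Gamma> 0" by simp
      moreover have "\<Gamma> 0 = ((1 + \<alpha>)\<^sup>2 - 1) / b" by (simp add: Gam_low)
      moreover have "((1 + \<alpha>)\<^sup>2 - 1) / b = 0" using A0(2) by simp
      ultimately have "\<Gamma> (f x) \<le> f x * 2 / b" by (simp only: add_0_right)
      then show ?thesis by (simp only: mult.commute[of 2])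
    qed
    also have "\<dots> \<le> 4 * m / b" using fx b_pos by (intro divide_right_mono) auto
    finally have "exp (2 * x) * A x \<le> 4 * m / b" using X_eq[of x] by simp
    then have "exp (- 2 * x) * (exp (2 * x) * A x) \<le> exp (- 2 * x) * (4 * m / b)" by (intro mult_left_mono) auto
    moreover have "m \<ge> 0" using fx fx1 by simp
    ultimately show ?thesis using A_nonneg[of x] by (simp add: h_def m_def mult.assoc[symmetric] flip: exp_add)
  next
    case False
    then have "A x = 0"
      using A_antimono[of r x] A_nonneg[of x] A0 by (auto simp: not_less)
    then show ?thesis using b_pos by (simp add: h_def)
  qed
  have "(h \<longlongrightarrow> exp (- 2 * r) * (4 * \<bar>exp (2 * (r - r)) - 1\<bar>) / b) (at r)"
    unfolding h_def[abs_def] using b_pos by (intro tendsto_intros) auto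
  then have hl: "(h \<longlongrightarrow> 0) (at r)" by simp
  have "((\<lambda>x. \<bar>exp (2 * (r - x)) - 1\<bar>) \<longlongrightarrow> \<bar>exp (2 * (r - r)) - 1\<bar>) (at r)" by (intro tendsto_intros)
  then have "\<forall>\<^sub>F x in at r. \<bar>exp (2 * (r - x)) - 1\<bar> < 1" by (rule order_tendstoD) simp
  then have "\<forall>\<^sub>F x in at r. norm (A x) \<le> h x" by eventually_elim (simp add: bound)
  then have "(A \<longlongrightarrow> 0) (at r)" by (rule Lim_null_comparison) (rule hl)
  then show ?thesis using A0 by (simp add: isCont_def)
qed

text \<open>The upper mass bound controls increments of \<open>f\<close> by increments of
  \<open>A\<close>.\<close>

lemma f_isCont: "isCont f r"
proof -
  define h where "h x = b / 2 * exp (2 * max x r) * \<bar>A x - A r\<bar>" for x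
  have bound: "\<bar>f x - f r\<bar> \<le> h x" for x
  proof (cases x r rule: linorder_cases)
    case less
    then have "\<bar>A x - A r\<bar> = A x - A r" "\<bar>f x - f r\<bar> = f x - f r" "max x r = r"
      using f_antimono[of x r] A_antimono[of x r] by auto
    then show ?thesis using mass_upper[OF less] by (simp add: h_def)
  next
    case greater
    then have "\<bar>A x - A r\<bar> = A r - A x" "\<bar>f x - f r\<bar> = f r - f x" "max x r = x"
      using f_antimono[of r x] A_antimono[of r x] by auto
    then show ?thesis using mass_upper[OF greater] by (simp add: h_def)
  qed (simp add: h_def)
  have "(h \<longlongrightarrow> b / 2 * exp (2 * max r r) * \<bar>A r - A r\<bar>) (at r)"
    unfolding h_def[abs_def] using A_isCont[of r] by (intro tendsto_intros) (auto simp: isCont_def)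
  then have h0: "(h \<longlongrightarrow> 0) (at r)" by simp
  have "\<forall>\<^sub>F x in at r. norm (f x - f r) \<le> h x" using bound by simp
  then have "((\<lambda>x. f x - f r) \<longlongrightarrow> 0) (at r)"
    by (rule Lim_null_comparison) (rule h0)
  then show ?thesis by (simp add: isCont_def LIM_zero_iff)
qed

text \<open>The quotient is squeezed between \<open>isop\<close> and the second part of
  \<open>eq_step\<close>; both bounds converge since \<open>A\<close> and \<open>f\<close> are
  continuous. Minimum and maximum of \<open>x\<close> and \<open>r\<close> treat the two sides at
  once.\<close>

lemma A_deriv:
  assumes fr: "f r > 0"
  shows "DERIV A r :> - (2 * A r / f r)"
proof -
  define L where "L x = 2 * A (max x r) / f (min x r)" for x
  define D where "D x = exp (2 * min x r) * f (max x r) - (exp (2 * max x r) - exp (2 * min x r))" for x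
  define U where "U x = 2 * exp (2 * max x r) * A (max x r) / D x" for x
  have maxc: "isCont (\<lambda>x. max x r) r" "isCont (\<lambda>x. min x r) r" by (intro continuous_intros)+
  have cA: "isCont (\<lambda>x. A (max x r)) r" by (rule isCont_o2[OF maxc(1)]) (simp add: A_isCont)
  have cf: "isCont (\<lambda>x. f (max x r)) r" "isCont (\<lambda>x. f (min x r)) r"
    by (rule isCont_o2[OF maxc(1)], simp add: f_isCont, rule isCont_o2[OF maxc(2)], simp add: f_isCont)
  have "isCont L r" unfolding L_def[abs_def] by (intro continuous_intros cA cf) (use fr in auto)
  then have L: "(L \<longlongrightarrow> 2 * A r / f r) (at r)" by (simp add: isCont_def L_def)
  have Dc: "isCont D r" unfolding D_def[abs_def] by (intro continuous_intros cA cf maxc)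
  have Dr: "D r = exp (2 * r) * f r" by (simp add: D_def)
  have "isCont U r" unfolding U_def[abs_def] by (intro continuous_intros cA Dc maxc) (use fr Dr in auto)
  then have U: "(U \<longlongrightarrow> 2 * A r / f r) (at r)" by (simp add: isCont_def U_def Dr)
  have "(D \<longlongrightarrow> D r) (at r)" using Dc by (simp add: isCont_def)
  then have Dpos: "\<forall>\<^sub>F x in at r. D x > 0" by (rule order_tendstoD) (use Dr fr in simp)
  have "(f \<longlongrightarrow> f r) (at r)" using f_isCont by (simp add: isCont_def)
  then have fpos: "\<forall>\<^sub>F x in at r. f x > 0" by (rule order_tendstoD) (use fr in simp)
  have sandwich: "L x \<le> (A r - A x) / (x - r) \<and> (A r - A x) / (x - r) \<le> U x" if "x \<noteq> r" "D x > 0" "f x > 0" for x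
  proof -
    define s where "s = min x r"
    define t where "t = max x r"
    have st: "s < t" "f s > 0" using that fr by (auto simp: s_def t_def min_def)
    have q: "(A r - A x) / (x - r) = (A s - A t) / (t - s)"
      using that(1) by (auto simp: s_def t_def min_def max_def field_simps)
    have "L x \<le> (A s - A t) / (t - s)"
      using isop[OF st(1)] st by (simp add: L_def s_def[symmetric] t_def[symmetric] field_simps)
    moreover have "(A s - A t) * D x \<le> 2 * (t - s) * exp (2 * t) * A t"
      using eq_step(2)[OF st(1)] by (simp add: D_def s_def[symmetric] t_def[symmetric] algebra_simps)
    then have "(A s - A t) / (t - s) \<le> U x"
      using that(2) st(1) by (simp add: U_def s_def[symmetric] t_def[symmetric] field_simps)
    ultimately show ?thesis by (simp add: q)
  qed
  have ev: "\<forall>\<^sub>F x in at r. L x \<le> (A r - A x) / (x - r)" "\<forall>\<^sub>F x in at r. (A r - A x) / (x - r) \<le> U x"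
    using Dpos fpos eventually_neq_at_within[of r r UNIV] by (eventually_elim, use sandwich in blast)+
  have "((\<lambda>x. (A r - A x) / (x - r)) \<longlongrightarrow> 2 * A r / f r) (at r)"
    by (rule tendsto_sandwich[OF ev L U])
  then have "((\<lambda>x. - ((A r - A x) / (x - r))) \<longlongrightarrow> - (2 * A r / f r)) (at r)" by (rule tendsto_minus)
  moreover have "- ((A r - A x) / (x - r)) = (A x - A r) / (x - r)" for x
    by (simp add: minus_divide_left)
  ultimately show ?thesis by (simp add: has_field_derivative_iff)
qed

lemma A_pos_f_pos: "A t > 0 \<Longrightarrow> f t > 0"
  using f_zero[of t] f_nonneg[of t] by (cases "f t = 0") auto

lemma A_strict: "s < t \<Longrightarrow> A t > 0 \<Longrightarrow> A t < A s \<and> f t < f s"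
proof -
  assume st: "s < t" "A t > 0"
  have "0 < 2 * (t - s) * A t" using st by simp
  then have "0 < f s * (A s - A t)" using isop[OF st(1)] by linarith
  then have 1: "A t < A s" using f_nonneg[of s] by (simp add: zero_less_mult_iff)
  then have "0 < a * exp (2 * s) * (A s - A t)" using ab by simp
  then show ?thesis using 1 mass_lower[OF st(1)] by simp
qed

text \<open>With f' = -(f + \<gamma>)(2 + \<gamma> - f) / f and A'/A = -2/f, the logarithm of (f +
  \<gamma>)/(2 + \<gamma> - f) changes at (1 + \<gamma>) times the rate of ln A, so the difference
  is a first integral. The pair (K, \<gamma>) stands for (b, \<alpha>) where f < 1 and for (a,
  \<beta>) where f > 1.\<close>

lemma profile_branch:
  assumes pq: "p < q" and Apos: "A q > 0"
    and \<sigma>: "\<sigma> = 1 \<or> \<sigma> = -1" and side: "\<And>t. p < t \<Longrightarrow> t < q \<Longrightarrow> \<sigma> * (1 - f t) > 0"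
    and K: "K > 0"
    and X: "\<And>t. p \<le> t \<Longrightarrow> t \<le> q \<Longrightarrow> K * (exp (2 * t) * A t) = (f t + \<gamma>) * (2 + \<gamma> - f t)"
    and pos: "\<And>t. p \<le> t \<Longrightarrow> t \<le> q \<Longrightarrow> 0 < f t + \<gamma> \<and> 0 < 2 + \<gamma> - f t"
  shows "ln ((f q + \<gamma>) / (2 + \<gamma> - f q)) - (1 + \<gamma>) * ln (A q) = ln ((f p + \<gamma>) / (2 + \<gamma> - f p)) - (1 + \<gamma>) * ln (A p)"
proof -
  define \<Phi> where "\<Phi> t = ln (f t + \<gamma>) - ln (2 + \<gamma> - f t) - (1 + \<gamma>) * ln (A t)" for t
  have A: "A t > 0" if "t \<le> q" for t using A_antimono[OF that] Apos by simp
  have der: "DERIV \<Phi> t :> 0" if t: "p < t" "t < q" for t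
  proof -
    \<comment> \<open>Differentiability of \<open>f\<close> is obtained by solving the quadratic
      relation for \<open>f\<close>: \<open>S\<close> is differentiable because \<open>A\<close> is,
      and the branch condition fixes the sign \<sigma> of the root.\<close>
    define S where "S u = (1 + \<gamma>)\<^sup>2 - K * (exp (2 * u) * A u)" for u
    have S: "S u = (1 - f u)\<^sup>2" if "p \<le> u" "u \<le> q" for u
      using X[OF that] by (simp add: S_def power2_eq_square algebra_simps)
    have fS: "f u = 1 - \<sigma> * sqrt (S u)" if "u \<in> {p<..<q}" for u
    proof -
      have "sqrt (S u) = \<bar>1 - f u\<bar>" using S[of u] that by simp
      then show ?thesis using side[of u] that \<sigma> by auto
    qed
    have ft: "f t > 0" using A_pos_f_pos A t by simp
    have ne: "1 - f t \<noteq> 0" using side[OF t] by auto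
    have St: "S t > 0" using S[of t] t ne by simp
    have dA: "DERIV A t :> - (2 * A t / f t)" by (rule A_deriv[OF ft])
    have dS: "DERIV S t :> - K * (2 * exp (2 * t) * A t + exp (2 * t) * (- (2 * A t / f t)))"
      unfolding S_def by (auto intro!: derivative_eq_intros dA)
    define w where "w = - (K * (exp (2 * t) * A t) / f t)"
    have sq: "\<sigma> * sqrt (S t) = 1 - f t" using fS[of t] t by simp
    have "DERIV (\<lambda>u. 1 - \<sigma> * sqrt (S u)) t :> - \<sigma> * ((- K * (2 * exp (2 * t) * A t + exp (2 * t) * (- (2 * A t / f t)))) * (inverse (sqrt (S t)) / 2))"
      using St by (auto intro!: derivative_eq_intros dS DERIV_real_sqrt)
    moreover have "- \<sigma> * ((- K * (2 * exp (2 * t) * A t + exp (2 * t) * (- (2 * A t / f t)))) * (inverse (sqrt (S t)) / 2)) = w"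
    proof -
      have "inverse (sqrt (S t)) = \<sigma> / (1 - f t)"
        using sq \<sigma> ne by (auto simp: field_simps)
      moreover have "\<sigma> * \<sigma> = 1" using \<sigma> by auto
      moreover define P where "P = K * (exp (2 * t) * A t)"
      moreover have "- K * (2 * exp (2 * t) * A t + exp (2 * t) * (- (2 * A t / f t))) = 2 * P * (1 - f t) / f t"
        using ft by (simp add: P_def field_simps)
      moreover define u where "u = 1 - f t"
      ultimately have "- \<sigma> * ((- K * (2 * exp (2 * t) * A t + exp (2 * t) * (- (2 * A t / f t)))) * (inverse (sqrt (S t)) / 2))
          = - \<sigma> * ((2 * P * u / f t) * (\<sigma> / u / 2))" by simp
      also have "\<dots> = - (\<sigma> * \<sigma>) * (P / f t)" using ne by (simp add: u_def[symmetric])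
      finally show ?thesis using \<open>\<sigma> * \<sigma> = 1\<close> by (simp add: w_def P_def)
    qed
    ultimately have "DERIV (\<lambda>u. 1 - \<sigma> * sqrt (S u)) t :> w" by simp
    then have df: "DERIV f t :> w"
      by (rule has_field_derivative_transform_within_open[where S = "{p<..<q}"]) (use t fS in auto)
    have p1: "f t + \<gamma> > 0" "2 + \<gamma> - f t > 0" using pos[of t] t by auto
    have "DERIV \<Phi> t :> w / (f t + \<gamma>) - (- w) / (2 + \<gamma> - f t) - (1 + \<gamma>) * ((- (2 * A t / f t)) / A t)"
      unfolding \<Phi>_def using p1 A[of t] t
      by (auto intro!: derivative_eq_intros df dA simp: divide_inverse)
    moreover have "w / (f t + \<gamma>) - (- w) / (2 + \<gamma> - f t) - (1 + \<gamma>) * ((- (2 * A t / f t)) / A t) = 0"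
    proof -
      have w: "w = - ((f t + \<gamma>) * (2 + \<gamma> - f t) / f t)" using X[of t] t by (simp add: w_def)
      have "w / (f t + \<gamma>) = - ((2 + \<gamma> - f t) / f t)" using p1 by (simp add: w)
      moreover have "(- w) / (2 + \<gamma> - f t) = (f t + \<gamma>) / f t" using p1 by (simp add: w)
      moreover have "(- (2 * A t / f t)) / A t = - (2 / f t)" using A[of t] t by simp
      ultimately have "w / (f t + \<gamma>) - (- w) / (2 + \<gamma> - f t) - (1 + \<gamma>) * ((- (2 * A t / f t)) / A t)
          = - ((2 + \<gamma> - f t) / f t) - (f t + \<gamma>) / f t - (1 + \<gamma>) * (- (2 / f t))"
        by (simp only:)
      also have "\<dots> = 0" using ft by (simp add: field_simps)
      finally show ?thesis .
    qed
    ultimately show ?thesis by simp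
  qed
  have cont: "isCont \<Phi> t" if "p \<le> t" "t \<le> q" for t
  proof -
    have "f t + \<gamma> > 0" "2 + \<gamma> - f t > 0" "A t > 0" using pos[OF that] A that by auto
    then show ?thesis unfolding \<Phi>_def by (intro continuous_intros A_isCont f_isCont) auto
  qed
  have "\<Phi> q = \<Phi> p"
    by (rule DERIV_isconst_end[OF pq]) (auto intro!: continuous_at_imp_continuous_on cont der)
  moreover have "\<Phi> t = ln ((f t + \<gamma>) / (2 + \<gamma> - f t)) - (1 + \<gamma>) * ln (A t)" if "p \<le> t" "t \<le> q" for t
    using pos[OF that] by (simp add: \<Phi>_def ln_div)
  ultimately show ?thesis using pq by simp
qed

text \<open>Turns the relation between exp(2t) A and \<open>f\<close> into the familiar density of a
  constant curvature cone, with \<open>Y\<close> as a power of the area ratio.\<close>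

lemma logistic_identity:
  fixes x \<gamma> Y :: real
  assumes "x + \<gamma> > 0" "2 + \<gamma> - x > 0" "Y = (x + \<gamma>) / (2 + \<gamma> - x)"
  shows "(x + \<gamma>) * (2 + \<gamma> - x) = 4 * (1 + \<gamma>)\<^sup>2 * Y / (1 + Y)\<^sup>2"
proof -
  define v where "v = 2 + \<gamma> - x"
  have v: "v > 0" "x + \<gamma> = 2 * (1 + \<gamma>) - v" using assms by (auto simp: v_def)
  define g where "g = 1 + \<gamma>"
  have "1 + Y = 2 * g / v" unfolding assms(3) v_def[symmetric] v(2) g_def using v(1) by (simp add: field_simps)
  moreover have "g \<noteq> 0" using v assms by (auto simp: g_def)
  ultimately have "4 * (1 + \<gamma>)\<^sup>2 * Y / (1 + Y)\<^sup>2 = v * v * Y"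
    unfolding g_def[symmetric] using v by (simp add: power2_eq_square)
  also have "\<dots> = (2 * (1 + \<gamma>) - v) * v" using v assms(3) by (simp add: v_def[symmetric])
  finally show ?thesis using v by (simp add: v_def[symmetric])
qed

text \<open>The two branches are glued at the level where f = 1; \<open>A1\<close> is the value of
  \<open>A\<close> there.\<close>

theorem profile:
  obtains A1 where "A1 > 0"
    "\<And>t. 0 < A t \<Longrightarrow> A t \<le> A1 \<Longrightarrow> exp (2 * t) * A t = 4 * (1 + \<alpha>)\<^sup>2 / b * (A t / A1) powr (1 + \<alpha>) / (1 + (A t / A1) powr (1 + \<alpha>))\<^sup>2"
    "\<And>t. A1 \<le> A t \<Longrightarrow> exp (2 * t) * A t = 4 * (1 + \<beta>)\<^sup>2 / a * (A t / A1) powr (1 + \<beta>) / (1 + (A t / A1) powr (1 + \<beta>))\<^sup>2"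
proof -
  have "\<forall>\<^sub>F t in at_top. f t < 1" by (rule order_tendstoD[OF lim_f_top]) (use al in simp)
  then obtain u where u: "f u < 1" by (auto simp: eventually_at_top_linorder)
  have "\<forall>\<^sub>F t in at_bot. f t > 1" by (rule order_tendstoD[OF lim_f_bot]) (use be in simp)
  then obtain l where l: "f l > 1" by (auto simp: eventually_at_bot_linorder)
  have "l \<le> u" using f_antimono[of u l] u l by (cases "l \<le> u") auto
  \<comment> \<open>At this level (f + \<gamma>)/(2 + \<gamma> - f) = 1 for every \<gamma>, so both
    first integrals take the value -(1 + \<gamma>) ln A1 and the same \<open>A1\<close> serves both
    branches.\<close>
  then obtain t1 where t1: "f t1 = 1"
    using IVT2[of f u 1 l] u l f_isCont by auto
  define A1 where "A1 = A t1"
  have "exp (2 * t1) * A1 = (1 + \<alpha>)\<^sup>2 / b" using X_eq[of t1] by (simp add: t1 A1_def Gam_low)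
  moreover have "(1 + \<alpha>)\<^sup>2 / b > 0" using al b_pos by simp
  ultimately have A1: "A1 > 0" by (metis exp_gt_zero zero_less_mult_pos)
  have before: "f t > 1" "A t > A1" if "t < t1" for t using A_strict[OF that] A1 t1 by (auto simp: A1_def)
  have after: "f t < 1" "A t < A1" if "t1 < t" "A t > 0" for t using A_strict[OF that] t1 by (auto simp: A1_def)
  have powr_eq: "Y = (x / A1) powr (1 + \<gamma>)" if "ln Y - (1 + \<gamma>) * ln x = - ((1 + \<gamma>) * ln A1)" "Y > 0" "x > 0" for Y x \<gamma>
  proof -
    have "ln Y = (1 + \<gamma>) * (ln x - ln A1)" using that(1) by (simp add: algebra_simps)
    also have "\<dots> = (1 + \<gamma>) * ln (x / A1)" using that A1 by (simp add: ln_div)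
    finally have "exp (ln Y) = exp ((1 + \<gamma>) * ln (x / A1))" by simp
    then show ?thesis using that A1 by (simp add: powr_def)
  qed
  show thesis
  proof (rule that[OF A1])
    fix t assume t: "0 < A t" "A t \<le> A1"
    have t1t: "t1 \<le> t" using before(2)[of t] t by (cases "t < t1") auto
    have Xb: "b * (exp (2 * s) * A s) = (f s + \<alpha>) * (2 + \<alpha> - f s)" if "t1 \<le> s" for s
    proof -
      have "b * \<Gamma> (f s) = (1 + \<alpha>)\<^sup>2 - (1 - f s)\<^sup>2" using f_antimono[OF that] b_pos by (simp add: t1 Gam_low)
      then show ?thesis unfolding X_eq[of s] by (simp add: power2_eq_square algebra_simps)
    qed
    have pos: "0 < f s + \<alpha> \<and> 0 < 2 + \<alpha> - f s" if "t1 \<le> s" "s \<le> t" for s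
    proof -
      have "A s > 0" using A_antimono[OF that(2)] t by simp
      then have "0 < (f s + \<alpha>) * (2 + \<alpha> - f s)" using Xb[OF that(1)] b_pos by (metis exp_gt_zero mult_pos_pos)
      then show ?thesis using f_lower[of s] by (auto simp: zero_less_mult_iff)
    qed
    define Y where "Y = (f t + \<alpha>) / (2 + \<alpha> - f t)"
    have Ypos: "Y > 0" using pos[of t] t1t by (simp add: Y_def)
    have "ln Y - (1 + \<alpha>) * ln (A t) = - ((1 + \<alpha>) * ln A1)"
    proof (cases "t = t1")
      case True
      then show ?thesis using al by (simp add: Y_def t1 A1_def add.commute)
    next
      case False
      then have lt: "t1 < t" using t1t by simp
      have "ln ((f t + \<alpha>) / (2 + \<alpha> - f t)) - (1 + \<alpha>) * ln (A t) = ln ((f t1 + \<alpha>) / (2 + \<alpha> - f t1)) - (1 + \<alpha>) * ln (A t1)"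
      proof (rule profile_branch[OF lt t(1), where \<sigma> = 1 and K = b])
        show "0 < 1 * (1 - f s)" if "t1 < s" "s < t" for s
          using after(1)[of s] that A_antimono[of s t] t by simp
      qed (use b_pos Xb pos in auto)
      then show ?thesis using al by (simp add: Y_def t1 A1_def add.commute)
    qed
    then have Y: "Y = (A t / A1) powr (1 + \<alpha>)" by (rule powr_eq) (use Ypos t in auto)
    have "b * (exp (2 * t) * A t) = 4 * (1 + \<alpha>)\<^sup>2 * Y / (1 + Y)\<^sup>2"
      using Xb[OF t1t] logistic_identity[of "f t" \<alpha> Y] pos[of t] t1t by (simp add: Y_def)
    then have "exp (2 * t) * A t = (4 * (1 + \<alpha>)\<^sup>2 * Y / (1 + Y)\<^sup>2) / b"
      using b_pos nonzero_mult_div_cancel_left[of b "exp (2 * t) * A t"] by simp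
    then show "exp (2 * t) * A t = 4 * (1 + \<alpha>)\<^sup>2 / b * (A t / A1) powr (1 + \<alpha>) / (1 + (A t / A1) powr (1 + \<alpha>))\<^sup>2"
      unfolding Y[symmetric] by (simp add: mult_ac)
  next
    fix t assume t: "A1 \<le> A t"
    have At: "A t > 0" using A1 t by simp
    have tt1: "t \<le> t1" using after(2)[of t] t At by (cases "t1 < t") auto
    have Xa: "a * (exp (2 * s) * A s) = (f s + \<beta>) * (2 + \<beta> - f s)" if "s \<le> t1" for s
    proof -
      have "\<Gamma> (f s) = ((1 + \<beta>)\<^sup>2 - (f s - 1)\<^sup>2) / a"
        using f_antimono[OF that] equality by (simp add: t1 Gam_high diff_divide_distrib)
      then have "a * \<Gamma> (f s) = (1 + \<beta>)\<^sup>2 - (f s - 1)\<^sup>2" using ab by simp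
      then show ?thesis unfolding X_eq[of s] by (simp add: power2_eq_square algebra_simps)
    qed
    have pos: "0 < f s + \<beta> \<and> 0 < 2 + \<beta> - f s" if "s \<le> t1" for s
    proof -
      have "A s > 0" using A_antimono[OF that] A1 by (simp add: A1_def)
      then have "0 < (f s + \<beta>) * (2 + \<beta> - f s)" using Xa[OF that] ab by (metis exp_gt_zero mult_pos_pos)
      moreover have "f s + \<beta> > 0" using f_antimono[OF that] t1 be by simp
      ultimately show ?thesis by (auto simp: zero_less_mult_iff)
    qed
    define Y where "Y = (f t + \<beta>) / (2 + \<beta> - f t)"
    have Ypos: "Y > 0" using pos[of t] tt1 by (simp add: Y_def)
    have "ln Y - (1 + \<beta>) * ln (A t) = - ((1 + \<beta>) * ln A1)"
    proof (cases "t = t1")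
      case True
      then show ?thesis using be by (simp add: Y_def t1 A1_def add.commute)
    next
      case False
      then have lt: "t < t1" using tt1 by simp
      have "ln ((f t1 + \<beta>) / (2 + \<beta> - f t1)) - (1 + \<beta>) * ln (A t1) = ln ((f t + \<beta>) / (2 + \<beta> - f t)) - (1 + \<beta>) * ln (A t)"
      proof (rule profile_branch[OF lt, where \<sigma> = "-1" and K = a])
        show "0 < - 1 * (1 - f s)" if "t < s" "s < t1" for s
          using before(1)[of s] that by simp
      qed (use ab Xa pos A1 in \<open>auto simp: A1_def\<close>)
      then show ?thesis using be by (simp add: Y_def t1 A1_def add.commute)
    qed
    then have Y: "Y = (A t / A1) powr (1 + \<beta>)" by (rule powr_eq) (use Ypos At in auto)
    have "a * (exp (2 * t) * A t) = 4 * (1 + \<beta>)\<^sup>2 * Y / (1 + Y)\<^sup>2"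
      using Xa[OF tt1] logistic_identity[of "f t" \<beta> Y] pos[of t] tt1 by (simp add: Y_def)
    then have "exp (2 * t) * A t = (4 * (1 + \<beta>)\<^sup>2 * Y / (1 + Y)\<^sup>2) / a"
      using ab nonzero_mult_div_cancel_left[of a "exp (2 * t) * A t"] by simp
    then show "exp (2 * t) * A t = 4 * (1 + \<beta>)\<^sup>2 / a * (A t / A1) powr (1 + \<beta>) / (1 + (A t / A1) powr (1 + \<beta>))\<^sup>2"
      unfolding Y[symmetric] by (simp add: mult_ac)
  qed
qed

end

section \<open>Cut-off functions and fluxes\<close>

lemma DERIV_max_power:
  fixes x :: real
  assumes "n \<ge> 1"
  shows "DERIV (\<lambda>x. (max 0 x) ^ Suc n) x :> real (Suc n) * (max 0 x) ^ n"
proof (cases x "0::real" rule: linorder_cases)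
  case less
  have "DERIV (\<lambda>x. 0) x :> 0" by simp
  then have "DERIV (\<lambda>x. (max 0 x) ^ Suc n) x :> 0"
    by (rule has_field_derivative_transform_within_open[where S = "{..<0}"]) (use less in auto)
  then show ?thesis using less assms by (simp add: max_absorb1 power_0_left)
next
  case greater
  have "DERIV (\<lambda>x. x ^ Suc n) x :> real (Suc n) * x ^ n"
    by (auto intro!: derivative_eq_intros simp del: power_Suc)
  then have "DERIV (\<lambda>x. (max 0 x) ^ Suc n) x :> real (Suc n) * x ^ n"
    by (rule has_field_derivative_transform_within_open[where S = "{0<..}"]) (use greater in auto)
  then show ?thesis using greater by (simp add: max_absorb2)
next
  case equal
  have lim0: "((\<lambda>h::real. \<bar>h\<bar> ^ n) \<longlongrightarrow> 0) (at 0)"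
  proof -
    have "((\<lambda>h::real. \<bar>h\<bar> ^ n) \<longlongrightarrow> \<bar>0\<bar> ^ n) (at 0)" by (intro tendsto_intros)
    then show ?thesis using assms by (simp add: power_0_left)
  qed
  have "\<forall>\<^sub>F h in at (0::real). norm ((max 0 (0 + h) ^ Suc n - max 0 0 ^ Suc n) / h) \<le> \<bar>h\<bar> ^ n"
    by (rule always_eventually) (auto simp: max_def abs_mult)
  then have "((\<lambda>h. (max 0 (0 + h) ^ Suc n - max 0 0 ^ Suc n) / h) \<longlongrightarrow> 0) (at (0::real))"
    by (rule Lim_null_comparison) (rule lim0)
  then show ?thesis using equal assms by (simp add: DERIV_def power_0_left)
qed

text \<open>Truncated powers, from which the spline cut-off and later the trapezoids are
  built.\<close>

definition tpow :: "nat \<Rightarrow> real \<Rightarrow> real \<Rightarrow> real" where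
  "tpow n c s = (max 0 (s - c)) ^ n"

text \<open>The cubic B-spline step: it decreases from \<open>1\<close> at \<open>s = 1\<close> to \<open>0\<close> at \<open>s = 4\<close> and is of class \<open>C\<^sup>2\<close>.\<close>

definition \<theta> :: "real \<Rightarrow> real" where
  "\<theta> s = 1 - (tpow 3 1 s - 3 * tpow 3 2 s + 3 * tpow 3 3 s - tpow 3 4 s) / 6"

definition \<theta>1 :: "real \<Rightarrow> real" where
  "\<theta>1 s = - (tpow 2 1 s - 3 * tpow 2 2 s + 3 * tpow 2 3 s - tpow 2 4 s) / 2"

definition \<theta>2 :: "real \<Rightarrow> real" where
  "\<theta>2 s = - (tpow 1 1 s - 3 * tpow 1 2 s + 3 * tpow 1 3 s - tpow 1 4 s)"

lemma DERIV_tpow: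
  assumes "n \<ge> 1"
  shows "DERIV (tpow (Suc n) c) s :> real (Suc n) * tpow n c s"
proof -
  have "DERIV (\<lambda>s. s - c) s :> 1" by (auto intro!: derivative_eq_intros)
  from DERIV_chain2[where f = "\<lambda>x. (max 0 x) ^ Suc n" and g = "\<lambda>s. s - c", OF DERIV_max_power[OF assms] this]
  show ?thesis by (simp add: tpow_def[abs_def] del: power_Suc)
qed

lemma DERIV_tpow3: "DERIV (tpow 3 c) s :> 3 * tpow 2 c s"
  using DERIV_tpow[of 2 c s] by (simp add: numeral_3_eq_3 numeral_2_eq_2)

lemma DERIV_tpow2: "DERIV (tpow 2 c) s :> 2 * tpow 1 c s"
  using DERIV_tpow[of 1 c s] by (simp add: numeral_2_eq_2)

lemma tpow_continuous: "continuous_on A (tpow n c)"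
  unfolding tpow_def[abs_def] by (intro continuous_intros)

lemma theta_deriv: "DERIV \<theta> s :> \<theta>1 s"
  unfolding \<theta>_def[abs_def] \<theta>1_def by (auto intro!: derivative_eq_intros DERIV_tpow3 simp: field_simps)

lemma theta1_deriv: "DERIV \<theta>1 s :> \<theta>2 s"
  unfolding \<theta>1_def[abs_def] \<theta>2_def by (auto intro!: derivative_eq_intros DERIV_tpow2)

lemma theta_low: "s \<le> 1 \<Longrightarrow> \<theta> s = 1 \<and> \<theta>1 s = 0 \<and> \<theta>2 s = 0"
  by (simp add: \<theta>_def \<theta>1_def \<theta>2_def tpow_def max_absorb1)

lemma theta_high: "4 \<le> s \<Longrightarrow> \<theta> s = 0 \<and> \<theta>1 s = 0 \<and> \<theta>2 s = 0"
  by (simp add: \<theta>_def \<theta>1_def \<theta>2_def tpow_def max_absorb2 power2_eq_square power3_eq_cube algebra_simps)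

lemma theta1_nonpos: "\<theta>1 s \<le> 0"
proof -
  consider "s \<le> 1" | "1 \<le> s" "s \<le> 2" | "2 \<le> s" "s \<le> 3" | "3 \<le> s" "s \<le> 4" | "4 \<le> s" by linarith
  then show ?thesis
  proof cases
    case 2
    then show ?thesis by (simp add: \<theta>1_def tpow_def max_absorb1)
  next
    case 3
    have "\<theta>1 s = - ((s - 1)\<^sup>2 - 3 * (s - 2)\<^sup>2) / 2" using 3 by (simp add: \<theta>1_def tpow_def max_absorb1 max_absorb2)
    also have "\<dots> = - (1 + 2 * ((s - 2) * (3 - s))) / 2" by (simp add: power2_eq_square algebra_simps)
    finally have "\<theta>1 s = - (1 + 2 * ((s - 2) * (3 - s))) / 2" .
    moreover have "0 \<le> (s - 2) * (3 - s)" by (rule mult_nonneg_nonneg) (use 3 in auto)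
    moreover define w where "w = (s - 2) * (3 - s)"
    ultimately have "\<theta>1 s = - (1 / 2 + w)" "0 \<le> w" by (auto simp: field_simps)
    then show ?thesis by simp
  next
    case 4
    have "\<theta>1 s = - ((s - 1)\<^sup>2 - 3 * (s - 2)\<^sup>2 + 3 * (s - 3)\<^sup>2) / 2" using 4 by (simp add: \<theta>1_def tpow_def max_absorb1 max_absorb2)
    also have "\<dots> = - ((4 - s)\<^sup>2) / 2" by (simp add: power2_eq_square algebra_simps)
    finally show ?thesis by simp
  qed (use theta_low theta_high in auto)
qed

lemma theta_antimono: "s \<le> t \<Longrightarrow> \<theta> t \<le> \<theta> s"
  by (rule DERIV_nonpos_imp_nonincreasing[of s t \<theta>]) (use theta_deriv theta1_nonpos in blast)+

lemma theta_bounds: "0 \<le> \<theta> s" "\<theta> s \<le> 1"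
  using theta_antimono[of s "max s 4"] theta_high[of "max s 4"] theta_antimono[of "min s 1" s] theta_low[of "min s 1"]
  by auto

lemma theta_continuous: "continuous_on UNIV \<theta>1" "continuous_on UNIV \<theta>2"
  unfolding \<theta>1_def[abs_def] \<theta>2_def[abs_def] by (intro continuous_intros tpow_continuous; simp)+

lemma theta_deriv_bound: "\<bar>\<theta>1 s\<bar> \<le> 1" "\<bar>\<theta>2 s\<bar> \<le> 1"
proof -
  consider "s \<le> 1" | "1 \<le> s" "s \<le> 2" | "2 \<le> s" "s \<le> 3" | "3 \<le> s" "s \<le> 4" | "4 \<le> s" by linarith
  then have "\<bar>\<theta>1 s\<bar> \<le> 1 \<and> \<bar>\<theta>2 s\<bar> \<le> 1"
  proof cases
    case 2
    have "\<theta>1 s = - ((s - 1)\<^sup>2 / 2)" "\<theta>2 s = - (s - 1)" using 2 by (simp_all add: \<theta>1_def \<theta>2_def tpow_def max_absorb1)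
    moreover have "(s - 1)\<^sup>2 \<le> 1\<^sup>2" using 2 by (intro power_mono) auto
    ultimately show ?thesis using 2 by simp
  next
    case 3
    have "\<theta>1 s = - ((s - 1)\<^sup>2 - 3 * (s - 2)\<^sup>2) / 2" using 3 by (simp add: \<theta>1_def tpow_def max_absorb1 max_absorb2)
    also have "\<dots> = (s - 5 / 2)\<^sup>2 - 3 / 4" by (simp add: power2_eq_square field_simps)
    finally have 1: "\<theta>1 s = (s - 5 / 2)\<^sup>2 - 3 / 4" .
    define w where "w = (s - 5 / 2)\<^sup>2"
    have "\<bar>s - 5 / 2\<bar>\<^sup>2 \<le> 1\<^sup>2" using 3 by (intro power_mono) (auto simp: abs_le_iff)
    then have "0 \<le> w" "w \<le> 1" by (simp_all add: w_def)
    moreover have "\<theta>1 s = w - 3 / 4" by (simp add: w_def 1)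
    moreover have "\<theta>2 s = 2 * s - 5" using 3 by (simp add: \<theta>2_def tpow_def max_absorb1 max_absorb2)
    ultimately show ?thesis using 3 by (simp add: abs_le_iff)
  next
    case 4
    have "\<theta>1 s = - ((s - 1)\<^sup>2 - 3 * (s - 2)\<^sup>2 + 3 * (s - 3)\<^sup>2) / 2" using 4 by (simp add: \<theta>1_def tpow_def max_absorb1 max_absorb2)
    also have "\<dots> = - ((4 - s)\<^sup>2 / 2)" by (simp add: power2_eq_square field_simps)
    finally have "\<theta>1 s = - ((4 - s)\<^sup>2 / 2)" .
    moreover have "(4 - s)\<^sup>2 \<le> 1\<^sup>2" using 4 by (intro power_mono) auto
    moreover have "\<theta>2 s = 4 - s" using 4 by (simp add: \<theta>2_def tpow_def max_absorb1 max_absorb2)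
    ultimately show ?thesis using 4 by simp
  qed (use theta_low theta_high in auto)
  then show "\<bar>\<theta>1 s\<bar> \<le> 1" "\<bar>\<theta>2 s\<bar> \<le> 1" by blast+
qed

lemma GDERIV_norm_square: "GDERIV (\<lambda>z::complex. (cmod (z - q))\<^sup>2) z :> 2 *\<^sub>R (z - q)"
proof -
  have "((\<lambda>z. (z - q) \<bullet> (z - q)) has_derivative (\<lambda>h. (z - q) \<bullet> h + h \<bullet> (z - q))) (at z)"
    by (auto intro!: derivative_eq_intros)
  moreover have "(\<lambda>h. (z - q) \<bullet> h + h \<bullet> (z - q)) = (\<lambda>h. h \<bullet> (2 *\<^sub>R (z - q)))"
    by (auto simp: inner_commute algebra_simps)
  ultimately show ?thesis by (simp add: gderiv_def power2_norm_eq_inner)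
qed

definition rsq :: "complex \<Rightarrow> real \<Rightarrow> complex \<Rightarrow> real" where
  "rsq q r z = (cmod (z - q))\<^sup>2 / r\<^sup>2"

lemma GDERIV_rsq: "GDERIV (rsq q r) z :> (2 / r\<^sup>2) *\<^sub>R (z - q)"
proof -
  have "GDERIV (\<lambda>z. (1 / r\<^sup>2) * (cmod (z - q))\<^sup>2) z :> (1 / r\<^sup>2) *\<^sub>R (2 *\<^sub>R (z - q)) + (cmod (z - q))\<^sup>2 *\<^sub>R 0"
    by (rule GDERIV_mult[OF GDERIV_const GDERIV_norm_square])
  then show ?thesis by (simp add: rsq_def[abs_def])
qed

lemma rsq_continuous: "continuous_on UNIV (rsq q r)"
  unfolding rsq_def[abs_def] divide_inverse by (intro continuous_intros)

text \<open>The argument is the squared scaled distance, smooth at the centre, so the transition of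
  \<theta> from s = 1 to s = 4 takes place for distances between r and 2r.\<close>

definition cut :: "complex \<Rightarrow> real \<Rightarrow> complex \<Rightarrow> real" where
  "cut q r z = \<theta> (rsq q r z)"

definition cutG :: "complex \<Rightarrow> real \<Rightarrow> complex \<Rightarrow> complex" where
  "cutG q r z = (\<theta>1 (rsq q r z) * (2 / r\<^sup>2)) *\<^sub>R (z - q)"

text \<open>Gradient of the component of \<open>cutG\<close> in direction \<open>d\<close>. It is
  continuous because \<theta> is of class C^2, so the components of \<open>cutG\<close> are test
  functions themselves.\<close>

definition cutH :: "complex \<Rightarrow> real \<Rightarrow> complex \<Rightarrow> complex \<Rightarrow> complex" where
  "cutH q r d z = (\<theta>2 (rsq q r z) * (2 / r\<^sup>2) * (2 / r\<^sup>2) * ((z - q) \<bullet> d)) *\<^sub>R (z - q) + (\<theta>1 (rsq q r z) * (2 / r\<^sup>2)) *\<^sub>R d"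

lemma cut_inside: "r > 0 \<Longrightarrow> cmod (z - q) \<le> r \<Longrightarrow> cut q r z = 1 \<and> cutG q r z = 0 \<and> cutH q r d z = 0"
  using theta_low[of "rsq q r z"] by (simp add: cut_def cutG_def cutH_def rsq_def power_mono)

lemma cut_outside: "r > 0 \<Longrightarrow> 2 * r \<le> cmod (z - q) \<Longrightarrow> cut q r z = 0 \<and> cutG q r z = 0 \<and> cutH q r d z = 0"
proof -
  assume r: "r > 0" "2 * r \<le> cmod (z - q)"
  have "(2 * r)\<^sup>2 \<le> (cmod (z - q))\<^sup>2" by (rule power_mono) (use r in auto)
  then have "4 \<le> rsq q r z" using r by (simp add: rsq_def field_simps)
  then show ?thesis using theta_high[of "rsq q r z"] by (simp add: cut_def cutG_def cutH_def)
qed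

lemma cut_bounds: "0 \<le> cut q r z" "cut q r z \<le> 1"
  by (simp_all add: cut_def theta_bounds)

lemma comp_rsq_continuous: "continuous_on UNIV h \<Longrightarrow> continuous_on UNIV (\<lambda>z. h (rsq q r z))" for h :: "real \<Rightarrow> real"
  by (rule continuous_on_compose2[OF _ rsq_continuous]) auto

lemma cutG_continuous: "continuous_on UNIV (cutG q r)"
  unfolding cutG_def[abs_def] by (intro continuous_intros comp_rsq_continuous theta_continuous)

lemma cutH_continuous: "continuous_on UNIV (cutH q r d)"
  unfolding cutH_def[abs_def] by (intro continuous_intros comp_rsq_continuous theta_continuous)

lemma far_from_center: "r > 0 \<Longrightarrow> norm z > cmod q + 2 * r \<Longrightarrow> 2 * r \<le> cmod (z - q)"
  using norm_triangle_ineq2[of z q] by simp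

lemma C1c_cut:
  assumes r: "r > 0"
  shows "C1c (cut q r) (cutG q r)"
  unfolding C1c_def
proof (intro conjI allI exI[of _ "cmod q + 2 * r"] impI)
  show "GDERIV (cut q r) z :> cutG q r z" for z
    using GDERIV_DERIV_compose[OF GDERIV_rsq theta_deriv, of q r z]
    by (simp add: cut_def[abs_def] cutG_def)
  show "cut q r z = 0" if "norm z > cmod q + 2 * r" for z
    using cut_outside[OF r far_from_center[OF r that]] by blast
qed (rule cutG_continuous)

lemma C1c_cutG_comp:
  assumes r: "r > 0"
  shows "C1c (\<lambda>z. cutG q r z \<bullet> d) (cutH q r d)"
  unfolding C1c_def
proof (intro conjI allI exI[of _ "cmod q + 2 * r"] impI)
  fix z
  have 1: "GDERIV (\<lambda>z. \<theta>1 (rsq q r z)) z :> \<theta>2 (rsq q r z) *\<^sub>R ((2 / r\<^sup>2) *\<^sub>R (z - q))"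
    by (rule GDERIV_DERIV_compose[OF GDERIV_rsq theta1_deriv])
  have "GDERIV (\<lambda>z. (z - q) \<bullet> d) z :> d"
    unfolding gderiv_def by (auto intro!: derivative_eq_intros)
  from GDERIV_mult[OF GDERIV_const[of "2 / r\<^sup>2"] this]
  have 2: "GDERIV (\<lambda>z. (2 / r\<^sup>2) * ((z - q) \<bullet> d)) z :> (2 / r\<^sup>2) *\<^sub>R d" by simp
  show "GDERIV (\<lambda>z. cutG q r z \<bullet> d) z :> cutH q r d z"
    using GDERIV_mult[OF 1 2] by (simp add: cutG_def cutH_def mult_ac add.commute)
next
  show "cutG q r z \<bullet> d = 0" if "norm z > cmod q + 2 * r" for z
    using cut_outside[OF r far_from_center[OF r that]] by simp
qed (rule cutH_continuous)

text \<open>\<open>W\<close> may be singular outside \<open>U\<close>; the test function vanishes on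
  an open set covering the rest, and the product is extended by 0.\<close>

lemma C1c_mult_local:
  assumes phi: "C1c \<phi> \<Phi>" and U: "open U" "\<And>z. z \<in> U \<Longrightarrow> GDERIV W z :> GW z" "continuous_on U GW"
    and N: "open N" "U \<union> N = UNIV" "\<And>z. z \<in> N \<Longrightarrow> \<phi> z = 0"
  shows "C1c (\<lambda>z. W z * \<phi> z) (\<lambda>z. W z *\<^sub>R \<Phi> z + \<phi> z *\<^sub>R GW z)"
proof -
  have \<Phi>0: "\<Phi> z = 0" if "z \<in> N" for z
    by (rule GDERIV_locally_const[of \<phi> z _ N 0]) (use phi N that in \<open>auto simp: C1c_def\<close>)
  have dphi: "GDERIV \<phi> z :> \<Phi> z" for z using phi by (simp add: C1c_def)
  have contW: "continuous_on U W"
  proof (rule continuous_at_imp_continuous_on, rule ballI)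
    fix z assume "z \<in> U"
    then have "(W has_derivative (\<lambda>h. h \<bullet> GW z)) (at z)" using U(2) by (simp add: gderiv_def)
    then show "isCont W z" by (rule has_derivative_continuous)
  qed
  show ?thesis
    unfolding C1c_def
  proof (intro conjI allI)
    fix z
    show "GDERIV (\<lambda>z. W z * \<phi> z) z :> W z *\<^sub>R \<Phi> z + \<phi> z *\<^sub>R GW z"
    proof (cases "z \<in> U")
      case True
      show ?thesis using GDERIV_mult[OF U(2)[OF True] dphi] by (simp add: add.commute)
    next
      case False
      then have zN: "z \<in> N" using N(2) by blast
      have "GDERIV (\<lambda>z. W z * \<phi> z) z :> 0"
        by (rule GDERIV_cong_open[OF GDERIV_const N(1) zN, of 0]) (simp add: N(3))
      then show ?thesis using \<Phi>0[OF zN] N(3)[OF zN] by simp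
    qed
  next
    have "continuous_on U (\<lambda>z. W z *\<^sub>R \<Phi> z + \<phi> z *\<^sub>R GW z)"
    proof (intro continuous_on_add continuous_on_scaleR)
      show "continuous_on U \<Phi>" by (rule continuous_on_subset[of UNIV]) (use phi in \<open>auto simp: C1c_def\<close>)
      show "continuous_on U \<phi>" by (rule continuous_on_subset[OF C1c_continuous[OF phi]]) simp
    qed (rule contW, rule U(3))
    moreover have "continuous_on N (\<lambda>z. W z *\<^sub>R \<Phi> z + \<phi> z *\<^sub>R GW z)"
      by (rule continuous_on_eq[of _ "\<lambda>_. 0"]) (auto simp: \<Phi>0 N(3))
    ultimately show "continuous_on UNIV (\<lambda>z. W z *\<^sub>R \<Phi> z + \<phi> z *\<^sub>R GW z)"
      using continuous_on_open_Un[OF U(1) N(1)] N(2) by simp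
  next
    obtain R where "R > 0" "\<And>z. norm z > R \<Longrightarrow> \<phi> z = 0" "\<And>z. norm z > R \<Longrightarrow> \<Phi> z = 0" by (rule C1cE[OF phi]) (rule that)
    then show "\<exists>R. \<forall>z. norm z > R \<longrightarrow> W z * \<phi> z = 0" by auto
  qed
qed

lemma C1c_inner_integrable:
  assumes phi: "C1c \<phi> \<Phi>" and U: "open U" "continuous_on U GW"
    and N: "open N" "U \<union> N = UNIV" "\<And>z. z \<in> N \<Longrightarrow> \<Phi> z = 0"
  shows "integrable lborel (\<lambda>z. \<Phi> z \<bullet> GW z)"
proof -
  have c: "continuous_on UNIV \<Phi>" using phi by (simp add: C1c_def)
  have "continuous_on U (\<lambda>z. \<Phi> z \<bullet> GW z)"
    by (intro continuous_intros U(2) continuous_on_subset[OF c]) auto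
  moreover have "continuous_on N (\<lambda>z. \<Phi> z \<bullet> GW z)"
    by (rule continuous_on_eq[of _ "\<lambda>_. 0"]) (auto simp: N(3))
  ultimately have cont: "continuous_on UNIV (\<lambda>z. \<Phi> z \<bullet> GW z)"
    using continuous_on_open_Un[OF U(1) N(1)] N(2) by simp
  obtain R where R: "R > 0" "\<And>z. norm z > R \<Longrightarrow> \<phi> z = 0" "\<And>z. norm z > R \<Longrightarrow> \<Phi> z = 0" by (rule C1cE[OF phi]) (rule that)
  have z: "\<Phi> z \<bullet> GW z = 0" if "norm z > R" for z using R(3)[OF that] by simp
  obtain C where C: "C \<ge> 0" "\<And>z. norm (\<Phi> z \<bullet> GW z) \<le> C"
    by (rule continuous_compact_support_bounded[OF cont z]) (assumption, rule that)
  show ?thesis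
    by (rule integrable_bounded_support[of _ C R]) (use C(2) z cont in \<open>auto intro: borel_measurable_continuous_onI\<close>)
qed

lemma C1c_inner_integrable_locally_const:
  assumes phi: "C1c \<phi> \<Phi>" and U: "open U" "continuous_on U GW"
    and const: "\<And>q. q \<notin> U \<Longrightarrow> \<exists>e>0. \<exists>c. \<forall>z\<in>ball q e. \<phi> z = c"
  shows "integrable lborel (\<lambda>z. \<Phi> z \<bullet> GW z)"
proof (rule C1c_inner_integrable[OF phi U, of "interior {z. \<Phi> z = 0}"])
  have "q \<in> interior {z. \<Phi> z = 0}" if "q \<notin> U" for q
  proof -
    obtain e c where e: "e > 0" "\<forall>z\<in>ball q e. \<phi> z = c" using const[OF \<open>q \<notin> U\<close>] by blast
    have "\<Phi> z = 0" if "z \<in> ball q e" for z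
      by (rule GDERIV_locally_const[of \<phi> z _ "ball q e" c]) (use phi e that in \<open>auto simp: C1c_def\<close>)
    then show ?thesis using e(1) by (intro interiorI[of "ball q e"]) auto
  qed
  then show "U \<union> interior {z. \<Phi> z = 0} = UNIV" by blast
qed (use interior_subset in auto)

text \<open>The Laplacian of the cut-off is (4 s \<theta>2(s) + 4 \<theta>1(s)) / r^2, and s \<le> 4
  on the support gives 16 B + 4 B = 20 B. Multiplied by the area 4 pi r^2 of the support this is a
  bound free of \<open>r\<close>, here 80 pi for B = 1.\<close>

lemma cut_radial_bounds:
  assumes B: "\<And>s. \<bar>\<theta>1 s\<bar> \<le> B" "\<And>s. \<bar>\<theta>2 s\<bar> \<le> B" and r: "r > 0"
  shows "cmod (cutG q r z) \<le> (4 * B / r) * indicator (cball q (2 * r)) z"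
    and "\<bar>cutH q r 1 z \<bullet> 1 + cutH q r \<i> z \<bullet> \<i>\<bar> \<le> (20 * B / r\<^sup>2) * indicator (cball q (2 * r)) z"
proof -
  have B0: "B \<ge> 0" using order_trans[OF abs_ge_zero B(1)[of 0]] .
  have "cmod (cutG q r z) \<le> (4 * B / r) * indicator (cball q (2 * r)) z \<and>
    \<bar>cutH q r 1 z \<bullet> 1 + cutH q r \<i> z \<bullet> \<i>\<bar> \<le> (20 * B / r\<^sup>2) * indicator (cball q (2 * r)) z"
  proof (cases "2 * r \<le> cmod (z - q)")
    case True
    then show ?thesis using cut_outside[OF r True] B0 r by simp
  next
    case False
    then have zin: "z \<in> cball q (2 * r)" by (simp add: dist_norm norm_minus_commute)
    define s where "s = rsq q r z"
    have "(cmod (z - q))\<^sup>2 \<le> (2 * r)\<^sup>2" by (rule power_mono) (use False in auto)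
    then have s: "0 \<le> s" "s \<le> 4" using r by (auto simp: s_def rsq_def field_simps)
    have "cmod (cutG q r z) = \<bar>\<theta>1 s\<bar> * (2 / r\<^sup>2) * cmod (z - q)"
      by (simp add: cutG_def s_def abs_mult)
    also have "\<dots> \<le> B * (2 / r\<^sup>2) * (2 * r)"
      using B False B0 by (intro mult_mono) auto
    also have "\<dots> = 4 * B / r" using r by (simp add: power2_eq_square)
    finally have 1: "cmod (cutG q r z) \<le> 4 * B / r" .
    have n: "(z - q) \<bullet> 1 * ((z - q) \<bullet> 1) + (z - q) \<bullet> \<i> * ((z - q) \<bullet> \<i>) = s * r\<^sup>2"
    proof -
      have "s * r\<^sup>2 = (cmod (z - q))\<^sup>2" using r by (simp add: s_def rsq_def)
      then show ?thesis unfolding cmod_power2 by (simp add: inner_complex_def power2_eq_square)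
    qed
    have quad: "cutH q r d z \<bullet> d = \<theta>2 s * (2 / r\<^sup>2) * (2 / r\<^sup>2) * ((z - q) \<bullet> d) * ((z - q) \<bullet> d) + \<theta>1 s * (2 / r\<^sup>2) * (d \<bullet> d)" for d
      by (simp only: cutH_def s_def inner_add_left inner_scaleR_left)
    define x where "x = (z - q) \<bullet> 1"
    define y where "y = (z - q) \<bullet> \<i>"
    have ii: "(1::complex) \<bullet> 1 = 1" "\<i> \<bullet> \<i> = 1" by (simp_all add: inner_complex_def)
    have "cutH q r 1 z \<bullet> 1 + cutH q r \<i> z \<bullet> \<i> =
       \<theta>2 s * (2 / r\<^sup>2) * (2 / r\<^sup>2) * ((z - q) \<bullet> 1 * ((z - q) \<bullet> 1) + (z - q) \<bullet> \<i> * ((z - q) \<bullet> \<i>)) + \<theta>1 s * (2 / r\<^sup>2) * 2"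
      unfolding quad ii x_def[symmetric] y_def[symmetric] by (simp add: algebra_simps add_divide_distrib)
    also have "\<dots> = (4 * (\<theta>2 s * s) + 4 * \<theta>1 s) / r\<^sup>2"
      unfolding n using r by (simp add: field_simps power2_eq_square)
    finally have eq: "cutH q r 1 z \<bullet> 1 + cutH q r \<i> z \<bullet> \<i> = (4 * (\<theta>2 s * s) + 4 * \<theta>1 s) / r\<^sup>2" .
    have "\<bar>\<theta>2 s * s\<bar> \<le> B * 4" unfolding abs_mult using B s B0 by (intro mult_mono) auto
    then have "\<bar>4 * (\<theta>2 s * s) + 4 * \<theta>1 s\<bar> \<le> 20 * B" using B(1)[of s] by linarith
    then have 2: "\<bar>cutH q r 1 z \<bullet> 1 + cutH q r \<i> z \<bullet> \<i>\<bar> \<le> 20 * B / r\<^sup>2"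
      unfolding eq by (simp add: divide_right_mono)
    show ?thesis using 1 2 zin by simp
  qed
  then show "cmod (cutG q r z) \<le> (4 * B / r) * indicator (cball q (2 * r)) z"
    and "\<bar>cutH q r 1 z \<bullet> 1 + cutH q r \<i> z \<bullet> \<i>\<bar> \<le> (20 * B / r\<^sup>2) * indicator (cball q (2 * r)) z"
    by blast+
qed

lemma integral_cball_indicator: "r > 0 \<Longrightarrow> (LINT z|lborel. C * indicator (cball (q::complex) (2 * r)) z) = C * (4 * pi * r\<^sup>2)"
  by (simp add: content_cball unit_ball_vol_2 power_mult_distrib)

lemma integrable_cball_indicator: "integrable lborel (\<lambda>z. (C::real) * indicator (cball (q::complex) r) z)"
  by (intro integrable_mult_right integrable_real_indicator) (use emeasure_bounded_finite[OF bounded_cball] in auto)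

text \<open>
  Integration by parts moves both derivatives to the cut-off, whose Laplacian has \<open>L\<^sup>1\<close> norm independent of the
  scale. So the flux of a bounded function through a small (or large) circle is controlled by its oscillation
  alone, without any bound on its gradient.
\<close>

lemma flux_bound:
  assumes r: "r > 0" and U: "open U" "{z. r \<le> cmod (z - q) \<and> cmod (z - q) \<le> 2 * r} \<subseteq> U"
    and W: "\<And>z. z \<in> U \<Longrightarrow> GDERIV W z :> GW z" "continuous_on U GW"
    and \<delta>: "\<delta> \<ge> 0" "\<And>z. r \<le> cmod (z - q) \<Longrightarrow> cmod (z - q) \<le> 2 * r \<Longrightarrow> \<bar>W z - c\<bar> \<le> \<delta>"
  shows "integrable lborel (\<lambda>z. cutG q r z \<bullet> GW z)" "\<bar>LINT z|lborel. cutG q r z \<bullet> GW z\<bar> \<le> 80 * pi * \<delta>"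
proof -
    define N where "N = {z. cmod (z - q) < r} \<union> {z. 2 * r < cmod (z - q)}"
    have N: "open N" "U \<union> N = UNIV"
    proof -
      show "open N" unfolding N_def by (intro open_Un open_Collect_less continuous_intros)
      show "U \<union> N = UNIV" using U(2) by (auto simp: N_def not_less subset_iff)
    qed
    have zN: "cutG q r z = 0" if "z \<in> N" for z
      using that cut_inside[OF r, of z q] cut_outside[OF r, of z q] by (auto simp: N_def)
    have int: "integrable lborel (\<lambda>z. cutG q r z \<bullet> GW z)"
      by (rule C1c_inner_integrable[OF C1c_cut[OF r] U(1) W(2) N zN])
    \<comment> \<open>Gradient of (W - c) times the \<open>d\<close>-component of
      \<open>cutG\<close>. Taking the \<open>d\<close>-components for d = 1 and d = \<i> and adding
      them gives the divergence of (W - c) grad cut, whose integral vanishes: this is Green's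
      formula.\<close>
    define P where "P d z = (W z - c) *\<^sub>R cutH q r d z + (cutG q r z \<bullet> d) *\<^sub>R GW z" for d z
    have P: "C1c (\<lambda>z. (W z - c) * (cutG q r z \<bullet> d)) (P d)" for d
      unfolding P_def
    proof (rule C1c_mult_local[OF C1c_cutG_comp[OF r] U(1) _ W(2) N])
      show "GDERIV (\<lambda>z. W z - c) z :> GW z" if "z \<in> U" for z
        using GDERIV_diff[OF W(1)[OF that] GDERIV_const[of c]] by simp
      show "cutG q r z \<bullet> d = 0" if "z \<in> N" for z using zN[OF that] by simp
    qed
    have Pint: "integrable lborel (P d)" "(LINT z|lborel. P d z) = 0" for d
      using C1c_integrable(2)[OF P] C1c_integral_gradient_zero[OF P] by blast+
    define Lap where "Lap z = cutH q r 1 z \<bullet> 1 + cutH q r \<i> z \<bullet> \<i>" for z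
    have sum: "P 1 z \<bullet> 1 + P \<i> z \<bullet> \<i> = (W z - c) * Lap z + cutG q r z \<bullet> GW z" for z
      by (simp add: P_def Lap_def inner_complex_def algebra_simps)
    have "(LINT z|lborel. P 1 z \<bullet> 1 + P \<i> z \<bullet> \<i>) = 0"
      using Pint by simp
    then have tot: "(LINT z|lborel. (W z - c) * Lap z + cutG q r z \<bullet> GW z) = 0" unfolding sum .
    have "integrable lborel (\<lambda>z. P 1 z \<bullet> 1 + P \<i> z \<bullet> \<i>)"
      using Pint(1) by (intro Bochner_Integration.integrable_add integrable_inner_left) auto
    then have "integrable lborel (\<lambda>z. (W z - c) * Lap z + cutG q r z \<bullet> GW z)" unfolding sum .
    then have "integrable lborel (\<lambda>z. ((W z - c) * Lap z + cutG q r z \<bullet> GW z) - cutG q r z \<bullet> GW z)"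
      using int by (rule Bochner_Integration.integrable_diff)
    then have intL: "integrable lborel (\<lambda>z. (W z - c) * Lap z)" by simp
    have "(LINT z|lborel. cutG q r z \<bullet> GW z) = - (LINT z|lborel. (W z - c) * Lap z)"
      using tot Bochner_Integration.integral_add[OF intL int] by linarith
    then have "\<bar>LINT z|lborel. cutG q r z \<bullet> GW z\<bar> = norm (LINT z|lborel. (W z - c) * Lap z)" by simp
    also have "\<dots> \<le> (LINT z|lborel. norm ((W z - c) * Lap z))" by (rule integral_norm_bound)
    also have "\<dots> \<le> (LINT z|lborel. \<delta> * (20 * 1 / r\<^sup>2) * indicator (cball q (2 * r)) z)"
    proof (rule integral_mono')
      show "norm ((W z - c) * Lap z) \<le> \<delta> * (20 * 1 / r\<^sup>2) * indicator (cball q (2 * r)) z" for z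
      proof (cases "z \<in> N")
        case True
        then have "Lap z = 0"
          using cut_inside[OF r, of z q] cut_outside[OF r, of z q] by (auto simp: N_def Lap_def)
        then show ?thesis using \<delta>(1) by (simp add: indicator_def)
      next
        case False
        then have "\<bar>W z - c\<bar> \<le> \<delta>" by (intro \<delta>(2)) (auto simp: N_def not_less)
        then show ?thesis
          using mult_mono[OF _ cut_radial_bounds(2)[OF theta_deriv_bound r], of "\<bar>W z - c\<bar>" \<delta> q z] \<delta>(1)
          by (simp add: Lap_def abs_mult mult.assoc)
      qed
      show "0 \<le> \<delta> * (20 * 1 / r\<^sup>2) * indicator (cball q (2 * r)) z" for z
        using \<delta>(1) by simp
    qed (rule integrable_cball_indicator)
    also have "\<dots> = 80 * pi * \<delta>"
      unfolding integral_cball_indicator[OF r] using r by simp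
    finally show "\<bar>LINT z|lborel. cutG q r z \<bullet> GW z\<bar> \<le> 80 * pi * \<delta>" .
    show "integrable lborel (\<lambda>z. cutG q r z \<bullet> GW z)" by (rule int)
qed

section \<open>Flux of a logarithmic pole\<close>

lemma inner_conv_cnj: "x \<bullet> y = Re (x * cnj y)" for x y :: complex
  by (simp add: inner_complex_def)

lemma GDERIV_ln_norm:
  assumes "z \<noteq> q"
  shows "GDERIV (\<lambda>z. ln (cmod (z - q))) z :> 1 / cnj (z - q)"
proof -
  have "(cmod (z - q))\<^sup>2 > 0" using assms by simp
  then have "DERIV (\<lambda>x. ln x / 2) ((cmod (z - q))\<^sup>2) :> 1 / (cmod (z - q))\<^sup>2 / 2"
    by (auto intro!: derivative_eq_intros)
  from GDERIV_DERIV_compose[OF GDERIV_norm_square this]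
  have "GDERIV (\<lambda>z. ln ((cmod (z - q))\<^sup>2) / 2) z :> (1 / (cmod (z - q))\<^sup>2) *\<^sub>R (z - q)" by simp
  moreover have "(1 / (cmod (z - q))\<^sup>2) *\<^sub>R (z - q) = 1 / cnj (z - q)"
  proof -
    have "(1 / (cmod (z - q))\<^sup>2) *\<^sub>R (z - q) = (z - q) / of_real ((cmod (z - q))\<^sup>2)"
      by (simp add: scaleR_conv_of_real)
    also have "of_real ((cmod (z - q))\<^sup>2) = (z - q) * cnj (z - q)" by (rule complex_norm_square)
    finally show ?thesis using assms by simp
  qed
  ultimately have *: "GDERIV (\<lambda>z. ln ((cmod (z - q))\<^sup>2) / 2) z :> 1 / cnj (z - q)" by simp
  show ?thesis
    by (rule GDERIV_cong_open[OF *, of "- {q}"]) (use assms in \<open>auto simp: ln_realpow\<close>)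
qed

lemma flux_ln:
  assumes phi: "C1c \<phi> \<Phi>" and e: "e > 0" and const: "\<And>z. z \<in> ball q e \<Longrightarrow> \<phi> z = \<phi> q"
  shows "(LINT z|lborel. \<Phi> z \<bullet> (1 / cnj (z - q))) = - 2 * pi * \<phi> q"
    and "integrable lborel (\<lambda>z. \<Phi> z \<bullet> (1 / cnj (z - q)))"
proof -
  have eq: "\<Phi> z \<bullet> (1 / cnj (z - q)) = Re (\<Phi> z / (z - q))" for z by (simp add: inner_conv_cnj)
  have z: "\<Phi> z = 0" if "z \<in> ball q e" for z
    by (rule GDERIV_locally_const[of \<phi> z _ "ball q e"]) (use phi that const in \<open>auto simp: C1c_def\<close>)
  have int: "integrable lborel (\<lambda>z. \<Phi> z / (z - q))"
  proof -
    obtain R where R: "R > 0" "\<And>z. norm z > R \<Longrightarrow> \<phi> z = 0" "\<And>z. norm z > R \<Longrightarrow> \<Phi> z = 0" by (rule C1cE[OF phi]) (rule that)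
    obtain C where C: "C \<ge> 0" "\<And>z. \<bar>\<phi> z\<bar> \<le> C" "\<And>z. norm (\<Phi> z) \<le> C" by (rule C1c_bounded[OF phi]) (rule that)
    have [measurable]: "\<Phi> \<in> borel_measurable borel" by (rule C1c_borel(2)[OF phi])
    show ?thesis
    proof (rule integrable_bounded_support[of _ "C / e" R])
      show "norm (\<Phi> z / (z - q)) \<le> C / e" for z
      proof (cases "z \<in> ball q e")
        case True
        then show ?thesis using z[OF True] C(1) e by simp
      next
        case False
        then have "e \<le> cmod (z - q)" by (simp add: dist_norm norm_minus_commute not_less)
        then show ?thesis unfolding norm_divide using C e by (intro frac_le) auto
      qed
    qed (auto simp: R(3))
  qed
  show "integrable lborel (\<lambda>z. \<Phi> z \<bullet> (1 / cnj (z - q)))"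
    unfolding eq using int by (rule integrable_Re)
  show "(LINT z|lborel. \<Phi> z \<bullet> (1 / cnj (z - q))) = - 2 * pi * \<phi> q"
    unfolding eq integral_Re[OF int]
    using arg_cong[OF integral_gradient_log_pole[OF phi e const], of Re] by simp
qed

section \<open>Singular conformal metrics in the plane\<close>

text \<open>\<open>Q\<close> contains all points near which the weak equation is not tested. Some
  may have order 0 and be regular, such as the image of the old point at infinity after an
  inversion. The decay exponent 2 + \<beta> expresses a cone of order \<beta> at infinity, since
  |dz|^2 is |w|^{-4} |dw|^2 for w = 1/z. At the singular points only a limit of the regular part is
  known, without any gradient bound.\<close>

locale conf_plane =
  fixes V :: "complex \<Rightarrow> real" and G :: "complex \<Rightarrow> complex" and k :: "complex \<Rightarrow> real"
    and Q :: "complex set" and \<omega> :: "complex \<Rightarrow> real" and \<beta> a b :: real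
  assumes finQ: "finite Q"
    and grad: "\<And>z. z \<notin> Q \<or> \<omega> z = 0 \<Longrightarrow> GDERIV V z :> G z"
    and contG: "continuous_on {z. z \<notin> Q \<or> \<omega> z = 0} G"
    and lim_Q: "\<And>q. q \<in> Q \<Longrightarrow> \<omega> q \<noteq> 0 \<Longrightarrow> \<exists>L. ((\<lambda>z. V z - \<omega> q * ln (cmod (z - q))) \<longlongrightarrow> L) (at q)"
    and lim_inf: "\<exists>L. ((\<lambda>z. V z + (2 + \<beta>) * ln (cmod z)) \<longlongrightarrow> L) at_infinity"
    and k_meas [measurable]: "k \<in> borel_measurable borel"
    and k_bounds: "0 < a" "\<And>z. a \<le> k z" "\<And>z. k z \<le> b"
    and weak: "\<And>\<phi> \<Phi>. C1c \<phi> \<Phi> \<Longrightarrow> (\<And>q. q \<in> Q \<Longrightarrow> \<exists>e>0. \<forall>z\<in>ball q e. \<phi> z = 0) \<Longrightarrow>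
       integrable lborel (\<lambda>z. k z * exp (2 * V z) * \<phi> z) \<and> (LINT z|lborel. \<Phi> z \<bullet> G z) = (LINT z|lborel. k z * exp (2 * V z) * \<phi> z)"
    and V_meas [measurable]: "V \<in> borel_measurable borel"
begin

text \<open>The points of \<open>Q\<close> that are genuine cone points.\<close>

definition S :: "complex set" where "S = {q \<in> Q. \<omega> q \<noteq> 0}"

lemma finS: "finite S" using finQ by (simp add: S_def)

lemma S_compl: "{z. z \<notin> Q \<or> \<omega> z = 0} = - S" by (auto simp: S_def)

lemma open_compl_S: "open (- S)" by (intro open_Compl finite_imp_closed finS)

lemma grad': "z \<notin> S \<Longrightarrow> GDERIV V z :> G z" using grad by (auto simp: S_def)

lemma contG': "continuous_on (- S) G" using contG unfolding S_compl .

lemma lim_Q': "q \<in> Q \<Longrightarrow> \<exists>L. ((\<lambda>z. V z - \<omega> q * ln (cmod (z - q))) \<longlongrightarrow> L) (at q)"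
proof (cases "\<omega> q = 0")
  case True
  assume "q \<in> Q"
  then have "GDERIV V q :> G q" using True by (intro grad) auto
  then have "isCont V q" unfolding gderiv_def by (rule has_derivative_continuous)
  then show ?thesis using True by (auto simp: isCont_def)
qed (rule lim_Q)

lemma isolated:
  assumes "finite F"
  obtains e where "e > 0" "\<And>z. z \<in> F \<Longrightarrow> z \<noteq> q \<Longrightarrow> e \<le> cmod (z - q)"
proof -
  obtain e where e: "e > 0" "\<forall>z\<in>F. z \<noteq> q \<longrightarrow> e \<le> dist q z"
    using finite_set_avoid[OF assms] by blast
  show thesis by (rule that[OF e(1)]) (use e(2) in \<open>auto simp: dist_norm norm_minus_commute\<close>)
qed

definition rad :: "nat \<Rightarrow> real" where "rad n = 1 / real (Suc n)"

lemma rad_pos: "rad n > 0" by (simp add: rad_def)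

lemma rad_lim: "rad \<longlonglongrightarrow> 0" unfolding rad_def[abs_def] by (rule LIMSEQ_Suc[OF lim_1_over_n])

lemma rad_eventually_less: "e > 0 \<Longrightarrow> \<forall>\<^sub>F n in sequentially. rad n < e"
  using order_tendstoD(2)[OF rad_lim] .

text \<open>After subtraction of \<omega> ln|z - q| the remainder converges at \<open>q\<close>, so
  its oscillation on a small annulus, and with it its flux by \<open>flux_bound\<close>, tends to 0.
  The logarithm contributes -2 pi \<omega>, the sign being due to the inward gradient of the
  cut-off.\<close>

lemma flux_at_pole:
  assumes q: "q \<in> Q"
  shows "(\<lambda>n. LINT z|lborel. cutG q (rad n) z \<bullet> G z) \<longlonglongrightarrow> - 2 * pi * \<omega> q"
    and "\<forall>\<^sub>F n in sequentially. integrable lborel (\<lambda>z. cutG q (rad n) z \<bullet> G z)"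
proof -
  define K where "K = 80 * pi"
  have K: "K \<ge> 0" by (simp add: K_def)
  obtain L where L: "((\<lambda>z. V z - \<omega> q * ln (cmod (z - q))) \<longlongrightarrow> L) (at q)" using lim_Q'[OF q] by blast
  obtain e0 where e0: "e0 > 0" "\<And>z. z \<in> S \<Longrightarrow> z \<noteq> q \<Longrightarrow> e0 \<le> cmod (z - q)" by (rule isolated[OF finS]) (rule that)
  define W where "W z = V z - \<omega> q * ln (cmod (z - q))" for z
  define GW where "GW z = G z - \<omega> q *\<^sub>R (1 / cnj (z - q))" for z
  define U where "U = - insert q S"
  have U: "open U" unfolding U_def by (intro open_Compl finite_imp_closed) (simp add: finS)
  have dW: "GDERIV W z :> GW z" if "z \<in> U" for z
  proof -
    have "GDERIV (\<lambda>z. \<omega> q * ln (cmod (z - q))) z :> \<omega> q *\<^sub>R (1 / cnj (z - q)) + ln (cmod (z - q)) *\<^sub>R 0"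
      by (rule GDERIV_mult[OF GDERIV_const GDERIV_ln_norm]) (use that in \<open>auto simp: U_def\<close>)
    then show ?thesis
      using GDERIV_diff[OF grad'] that by (simp add: W_def[abs_def] GW_def U_def)
  qed
  have cW: "continuous_on U GW"
    unfolding GW_def[abs_def]
    by (intro continuous_intros continuous_on_subset[OF contG']) (auto simp: U_def)
  have step: "integrable lborel (\<lambda>z. cutG q r z \<bullet> G z) \<and> \<bar>(LINT z|lborel. cutG q r z \<bullet> G z) - (- 2 * pi * \<omega> q)\<bar> \<le> K * \<delta>"
    if r: "r > 0" "2 * r < e0" and \<delta>: "\<delta> \<ge> 0" and osc: "\<And>z. r \<le> cmod (z - q) \<Longrightarrow> cmod (z - q) \<le> 2 * r \<Longrightarrow> \<bar>W z - L\<bar> \<le> \<delta>" for r \<delta>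
  proof -
    have sub: "{z. r \<le> cmod (z - q) \<and> cmod (z - q) \<le> 2 * r} \<subseteq> U"
      using r e0(2) by (force simp: U_def)
    have 1: "integrable lborel (\<lambda>z. cutG q r z \<bullet> GW z) \<and> \<bar>LINT z|lborel. cutG q r z \<bullet> GW z\<bar> \<le> K * \<delta>"
      unfolding K_def by (intro conjI flux_bound[OF r(1) U sub dW cW \<delta> osc])
    have cst: "cut q r z = cut q r q" if "z \<in> ball q r" for z
      using cut_inside[OF r(1), of z q] cut_inside[OF r(1), of q q] that r by (auto simp: dist_norm norm_minus_commute)
    have cq: "cut q r q = 1" using cut_inside[OF r(1), of q q] r by simp
    note f = flux_ln[OF C1c_cut[OF r(1)] r(1) cst]
    have eq: "cutG q r z \<bullet> G z = cutG q r z \<bullet> GW z + \<omega> q * (cutG q r z \<bullet> (1 / cnj (z - q)))" for z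
      by (simp add: GW_def inner_diff_right)
    have i: "integrable lborel (\<lambda>z. cutG q r z \<bullet> G z)"
      unfolding eq using 1 f(2) by (intro Bochner_Integration.integrable_add integrable_mult_right) auto
    have "(LINT z|lborel. cutG q r z \<bullet> G z) = (LINT z|lborel. cutG q r z \<bullet> GW z) + \<omega> q * (LINT z|lborel. cutG q r z \<bullet> (1 / cnj (z - q)))"
      unfolding eq using 1 f(2) by (subst Bochner_Integration.integral_add) auto
    also have "\<omega> q * (LINT z|lborel. cutG q r z \<bullet> (1 / cnj (z - q))) = - 2 * pi * \<omega> q"
      using f(1) cq by simp
    finally show ?thesis using 1 i by simp
  qed
  have ev: "\<forall>\<^sub>F n in sequentially. integrable lborel (\<lambda>z. cutG q (rad n) z \<bullet> G z) \<and>
      \<bar>(LINT z|lborel. cutG q (rad n) z \<bullet> G z) - (- 2 * pi * \<omega> q)\<bar> \<le> K * \<delta>" if \<delta>0: "\<delta> > 0" for \<delta>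
  proof -
    obtain d where d: "d > 0" "\<And>z. z \<noteq> q \<Longrightarrow> cmod (z - q) < d \<Longrightarrow> \<bar>W z - L\<bar> < \<delta>"
      using LIM_D[OF L \<delta>0] unfolding W_def real_norm_def by blast
    have "\<forall>\<^sub>F n in sequentially. rad n < min d e0 / 2" using d(1) e0(1) by (intro rad_eventually_less) auto
    then show ?thesis
    proof eventually_elim
      case (elim n)
      show ?case
      proof (rule step)
        show "\<bar>W z - L\<bar> \<le> \<delta>" if "rad n \<le> cmod (z - q)" "cmod (z - q) \<le> 2 * rad n" for z
          using d(2)[of z] that elim rad_pos[of n] by fastforce
      qed (use elim \<delta>0 rad_pos[of n] in auto)
    qed
  qed
  show "\<forall>\<^sub>F n in sequentially. integrable lborel (\<lambda>z. cutG q (rad n) z \<bullet> G z)"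
    using ev[of 1] by (auto elim: eventually_mono)
  show "(\<lambda>n. LINT z|lborel. cutG q (rad n) z \<bullet> G z) \<longlonglongrightarrow> - 2 * pi * \<omega> q"
  proof (rule tendstoI)
    fix \<epsilon> :: real assume \<epsilon>: "\<epsilon> > 0"
    define \<delta> where "\<delta> = \<epsilon> / (K + 1)"
    have \<delta>: "\<delta> > 0" "K * \<delta> < \<epsilon>" using K \<epsilon> by (auto simp: \<delta>_def field_simps)
    show "\<forall>\<^sub>F n in sequentially. dist (LINT z|lborel. cutG q (rad n) z \<bullet> G z) (- 2 * pi * \<omega> q) < \<epsilon>"
      using ev[OF \<delta>(1)] by eventually_elim (use \<delta>(2) in \<open>simp add: dist_real_def\<close>)
  qed
qed

text \<open>The argument at a pole, with growing discs that eventually contain all singular points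
  and with -(2 + \<beta>) ln|z| as the singular part.\<close>

lemma flux_at_infinity:
  shows "(\<lambda>n. LINT z|lborel. cutG 0 (real (Suc n)) z \<bullet> G z) \<longlonglongrightarrow> 2 * pi * (2 + \<beta>)"
    and "\<forall>\<^sub>F n in sequentially. integrable lborel (\<lambda>z. cutG 0 (real (Suc n)) z \<bullet> G z)"
proof -
  define K where "K = 80 * pi"
  have K: "K \<ge> 0" by (simp add: K_def)
  obtain L where L: "((\<lambda>z. V z + (2 + \<beta>) * ln (cmod z)) \<longlongrightarrow> L) at_infinity" using lim_inf by blast
  have "bounded S" by (rule finite_imp_bounded[OF finS])
  then obtain M where M: "\<And>z. z \<in> S \<Longrightarrow> cmod z \<le> M" unfolding bounded_iff by blast
  define W where "W z = V z + (2 + \<beta>) * ln (cmod (z - 0))" for z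
  define GW where "GW z = G z + (2 + \<beta>) *\<^sub>R (1 / cnj (z - 0))" for z
  define U where "U = - insert 0 S"
  have U: "open U" unfolding U_def by (intro open_Compl finite_imp_closed) (simp add: finS)
  have dW: "GDERIV W z :> GW z" if "z \<in> U" for z
  proof -
    have "GDERIV (\<lambda>z. (2 + \<beta>) * ln (cmod (z - 0))) z :> (2 + \<beta>) *\<^sub>R (1 / cnj (z - 0)) + ln (cmod (z - 0)) *\<^sub>R 0"
      by (rule GDERIV_mult[OF GDERIV_const GDERIV_ln_norm]) (use that in \<open>auto simp: U_def\<close>)
    then have "GDERIV (\<lambda>z. (2 + \<beta>) * ln (cmod (z - 0))) z :> (2 + \<beta>) *\<^sub>R (1 / cnj (z - 0))" by simp
    then show ?thesis
      unfolding W_def[abs_def] GW_def using that by (intro GDERIV_add grad') (auto simp: U_def)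
  qed
  have cW: "continuous_on U GW"
    unfolding GW_def[abs_def]
    by (intro continuous_intros continuous_on_subset[OF contG']) (auto simp: U_def)
  have step: "integrable lborel (\<lambda>z. cutG 0 r z \<bullet> G z) \<and> \<bar>(LINT z|lborel. cutG 0 r z \<bullet> G z) - 2 * pi * (2 + \<beta>)\<bar> \<le> K * \<delta>"
    if r: "r > 0" "M < r" and \<delta>: "\<delta> \<ge> 0" and osc: "\<And>z. r \<le> cmod (z - 0) \<Longrightarrow> cmod (z - 0) \<le> 2 * r \<Longrightarrow> \<bar>W z - L\<bar> \<le> \<delta>" for r \<delta>
  proof -
    have sub: "{z. r \<le> cmod (z - 0) \<and> cmod (z - 0) \<le> 2 * r} \<subseteq> U"
      using r M by (force simp: U_def)
    have 1: "integrable lborel (\<lambda>z. cutG 0 r z \<bullet> GW z) \<and> \<bar>LINT z|lborel. cutG 0 r z \<bullet> GW z\<bar> \<le> K * \<delta>"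
      unfolding K_def by (intro conjI flux_bound[OF r(1) U sub dW cW \<delta> osc])
    have cst: "cut 0 r z = cut 0 r 0" if "z \<in> ball 0 r" for z
      using cut_inside[OF r(1), of z 0] cut_inside[OF r(1), of 0 0] that r by auto
    have cq: "cut 0 r 0 = 1" using cut_inside[OF r(1), of 0 0] r by simp
    note f = flux_ln[OF C1c_cut[OF r(1)] r(1) cst]
    have eq: "cutG 0 r z \<bullet> G z = cutG 0 r z \<bullet> GW z - (2 + \<beta>) * (cutG 0 r z \<bullet> (1 / cnj (z - 0)))" for z
      by (simp add: GW_def inner_add_right)
    have i: "integrable lborel (\<lambda>z. cutG 0 r z \<bullet> G z)"
      unfolding eq using 1 f(2) by (intro Bochner_Integration.integrable_diff integrable_mult_right) auto
    have "(LINT z|lborel. cutG 0 r z \<bullet> G z) = (LINT z|lborel. cutG 0 r z \<bullet> GW z) - (2 + \<beta>) * (LINT z|lborel. cutG 0 r z \<bullet> (1 / cnj (z - 0)))"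
      unfolding eq using 1 f(2) by (subst Bochner_Integration.integral_diff) auto
    also have "(2 + \<beta>) * (LINT z|lborel. cutG 0 r z \<bullet> (1 / cnj (z - 0))) = - (2 * pi * (2 + \<beta>))"
      using f(1) cq by simp
    finally show ?thesis using 1 i by simp
  qed
  have ev: "\<forall>\<^sub>F n in sequentially. integrable lborel (\<lambda>z. cutG 0 (real (Suc n)) z \<bullet> G z) \<and>
      \<bar>(LINT z|lborel. cutG 0 (real (Suc n)) z \<bullet> G z) - 2 * pi * (2 + \<beta>)\<bar> \<le> K * \<delta>" if \<delta>0: "\<delta> > 0" for \<delta>
  proof -
    from tendstoD[OF L \<delta>0] obtain R where R: "\<And>z. R \<le> cmod z \<Longrightarrow> dist (V z + (2 + \<beta>) * ln (cmod z)) L < \<delta>"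
      unfolding eventually_at_infinity by blast
    obtain N :: nat where N: "max R M < real N" using reals_Archimedean2 by blast
    show ?thesis
      unfolding eventually_sequentially
    proof (intro exI[of _ N] allI impI)
      fix n assume "N \<le> n"
      then have n: "max R M < real (Suc n)" using N by simp
      show "integrable lborel (\<lambda>z. cutG 0 (real (Suc n)) z \<bullet> G z) \<and>
      \<bar>(LINT z|lborel. cutG 0 (real (Suc n)) z \<bullet> G z) - 2 * pi * (2 + \<beta>)\<bar> \<le> K * \<delta>"
      proof (rule step)
        show "\<bar>W z - L\<bar> \<le> \<delta>" if "real (Suc n) \<le> cmod (z - 0)" for z
          using R[of z] that n by (simp add: W_def dist_real_def)
      qed (use n \<delta>0 in auto)
    qed
  qed
  show "\<forall>\<^sub>F n in sequentially. integrable lborel (\<lambda>z. cutG 0 (real (Suc n)) z \<bullet> G z)"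
    using ev[of 1] by (auto elim: eventually_mono)
  show "(\<lambda>n. LINT z|lborel. cutG 0 (real (Suc n)) z \<bullet> G z) \<longlonglongrightarrow> 2 * pi * (2 + \<beta>)"
  proof (rule tendstoI)
    fix \<epsilon> :: real assume \<epsilon>: "\<epsilon> > 0"
    define \<delta> where "\<delta> = \<epsilon> / (K + 1)"
    have \<delta>: "\<delta> > 0" "K * \<delta> < \<epsilon>" using K \<epsilon> by (auto simp: \<delta>_def field_simps)
    show "\<forall>\<^sub>F n in sequentially. dist (LINT z|lborel. cutG 0 (real (Suc n)) z \<bullet> G z) (2 * pi * (2 + \<beta>)) < \<epsilon>"
      using ev[OF \<delta>(1)] by eventually_elim (use \<delta>(2) in \<open>simp add: dist_real_def\<close>)
  qed
qed

definition hole :: "nat \<Rightarrow> complex \<Rightarrow> real" where "hole n z = (\<Sum>q\<in>Q. cut q (rad n) z)"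
definition holeG :: "nat \<Rightarrow> complex \<Rightarrow> complex" where "holeG n z = (\<Sum>q\<in>Q. cutG q (rad n) z)"

lemma C1c_add: "C1c f F \<Longrightarrow> C1c h H \<Longrightarrow> C1c (\<lambda>z. f z + h z) (\<lambda>z. F z + H z)"
proof -
  assume f: "C1c f F" and h: "C1c h H"
  obtain R1 where R1: "R1 > 0" "\<And>z. norm z > R1 \<Longrightarrow> f z = 0" "\<And>z. norm z > R1 \<Longrightarrow> F z = 0" by (rule C1cE[OF f]) (rule that)
  obtain R2 where R2: "R2 > 0" "\<And>z. norm z > R2 \<Longrightarrow> h z = 0" "\<And>z. norm z > R2 \<Longrightarrow> H z = 0" by (rule C1cE[OF h]) (rule that)
  show ?thesis
    unfolding C1c_def
  proof (intro conjI allI exI[of _ "max R1 R2"] impI)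
    show "GDERIV (\<lambda>z. f z + h z) z :> F z + H z" for z
      by (rule GDERIV_add) (use f h in \<open>auto simp: C1c_def\<close>)
    show "continuous_on UNIV (\<lambda>z. F z + H z)"
      by (rule continuous_on_add) (use f h in \<open>auto simp: C1c_def\<close>)
    show "f z + h z = 0" if "norm z > max R1 R2" for z using R1(2)[of z] R2(2)[of z] that by simp
  qed
qed

lemma C1c_minus: "C1c f F \<Longrightarrow> C1c (\<lambda>z. - f z) (\<lambda>z. - F z)"
  unfolding C1c_def by (auto intro: GDERIV_minus continuous_on_minus)

lemma C1c_zero: "C1c (\<lambda>z. 0) (\<lambda>z. 0)"
  unfolding C1c_def by (auto intro: GDERIV_const continuous_on_const)

lemma C1c_sum: "finite I \<Longrightarrow> (\<And>i. i \<in> I \<Longrightarrow> C1c (f i) (F i)) \<Longrightarrow> C1c (\<lambda>z. \<Sum>i\<in>I. f i z) (\<lambda>z. \<Sum>i\<in>I. F i z)"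
  by (induction I rule: finite_induct) (auto intro: C1c_zero C1c_add)

lemma C1c_mult:
  assumes f: "C1c f F" and h: "\<And>z. GDERIV h z :> H z" "continuous_on UNIV H"
  shows "C1c (\<lambda>z. h z * f z) (\<lambda>z. h z *\<^sub>R F z + f z *\<^sub>R H z)"
  by (rule C1c_mult_local[OF f, of UNIV h H "{}"]) (use h in auto)

lemma C1c_hole: "C1c (hole n) (holeG n)"
  unfolding hole_def[abs_def] holeG_def[abs_def] by (intro C1c_sum finQ C1c_cut rad_pos)

text \<open>The discs of radius \<open>2 * rad n\<close> around the points of \<open>Q\<close> are eventually disjoint, so at most one summand is nonzero.\<close>

lemma hole_eventually:
  "\<forall>\<^sub>F n in sequentially. (\<forall>z. 0 \<le> hole n z \<and> hole n z \<le> 1) \<and> (\<forall>q\<in>Q. \<forall>z\<in>ball q (rad n). hole n z = 1)"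
proof -
  have sep: "\<exists>e>0. \<forall>p\<in>Q. \<forall>q\<in>Q. p \<noteq> q \<longrightarrow> e \<le> cmod (p - q)"
  proof -
    have "\<forall>q. \<exists>e>0. \<forall>z\<in>Q. z \<noteq> q \<longrightarrow> e \<le> cmod (z - q)" using isolated[OF finQ] by metis
    then obtain e where e: "\<And>q. e q > 0" "\<And>q z. z \<in> Q \<Longrightarrow> z \<noteq> q \<Longrightarrow> e q \<le> cmod (z - q)" by metis
    define m where "m = Min (insert 1 (e ` Q))"
    have "m > 0" using finQ e(1) by (simp add: m_def)
    moreover have "m \<le> e q" if "q \<in> Q" for q using finQ that by (simp add: m_def)
    ultimately show ?thesis using e(2) order_trans by (metis (no_types, lifting))
  qed
  then obtain e where e: "e > 0" "\<And>p q. p \<in> Q \<Longrightarrow> q \<in> Q \<Longrightarrow> p \<noteq> q \<Longrightarrow> e \<le> cmod (p - q)" by blast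
  have "\<forall>\<^sub>F n in sequentially. rad n < e / 4" by (rule rad_eventually_less) (use e in simp)
  then show ?thesis
  proof eventually_elim
    case (elim n)
    have single: "hole n z = cut q (rad n) z" if "q \<in> Q" "cmod (z - q) < 2 * rad n" for q z
    proof -
      have "cut p (rad n) z = 0" if p: "p \<in> Q - {q}" for p
      proof -
        have "e \<le> cmod (p - q)" using e(2) p \<open>q \<in> Q\<close> by blast
        also have "cmod (p - q) \<le> cmod (z - q) + cmod (z - p)" by (metis norm_minus_commute norm_triangle_sub add.commute diff_diff_eq2 diff_add_cancel norm_triangle_ineq4)
        finally have "2 * rad n \<le> cmod (z - p)" using elim \<open>cmod (z - q) < 2 * rad n\<close> by linarith
        then show ?thesis using cut_outside[OF rad_pos] by blast
      qed
      then show ?thesis unfolding hole_def using sum.remove[OF finQ \<open>q \<in> Q\<close>, of "\<lambda>q. cut q (rad n) z"] by simp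
    qed
    have bd: "0 \<le> hole n z \<and> hole n z \<le> 1" for z
    proof (cases "\<exists>q\<in>Q. cmod (z - q) < 2 * rad n")
      case True
      then show ?thesis using single cut_bounds by metis
    next
      case False
      then have "hole n z = 0" unfolding hole_def using cut_outside[OF rad_pos] by (intro sum.neutral) (auto simp: not_less)
      then show ?thesis by simp
    qed
    have "hole n z = 1" if "q \<in> Q" "z \<in> ball q (rad n)" for q z
    proof -
      have "cmod (z - q) < rad n" using that by (simp add: dist_norm norm_minus_commute)
      then show ?thesis using single[OF that(1)] cut_inside[OF rad_pos, of z q n] rad_pos[of n] by simp
    qed
    with bd show ?case by blast
  qed
qed

lemma hole_pointwise: "z \<notin> Q \<Longrightarrow> \<forall>\<^sub>F n in sequentially. hole n z = 0"
proof -
  assume z: "z \<notin> Q"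
  have "\<forall>\<^sub>F n in sequentially. cut q (rad n) z = 0" if "q \<in> Q" for q
  proof -
    have "cmod (z - q) > 0" using that z by auto
    then have "\<forall>\<^sub>F n in sequentially. rad n < cmod (z - q) / 2" by (intro rad_eventually_less) auto
    then show ?thesis by eventually_elim (use cut_outside[OF rad_pos] in auto)
  qed
  then have "\<forall>\<^sub>F n in sequentially. \<forall>q\<in>Q. cut q (rad n) z = 0"
    using finQ by (simp add: eventually_ball_finite)
  then show ?thesis by eventually_elim (simp add: hole_def)
qed

lemma AE_not_in_finite: "finite F \<Longrightarrow> AE z in lborel. z \<notin> F" for F :: "complex set"
  using AE_not_in[OF finite_imp_null_set_lborel] by blast

lemma holeG_flux:
  "(\<lambda>n. LINT z|lborel. holeG n z \<bullet> G z) \<longlonglongrightarrow> - 2 * pi * (\<Sum>q\<in>Q. \<omega> q)"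
  "\<forall>\<^sub>F n in sequentially. integrable lborel (\<lambda>z. holeG n z \<bullet> G z)"
proof -
  have ev: "\<forall>\<^sub>F n in sequentially. \<forall>q\<in>Q. integrable lborel (\<lambda>z. cutG q (rad n) z \<bullet> G z)"
    using finQ flux_at_pole(2) by (simp add: eventually_ball_finite)
  have eq: "holeG n z \<bullet> G z = (\<Sum>q\<in>Q. cutG q (rad n) z \<bullet> G z)" for n z
    by (simp add: holeG_def inner_sum_left)
  show "\<forall>\<^sub>F n in sequentially. integrable lborel (\<lambda>z. holeG n z \<bullet> G z)"
    using ev by eventually_elim (auto simp: eq)
  have "(\<lambda>n. \<Sum>q\<in>Q. LINT z|lborel. cutG q (rad n) z \<bullet> G z) \<longlonglongrightarrow> (\<Sum>q\<in>Q. - 2 * pi * \<omega> q)"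
    by (intro tendsto_sum flux_at_pole(1))
  moreover have "\<forall>\<^sub>F n in sequentially. (\<Sum>q\<in>Q. LINT z|lborel. cutG q (rad n) z \<bullet> G z) = (LINT z|lborel. holeG n z \<bullet> G z)"
    using ev by eventually_elim (simp add: eq)
  ultimately have "(\<lambda>n. LINT z|lborel. holeG n z \<bullet> G z) \<longlonglongrightarrow> (\<Sum>q\<in>Q. - 2 * pi * \<omega> q)"
    by (rule Lim_transform_eventually)
  then show "(\<lambda>n. LINT z|lborel. holeG n z \<bullet> G z) \<longlonglongrightarrow> - 2 * pi * (\<Sum>q\<in>Q. \<omega> q)"
    by (simp add: sum_distrib_left)
qed

definition dens :: "complex \<Rightarrow> real" where "dens z = k z * exp (2 * V z)"

lemma dens_meas [measurable]: "dens \<in> borel_measurable borel" unfolding dens_def[abs_def] by measurable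

lemma k_pos: "k z > 0" using k_bounds(1,2) by (rule less_le_trans)

lemma dens_pos: "dens z > 0" using k_pos[of z] by (simp add: dens_def)

definition \<Psi> :: "nat \<Rightarrow> complex \<Rightarrow> real" where "\<Psi> n z = cut 0 (real (Suc n)) z * (1 - hole n z)"

text \<open>Eventually all holes lie where the large cut-off equals 1. The product is then a
  difference, and its flux splits into the flux at infinity and those at the poles.\<close>

lemma Psi_far: "\<forall>\<^sub>F n in sequentially. \<Psi> n = (\<lambda>z. cut 0 (real (Suc n)) z + - hole n z)"
proof -
  have "bounded Q" by (rule finite_imp_bounded[OF finQ])
  then obtain M where M: "\<And>z. z \<in> Q \<Longrightarrow> cmod z \<le> M" unfolding bounded_iff by blast
  obtain N :: nat where N: "M + 2 < real N" using reals_Archimedean2 by blast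
  show ?thesis
    unfolding eventually_sequentially
  proof (intro exI[of _ N] allI impI ext)
    fix n z assume n: "N \<le> n"
    show "\<Psi> n z = cut 0 (real (Suc n)) z + - hole n z"
    proof (cases "cmod z \<le> real (Suc n)")
      case True
      then have "cut 0 (real (Suc n)) z = 1" using cut_inside[of "real (Suc n)" z 0] by simp
      then show ?thesis by (simp add: \<Psi>_def)
    next
      case False
      have "cut q (rad n) z = 0" if q: "q \<in> Q" for q
      proof -
        have "cmod z - cmod q \<le> cmod (z - q)" by (rule norm_triangle_ineq2)
        moreover have "rad n \<le> 1" by (simp add: rad_def)
        ultimately have "2 * rad n \<le> cmod (z - q)" using M[OF q] False n N by linarith
        then show ?thesis using cut_outside[OF rad_pos] by blast
      qed
      then show ?thesis by (simp add: \<Psi>_def hole_def)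
    qed
  qed
qed

text \<open>Gauss-Bonnet for the cone metric: the weak equation is tested with
  \<open>\<Psi> n\<close>, and the fluxes through the small and the large circles survive in the
  limit.\<close>

theorem total_mass:
  "integrable lborel dens" "(LINT z|lborel. dens z) = 2 * pi * (2 + \<beta> + (\<Sum>q\<in>Q. \<omega> q))"
proof -
  define T where "T = 2 * pi * (2 + \<beta> + (\<Sum>q\<in>Q. \<omega> q))"
  have lhs: "\<forall>\<^sub>F n in sequentially. integrable lborel (\<lambda>z. dens z * \<Psi> n z) \<and>
      (LINT z|lborel. dens z * \<Psi> n z) = (LINT z|lborel. cutG 0 (real (Suc n)) z \<bullet> G z) - (LINT z|lborel. holeG n z \<bullet> G z)"
    using Psi_far hole_eventually flux_at_infinity(2) holeG_flux(2)
  proof eventually_elim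
    case (elim n)
    have C: "C1c (\<Psi> n) (\<lambda>z. cutG 0 (real (Suc n)) z + - holeG n z)"
      unfolding elim(1) by (intro C1c_add C1c_minus C1c_hole C1c_cut) simp
    have "integrable lborel (\<lambda>z. k z * exp (2 * V z) * \<Psi> n z) \<and>
        (LINT z|lborel. (cutG 0 (real (Suc n)) z + - holeG n z) \<bullet> G z) = (LINT z|lborel. k z * exp (2 * V z) * \<Psi> n z)"
    proof (rule weak[OF C])
      show "\<exists>e>0. \<forall>z\<in>ball q e. \<Psi> n z = 0" if "q \<in> Q" for q
        by (rule exI[of _ "rad n"]) (use elim(2) that rad_pos in \<open>simp add: \<Psi>_def\<close>)
    qed
    moreover have "(LINT z|lborel. (cutG 0 (real (Suc n)) z + - holeG n z) \<bullet> G z) = (LINT z|lborel. cutG 0 (real (Suc n)) z \<bullet> G z) - (LINT z|lborel. holeG n z \<bullet> G z)"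
      using elim(3,4) by (simp add: inner_diff_left)
    ultimately show ?case by (simp add: dens_def)
  qed
  have "(\<lambda>n. (LINT z|lborel. cutG 0 (real (Suc n)) z \<bullet> G z) - (LINT z|lborel. holeG n z \<bullet> G z)) \<longlonglongrightarrow> 2 * pi * (2 + \<beta>) - (- 2 * pi * (\<Sum>q\<in>Q. \<omega> q))"
    by (intro tendsto_diff flux_at_infinity(1) holeG_flux(1))
  then have "(\<lambda>n. (LINT z|lborel. cutG 0 (real (Suc n)) z \<bullet> G z) - (LINT z|lborel. holeG n z \<bullet> G z)) \<longlonglongrightarrow> T"
    by (simp add: T_def algebra_simps)
  then have lim: "(\<lambda>n. LINT z|lborel. dens z * \<Psi> n z) \<longlonglongrightarrow> T"
    by (rule Lim_transform_eventually) (use lhs in \<open>auto elim: eventually_mono\<close>)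
  have Psi_meas [measurable]: "\<Psi> n \<in> borel_measurable borel" for n
    unfolding \<Psi>_def[abs_def] using C1c_borel(1)[OF C1c_hole] C1c_borel(1)[OF C1c_cut] by measurable
  have Psi_bd: "\<forall>\<^sub>F n in sequentially. \<forall>z. 0 \<le> \<Psi> n z \<and> \<Psi> n z \<le> 1"
    using hole_eventually
  proof eventually_elim
    case (elim n)
    show ?case
    proof
      fix z
      have "0 \<le> 1 - hole n z" "1 - hole n z \<le> 1" using elim by auto
      then show "0 \<le> \<Psi> n z \<and> \<Psi> n z \<le> 1"
        unfolding \<Psi>_def using cut_bounds[of 0 "real (Suc n)" z] mult_mono[of "cut 0 (real (Suc n)) z" 1 "1 - hole n z" 1] by simp
    qed
  qed
  then obtain N where N: "\<And>n z. N \<le> n \<Longrightarrow> 0 \<le> \<Psi> n z \<and> \<Psi> n z \<le> 1" unfolding eventually_sequentially by blast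
  define f where "f n z = dens z * \<Psi> (n + N) z" for n z
  have f_meas [measurable]: "f n \<in> borel_measurable lborel" for n unfolding f_def[abs_def] by measurable
  have f_bd: "0 \<le> f n z" "f n z \<le> dens z" for n z
    unfolding f_def using N[of "n + N" z] dens_pos[of z] by (auto simp: mult_le_cancel_left2 intro!: mult_nonneg_nonneg)
  have f_lim: "AE z in lborel. (\<lambda>n. f n z) \<longlonglongrightarrow> dens z"
    using AE_not_in_finite[OF finQ]
  proof eventually_elim
    case (elim z)
    obtain M :: nat where M: "cmod z < real M" using reals_Archimedean2 by blast
    have "\<forall>\<^sub>F n in sequentially. cut 0 (real (Suc n)) z = 1"
      unfolding eventually_sequentially
      by (rule exI[of _ M]) (use M cut_inside[of "real (Suc n)" z 0 for n] in auto)
    with hole_pointwise[OF elim] have "\<forall>\<^sub>F n in sequentially. \<Psi> n z = 1"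
      by eventually_elim (simp add: \<Psi>_def)
    then have "(\<lambda>n. \<Psi> n z) \<longlonglongrightarrow> 1" by (rule tendsto_eventually)
    then have "(\<lambda>n. \<Psi> (n + N) z) \<longlonglongrightarrow> 1" by (rule LIMSEQ_ignore_initial_segment)
    then have "(\<lambda>n. dens z * \<Psi> (n + N) z) \<longlonglongrightarrow> dens z * 1" by (intro tendsto_intros)
    then show ?case by (simp add: f_def)
  qed
  have f_int_lim: "(\<lambda>n. LINT z|lborel. f n z) \<longlonglongrightarrow> T"
    unfolding f_def by (rule LIMSEQ_ignore_initial_segment[OF lim])
  have "\<forall>\<^sub>F n in sequentially. integrable lborel (\<lambda>z. dens z * \<Psi> (n + N) z)"
    using lhs by (subst eventually_sequentially_seg) (auto elim: eventually_mono)
  then have f_integrable: "\<forall>\<^sub>F n in sequentially. integrable lborel (f n)" by (simp add: f_def[abs_def])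
  \<comment> \<open>Finiteness of the total curvature is not given and comes from Fatou's lemma;
    only then is \<open>dens\<close> available as a dominating function.\<close>
  have fin: "(\<integral>\<^sup>+z. ennreal (dens z) \<partial>lborel) \<le> ennreal T"
  proof -
    have "(\<integral>\<^sup>+z. ennreal (dens z) \<partial>lborel) = (\<integral>\<^sup>+z. liminf (\<lambda>n. ennreal (f n z)) \<partial>lborel)"
    proof (rule nn_integral_cong_AE)
      show "AE z in lborel. ennreal (dens z) = liminf (\<lambda>n. ennreal (f n z))"
        using f_lim by eventually_elim (metis tendsto_ennrealI lim_imp_Liminf trivial_limit_sequentially)
    qed
    also have "\<dots> \<le> liminf (\<lambda>n. \<integral>\<^sup>+z. ennreal (f n z) \<partial>lborel)" by (rule nn_integral_liminf) measurable
    also have "\<dots> = ennreal T"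
    proof (rule lim_imp_Liminf)
      have "(\<lambda>n. ennreal (LINT z|lborel. f n z)) \<longlonglongrightarrow> ennreal T" by (rule tendsto_ennrealI[OF f_int_lim])
      moreover have "\<forall>\<^sub>F n in sequentially. ennreal (LINT z|lborel. f n z) = (\<integral>\<^sup>+z. ennreal (f n z) \<partial>lborel)"
        using f_integrable by eventually_elim (use f_bd in \<open>simp add: nn_integral_eq_integral\<close>)
      ultimately show "(\<lambda>n. \<integral>\<^sup>+z. ennreal (f n z) \<partial>lborel) \<longlonglongrightarrow> ennreal T" by (rule Lim_transform_eventually)
    qed simp
    finally show ?thesis .
  qed
  show int: "integrable lborel dens"
  proof (rule integrableI_bounded)
    have "(\<integral>\<^sup>+z. ennreal (norm (dens z)) \<partial>lborel) = (\<integral>\<^sup>+z. ennreal (dens z) \<partial>lborel)"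
      using dens_pos by (intro nn_integral_cong) (simp add: less_imp_le)
    also have "\<dots> < \<infinity>" using fin by (simp add: le_less_trans)
    finally show "(\<integral>\<^sup>+z. ennreal (norm (dens z)) \<partial>lborel) < \<infinity>" .
  qed measurable
  have "(\<lambda>n. LINT z|lborel. f n z) \<longlonglongrightarrow> (LINT z|lborel. dens z)"
    by (rule integral_dominated_convergence[where w = dens]) (use f_lim int f_bd in auto)
  then have "(LINT z|lborel. dens z) = T" using f_int_lim LIMSEQ_unique by blast
  then show "(LINT z|lborel. dens z) = 2 * pi * (2 + \<beta> + (\<Sum>q\<in>Q. \<omega> q))" by (simp add: T_def)
qed

end

section \<open>The weak equation for test functions that do not vanish on Q\<close>

context conf_plane
begin

text \<open>Here \<open>G\<close> is bounded, while the gradient of the cut-off is of order 1/r on a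
  disc of area of order r^2; so the flux is of order r even if the test function varies near
  \<open>q\<close>.\<close>

lemma flux_regular_point:
  assumes phi: "C1c \<phi> \<Phi>" and q: "q \<in> Q" "\<omega> q = 0"
  shows "(\<lambda>n. LINT z|lborel. \<phi> z * (cutG q (rad n) z \<bullet> G z)) \<longlonglongrightarrow> 0"
    and "\<forall>\<^sub>F n in sequentially. integrable lborel (\<lambda>z. \<phi> z * (cutG q (rad n) z \<bullet> G z))"
proof -
  obtain C where C: "C \<ge> 0" "\<And>z. \<bar>\<phi> z\<bar> \<le> C" "\<And>z. norm (\<Phi> z) \<le> C" by (rule C1c_bounded[OF phi]) (rule that)
  have [measurable]: "\<phi> \<in> borel_measurable borel" by (rule C1c_borel(1)[OF phi])
  have qS: "q \<in> - S" using q by (simp add: S_def)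
  obtain e where e: "e > 0" "cball q e \<subseteq> - S" using open_compl_S qS open_contains_cball by blast
  have "compact (G ` cball q e)"
    by (rule compact_continuous_image[OF continuous_on_subset[OF contG' e(2)]]) simp
  then obtain B where "\<forall>y\<in>G ` cball q e. norm y \<le> B" using compact_imp_bounded bounded_iff by metis
  then have B: "norm (G z) \<le> B" if "z \<in> cball q e" for z using that by blast
  have B0: "B \<ge> 0" using order_trans[OF norm_ge_zero B[of q]] e(1) by simp
  have evr: "\<forall>\<^sub>F n in sequentially. rad n < e / 2" using e(1) by (intro rad_eventually_less) simp
  have bound: "norm (\<phi> z * (cutG q (rad n) z \<bullet> G z)) \<le> C * (4 / rad n * B) * indicator (cball q (2 * rad n)) z" if n: "rad n < e / 2" for n z
  proof (cases "z \<in> cball q (2 * rad n)")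
    case True
    then have "z \<in> cball q e" using n by simp
    then have "norm (G z) \<le> B" by (rule B)
    moreover have "norm (cutG q (rad n) z) \<le> 4 / rad n"
      using cut_radial_bounds(1)[OF theta_deriv_bound rad_pos, of q n z] True by simp
    ultimately have "\<bar>cutG q (rad n) z \<bullet> G z\<bar> \<le> 4 / rad n * B"
      using rad_pos[of n] by (intro order_trans[OF Cauchy_Schwarz_ineq2] mult_mono) auto
    then have "\<bar>\<phi> z\<bar> * \<bar>cutG q (rad n) z \<bullet> G z\<bar> \<le> C * (4 / rad n * B)"
      using C(1) by (intro mult_mono C(2)) auto
    then show ?thesis using True by (simp add: abs_mult)
  next
    case False
    then have "cutG q (rad n) z = 0"
      using cut_outside[OF rad_pos, of n z q] by (simp add: dist_norm norm_minus_commute)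
    then show ?thesis using False by simp
  qed
  have meas: "(\<lambda>z. \<phi> z * (cutG q (rad n) z \<bullet> G z)) \<in> borel_measurable borel" if n: "rad n < e / 2" for n
  proof -
    have "integrable lborel (\<lambda>z. cutG q (rad n) z \<bullet> G z)"
    proof (rule C1c_inner_integrable[OF C1c_cut[OF rad_pos] open_compl_S contG'])
      show "open (- cball q (2 * rad n))" by (rule open_Compl) simp
      have "cball q (2 * rad n) \<subseteq> cball q e" using n by (intro subset_cball) simp
      then show "- S \<union> - cball q (2 * rad n) = UNIV" using e(2) by blast
      show "cutG q (rad n) z = 0" if "z \<in> - cball q (2 * rad n)" for z
        using that cut_outside[OF rad_pos, of n z q] by (simp add: dist_norm norm_minus_commute)
    qed
    then have [measurable]: "(\<lambda>z. cutG q (rad n) z \<bullet> G z) \<in> borel_measurable borel" by (simp add: borel_measurable_integrable)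
    show ?thesis by measurable
  qed
  have int: "integrable lborel (\<lambda>z. \<phi> z * (cutG q (rad n) z \<bullet> G z))" if n: "rad n < e / 2" for n
    by (rule Bochner_Integration.integrable_bound[OF integrable_cball_indicator[of "C * (4 / rad n * B)" q "2 * rad n"]])
      (use meas[OF n] bound[OF n] C(1) B0 rad_pos[of n] in \<open>auto intro!: AE_I2 order_trans[OF bound[OF n]]\<close>)
  show "\<forall>\<^sub>F n in sequentially. integrable lborel (\<lambda>z. \<phi> z * (cutG q (rad n) z \<bullet> G z))"
    using evr by eventually_elim (rule int)
  have le: "norm (LINT z|lborel. \<phi> z * (cutG q (rad n) z \<bullet> G z)) \<le> 16 * pi * C * B * rad n" if n: "rad n < e / 2" for n
  proof -
    have "norm (LINT z|lborel. \<phi> z * (cutG q (rad n) z \<bullet> G z)) \<le> (LINT z|lborel. norm (\<phi> z * (cutG q (rad n) z \<bullet> G z)))"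
      by (rule integral_norm_bound)
    also have "\<dots> \<le> (LINT z|lborel. C * (4 / rad n * B) * indicator (cball q (2 * rad n)) z)"
      by (rule integral_mono'[OF integrable_cball_indicator bound[OF n]]) (use C(1) B0 rad_pos[of n] in simp)
    also have "\<dots> = 16 * pi * C * B * rad n"
      unfolding integral_cball_indicator[OF rad_pos] using rad_pos[of n] by (simp add: power2_eq_square)
    finally show ?thesis .
  qed
  have "(\<lambda>n. 16 * pi * C * B * rad n) \<longlonglongrightarrow> 16 * pi * C * B * 0" by (intro tendsto_intros rad_lim)
  then have "(\<lambda>n. 16 * pi * C * B * rad n) \<longlonglongrightarrow> 0" by simp
  moreover have "\<forall>\<^sub>F n in sequentially. norm (LINT z|lborel. \<phi> z * (cutG q (rad n) z \<bullet> G z)) \<le> 16 * pi * C * B * rad n"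
    using evr by eventually_elim (rule le)
  ultimately show "(\<lambda>n. LINT z|lborel. \<phi> z * (cutG q (rad n) z \<bullet> G z)) \<longlonglongrightarrow> 0"
    by (rule Lim_null_comparison[rotated])
qed

lemma flux_weighted:
  assumes phi: "C1c \<phi> \<Phi>" and q: "q \<in> Q" and const: "q \<in> S \<Longrightarrow> \<exists>e>0. \<forall>z\<in>ball q e. \<phi> z = \<phi> q"
  shows "(\<lambda>n. LINT z|lborel. \<phi> z * (cutG q (rad n) z \<bullet> G z)) \<longlonglongrightarrow> - 2 * pi * (\<omega> q * \<phi> q)"
    and "\<forall>\<^sub>F n in sequentially. integrable lborel (\<lambda>z. \<phi> z * (cutG q (rad n) z \<bullet> G z))"
proof -
  have "(\<lambda>n. LINT z|lborel. \<phi> z * (cutG q (rad n) z \<bullet> G z)) \<longlonglongrightarrow> - 2 * pi * (\<omega> q * \<phi> q) \<and>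
    (\<forall>\<^sub>F n in sequentially. integrable lborel (\<lambda>z. \<phi> z * (cutG q (rad n) z \<bullet> G z)))"
  proof (cases "\<omega> q = 0")
    case True
    then show ?thesis using flux_regular_point[OF phi q True] by simp
  next
    case False
    then have "q \<in> S" using q by (simp add: S_def)
    then obtain e where e: "e > 0" "\<forall>z\<in>ball q e. \<phi> z = \<phi> q" using const by blast
    have "\<forall>\<^sub>F n in sequentially. rad n < e / 2" using e(1) by (intro rad_eventually_less) simp
    then have ev: "\<forall>\<^sub>F n in sequentially. (\<lambda>z. \<phi> q * (cutG q (rad n) z \<bullet> G z)) = (\<lambda>z. \<phi> z * (cutG q (rad n) z \<bullet> G z))"
    proof eventually_elim
      case (elim n)
      show ?case
      proof
        fix z
        show "\<phi> q * (cutG q (rad n) z \<bullet> G z) = \<phi> z * (cutG q (rad n) z \<bullet> G z)"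
        proof (cases "z \<in> ball q e")
          case True
          then show ?thesis using e(2) by simp
        next
          case False
          then have "2 * rad n \<le> cmod (z - q)" using elim by (simp add: dist_norm norm_minus_commute)
          then show ?thesis using cut_outside[OF rad_pos] by simp
        qed
      qed
    qed
    have "(\<lambda>n. \<phi> q * (LINT z|lborel. cutG q (rad n) z \<bullet> G z)) \<longlonglongrightarrow> \<phi> q * (- 2 * pi * \<omega> q)"
      by (intro tendsto_mult tendsto_const flux_at_pole(1)[OF q])
    moreover have "\<forall>\<^sub>F n in sequentially. \<phi> q * (LINT z|lborel. cutG q (rad n) z \<bullet> G z) = (LINT z|lborel. \<phi> z * (cutG q (rad n) z \<bullet> G z))"
      using ev by eventually_elim (metis integral_mult_right_zero)
    ultimately have 1: "(\<lambda>n. LINT z|lborel. \<phi> z * (cutG q (rad n) z \<bullet> G z)) \<longlonglongrightarrow> \<phi> q * (- 2 * pi * \<omega> q)"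
      by (rule Lim_transform_eventually)
    have 2: "\<forall>\<^sub>F n in sequentially. integrable lborel (\<lambda>z. \<phi> z * (cutG q (rad n) z \<bullet> G z))"
      using ev flux_at_pole(2)[OF q]
    proof eventually_elim
      case (elim n)
      have "integrable lborel (\<lambda>z. \<phi> q * (cutG q (rad n) z \<bullet> G z))" by (rule integrable_mult_right) (rule elim(2))
      then show ?case unfolding elim(1) .
    qed
    show ?thesis using 1 2 by (simp add: mult_ac)
  qed
  then show "(\<lambda>n. LINT z|lborel. \<phi> z * (cutG q (rad n) z \<bullet> G z)) \<longlonglongrightarrow> - 2 * pi * (\<omega> q * \<phi> q)"
    and "\<forall>\<^sub>F n in sequentially. integrable lborel (\<lambda>z. \<phi> z * (cutG q (rad n) z \<bullet> G z))" by blast+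
qed

lemma gradient_pairing_integrable:
  assumes phi: "C1c \<phi> \<Phi>" and const: "\<And>q. q \<in> S \<Longrightarrow> \<exists>e>0. \<forall>z\<in>ball q e. \<phi> z = \<phi> q"
  shows "integrable lborel (\<lambda>z. \<Phi> z \<bullet> G z)"
  by (rule C1c_inner_integrable_locally_const[OF phi open_compl_S contG']) (use const in blast)

text \<open>The weak equation is tested with (1 - hole) \<phi>. As the holes shrink, the gradient of
  the hole function leaves the pole fluxes weighted with \<phi>(q). Only at true singular points
  must \<phi> be locally constant.\<close>

theorem weak_full:
  assumes phi: "C1c \<phi> \<Phi>" and const: "\<And>q. q \<in> S \<Longrightarrow> \<exists>e>0. \<forall>z\<in>ball q e. \<phi> z = \<phi> q"
  shows "(LINT z|lborel. \<Phi> z \<bullet> G z) = (LINT z|lborel. dens z * \<phi> z) - 2 * pi * (\<Sum>q\<in>Q. \<omega> q * \<phi> q)"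
proof -
  obtain C where C: "C \<ge> 0" "\<And>z. \<bar>\<phi> z\<bar> \<le> C" "\<And>z. norm (\<Phi> z) \<le> C" by (rule C1c_bounded[OF phi]) (rule that)
  have [measurable]: "\<phi> \<in> borel_measurable borel" by (rule C1c_borel(1)[OF phi])
  have [measurable]: "hole n \<in> borel_measurable borel" for n by (rule C1c_borel(1)[OF C1c_hole])
  have pair: "integrable lborel (\<lambda>z. \<Phi> z \<bullet> G z)" by (rule gradient_pairing_integrable[OF phi const])
  have pair_meas [measurable]: "(\<lambda>z. \<Phi> z \<bullet> G z) \<in> borel_measurable lborel" using pair by (rule borel_measurable_integrable)
  have fluxes: "\<forall>\<^sub>F n in sequentially. \<forall>q\<in>Q. integrable lborel (\<lambda>z. \<phi> z * (cutG q (rad n) z \<bullet> G z))"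
    using finQ flux_weighted(2)[OF phi _ const] by (simp add: eventually_ball_finite)
  have main: "\<forall>\<^sub>F n in sequentially. (LINT z|lborel. (1 - hole n z) * (\<Phi> z \<bullet> G z)) - (\<Sum>q\<in>Q. LINT z|lborel. \<phi> z * (cutG q (rad n) z \<bullet> G z))
      = (LINT z|lborel. dens z * ((1 - hole n z) * \<phi> z))"
    using hole_eventually fluxes
  proof eventually_elim
    case (elim n)
    have "C1c (\<lambda>z. (1 - hole n z) * \<phi> z) (\<lambda>z. (1 - hole n z) *\<^sub>R \<Phi> z + \<phi> z *\<^sub>R (- holeG n z))"
    proof (rule C1c_mult[OF phi])
      show "GDERIV (\<lambda>z. 1 - hole n z) z :> - holeG n z" for z
        using GDERIV_diff[OF GDERIV_const[of 1 z], of "hole n" "holeG n z"] C1c_hole[of n] by (simp add: C1c_def)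
      show "continuous_on UNIV (\<lambda>z. - holeG n z)"
        by (rule continuous_on_minus) (use C1c_hole[of n] in \<open>simp add: C1c_def\<close>)
    qed
    then have "(LINT z|lborel. ((1 - hole n z) *\<^sub>R \<Phi> z + \<phi> z *\<^sub>R (- holeG n z)) \<bullet> G z) = (LINT z|lborel. k z * exp (2 * V z) * ((1 - hole n z) * \<phi> z))"
    proof (rule weak[THEN conjunct2])
      show "\<exists>e>0. \<forall>z\<in>ball q e. (1 - hole n z) * \<phi> z = 0" if "q \<in> Q" for q
        by (rule exI[of _ "rad n"]) (use elim(1) that rad_pos in simp)
    qed
    moreover have "((1 - hole n z) *\<^sub>R \<Phi> z + \<phi> z *\<^sub>R (- holeG n z)) \<bullet> G z = (1 - hole n z) * (\<Phi> z \<bullet> G z) - (\<Sum>q\<in>Q. \<phi> z * (cutG q (rad n) z \<bullet> G z))" for z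
      by (simp add: inner_diff_left holeG_def inner_sum_left sum_distrib_left)
    moreover have "integrable lborel (\<lambda>z. (1 - hole n z) * (\<Phi> z \<bullet> G z))"
    proof (rule Bochner_Integration.integrable_bound[OF pair])
      show "AE z in lborel. norm ((1 - hole n z) * (\<Phi> z \<bullet> G z)) \<le> norm (\<Phi> z \<bullet> G z)"
        using elim(1) by (auto simp: abs_mult mult_le_cancel_right2)
    qed measurable
    ultimately show ?case using elim(2) by (simp add: dens_def)
  qed
  have AEhole: "AE z in lborel. (\<lambda>n. hole n z) \<longlonglongrightarrow> 0"
    using AE_not_in_finite[OF finQ] by eventually_elim (rule tendsto_eventually, rule hole_pointwise)
  obtain N where N: "\<And>n z. N \<le> n \<Longrightarrow> 0 \<le> hole n z \<and> hole n z \<le> 1"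
    using hole_eventually unfolding eventually_sequentially by blast
  have l1: "(\<lambda>n. LINT z|lborel. (1 - hole (n + N) z) * (\<Phi> z \<bullet> G z)) \<longlonglongrightarrow> (LINT z|lborel. \<Phi> z \<bullet> G z)"
  proof (rule integral_dominated_convergence[where w = "\<lambda>z. \<bar>\<Phi> z \<bullet> G z\<bar>"])
    show "AE z in lborel. (\<lambda>n. (1 - hole (n + N) z) * (\<Phi> z \<bullet> G z)) \<longlonglongrightarrow> \<Phi> z \<bullet> G z"
      using AEhole
    proof eventually_elim
      case (elim z)
      from LIMSEQ_ignore_initial_segment[OF this, of N]
      have "(\<lambda>n. (1 - hole (n + N) z) * (\<Phi> z \<bullet> G z)) \<longlonglongrightarrow> (1 - 0) * (\<Phi> z \<bullet> G z)" by (intro tendsto_intros)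
      then show ?case by simp
    qed
    show "AE z in lborel. norm ((1 - hole (n + N) z) * (\<Phi> z \<bullet> G z)) \<le> \<bar>\<Phi> z \<bullet> G z\<bar>" for n
      using N[of "n + N"] by (auto simp: abs_mult mult_le_cancel_right2)
  qed (use pair in auto)
  have l2: "(\<lambda>n. \<Sum>q\<in>Q. LINT z|lborel. \<phi> z * (cutG q (rad (n + N)) z \<bullet> G z)) \<longlonglongrightarrow> (\<Sum>q\<in>Q. - 2 * pi * (\<omega> q * \<phi> q))"
    by (rule LIMSEQ_ignore_initial_segment) (intro tendsto_sum flux_weighted(1)[OF phi _ const])
  have l3: "(\<lambda>n. LINT z|lborel. dens z * ((1 - hole (n + N) z) * \<phi> z)) \<longlonglongrightarrow> (LINT z|lborel. dens z * \<phi> z)"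
  proof (rule integral_dominated_convergence[where w = "\<lambda>z. dens z * C"])
    show "AE z in lborel. (\<lambda>n. dens z * ((1 - hole (n + N) z) * \<phi> z)) \<longlonglongrightarrow> dens z * \<phi> z"
      using AEhole
    proof eventually_elim
      case (elim z)
      from LIMSEQ_ignore_initial_segment[OF this, of N]
      have "(\<lambda>n. dens z * ((1 - hole (n + N) z) * \<phi> z)) \<longlonglongrightarrow> dens z * ((1 - 0) * \<phi> z)" by (intro tendsto_intros)
      then show ?case by simp
    qed
    show "AE z in lborel. norm (dens z * ((1 - hole (n + N) z) * \<phi> z)) \<le> dens z * C" for n
    proof (rule AE_I2)
      fix z
      have "\<bar>1 - hole (n + N) z\<bar> \<le> 1" using N[of "n + N" z] by simp
      then have "\<bar>(1 - hole (n + N) z) * \<phi> z\<bar> \<le> 1 * C" unfolding abs_mult by (intro mult_mono C(2)) auto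
      then show "norm (dens z * ((1 - hole (n + N) z) * \<phi> z)) \<le> dens z * C"
        using dens_pos[of z] unfolding real_norm_def abs_mult[of "dens z"] by simp
    qed
  qed (use total_mass(1) in auto)
  have "\<forall>\<^sub>F n in sequentially. (LINT z|lborel. (1 - hole (n + N) z) * (\<Phi> z \<bullet> G z)) - (\<Sum>q\<in>Q. LINT z|lborel. \<phi> z * (cutG q (rad (n + N)) z \<bullet> G z))
      = (LINT z|lborel. dens z * ((1 - hole (n + N) z) * \<phi> z))"
    using main by (subst eventually_sequentially_seg)
  with tendsto_diff[OF l1 l2]
  have "(\<lambda>n. LINT z|lborel. dens z * ((1 - hole (n + N) z) * \<phi> z)) \<longlonglongrightarrow> (LINT z|lborel. \<Phi> z \<bullet> G z) - (\<Sum>q\<in>Q. - 2 * pi * (\<omega> q * \<phi> q))"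
    by (rule Lim_transform_eventually)
  then have "(LINT z|lborel. dens z * \<phi> z) = (LINT z|lborel. \<Phi> z \<bullet> G z) - (\<Sum>q\<in>Q. - 2 * pi * (\<omega> q * \<phi> q))"
    using l3 LIMSEQ_unique by blast
  then show ?thesis by (simp add: sum_distrib_left sum_negf)
qed

end

text \<open>Plateau of height 1 with ramps of width \<delta>. A plain indicator of the band would
  not be continuous, as the gradient of a test function must be; \<open>trapI\<close> is the
  antiderivative.\<close>

definition trap :: "real \<Rightarrow> real \<Rightarrow> real \<Rightarrow> real \<Rightarrow> real" where
  "trap s t \<delta> x = (tpow 1 s x - tpow 1 (s + \<delta>) x - tpow 1 (t - \<delta>) x + tpow 1 t x) / \<delta>"

definition trapI :: "real \<Rightarrow> real \<Rightarrow> real \<Rightarrow> real \<Rightarrow> real" where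
  "trapI s t \<delta> x = (tpow 2 s x - tpow 2 (s + \<delta>) x - tpow 2 (t - \<delta>) x + tpow 2 t x) / (2 * \<delta>)"

lemma trapI_deriv: "\<delta> > 0 \<Longrightarrow> DERIV (trapI s t \<delta>) x :> trap s t \<delta> x"
  unfolding trapI_def[abs_def] trap_def
  by (auto intro!: derivative_eq_intros DERIV_tpow2 simp: field_simps)

lemma trap_continuous: "continuous_on A (trap s t \<delta>)"
  unfolding trap_def[abs_def] divide_inverse by (intro continuous_intros tpow_continuous)

lemma trap_props:
  assumes \<delta>: "\<delta> > 0" "2 * \<delta> \<le> t - s"
  shows "0 \<le> trap s t \<delta> x" "trap s t \<delta> x \<le> 1" "x \<le> s \<Longrightarrow> trap s t \<delta> x = 0" "t \<le> x \<Longrightarrow> trap s t \<delta> x = 0"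
    "s + \<delta> \<le> x \<Longrightarrow> x \<le> t - \<delta> \<Longrightarrow> trap s t \<delta> x = 1"
proof -
  consider "x \<le> s" | "s \<le> x" "x \<le> s + \<delta>" | "s + \<delta> \<le> x" "x \<le> t - \<delta>" | "t - \<delta> \<le> x" "x \<le> t" | "t \<le> x" by linarith
  then show "0 \<le> trap s t \<delta> x"
    using \<delta> by cases (auto simp: trap_def tpow_def max_absorb1 max_absorb2)
  consider "x \<le> s" | "s \<le> x" "x \<le> s + \<delta>" | "s + \<delta> \<le> x" "x \<le> t - \<delta>" | "t - \<delta> \<le> x" "x \<le> t" | "t \<le> x" by linarith
  then show "trap s t \<delta> x \<le> 1"
    using \<delta> by cases (auto simp: trap_def tpow_def max_absorb1 max_absorb2)
  show "x \<le> s \<Longrightarrow> trap s t \<delta> x = 0" "t \<le> x \<Longrightarrow> trap s t \<delta> x = 0"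
    "s + \<delta> \<le> x \<Longrightarrow> x \<le> t - \<delta> \<Longrightarrow> trap s t \<delta> x = 1"
    using \<delta> by (auto simp: trap_def tpow_def max_absorb1 max_absorb2)
qed

lemma trapI_low:
  assumes "\<delta> > 0" "2 * \<delta> \<le> t - s" "x \<le> s"
  shows "trapI s t \<delta> x = 0"
  using assms by (simp add: trapI_def tpow_def max_absorb1)

lemma trapI_high:
  assumes "\<delta> > 0" "2 * \<delta> \<le> t - s" "t \<le> x"
  shows "trapI s t \<delta> x = t - s - \<delta>"
  using assms by (simp add: trapI_def tpow_def max_absorb2 power2_eq_square field_simps)

lemma trapI_bounds:
  assumes "\<delta> > 0" "2 * \<delta> \<le> t - s"
  shows "0 \<le> trapI s t \<delta> x" "trapI s t \<delta> x \<le> t - s - \<delta>"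
proof -
  have mono: "trapI s t \<delta> x \<le> trapI s t \<delta> y" if "x \<le> y" for x y
    by (rule DERIV_nonneg_imp_nondecreasing[OF that]) (use trapI_deriv[OF assms(1)] trap_props(1)[OF assms] in blast)
  show "0 \<le> trapI s t \<delta> x"
    using mono[of "min x s" x] trapI_low[OF assms, of "min x s"] by simp
  show "trapI s t \<delta> x \<le> t - s - \<delta>"
    using mono[of x "max x t"] trapI_high[OF assms, of "max x t"] by simp
qed

section \<open>The level sets of the conformal factor\<close>

text \<open>The orders in the plane are nonpositive with sum above -1; this sum becomes the \<alpha>
  of the comparison football.\<close>

locale conf_football = conf_plane +
  assumes \<omega>_nonpos: "\<And>q. q \<in> Q \<Longrightarrow> \<omega> q \<le> 0"
    and \<beta>_gt: "-1 < \<beta>" and sum_\<omega>: "-1 < (\<Sum>q\<in>Q. \<omega> q)"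
begin

definition \<alpha> :: real where "\<alpha> = (\<Sum>q\<in>Q. \<omega> q)"

lemma alpha: "-1 < \<alpha>" "\<alpha> \<le> 0"
  using sum_\<omega> \<omega>_nonpos by (auto simp: \<alpha>_def intro: sum_nonpos)

text \<open>The place where the sign of the orders enters: a negative order sends V to plus
  infinity, so every superlevel set is a neighbourhood of the singular points.\<close>

lemma V_large_near_S:
  assumes "q \<in> S"
  obtains e where "e > 0" "\<And>z. z \<noteq> q \<Longrightarrow> cmod (z - q) < e \<Longrightarrow> z \<notin> S \<and> V z > t"
proof -
  have q: "q \<in> Q" "\<omega> q < 0" using assms \<omega>_nonpos[of q] by (auto simp: S_def)
  obtain L where L: "((\<lambda>z. V z - \<omega> q * ln (cmod (z - q))) \<longlongrightarrow> L) (at q)" using lim_Q'[OF q(1)] by blast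
  obtain d where d: "d > 0" "\<And>z. z \<noteq> q \<Longrightarrow> cmod (z - q) < d \<Longrightarrow> \<bar>V z - \<omega> q * ln (cmod (z - q)) - L\<bar> < 1"
    using LIM_D[OF L zero_less_one] unfolding real_norm_def by blast
  obtain e0 where e0: "e0 > 0" "\<And>z. z \<in> S \<Longrightarrow> z \<noteq> q \<Longrightarrow> e0 \<le> cmod (z - q)" by (rule isolated[OF finS]) (rule that)
  define e where "e = min (min d e0) (exp ((t - L + 1) / \<omega> q))"
  show thesis
  proof (rule that)
    show "e > 0" using d e0 by (simp add: e_def)
    fix z assume z: "z \<noteq> q" "cmod (z - q) < e"
    have "ln (cmod (z - q)) < (t - L + 1) / \<omega> q"
    proof -
      have "cmod (z - q) < exp ((t - L + 1) / \<omega> q)" using z(2) by (simp add: e_def)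
      then have "ln (cmod (z - q)) < ln (exp ((t - L + 1) / \<omega> q))" using z(1) by (subst ln_less_cancel_iff) auto
      then show ?thesis by simp
    qed
    then have "\<omega> q * ln (cmod (z - q)) > t - L + 1" using q(2) by (simp add: field_simps)
    moreover have "\<bar>V z - \<omega> q * ln (cmod (z - q)) - L\<bar> < 1" using d(2)[OF z(1)] z(2) by (simp add: e_def)
    ultimately have "V z > t" by linarith
    moreover have "z \<notin> S" using e0(2)[of z] z by (auto simp: e_def)
    ultimately show "z \<notin> S \<and> V z > t" by blast
  qed
qed

lemma V_small_far:
  obtains R where "R > 0" "\<And>z. R < cmod z \<Longrightarrow> z \<notin> S \<and> V z < s"
proof -
  obtain L where L: "((\<lambda>z. V z + (2 + \<beta>) * ln (cmod z)) \<longlongrightarrow> L) at_infinity" using lim_inf by blast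
  from tendstoD[OF L zero_less_one] obtain R where R: "\<And>z. R \<le> cmod z \<Longrightarrow> dist (V z + (2 + \<beta>) * ln (cmod z)) L < 1"
    unfolding eventually_at_infinity by blast
  have "bounded S" by (rule finite_imp_bounded[OF finS])
  then obtain M where M: "\<And>z. z \<in> S \<Longrightarrow> cmod z \<le> M" unfolding bounded_iff by blast
  define E where "E = exp ((L + 1 - s) / (2 + \<beta>))"
  show thesis
  proof (rule that)
    show "max (max R M) E > 0" by (simp add: E_def less_max_iff_disj)
    fix z assume z: "max (max R M) E < cmod z"
    have "ln E < ln (cmod z)" using z by (subst ln_less_cancel_iff) (auto simp: E_def intro: less_trans[OF exp_gt_zero])
    then have "(L + 1 - s) / (2 + \<beta>) < ln (cmod z)" by (simp add: E_def)
    then have "L + 1 - s < (2 + \<beta>) * ln (cmod z)" using \<beta>_gt by (simp add: field_simps)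
    moreover have "\<bar>V z + (2 + \<beta>) * ln (cmod z) - L\<bar> < 1" using R[of z] z by (simp add: dist_real_def)
    ultimately have "V z < s" by linarith
    moreover have "z \<notin> S" using M[of z] z by auto
    ultimately show "z \<notin> S \<and> V z < s" by blast
  qed
qed

text \<open>A function of \<open>V\<close>, completed at the singular points by its value
  \<open>I\<close> for large arguments.\<close>

definition comp :: "(real \<Rightarrow> real) \<Rightarrow> real \<Rightarrow> complex \<Rightarrow> real" where
  "comp \<psi> I z = (if z \<in> S then I else \<psi> (V z))"

definition compG :: "(real \<Rightarrow> real) \<Rightarrow> complex \<Rightarrow> complex" where
  "compG \<eta> z = (if z \<in> S then 0 else \<eta> (V z) *\<^sub>R G z)"

lemma V_continuous: "continuous_on (- S) V"
proof (rule continuous_at_imp_continuous_on, rule ballI)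
  fix z assume "z \<in> - S"
  then show "isCont V z" using grad'[of z] unfolding gderiv_def by (intro has_derivative_continuous) auto
qed

lemma comp_C1c:
  assumes \<psi>: "\<And>x. DERIV \<psi> x :> \<eta> x" and \<eta>: "continuous_on UNIV \<eta>"
    and low: "\<And>x. x \<le> s \<Longrightarrow> \<psi> x = 0" and high: "\<And>x. t \<le> x \<Longrightarrow> \<psi> x = I \<and> \<eta> x = 0"
  shows "C1c (comp \<psi> I) (compG \<eta>)" "\<And>q. q \<in> S \<Longrightarrow> \<exists>e>0. \<forall>z\<in>ball q e. comp \<psi> I z = I"
proof -
  show locI: "\<exists>e>0. \<forall>z\<in>ball q e. comp \<psi> I z = I" if qS: "q \<in> S" for q
  proof -
    obtain e where e: "e > 0" "\<And>z. z \<noteq> q \<Longrightarrow> cmod (z - q) < e \<Longrightarrow> z \<notin> S \<and> V z > t" using V_large_near_S[OF qS, of t] by blast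
    have "comp \<psi> I z = I" if "z \<in> ball q e" for z
      using e(2)[of z] that high[of "V z"] \<open>q \<in> S\<close> by (cases "z = q") (auto simp: comp_def dist_norm norm_minus_commute)
    then show ?thesis using e(1) by blast
  qed
  have locG: "\<exists>e>0. \<forall>z\<in>ball q e. compG \<eta> z = 0" if qS: "q \<in> S" for q
  proof -
    obtain e where e: "e > 0" "\<And>z. z \<noteq> q \<Longrightarrow> cmod (z - q) < e \<Longrightarrow> z \<notin> S \<and> V z > t" using V_large_near_S[OF qS, of t] by blast
    have "compG \<eta> z = 0" if "z \<in> ball q e" for z
      using e(2)[of z] that high[of "V z"] \<open>q \<in> S\<close> by (cases "z = q") (auto simp: compG_def dist_norm norm_minus_commute)
    then show ?thesis using e(1) by blast
  qed
  have cS: "continuous_on (- S) (compG \<eta>)"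
  proof (rule continuous_on_eq)
    show "continuous_on (- S) (\<lambda>z. \<eta> (V z) *\<^sub>R G z)"
      by (rule continuous_on_scaleR[OF continuous_on_compose2[OF \<eta> V_continuous] contG']) auto
  qed (simp add: compG_def)
  show "C1c (comp \<psi> I) (compG \<eta>)"
    unfolding C1c_def
  proof (intro conjI allI)
    fix z
    show "GDERIV (comp \<psi> I) z :> compG \<eta> z"
    proof (cases "z \<in> S")
      case True
      obtain e where e: "e > 0" "\<forall>z\<in>ball z e. comp \<psi> I z = I" using locI[OF True] by blast
      have "GDERIV (comp \<psi> I) z :> 0"
        by (rule GDERIV_cong_open[OF GDERIV_const, of "ball z e" z I]) (use e in auto)
      then show ?thesis using True by (simp add: compG_def)
    next
      case False
      have "GDERIV (\<lambda>z. \<psi> (V z)) z :> \<eta> (V z) *\<^sub>R G z"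
        by (rule GDERIV_DERIV_compose[OF grad'[OF False] \<psi>])
      then have "GDERIV (comp \<psi> I) z :> \<eta> (V z) *\<^sub>R G z"
        by (rule GDERIV_cong_open[of _ _ _ "- S"]) (use False open_compl_S in \<open>auto simp: comp_def\<close>)
      then show ?thesis using False by (simp add: compG_def)
    qed
  next
    have "isCont (compG \<eta>) z" for z
    proof (cases "z \<in> S")
      case True
      obtain e where e: "e > 0" "\<forall>z\<in>ball z e. compG \<eta> z = 0" using locG[OF True] by blast
      have "continuous_on (ball z e) (compG \<eta>)"
        by (rule continuous_on_eq[of _ "\<lambda>_. 0"]) (use e in auto)
      then show ?thesis using e(1) by (simp add: continuous_on_eq_continuous_at)
    next
      case False
      then show ?thesis using cS open_compl_S by (simp add: continuous_on_eq_continuous_at)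
    qed
    then show "continuous_on UNIV (compG \<eta>)" by (simp add: continuous_at_imp_continuous_on)
  next
    obtain R where R: "R > 0" "\<And>z. R < cmod z \<Longrightarrow> z \<notin> S \<and> V z < s" using V_small_far[of s] by blast
    show "\<exists>R. \<forall>z. norm z > R \<longrightarrow> comp \<psi> I z = 0"
    proof (intro exI[of _ R] allI impI)
      fix z assume "R < cmod z"
      then have "z \<notin> S" "V z \<le> s" using R(2)[of z] by auto
      then show "comp \<psi> I z = 0" using low[of "V z"] by (simp add: comp_def)
    qed
  qed
qed

text \<open>After division by pi the square root of \<open>A\<close> is the radius of the disc with
  the same area as the superlevel set.\<close>

definition area :: "real \<Rightarrow> real" where "area t = (LINT z|lborel. indicator {z. V z > t} z)"
definition A :: "real \<Rightarrow> real" where "A t = area t / pi"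
definition mass :: "real \<Rightarrow> real" where "mass t = (LINT z|lborel. dens z * indicator {z. V z > t} z)"
definition f :: "real \<Rightarrow> real" where "f t = - \<alpha> + mass t / (2 * pi)"

text \<open>Finite total area: the curvature is at least \<open>a\<close> and its integral is
  finite.\<close>

lemma exp_integrable: "integrable lborel (\<lambda>z. exp (2 * V z))"
proof (rule Bochner_Integration.integrable_bound)
  show "integrable lborel (\<lambda>z. dens z / a)" using total_mass(1) by simp
  show "AE z in lborel. norm (exp (2 * V z)) \<le> norm (dens z / a)"
    using k_bounds(1,2) k_pos by (auto simp: dens_def field_simps abs_mult less_imp_le intro!: AE_I2)
qed measurable

lemma level_integrable: "integrable lborel (\<lambda>z. indicator {z. V z > t} z :: real)"
proof (rule Bochner_Integration.integrable_bound)
  show "integrable lborel (\<lambda>z. exp (- 2 * t) * exp (2 * V z))" using exp_integrable by simp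
  show "AE z in lborel. norm (indicator {z. V z > t} z :: real) \<le> norm (exp (- 2 * t) * exp (2 * V z))"
    by (auto simp: indicator_def simp flip: exp_add intro!: AE_I2)
qed measurable

lemma band_indicator:
  assumes "s \<le> t"
  shows "indicator {z. V z > s} z - indicator {z. V z > t} z = (indicator {z. s < V z \<and> V z \<le> t} z :: real)"
  using assms by (auto simp: indicator_def)

lemma band_integrable: "integrable lborel (\<lambda>z. indicator {z. s < V z \<and> V z \<le> t} z :: real)"
proof (rule Bochner_Integration.integrable_bound[OF level_integrable[of s]])
  show "AE z in lborel. norm (indicator {z. s < V z \<and> V z \<le> t} z :: real) \<le> norm (indicator {z. V z > s} z :: real)"
    by (auto simp: indicator_def)
qed measurable

lemma area_diff: "s \<le> t \<Longrightarrow> area s - area t = (LINT z|lborel. indicator {z. s < V z \<and> V z \<le> t} z)"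
  unfolding area_def
  by (subst Bochner_Integration.integral_diff[symmetric]) (auto simp: level_integrable band_indicator)

lemma A_diff:
  assumes "s \<le> t"
  shows "pi * (A s - A t) = (LINT z|lborel. indicator {z. s < V z \<and> V z \<le> t} z)"
proof -
  have "pi * (A s - A t) = area s - area t" by (simp add: A_def right_diff_distrib)
  also have "\<dots> = (LINT z|lborel. indicator {z. s < V z \<and> V z \<le> t} z)" by (rule area_diff[OF assms])
  finally show ?thesis .
qed

lemma dens_level_integrable: "integrable lborel (\<lambda>z. dens z * indicator {z. V z > t} z)"
proof (rule Bochner_Integration.integrable_bound[OF total_mass(1)])
  show "AE z in lborel. norm (dens z * indicator {z. V z > t} z) \<le> norm (dens z)"
    by (auto simp: indicator_def)
qed measurable

lemma mass_diff: "s \<le> t \<Longrightarrow> mass s - mass t = (LINT z|lborel. dens z * indicator {z. s < V z \<and> V z \<le> t} z)"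
  unfolding mass_def
  by (subst Bochner_Integration.integral_diff[symmetric])
     (auto simp: dens_level_integrable band_indicator[symmetric] right_diff_distrib)

lemma f_diff: "2 * pi * (f s - f t) = mass s - mass t"
  by (simp add: f_def field_simps)

lemma A_nonneg: "0 \<le> A t"
  unfolding A_def area_def by (intro divide_nonneg_nonneg integral_nonneg_AE) auto

lemma A_antimono: "s \<le> t \<Longrightarrow> A t \<le> A s"
proof -
  assume "s \<le> t"
  then have "0 \<le> pi * (A s - A t)" unfolding A_diff[OF \<open>s \<le> t\<close>] by (intro integral_nonneg_AE) auto
  then show ?thesis using pi_gt_zero by (auto simp: zero_le_mult_iff)
qed

lemma mass_nonneg: "0 \<le> mass t"
  unfolding mass_def using dens_pos by (intro integral_nonneg_AE) (auto simp: indicator_def less_imp_le)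

lemma mass_le: "mass t \<le> 2 * pi * (2 + \<beta> + \<alpha>)"
  unfolding mass_def \<alpha>_def total_mass(2)[symmetric]
  using dens_pos by (intro integral_mono dens_level_integrable total_mass(1)) (auto simp: indicator_def less_imp_le)

lemma f_lower: "- \<alpha> \<le> f t" using mass_nonneg[of t] by (simp add: f_def)

lemma f_upper: "f t \<le> 2 + \<beta>" using mass_le[of t] by (simp add: f_def field_simps)

lemma mass_lower:
  assumes st: "s < t"
  shows "a * exp (2 * s) * (A s - A t) \<le> 2 * (f s - f t)"
proof -
  have "a * exp (2 * s) * (pi * (A s - A t)) = (LINT z|lborel. a * exp (2 * s) * indicator {z. s < V z \<and> V z \<le> t} z)"
    using st by (simp add: A_diff)
  also have "\<dots> \<le> (LINT z|lborel. dens z * indicator {z. s < V z \<and> V z \<le> t} z)"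
  proof (rule integral_mono)
    show "integrable lborel (\<lambda>z. dens z * indicator {z. s < V z \<and> V z \<le> t} z)"
      by (rule Bochner_Integration.integrable_bound[OF total_mass(1)]) (auto simp: indicator_def)
    show "a * exp (2 * s) * indicator {z. s < V z \<and> V z \<le> t} z \<le> dens z * indicator {z. s < V z \<and> V z \<le> t} z" for z
    proof (cases "s < V z \<and> V z \<le> t")
      case True
      have "a * exp (2 * s) \<le> k z * exp (2 * V z)" by (rule mult_mono) (use True k_bounds(1) k_bounds(2)[of z] in auto)
      then show ?thesis using True by (simp add: dens_def)
    qed (auto simp: indicator_def)
  qed (intro integrable_mult_right band_integrable)
  also have "\<dots> = 2 * pi * (f s - f t)" using st by (simp add: f_diff mass_diff)
  finally have "pi * (a * exp (2 * s) * (A s - A t)) \<le> pi * (2 * (f s - f t))" by (simp add: mult_ac)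
  then show ?thesis by (simp add: mult_le_cancel_left)
qed

lemma mass_upper:
  assumes st: "s < t"
  shows "2 * (f s - f t) \<le> b * exp (2 * t) * (A s - A t)"
proof -
  have "2 * pi * (f s - f t) = (LINT z|lborel. dens z * indicator {z. s < V z \<and> V z \<le> t} z)"
    using st by (simp add: f_diff mass_diff)
  also have "\<dots> \<le> (LINT z|lborel. b * exp (2 * t) * indicator {z. s < V z \<and> V z \<le> t} z)"
  proof (rule integral_mono)
    show "integrable lborel (\<lambda>z. dens z * indicator {z. s < V z \<and> V z \<le> t} z)"
      by (rule Bochner_Integration.integrable_bound[OF total_mass(1)]) (auto simp: indicator_def)
    show "dens z * indicator {z. s < V z \<and> V z \<le> t} z \<le> b * exp (2 * t) * indicator {z. s < V z \<and> V z \<le> t} z" for z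
    proof (cases "s < V z \<and> V z \<le> t")
      case True
      have "k z * exp (2 * V z) \<le> b * exp (2 * t)" by (rule mult_mono) (use True k_pos[of z] k_bounds(3)[of z] in auto)
      then show ?thesis using True by (simp add: dens_def)
    qed (auto simp: indicator_def)
  qed (intro integrable_mult_right band_integrable)
  also have "\<dots> = b * exp (2 * t) * (pi * (A s - A t))" using st by (simp add: A_diff)
  finally have "pi * (2 * (f s - f t)) \<le> pi * (b * exp (2 * t) * (A s - A t))" by (simp add: mult_ac)
  then show ?thesis by (simp add: mult_le_cancel_left)
qed

lemma AE_not_S: "AE z in lborel. z \<notin> S" by (rule AE_not_in_finite[OF finS])

text \<open>At the singular points \<open>G\<close> is arbitrary; a Borel representative is needed
  under the integral.\<close>

lemma G_borel: obtains G' where "G' \<in> borel_measurable borel" "\<And>z. z \<notin> S \<Longrightarrow> G' z = G z"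
proof -
  have "(\<lambda>z. indicator (- S) z *\<^sub>R G z) \<in> borel_measurable borel"
    using contG' open_compl_S by (intro borel_measurable_continuous_on_indicator) auto
  then show thesis by (rule that) auto
qed

text \<open>
  The isoperimetric inequality for the superlevel sets enters through the Sobolev inequality for a function of \<open>V\<close>
  whose derivative is the trapezoid \<open>trap s t \<delta>\<close>. The square of \<open>|G| - \<lambda>\<close> is kept because its integral also controls
  the equality case.
\<close>

lemma band_energy:
  assumes \<delta>: "\<delta> > 0" "2 * \<delta> \<le> t - s" and l: "l \<ge> 0"
  defines "I \<equiv> t - s - \<delta>"
  shows "integrable lborel (\<lambda>z. trap s t \<delta> (V z) * (norm (G z) - l)\<^sup>2)"
    and "(LINT z|lborel. trap s t \<delta> (V z) * (norm (G z) - l)\<^sup>2) \<le> 2 * pi * f s * I - 4 * pi * l * I * sqrt (A t) + pi * l\<^sup>2 * (A s - A t)"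
proof -
  define \<eta> where "\<eta> = trap s t \<delta>"
  define \<phi> where "\<phi> = comp (trapI s t \<delta>) I"
  define \<Phi> where "\<Phi> = compG \<eta>"
  have I0: "I > 0" using \<delta> by (simp add: I_def)
  have C: "C1c \<phi> \<Phi>" and loc: "\<And>q. q \<in> S \<Longrightarrow> \<exists>e>0. \<forall>z\<in>ball q e. \<phi> z = I"
    unfolding \<phi>_def \<Phi>_def \<eta>_def I_def
    by (rule comp_C1c[where s = s and t = t and \<eta> = "trap s t \<delta>" and \<psi> = "trapI s t \<delta>"];
        use \<delta> in \<open>simp add: trapI_deriv trap_continuous trapI_low trapI_high trap_props(4)\<close>)+
  have \<phi>S: "\<phi> q = I" if "q \<in> S" for q using that by (simp add: \<phi>_def comp_def)
  have loc': "\<exists>e>0. \<forall>z\<in>ball q e. \<phi> z = \<phi> q" if "q \<in> S" for q using loc[OF that] \<phi>S[OF that] by simp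
  have \<eta>: "0 \<le> \<eta> x" "\<eta> x \<le> 1" for x using trap_props(1,2)[OF \<delta>] by (auto simp: \<eta>_def)
  have \<eta>_band: "\<eta> (V z) \<le> indicator {z. s < V z \<and> V z \<le> t} z" for z
    using \<eta>[of "V z"] trap_props(3,4)[OF \<delta>, of "V z"] by (auto simp: \<eta>_def indicator_def not_less)
  have \<phi>_bounds: "0 \<le> \<phi> z" "\<phi> z \<le> I" for z
    using trapI_bounds[OF \<delta>, of "V z"] I0 by (auto simp: \<phi>_def comp_def I_def)
  have \<phi>_low: "\<phi> z \<le> I * indicator {z. V z > s} z" if "z \<notin> S" for z
    using that \<phi>_bounds(2)[of z] trapI_low[OF \<delta>, of "V z"] by (auto simp: \<phi>_def comp_def indicator_def not_less)
  have \<phi>_high: "I * indicator {z. V z > t} z \<le> \<phi> z" if "z \<notin> S" for z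
    using that \<phi>_bounds(1)[of z] trapI_high[OF \<delta>, of "V z"] by (auto simp: \<phi>_def comp_def I_def indicator_def)
  have [measurable]: "\<eta> \<in> borel_measurable borel"
    unfolding \<eta>_def by (rule borel_measurable_continuous_onI[OF trap_continuous])
  have [measurable]: "\<phi> \<in> borel_measurable borel" "\<Phi> \<in> borel_measurable borel" by (rule C1c_borel[OF C])+
  obtain G' where [measurable]: "G' \<in> borel_measurable borel" and G': "\<And>z. z \<notin> S \<Longrightarrow> G' z = G z" by (rule G_borel) (rule that)
  have G_meas [measurable]: "G \<in> borel_measurable (borel :: complex measure) \<or> True" by simp
  have normG: "norm (\<Phi> z) = \<eta> (V z) * norm (G z)" if "z \<notin> S" for z
    using that \<eta>(1)[of "V z"] by (simp add: \<Phi>_def compG_def)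
  \<comment> \<open>The weighted Dirichlet energy. Testing the weak equation with \<phi> turns it
    into a flux: \<phi> \<le> I inside {V > s} and \<phi> = I at the poles give at most 2 pi f(s)
    I.\<close>
  define P where "P = (LINT z|lborel. \<eta> (V z) * (norm (G' z))\<^sup>2)"
  have inner: "\<Phi> z \<bullet> G z = \<eta> (V z) * (norm (G' z))\<^sup>2" if "z \<notin> S" for z
    using that G'[OF that] by (simp add: \<Phi>_def compG_def power2_norm_eq_inner)
  have pair: "integrable lborel (\<lambda>z. \<Phi> z \<bullet> G z)" by (rule gradient_pairing_integrable[OF C loc'])
  have AEinner: "AE z in lborel. \<Phi> z \<bullet> G z = \<eta> (V z) * (norm (G' z))\<^sup>2"
    using AE_not_S by eventually_elim (rule inner)
  have iP: "integrable lborel (\<lambda>z. \<eta> (V z) * (norm (G' z))\<^sup>2)"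
    using pair by (rule integrable_cong_AE_imp) (use AEinner in \<open>auto elim: eventually_mono\<close>)
  have P_eq: "P = (LINT z|lborel. \<Phi> z \<bullet> G z)"
    unfolding P_def by (rule integral_cong_AE) (use AEinner borel_measurable_integrable[OF pair] in \<open>auto elim: eventually_mono\<close>)
  also have "\<dots> = (LINT z|lborel. dens z * \<phi> z) - 2 * pi * (\<Sum>q\<in>Q. \<omega> q * \<phi> q)"
    by (rule weak_full[OF C loc'])
  also have "(\<Sum>q\<in>Q. \<omega> q * \<phi> q) = \<alpha> * I"
    unfolding \<alpha>_def sum_distrib_right
  proof (rule sum.cong)
    show "\<omega> q * \<phi> q = \<omega> q * I" if "q \<in> Q" for q
      using \<phi>S[of q] that by (cases "\<omega> q = 0") (auto simp: S_def)
  qed simp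
  also have "(LINT z|lborel. dens z * \<phi> z) \<le> I * mass s"
  proof -
    have "(LINT z|lborel. dens z * \<phi> z) \<le> (LINT z|lborel. I * (dens z * indicator {z. V z > s} z))"
    proof (rule integral_mono_AE)
      show "integrable lborel (\<lambda>z. dens z * \<phi> z)"
      proof (rule Bochner_Integration.integrable_bound)
        show "integrable lborel (\<lambda>z. dens z * I)" using total_mass(1) by simp
        show "AE z in lborel. norm (dens z * \<phi> z) \<le> norm (dens z * I)"
          using \<phi>_bounds I0 by (auto simp: abs_mult intro!: AE_I2 mult_left_mono)
      qed measurable
      show "integrable lborel (\<lambda>z. I * (dens z * indicator {z. V z > s} z))"
        by (rule integrable_mult_right[OF dens_level_integrable])
      show "AE z in lborel. dens z * \<phi> z \<le> I * (dens z * indicator {z. V z > s} z)"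
        using AE_not_S
      proof eventually_elim
        case (elim z)
        show ?case using mult_left_mono[OF \<phi>_low[OF elim] less_imp_le[OF dens_pos[of z]]] by (simp add: mult_ac)
      qed
    qed
    then show ?thesis by (simp add: mass_def)
  qed
  finally have "P \<le> (mass s - 2 * pi * \<alpha>) * I" by (simp add: algebra_simps)
  moreover have "2 * pi * f s = mass s - 2 * pi * \<alpha>" by (simp add: f_def field_simps)
  ultimately have P_le: "P \<le> 2 * pi * f s * I" by simp
  define E where "E = (LINT z|lborel. \<eta> (V z))"
  have iE: "integrable lborel (\<lambda>z. \<eta> (V z))"
    by (rule Bochner_Integration.integrable_bound[OF band_integrable[of s t]])
       (use \<eta> \<eta>_band in \<open>auto intro!: AE_I2\<close>)
  have E_le: "E \<le> pi * (A s - A t)"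
  proof -
    have "E \<le> (LINT z|lborel. indicator {z. s < V z \<and> V z \<le> t} z)"
      unfolding E_def by (rule integral_mono[OF iE band_integrable \<eta>_band])
    also have "\<dots> = pi * (A s - A t)" by (rule A_diff[symmetric]) (use \<delta> in simp)
    finally show ?thesis .
  qed
  define R where "R = (LINT z|lborel. norm (\<Phi> z))"
  have R0: "R \<ge> 0" by (simp add: R_def)
  have iR: "integrable lborel (\<lambda>z. norm (\<Phi> z))" using C1c_integrable(2)[OF C] by simp
  \<comment> \<open>Since \<phi> = I almost everywhere on {V > t}, Sobolev bounds the L^1 norm of
    the gradient from below by I times the perimeter of the disc of equal area.\<close>
  have "(2 * pi * I * sqrt (A t))\<^sup>2 = 4 * pi * (I\<^sup>2 * (pi * A t))"
    using A_nonneg[of t] by (simp add: power_mult_distrib power2_eq_square)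
  also have "I\<^sup>2 * (pi * A t) = (LINT z|lborel. I\<^sup>2 * indicator {z. V z > t} z)"
    by (simp add: A_def area_def)
  also have "\<dots> \<le> (LINT z|lborel. (\<phi> z)\<^sup>2)"
  proof (rule integral_mono_AE)
    show "integrable lborel (\<lambda>z. I\<^sup>2 * indicator {z. V z > t} z)" by (rule integrable_mult_right[OF level_integrable])
    show "integrable lborel (\<lambda>z. (\<phi> z)\<^sup>2)"
    proof (rule Bochner_Integration.integrable_bound)
      show "integrable lborel (\<lambda>z. I * \<phi> z)" using C1c_integrable(1)[OF C] by simp
      show "AE z in lborel. norm ((\<phi> z)\<^sup>2) \<le> norm (I * \<phi> z)"
        using \<phi>_bounds I0 by (auto simp: abs_mult power2_eq_square intro!: AE_I2 mult_right_mono)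
    qed measurable
    show "AE z in lborel. I\<^sup>2 * indicator {z. V z > t} z \<le> (\<phi> z)\<^sup>2"
      using AE_not_S
    proof eventually_elim
      case (elim z)
      have "(I * indicator {z. V z > t} z)\<^sup>2 \<le> (\<phi> z)\<^sup>2"
        by (rule power_mono[OF \<phi>_high[OF elim]]) (use I0 in simp)
      then show ?case by (cases "V z > t") (simp_all add: power_mult_distrib)
    qed
  qed
  finally have "(2 * pi * I * sqrt (A t))\<^sup>2 \<le> 4 * pi * (LINT z|lborel. (\<phi> z)\<^sup>2)" by simp
  also have "\<dots> \<le> R\<^sup>2" unfolding R_def by (rule sobolev_plane[OF C \<phi>_bounds(1)])
  finally have R_ge: "2 * pi * I * sqrt (A t) \<le> R" using R0 by (rule power2_le_imp_le)
  have expand: "AE z in lborel. \<eta> (V z) * (norm (G' z))\<^sup>2 - 2 * l * norm (\<Phi> z) + l\<^sup>2 * \<eta> (V z) = \<eta> (V z) * (norm (G z) - l)\<^sup>2"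
    using AE_not_S
  proof eventually_elim
    case (elim z)
    show ?case unfolding normG[OF elim] G'[OF elim] by (simp add: power2_eq_square algebra_simps)
  qed
  have iT: "integrable lborel (\<lambda>z. \<eta> (V z) * (norm (G' z))\<^sup>2 - 2 * l * norm (\<Phi> z) + l\<^sup>2 * \<eta> (V z))"
    by (intro Bochner_Integration.integrable_add Bochner_Integration.integrable_diff integrable_mult_right iP iR iE)
  have mT: "(\<lambda>z. \<eta> (V z) * (norm (G z) - l)\<^sup>2) \<in> borel_measurable lborel"
  proof -
    have "(\<lambda>z. if z \<in> S then \<eta> (V z) * (norm (G z) - l)\<^sup>2 else \<eta> (V z) * (norm (G' z) - l)\<^sup>2) \<in> borel_measurable borel"
    proof (rule measurable_discrete_difference[where X = S])
      show "(\<lambda>z. \<eta> (V z) * (norm (G' z) - l)\<^sup>2) \<in> borel_measurable borel" by measurable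
    qed (use finS in \<open>auto intro: countable_finite\<close>)
    moreover have "(\<lambda>z. if z \<in> S then \<eta> (V z) * (norm (G z) - l)\<^sup>2 else \<eta> (V z) * (norm (G' z) - l)\<^sup>2) = (\<lambda>z. \<eta> (V z) * (norm (G z) - l)\<^sup>2)"
      using G' by auto
    ultimately show ?thesis by simp
  qed
  show "integrable lborel (\<lambda>z. trap s t \<delta> (V z) * (norm (G z) - l)\<^sup>2)"
    using integrable_cong_AE_imp[OF iT mT] expand by (auto simp: \<eta>_def elim: eventually_mono)
  have "(LINT z|lborel. \<eta> (V z) * (norm (G z) - l)\<^sup>2) = (LINT z|lborel. \<eta> (V z) * (norm (G' z))\<^sup>2 - 2 * l * norm (\<Phi> z) + l\<^sup>2 * \<eta> (V z))"
    using expand by (intro integral_cong_AE mT borel_measurable_integrable[OF iT]) (auto elim: eventually_mono)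
  also have "\<dots> = P - 2 * l * R + l\<^sup>2 * E"
    using iP iR iE by (simp add: P_def R_def E_def)
  also have "\<dots> \<le> 2 * pi * f s * I - 2 * l * (2 * pi * I * sqrt (A t)) + l\<^sup>2 * (pi * (A s - A t))"
    using P_le R_ge E_le l by (intro add_mono diff_mono mult_left_mono) auto
  finally show "(LINT z|lborel. trap s t \<delta> (V z) * (norm (G z) - l)\<^sup>2) \<le> 2 * pi * f s * I - 4 * pi * l * I * sqrt (A t) + pi * l\<^sup>2 * (A s - A t)"
    by (simp add: \<eta>_def mult_ac)
qed

lemma f_nonneg: "0 \<le> f t" using f_lower[of t] alpha by simp

text \<open>The integral of a square is nonnegative for every \<open>l\<close>, so the energy bound
  is a nonnegative quadratic in \<open>l\<close>; a suitable \<open>l\<close> and \<delta> tending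
  to 0 give the claim.\<close>

lemma isop:
  assumes st: "s < t"
  shows "2 * (t - s) * A t \<le> f s * (A s - A t)"
proof -
  have step: "2 * (t - s - \<delta>) * A t \<le> f s * (A s - A t)" if \<delta>: "\<delta> > 0" "2 * \<delta> \<le> t - s" for \<delta>
  proof -
    define I where "I = t - s - \<delta>"
    have I: "I > 0" using \<delta> by (simp add: I_def)
    define d where "d = A s - A t"
    have d: "d \<ge> 0" using A_antimono[of s t] st by (simp add: d_def)
    have quad: "0 \<le> 2 * f s * I - 4 * l * I * sqrt (A t) + l\<^sup>2 * d" if l: "l \<ge> 0" for l
    proof -
      have "0 \<le> (LINT z|lborel. trap s t \<delta> (V z) * (norm (G z) - l)\<^sup>2)"
        using trap_props(1)[OF \<delta>] by (intro integral_nonneg_AE) auto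
      also have "\<dots> \<le> 2 * pi * f s * I - 4 * pi * l * I * sqrt (A t) + pi * l\<^sup>2 * (A s - A t)"
        unfolding I_def by (rule band_energy(2)[OF \<delta> l])
      also have "\<dots> = pi * (2 * f s * I - 4 * l * I * sqrt (A t) + l\<^sup>2 * d)"
        by (simp add: d_def algebra_simps)
      finally show ?thesis using pi_gt_zero by (auto simp: zero_le_mult_iff)
    qed
    show ?thesis
    proof (cases "A t = 0")
      case True
      then show ?thesis using f_nonneg[of s] d by (simp add: d_def)
    next
      case False
      then have At: "A t > 0" using A_nonneg[of t] by simp
      \<comment> \<open>The length that |G| would have on a round level set; with it the first two
        terms add up to -2 f(s) I.\<close>
      define l where "l = f s / sqrt (A t)"
      have "l \<ge> 0" using f_nonneg[of s] At by (simp add: l_def)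
      from quad[OF this] have "0 \<le> 2 * f s * I - 4 * l * I * sqrt (A t) + l\<^sup>2 * d" .
      also have "l * sqrt (A t) = f s" using At by (simp add: l_def)
      then have "2 * f s * I - 4 * l * I * sqrt (A t) + l\<^sup>2 * d = - 2 * f s * I + (f s)\<^sup>2 / A t * d"
        using At by (simp add: l_def power_divide)
      finally have 1: "2 * f s * I * A t \<le> (f s)\<^sup>2 * d" using At by (simp add: field_simps)
      show ?thesis
      proof (cases "f s = 0")
        case True
        have "0 \<le> - 4 * l * I * sqrt (A t) + l\<^sup>2 * d" if "l \<ge> 0" for l using quad[OF that] True by simp
        note q0 = this
        \<comment> \<open>With f(s) = 0 the linear term is negative and dominates for small positive
          \<open>l\<close>; the summand 1 covers d = 0.\<close>
        define l0 where "l0 = 2 * I * sqrt (A t) / (d + 1)"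
        have l0: "l0 > 0" using I At d by (simp add: l0_def)
        have "0 \<le> l0 * (l0 * d - 4 * I * sqrt (A t))" using q0[of l0] l0 by (simp add: power2_eq_square algebra_simps)
        then have "4 * I * sqrt (A t) \<le> l0 * d" using l0 by (simp add: zero_le_mult_iff)
        also have "\<dots> \<le> 2 * I * sqrt (A t)" using I At d by (simp add: l0_def field_simps)
        finally have False using I At by simp
        then show ?thesis ..
      next
        case False
        then have fs: "f s > 0" using f_nonneg[of s] by simp
        have "f s * (2 * I * A t) \<le> f s * (f s * d)" using 1 by (simp add: power2_eq_square mult_ac)
        then show ?thesis using fs by (simp add: I_def d_def)
      qed
    qed
  qed
  have "((\<lambda>\<delta>. 2 * (t - s - \<delta>) * A t) \<longlongrightarrow> 2 * (t - s - 0) * A t) (at_right 0)" by (intro tendsto_intros)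
  moreover have "\<forall>\<^sub>F \<delta> in at_right 0. 2 * (t - s - \<delta>) * A t \<le> f s * (A s - A t)"
    unfolding eventually_at_right_field using step st by (intro exI[of _ "(t - s) / 2"]) auto
  ultimately have "2 * (t - s - 0) * A t \<le> f s * (A s - A t)" by (rule tendsto_upperbound) simp
  then show ?thesis by simp
qed

text \<open>Chebyshev: the integrand exp(2t) on {V > t} is at most exp(2V), an integrable bound, and
  it tends to 0 pointwise.\<close>

lemma A_lim_top: "((\<lambda>t. exp (2 * t) * A t) \<longlongrightarrow> 0) at_top"
proof -
  have "((\<lambda>t. LINT z|lborel. exp (2 * t) * indicator {z. V z > t} z) \<longlongrightarrow> integral\<^sup>L (lborel :: complex measure) (\<lambda>z. 0 :: real)) at_top"
  proof (rule integral_dominated_convergence_at_top[where M = lborel and s = "\<lambda>t z. exp (2 * t) * indicator {z. V z > t} z" and f = "\<lambda>z. 0 :: real" and w = "\<lambda>z. exp (2 * V z)"])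
    show "AE z in lborel. ((\<lambda>t. exp (2 * t) * indicator {z. V z > t} z) \<longlongrightarrow> (0::real)) at_top"
    proof (rule AE_I2)
      fix z
      have "\<forall>\<^sub>F t in at_top. exp (2 * t) * indicator {z. V z > t} z = (0::real)"
        using eventually_ge_at_top[of "V z"] by eventually_elim auto
      then show "((\<lambda>t. exp (2 * t) * indicator {z. V z > t} z) \<longlongrightarrow> (0::real)) at_top" by (rule tendsto_eventually)
    qed
    show "\<forall>\<^sub>F t in at_top. AE z in lborel. norm (exp (2 * t) * indicator {z. V z > t} z :: real) \<le> exp (2 * V z)"
      by (intro always_eventually allI AE_I2) (auto simp: indicator_def)
  qed (use exp_integrable in auto)
  then have "((\<lambda>t. exp (2 * t) * area t) \<longlongrightarrow> 0) at_top" by (simp add: area_def)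
  then have "((\<lambda>t. exp (2 * t) * area t / pi) \<longlongrightarrow> 0 / pi) at_top" by (intro tendsto_intros) auto
  then show ?thesis by (simp add: A_def)
qed

lemma A_lim_bot: "((\<lambda>t. exp (2 * t) * A t) \<longlongrightarrow> 0) at_bot"
proof -
  have "((\<lambda>t. LINT z|lborel. exp (2 * (-t)) * indicator {z. V z > - t} z) \<longlongrightarrow> integral\<^sup>L (lborel :: complex measure) (\<lambda>z. 0 :: real)) at_top"
  proof (rule integral_dominated_convergence_at_top[where M = lborel and s = "\<lambda>t z. exp (2 * (-t)) * indicator {z. V z > - t} z" and f = "\<lambda>z. 0 :: real" and w = "\<lambda>z. exp (2 * V z)"])
    have "filterlim (\<lambda>t::real. 2 * (-t)) at_bot at_top"
      unfolding filterlim_at_bot eventually_at_top_linorder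
    proof
      fix Z :: real
      show "\<exists>N. \<forall>t\<ge>N. 2 * (-t) \<le> Z" by (rule exI[of _ "- Z / 2"]) auto
    qed
    then have e0: "((\<lambda>t::real. exp (2 * (-t))) \<longlongrightarrow> 0) at_top" by (rule filterlim_compose[OF exp_at_bot])
    show "AE z in lborel. ((\<lambda>t. exp (2 * (-t)) * indicator {z. V z > - t} z) \<longlongrightarrow> (0::real)) at_top"
    proof (rule AE_I2)
      fix z
      have "\<forall>\<^sub>F t in at_top. norm (exp (2 * (-t)) * indicator {z. V z > - t} z :: real) \<le> exp (2 * (-t))"
        by (intro always_eventually allI) (auto simp: indicator_def)
      then show "((\<lambda>t. exp (2 * (-t)) * indicator {z. V z > - t} z) \<longlongrightarrow> (0::real)) at_top"
        by (rule Lim_null_comparison) (rule e0)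
    qed
    show "\<forall>\<^sub>F t in at_top. AE z in lborel. norm (exp (2 * (-t)) * indicator {z. V z > - t} z :: real) \<le> exp (2 * V z)"
      by (intro always_eventually allI AE_I2) (auto simp: indicator_def)
  qed (use exp_integrable in auto)
  then have "((\<lambda>t. exp (2 * (-t)) * area (-t)) \<longlongrightarrow> 0) at_top" by (simp add: area_def)
  then have "((\<lambda>t. exp (2 * (-t)) * area (-t) / pi) \<longlongrightarrow> 0 / pi) at_top" by (intro tendsto_intros) auto
  then show ?thesis by (simp add: A_def filterlim_at_bot_mirror)
qed

lemma f_lim_top: "(f \<longlongrightarrow> - \<alpha>) at_top"
proof -
  have "((\<lambda>t. LINT z|lborel. dens z * indicator {z. V z > t} z) \<longlongrightarrow> integral\<^sup>L (lborel :: complex measure) (\<lambda>z. 0 :: real)) at_top"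
  proof (rule integral_dominated_convergence_at_top[where M = lborel and s = "\<lambda>t z. dens z * indicator {z. V z > t} z" and f = "\<lambda>z. 0 :: real" and w = "dens"])
    show "AE z in lborel. ((\<lambda>t. dens z * indicator {z. V z > t} z) \<longlongrightarrow> (0::real)) at_top"
    proof (rule AE_I2)
      fix z
      have "\<forall>\<^sub>F t in at_top. dens z * indicator {z. V z > t} z = (0::real)"
        using eventually_ge_at_top[of "V z"] by eventually_elim auto
      then show "((\<lambda>t. dens z * indicator {z. V z > t} z) \<longlongrightarrow> (0::real)) at_top" by (rule tendsto_eventually)
    qed
    show "\<forall>\<^sub>F t in at_top. AE z in lborel. norm (dens z * indicator {z. V z > t} z :: real) \<le> dens z"
      using dens_pos by (intro always_eventually allI AE_I2) (auto simp: indicator_def less_imp_le)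
  qed (use total_mass(1) in auto)
  then have "(mass \<longlongrightarrow> 0) at_top" by (simp add: mass_def[abs_def])
  then have "((\<lambda>t. - \<alpha> + mass t / (2 * pi)) \<longlongrightarrow> - \<alpha> + 0 / (2 * pi)) at_top" by (intro tendsto_intros) auto
  then show ?thesis by (simp add: f_def[abs_def])
qed

text \<open>The superlevel sets exhaust the plane, so the limit is the Gauss-Bonnet mass.\<close>

lemma f_lim_bot: "(f \<longlongrightarrow> 2 + \<beta>) at_bot"
proof -
  have "((\<lambda>t. LINT z|lborel. dens z * indicator {z. V z > - t} z) \<longlongrightarrow> (LINT z|lborel. dens z)) at_top"
  proof (rule integral_dominated_convergence_at_top[where M = lborel and s = "\<lambda>t z. dens z * indicator {z. V z > - t} z" and f = "dens" and w = "dens"])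
    show "AE z in lborel. ((\<lambda>t. dens z * indicator {z. V z > - t} z) \<longlongrightarrow> dens z) at_top"
    proof (rule AE_I2)
      fix z
      have "\<forall>\<^sub>F t in at_top. dens z * indicator {z. V z > - t} z = dens z"
        using eventually_gt_at_top[of "- V z"] by eventually_elim auto
      then show "((\<lambda>t. dens z * indicator {z. V z > - t} z) \<longlongrightarrow> dens z) at_top" by (rule tendsto_eventually)
    qed
    show "\<forall>\<^sub>F t in at_top. AE z in lborel. norm (dens z * indicator {z. V z > - t} z :: real) \<le> dens z"
      using dens_pos by (intro always_eventually allI AE_I2) (auto simp: indicator_def less_imp_le)
  qed (use total_mass(1) in auto)
  then have "((\<lambda>t. mass (- t)) \<longlongrightarrow> 2 * pi * (2 + \<beta> + \<alpha>)) at_top" by (simp add: mass_def total_mass(2) \<alpha>_def)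
  then have "((\<lambda>t. - \<alpha> + mass (- t) / (2 * pi)) \<longlongrightarrow> - \<alpha> + 2 * pi * (2 + \<beta> + \<alpha>) / (2 * pi)) at_top" by (intro tendsto_intros) auto
  then show ?thesis by (simp add: f_def[abs_def] filterlim_at_bot_mirror)
qed

sublocale profile: bol_profile A f a b \<alpha> \<beta>
proof
  show "a \<le> b" using k_bounds(2)[of 0] k_bounds(3)[of 0] by linarith
qed (use k_bounds(1) alpha \<beta>_gt A_nonneg A_antimono f_lower f_upper mass_lower mass_upper isop
      A_lim_top A_lim_bot f_lim_top f_lim_bot in auto)

end

section \<open>Rigidity\<close>

text \<open>The mean value theorem on the segment from \<open>x\<close> to \<open>y\<close>, but
  only after the last zero of \<open>N\<close>; what happens before can only help because N is
  nonnegative.\<close>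

lemma lipschitz_of_gradient_off_zeros:
  fixes N :: "complex \<Rightarrow> real"
  assumes cont: "continuous_on UNIV N" and nonneg: "\<And>z. 0 \<le> N z"
    and grad: "\<And>z. N z > 0 \<Longrightarrow> \<exists>D. GDERIV N z :> D \<and> norm D \<le> 1"
  shows "N y \<le> N x + cmod (y - x)"
proof (cases "N y = 0")
  case True
  then show ?thesis using nonneg[of x] by simp
next
  case False
  define g where "g u = N (x + u *\<^sub>R (y - x))" for u :: real
  have gc: "continuous_on UNIV g"
    unfolding g_def by (rule continuous_on_compose2[OF cont]) (auto intro!: continuous_intros)
  have g0: "0 \<le> g u" for u by (simp add: g_def nonneg)
  have g1: "g 1 > 0" using False nonneg[of y] by (simp add: g_def less_le)
  define Z where "Z = {u \<in> {0..1}. g u = 0}"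
  have Zc: "compact Z"
  proof -
    have "closed (g -` {0})" using gc by (intro closed_vimage) auto
    then have "compact ({0..1} \<inter> g -` {0})" by (intro compact_Int_closed) auto
    moreover have "Z = {0..1} \<inter> g -` {0}" by (auto simp: Z_def)
    ultimately show ?thesis by simp
  qed
  \<comment> \<open>The last zero of \<open>g\<close> on the unit interval, or 0 if there is none;
    in both cases g(u0) \<le> g(0) and the gradient exists on the remaining open part.\<close>
  obtain u0 where u0: "0 \<le> u0" "u0 < 1" "g u0 \<le> g 0" "\<And>u. u0 < u \<Longrightarrow> u \<le> 1 \<Longrightarrow> g u > 0"
  proof (cases "Z = {}")
    case True
    show thesis
      by (rule that[of 0]) (use True g0 in \<open>auto simp: Z_def less_le\<close>)
  next
    case False
    obtain m where m: "m \<in> Z" "\<And>u. u \<in> Z \<Longrightarrow> u \<le> m" using compact_attains_sup[OF Zc False] by blast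
    have gm: "g m = 0" "0 \<le> m" "m \<le> 1" using m(1) by (auto simp: Z_def)
    show thesis
    proof (rule that[of m])
      show "m < 1" using gm g1 by (cases "m = 1") auto
      show "g u > 0" if u: "m < u" "u \<le> 1" for u
      proof (rule ccontr)
        assume "\<not> g u > 0"
        then have "u \<in> Z" using g0[of u] u gm by (auto simp: Z_def)
        then show False using m(2) u by fastforce
      qed
    qed (use gm g0 in auto)
  qed
  have der: "\<exists>d. DERIV g u :> d \<and> d \<le> cmod (y - x)" if u: "u0 < u" "u < 1" for u
  proof -
    have "N (x + u *\<^sub>R (y - x)) > 0" using u0(4)[of u] u by (simp add: g_def)
    then obtain D where D: "GDERIV N (x + u *\<^sub>R (y - x)) :> D" "norm D \<le> 1" using grad by blast
    have "((\<lambda>t. N (x + u *\<^sub>R (y - x) + t *\<^sub>R (y - x))) has_real_derivative inner (y - x) D) (at 0)"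
      by (rule GDERIV_directional[OF D(1)])
    then have "((\<lambda>t. g (t + u)) has_real_derivative inner (y - x) D) (at 0)"
      by (simp add: g_def scaleR_add_left add_ac)
    then have "DERIV g u :> inner (y - x) D" using DERIV_shift[of g _ 0 u] by simp
    moreover have "inner (y - x) D \<le> norm (y - x) * norm D" by (rule norm_cauchy_schwarz)
    moreover have "norm (y - x) * norm D \<le> norm (y - x)" using D(2) by (simp add: mult_left_le)
    ultimately show ?thesis using order_trans by blast
  qed
  obtain \<xi> d where \<xi>: "u0 < \<xi>" "\<xi> < 1" "DERIV g \<xi> :> d" "g 1 - g u0 = (1 - u0) * d"
  proof -
    have "\<exists>l z. u0 < z \<and> z < 1 \<and> DERIV g z :> l \<and> g 1 - g u0 = (1 - u0) * l"
    proof (rule MVT[OF u0(2)])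
      show "continuous_on {u0..1} g" by (rule continuous_on_subset[OF gc]) simp
      show "g differentiable (at u)" if "u0 < u" "u < 1" for u
        using der[OF that] by (auto simp: real_differentiable_def)
    qed
    then show thesis using that by blast
  qed
  obtain d' where "DERIV g \<xi> :> d'" "d' \<le> cmod (y - x)" using der[OF \<xi>(1,2)] by blast
  then have "d \<le> cmod (y - x)" using \<xi>(3) DERIV_unique by blast
  then have "(1 - u0) * d \<le> (1 - u0) * cmod (y - x)" using u0 by (intro mult_left_mono) auto
  also have "\<dots> \<le> cmod (y - x)" using u0 by (simp add: mult_left_le_one_le)
  finally have "g 1 \<le> g 0 + cmod (y - x)" using \<xi>(4) u0(3) by linarith
  then show ?thesis by (simp add: g_def)
qed

text \<open>Nonempty open sets are not null, so an almost everywhere identity between continuous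
  functions holds everywhere. With a constant function it shows that an open null set is
  empty.\<close>

lemma open_AE_imp:
  fixes h :: "complex \<Rightarrow> real"
  assumes "open U" "continuous_on U h" "AE z in lborel. z \<in> U \<longrightarrow> h z = 0" "z \<in> U"
  shows "h z = 0"
proof (rule ccontr)
  assume nz: "h z \<noteq> 0"
  define W where "W = U \<inter> h -` (- {0})"
  have W: "open W" "z \<in> W"
    unfolding W_def using assms nz by (auto intro: continuous_open_preimage)
  have "AE z in lborel. z \<notin> W" using assms(3) by eventually_elim (auto simp: W_def)
  moreover have "W \<in> sets lborel" using W(1) by simp
  ultimately have "W \<in> null_sets lborel" using AE_iff_null_sets by metis
  then have "negligible W" by (simp add: negligible_iff_null_sets null_sets_completionI)
  then show False using open_not_negligible[OF W(1)] W(2) by blast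
qed

locale conf_football_eq = conf_football +
  assumes equality: "(1 + (\<Sum>q\<in>Q. \<omega> q))\<^sup>2 / b = (1 + \<beta>)\<^sup>2 / a"
begin

sublocale profile_eq: bol_profile_eq A f a b \<alpha> \<beta>
  by unfold_locales (use equality in \<open>simp add: \<alpha>_def\<close>)

lemma A_continuous: "continuous_on UNIV A"
  using profile_eq.A_isCont by (simp add: continuous_at_imp_continuous_on)

lemma f_continuous: "continuous_on UNIV f"
  using profile_eq.f_isCont by (simp add: continuous_at_imp_continuous_on)

lemma A_borel [measurable]: "A \<in> borel_measurable borel"
  by (rule borel_measurable_continuous_onI[OF A_continuous])

lemma f_borel [measurable]: "f \<in> borel_measurable borel"
  by (rule borel_measurable_continuous_onI[OF f_continuous])

text \<open>The bound of \<open>band_energy\<close> in the limit of vanishing ramps.\<close>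

definition excess :: "real \<Rightarrow> real \<Rightarrow> real \<Rightarrow> real" where
  "excess s t l = 2 * pi * f s * (t - s) - 4 * pi * l * (t - s) * sqrt (A t) + pi * l\<^sup>2 * (A s - A t)"

text \<open>The trapezoid is widened by \<delta> on both sides so that it equals 1 on the closed
  band; continuity of \<open>A\<close> and \<open>f\<close> in the equality case permits \<delta>
  tending to 0.\<close>

lemma band_excess:
  assumes st: "s < t" and l: "l \<ge> 0"
  shows "integrable lborel (\<lambda>z. indicator {z. s \<le> V z \<and> V z \<le> t} z * (norm (G z) - l)\<^sup>2)"
    and "(LINT z|lborel. indicator {z. s \<le> V z \<and> V z \<le> t} z * (norm (G z) - l)\<^sup>2) \<le> excess s t l"
proof -
  define B where "B z = indicator {z. s \<le> V z \<and> V z \<le> t} z * (norm (G z) - l)\<^sup>2" for z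
  define E where "E \<delta> = 2 * pi * f (s - \<delta>) * (t - s + \<delta>) - 4 * pi * l * (t - s + \<delta>) * sqrt (A (t + \<delta>)) + pi * l\<^sup>2 * (A (s - \<delta>) - A (t + \<delta>))" for \<delta>
  have step: "integrable lborel B \<and> (LINT z|lborel. B z) \<le> E \<delta>" if \<delta>: "\<delta> > 0" for \<delta>
  proof -
    have \<delta>': "2 * \<delta> \<le> (t + \<delta>) - (s - \<delta>)" using st by simp
    note T = band_energy[OF \<delta> \<delta>' l]
    define T where "T z = trap (s - \<delta>) (t + \<delta>) \<delta> (V z) * (norm (G z) - l)\<^sup>2" for z
    have iT: "integrable lborel T" unfolding T_def by (rule T(1))
    have BT: "B z = indicator {z. s \<le> V z \<and> V z \<le> t} z * T z" for z
      using trap_props(5)[OF \<delta> \<delta>', of "V z"] by (auto simp: B_def T_def indicator_def)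
    have T0: "0 \<le> T z" for z unfolding T_def using trap_props(1)[OF \<delta> \<delta>'] by simp
    have [measurable]: "T \<in> borel_measurable lborel" using iT by (rule borel_measurable_integrable)
    have iB: "integrable lborel B"
    proof (rule Bochner_Integration.integrable_bound[OF iT])
      show "B \<in> borel_measurable lborel" unfolding BT[abs_def] by measurable
      show "AE z in lborel. norm (B z) \<le> norm (T z)" unfolding BT using T0 by (auto simp: indicator_def)
    qed
    have "(LINT z|lborel. B z) \<le> (LINT z|lborel. T z)"
      by (rule integral_mono[OF iB iT]) (use T0 in \<open>auto simp: BT indicator_def\<close>)
    also have "\<dots> \<le> E \<delta>" using T(2) by (simp add: T_def E_def algebra_simps)
    finally show ?thesis using iB by blast
  qed
  show "integrable lborel (\<lambda>z. indicator {z. s \<le> V z \<and> V z \<le> t} z * (norm (G z) - l)\<^sup>2)"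
    using step[of 1] by (simp add: B_def[abs_def])
  have "isCont E 0"
  proof -
    have m: "isCont (\<lambda>\<delta>. s - \<delta>) 0" "isCont (\<lambda>\<delta>. t + \<delta>) 0" by (intro continuous_intros)+
    have c1: "isCont (\<lambda>\<delta>. f (s - \<delta>)) 0" by (rule isCont_o2[OF m(1) profile_eq.f_isCont])
    have c2: "isCont (\<lambda>\<delta>. A (t + \<delta>)) 0" by (rule isCont_o2[OF m(2) profile_eq.A_isCont])
    have c3: "isCont (\<lambda>\<delta>. A (s - \<delta>)) 0" by (rule isCont_o2[OF m(1) profile_eq.A_isCont])
    have c4: "isCont (\<lambda>\<delta>. sqrt (A (t + \<delta>))) 0" by (rule isCont_o2[OF c2 isCont_real_sqrt])
    show ?thesis
      unfolding E_def[abs_def] by (intro continuous_intros c1 c2 c3 c4)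
  qed
  then have "(E \<longlongrightarrow> E 0) (at 0)" by (simp add: isCont_def)
  then have "(E \<longlongrightarrow> E 0) (at_right 0)" by (rule tendsto_mono[rotated]) (simp add: at_le)
  moreover have "\<forall>\<^sub>F \<delta> in at_right 0. (LINT z|lborel. B z) \<le> E \<delta>"
    using eventually_at_right_less[of "0::real"] by eventually_elim (use step in blast)
  ultimately have "(LINT z|lborel. B z) \<le> E 0" by (rule tendsto_lowerbound) simp
  then show "(LINT z|lborel. indicator {z. s \<le> V z \<and> V z \<le> t} z * (norm (G z) - l)\<^sup>2) \<le> excess s t l"
    by (simp add: B_def[abs_def] E_def excess_def)
qed

text \<open>The gradient length that a rotationally symmetric solution has at level
  \<open>t\<close>: flux 2 pi f divided by the perimeter 2 pi sqrt(A).\<close>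

definition lam :: "real \<Rightarrow> real" where "lam t = f t / sqrt (A t)"

lemma lam_borel [measurable]: "lam \<in> borel_measurable borel" unfolding lam_def[abs_def] by measurable

lemma lam_between:
  assumes "s \<le> x" "x \<le> t" "A t > 0"
  shows "f t / sqrt (A s) \<le> lam x" "lam x \<le> f s / sqrt (A t)"
proof -
  have "A t \<le> A x" "A x \<le> A s" "f t \<le> f x" "f x \<le> f s"
    using assms A_antimono profile.f_antimono by auto
  then show "f t / sqrt (A s) \<le> lam x" "lam x \<le> f s / sqrt (A t)"
    unfolding lam_def using assms(3) f_nonneg by (auto intro!: frac_le real_sqrt_le_mono)
qed

definition def :: "complex \<Rightarrow> real" where "def z = (norm (G z) - lam (V z))\<^sup>2"

text \<open>\<open>band_excess\<close> compares |G| with a single length \<open>lam r\<close>.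
  Within the band \<open>lam\<close> varies by at most the difference of the two extreme quotients,
  and (p + q)^2 \<le> 2 p^2 + 2 q^2 combines both errors.\<close>

lemma band_defect:
  assumes st: "s < t" and At: "A t > 0" and r: "s \<le> r" "r \<le> t"
  shows "integrable lborel (\<lambda>z. indicator {z. s < V z \<and> V z \<le> t} z * def z)"
    and "(LINT z|lborel. indicator {z. s < V z \<and> V z \<le> t} z * def z) \<le>
       2 * excess s t (lam r) + 2 * (f s / sqrt (A t) - f t / sqrt (A s))\<^sup>2 * (pi * (A s - A t))"
proof -
  define l where "l = lam r"
  have l0: "l \<ge> 0" using f_nonneg[of r] A_nonneg[of r] by (simp add: l_def lam_def)
  define w where "w = f s / sqrt (A t) - f t / sqrt (A s)"
  define I where "I z = (indicator {z. s < V z \<and> V z \<le> t} z :: real)" for z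
  define J where "J z = (indicator {z. s \<le> V z \<and> V z \<le> t} z :: real)" for z
  have J_int: "integrable lborel (\<lambda>z. J z * (norm (G z) - l)\<^sup>2)" and
    J_le: "(LINT z|lborel. J z * (norm (G z) - l)\<^sup>2) \<le> excess s t l"
    using band_excess[OF st l0] by (auto simp: J_def)
  have J0_int: "integrable lborel (\<lambda>z. J z * (norm (G z) - 0)\<^sup>2)"
    using band_excess(1)[OF st, of 0] by (auto simp: J_def)
  have [measurable]: "I \<in> borel_measurable borel" "J \<in> borel_measurable borel" unfolding I_def[abs_def] J_def[abs_def] by measurable
  have iI: "integrable lborel I" unfolding I_def[abs_def] by (rule band_integrable)
  have bound: "I z * def z \<le> 2 * (J z * (norm (G z) - l)\<^sup>2) + 2 * w\<^sup>2 * I z" for z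
  proof (cases "s < V z \<and> V z \<le> t")
    case True
    then have *: "I z = 1" "J z = 1" by (auto simp: I_def J_def)
    have "\<bar>l - lam (V z)\<bar> \<le> w"
      using lam_between[of s "V z" t] lam_between[of s r t] True At r by (simp add: w_def l_def abs_le_iff)
    then have "\<bar>l - lam (V z)\<bar>\<^sup>2 \<le> w\<^sup>2" by (intro power_mono) auto
    moreover have "def z \<le> 2 * (norm (G z) - l)\<^sup>2 + 2 * (l - lam (V z))\<^sup>2"
    proof -
      define p where "p = norm (G z) - l"
      define q where "q = l - lam (V z)"
      have "def z = (p + q)\<^sup>2" by (simp add: def_def p_def q_def)
      also have "\<dots> \<le> 2 * p\<^sup>2 + 2 * q\<^sup>2"
        using zero_le_power2[of "p - q"] by (simp add: power2_eq_square algebra_simps)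
      finally show ?thesis by (simp add: p_def q_def)
    qed
    ultimately show ?thesis using * by simp
  next
    case False
    then have "I z = 0" by (auto simp: I_def)
    then show ?thesis by (simp add: J_def)
  qed
  have meas: "(\<lambda>z. I z * def z) \<in> borel_measurable lborel"
  proof -
    have [measurable]: "(\<lambda>z. J z * (norm (G z) - 0)\<^sup>2) \<in> borel_measurable lborel"
      using J0_int by (rule borel_measurable_integrable)
    have *: "(\<lambda>z. I z * def z) = (\<lambda>z. I z * (sqrt (J z * (norm (G z) - 0)\<^sup>2) - lam (V z))\<^sup>2)"
      by (auto simp: I_def J_def def_def indicator_def fun_eq_iff)
    show ?thesis unfolding * by measurable
  qed
  have iR: "integrable lborel (\<lambda>z. 2 * (J z * (norm (G z) - l)\<^sup>2) + 2 * w\<^sup>2 * I z)"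
    by (intro Bochner_Integration.integrable_add integrable_mult_right J_int iI)
  have pos: "0 \<le> I z * def z" for z by (simp add: I_def def_def)
  have int: "integrable lborel (\<lambda>z. I z * def z)"
    by (rule Bochner_Integration.integrable_bound[OF iR meas])
       (use bound pos in \<open>auto intro!: AE_I2 intro: order_trans[OF _ abs_ge_self]\<close>)
  then show "integrable lborel (\<lambda>z. indicator {z. s < V z \<and> V z \<le> t} z * def z)" by (simp add: I_def)
  have "(LINT z|lborel. I z * def z) \<le> (LINT z|lborel. 2 * (J z * (norm (G z) - l)\<^sup>2) + 2 * w\<^sup>2 * I z)"
    by (rule integral_mono[OF int iR bound])
  also have "\<dots> = 2 * (LINT z|lborel. J z * (norm (G z) - l)\<^sup>2) + 2 * w\<^sup>2 * (LINT z|lborel. I z)"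
    using J_int iI by simp
  also have "(LINT z|lborel. I z) = pi * (A s - A t)" using st by (simp add: A_diff I_def)
  also have "2 * (LINT z|lborel. J z * (norm (G z) - l)\<^sup>2) \<le> 2 * excess s t l" using J_le by simp
  finally show "(LINT z|lborel. indicator {z. s < V z \<and> V z \<le> t} z * def z) \<le>
       2 * excess s t (lam r) + 2 * (f s / sqrt (A t) - f t / sqrt (A s))\<^sup>2 * (pi * (A s - A t))"
    by (simp add: I_def l_def w_def)
qed

text \<open>As a function of its lower level the accumulated defect has derivative 0: the excess of
  a thin band is of smaller order than its height, by the formula for A'.\<close>

lemma defect_zero:
  assumes r01: "r0 < r1" and Ar1: "A r1 > 0"
  shows "(LINT z|lborel. indicator {z. r0 < V z \<and> V z \<le> r1} z * def z) = 0"
proof -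
  have "(A \<longlongrightarrow> A r1) (at_right r1)" using profile_eq.A_isCont[of r1] by (simp add: isCont_def filterlim_at_split)
  then have "\<forall>\<^sub>F x in at_right r1. A x > 0" by (rule order_tendstoD) (rule Ar1)
  then obtain r2 where r2: "r2 > r1" "\<And>x. r1 < x \<Longrightarrow> x < r2 \<Longrightarrow> A x > 0" unfolding eventually_at_right_field by blast
  \<comment> \<open>A level slightly above \<open>r1\<close> at which \<open>A\<close> is still
    positive, so that two-sided derivatives exist at \<open>r1\<close> too.\<close>
  define R where "R = (r1 + r2) / 2"
  have R: "r1 < R" "A R > 0" using r2 by (auto simp: R_def)
  define J where "J t = (LINT z|lborel. indicator {z. t < V z \<and> V z \<le> R} z * def z)" for t
  have split: "J s - J t = (LINT z|lborel. indicator {z. s < V z \<and> V z \<le> t} z * def z)" if "s < t" "t < R" for s t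
  proof -
    have At: "A t > 0" using R A_antimono[of t R] that by simp
    have i: "integrable lborel (\<lambda>z. indicator {z. s < V z \<and> V z \<le> t} z * def z)"
      by (rule band_defect(1)[where r = s]) (use that At in auto)
    have j: "integrable lborel (\<lambda>z. indicator {z. t < V z \<and> V z \<le> R} z * def z)"
      by (rule band_defect(1)[where r = t]) (use that R in auto)
    have "indicator {z. s < V z \<and> V z \<le> R} z * def z = indicator {z. s < V z \<and> V z \<le> t} z * def z + indicator {z. t < V z \<and> V z \<le> R} z * def z" for z
      using that by (auto simp: indicator_def)
    then have "J s = (LINT z|lborel. indicator {z. s < V z \<and> V z \<le> t} z * def z) + J t"
      using i j by (simp add: J_def)
    then show ?thesis by simp
  qed
  have der: "DERIV J r :> 0" if r: "r < R" for r
  proof -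
    have Ar: "A r > 0" using R A_antimono[of r R] r by simp
    have fr: "f r > 0" by (rule profile_eq.A_pos_f_pos[OF Ar])
    define q where "q x = \<bar>(A x - A r) / (x - r)\<bar>" for x
    define M where "M x = 2 * (2 * pi * f (min x r) - 4 * pi * lam r * sqrt (A (max x r)) + pi * (lam r)\<^sup>2 * q x)
        + 2 * (f (min x r) / sqrt (A (max x r)) - f (max x r) / sqrt (A (min x r)))\<^sup>2 * (pi * q x)" for x
    have bound: "\<bar>(J x - J r) / (x - r)\<bar> \<le> M x" if x: "x \<noteq> r" "x < R" for x
    proof -
      define s where "s = min x r"
      define t where "t = max x r"
      have st: "s < t" "t < R" "s \<le> r" "r \<le> t" using x r by (auto simp: s_def t_def)
      have At: "A t > 0" using R A_antimono[of t R] st by simp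
      have qst: "q x = (A s - A t) / (t - s)"
        using x(1) A_antimono[of s t] st(1)
        by (auto simp: q_def s_def t_def min_def max_def abs_div abs_if field_simps split: if_splits)
      have "0 \<le> J s - J t" unfolding split[OF st(1,2)] by (intro integral_nonneg_AE) (auto simp: def_def)
      then have "\<bar>(J x - J r) / (x - r)\<bar> = (J s - J t) / (t - s)"
        using x(1) st(1) by (auto simp: s_def t_def min_def max_def abs_div abs_if field_simps split: if_splits)
      also have "\<dots> \<le> (2 * excess s t (lam r) + 2 * (f s / sqrt (A t) - f t / sqrt (A s))\<^sup>2 * (pi * (A s - A t))) / (t - s)"
        unfolding split[OF st(1,2)] using st(1) by (intro divide_right_mono band_defect(2)[OF st(1) At st(3,4)]) simp
      also have "\<dots> = M x"
      proof -
        have *: "(2 * (2 * pi * F * h - 4 * pi * l * h * B + pi * l\<^sup>2 * d) + 2 * X * (pi * d)) / h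
            = 2 * (2 * pi * F - 4 * pi * l * B + pi * l\<^sup>2 * (d / h)) + 2 * X * (pi * (d / h))"
          if "h > 0" for F h l B d X :: real
          using that by (simp add: field_simps)
        show ?thesis
          unfolding M_def qst s_def[symmetric] t_def[symmetric] excess_def using st(1) by (intro *) simp
      qed
      finally show ?thesis .
    qed
    have "((\<lambda>x. (A x - A r) / (x - r)) \<longlongrightarrow> - (2 * A r / f r)) (at r)"
      using profile_eq.A_deriv[OF fr] by (simp add: has_field_derivative_iff)
    then have "(q \<longlongrightarrow> \<bar>- (2 * A r / f r)\<bar>) (at r)" unfolding q_def[abs_def] by (rule tendsto_rabs)
    then have ql: "(q \<longlongrightarrow> 2 * A r / f r) (at r)" using Ar fr by simp
    have maxc: "isCont (\<lambda>x. max x r) r" "isCont (\<lambda>x. min x r) r" by (intro continuous_intros)+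
    have c: "isCont (\<lambda>x. A (max x r)) r" "isCont (\<lambda>x. A (min x r)) r" "isCont (\<lambda>x. f (max x r)) r" "isCont (\<lambda>x. f (min x r)) r"
      by (rule isCont_o2[OF maxc(1)], simp add: profile_eq.A_isCont, rule isCont_o2[OF maxc(2)], simp add: profile_eq.A_isCont,
          rule isCont_o2[OF maxc(1)], simp add: profile_eq.f_isCont, rule isCont_o2[OF maxc(2)], simp add: profile_eq.f_isCont)
    have l: "((\<lambda>x. A (max x r)) \<longlongrightarrow> A r) (at r)" "((\<lambda>x. A (min x r)) \<longlongrightarrow> A r) (at r)"
      "((\<lambda>x. f (max x r)) \<longlongrightarrow> f r) (at r)" "((\<lambda>x. f (min x r)) \<longlongrightarrow> f r) (at r)"
      using c by (auto simp: isCont_def)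
    have "(M \<longlongrightarrow> 2 * (2 * pi * f r - 4 * pi * lam r * sqrt (A r) + pi * (lam r)\<^sup>2 * (2 * A r / f r))
        + 2 * (f r / sqrt (A r) - f r / sqrt (A r))\<^sup>2 * (pi * (2 * A r / f r))) (at r)"
      unfolding M_def[abs_def] by (intro tendsto_intros l ql) (use Ar in auto)
    \<comment> \<open>Inside the first bracket the three terms are 2 pi f, -4 pi f and 2 pi f,
      because lam sqrt(A) = f and the limit of the area quotient is 2 A / f.\<close>
    moreover have "2 * (2 * pi * f r - 4 * pi * lam r * sqrt (A r) + pi * (lam r)\<^sup>2 * (2 * A r / f r))
        + 2 * (f r / sqrt (A r) - f r / sqrt (A r))\<^sup>2 * (pi * (2 * A r / f r)) = 0"
    proof -
      have "lam r * sqrt (A r) = f r" using Ar by (simp add: lam_def)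
      moreover have "(lam r)\<^sup>2 * (2 * A r / f r) = 2 * f r"
        using Ar fr by (simp add: lam_def power_divide power2_eq_square)
      ultimately show ?thesis
        by (simp only: mult.assoc diff_self) simp
    qed
    ultimately have Ml: "(M \<longlongrightarrow> 0) (at r)" by simp
    have "\<forall>\<^sub>F x in at r. norm ((J x - J r) / (x - r)) \<le> M x"
      unfolding eventually_at
    proof (intro exI[of _ "R - r"] conjI ballI impI)
      fix x assume "x \<noteq> r \<and> dist x r < R - r"
      then show "norm ((J x - J r) / (x - r)) \<le> M x"
        using bound[of x] by (simp add: dist_real_def abs_less_iff)
    qed (use r in simp)
    then have "((\<lambda>x. (J x - J r) / (x - r)) \<longlongrightarrow> 0) (at r)" by (rule Lim_null_comparison) (rule Ml)
    then show ?thesis by (simp add: has_field_derivative_iff)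
  qed
  have "J r1 = J r0"
  proof (rule DERIV_isconst_end[OF r01])
    show "continuous_on {r0..r1} J"
      by (rule continuous_at_imp_continuous_on) (use der R DERIV_isCont in \<open>auto intro!: DERIV_isCont[OF der]\<close>)
  qed (use der R in auto)
  then show ?thesis using split[of r0 r1] r01 R by simp
qed

text \<open>Off the singular points {V > t} is open and contains \<open>z\<close>, hence has
  positive area.\<close>

lemma A_pos_below: "z \<notin> S \<Longrightarrow> t < V z \<Longrightarrow> A t > 0"
proof -
  assume z: "z \<notin> S" "t < V z"
  define U where "U = - S \<inter> V -` {t<..}"
  have U: "open U" "z \<in> U"
    unfolding U_def using z open_compl_S V_continuous by (auto intro: continuous_open_preimage)
  show ?thesis
  proof (rule ccontr)
    assume "\<not> A t > 0"
    then have "A t = 0" using A_nonneg[of t] by simp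
    then have "area t = 0" by (simp add: A_def)
    then have "(LINT z|lborel. indicator {z. V z > t} z :: real) = 0" unfolding area_def .
    then have "AE z in lborel. indicator {z. V z > t} z = (0::real)"
      using integral_nonneg_eq_0_iff_AE[OF level_integrable[of t]] by auto
    then have "AE z in lborel. z \<notin> U" by eventually_elim (auto simp: U_def indicator_def split: if_splits)
    then have "AE z in lborel. z \<in> U \<longrightarrow> (1::real) = 0" by eventually_elim auto
    from open_AE_imp[OF U(1) continuous_on_const this U(2)] show False by simp
  qed
qed

text \<open>Vanishing of the defect integral gives the identity almost everywhere on a band around
  V(z); continuity gives it everywhere.\<close>

lemma gradient_norm:
  assumes z: "z \<notin> S" and Az: "A (V z) > 0"
  shows "norm (G z) = lam (V z)"
proof -
  have "(A \<longlongrightarrow> A (V z)) (at_right (V z))" using profile_eq.A_isCont[of "V z"] by (simp add: isCont_def filterlim_at_split)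
  then have "\<forall>\<^sub>F x in at_right (V z). A x > 0" by (rule order_tendstoD) (rule Az)
  then obtain r2 where r2: "r2 > V z" "\<And>x. V z < x \<Longrightarrow> x < r2 \<Longrightarrow> A x > 0" unfolding eventually_at_right_field by blast
  define r1 where "r1 = (V z + r2) / 2"
  define r0 where "r0 = V z - 1"
  have r: "r0 < V z" "V z < r1" "A r1 > 0" using r2 by (auto simp: r1_def r0_def)
  define U where "U = - S \<inter> V -` {r0<..<r1}"
  have U: "open U" "z \<in> U"
    unfolding U_def using z r open_compl_S V_continuous by (auto intro: continuous_open_preimage)
  have int: "integrable lborel (\<lambda>z. indicator {z. r0 < V z \<and> V z \<le> r1} z * def z)"
    by (rule band_defect(1)[where r = r0]) (use r in auto)
  have "(LINT z|lborel. indicator {z. r0 < V z \<and> V z \<le> r1} z * def z) = 0"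
    by (rule defect_zero) (use r in auto)
  then have "AE z in lborel. indicator {z. r0 < V z \<and> V z \<le> r1} z * def z = 0"
    using integral_nonneg_eq_0_iff_AE[OF int] by (auto simp: def_def)
  then have ae: "AE z in lborel. z \<in> U \<longrightarrow> norm (G z) - lam (V z) = 0"
    by eventually_elim (auto simp: U_def indicator_def def_def)
  have cont: "continuous_on U (\<lambda>z. norm (G z) - lam (V z))"
    unfolding lam_def
  proof (intro continuous_intros)
    show "continuous_on U G" by (rule continuous_on_subset[OF contG']) (auto simp: U_def)
    have VU: "continuous_on U V" by (rule continuous_on_subset[OF V_continuous]) (auto simp: U_def)
    show "continuous_on U (\<lambda>z. f (V z))" by (rule continuous_on_compose2[OF f_continuous VU]) auto
    show "continuous_on U (\<lambda>z. A (V z))" by (rule continuous_on_compose2[OF A_continuous VU]) auto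
    show "\<forall>z\<in>U. sqrt (A (V z)) \<noteq> 0"
    proof
      fix z assume "z \<in> U"
      then have "V z < r1" by (auto simp: U_def)
      then have "A (V z) > 0" using A_antimono[of "V z" r1] r(3) by linarith
      then show "sqrt (A (V z)) \<noteq> 0" by simp
    qed
  qed
  from open_AE_imp[OF U(1) cont ae U(2)] show ?thesis by simp
qed

text \<open>Radius of the disc with the area of the superlevel set through \<open>z\<close>; it will
  turn out to be the distance to a centre. The value 0 on \<open>S\<close> is the limit, since V
  tends to infinity there.\<close>

definition N :: "complex \<Rightarrow> real" where "N z = (if z \<in> S then 0 else sqrt (A (V z)))"

lemma N_nonneg: "0 \<le> N z" using A_nonneg by (simp add: N_def)

lemma A_tendsto_top: "(A \<longlongrightarrow> 0) at_top"
proof -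
  have "\<forall>\<^sub>F t in at_top. norm (A t) \<le> exp (2 * t) * A t"
    using eventually_ge_at_top[of 0]
  proof eventually_elim
    case (elim t)
    then have "1 * A t \<le> exp (2 * t) * A t" using A_nonneg[of t] by (intro mult_right_mono) auto
    then show ?case using A_nonneg[of t] by simp
  qed
  then show ?thesis by (rule Lim_null_comparison) (rule A_lim_top)
qed

lemma N_continuous: "continuous_on UNIV N"
proof (rule continuous_at_imp_continuous_on, rule ballI)
  fix z
  show "isCont N z"
  proof (cases "z \<in> S")
    case False
    have "continuous_on (- S) (\<lambda>z. sqrt (A (V z)))"
      by (intro continuous_intros continuous_on_compose2[OF A_continuous V_continuous]) auto
    then have "continuous_on (- S) N" by (rule continuous_on_eq) (simp add: N_def)
    then show ?thesis using False open_compl_S by (simp add: continuous_on_eq_continuous_at)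
  next
    case True
    have "(N \<longlongrightarrow> 0) (at z)"
    proof (rule tendstoI)
      fix \<epsilon> :: real assume \<epsilon>: "\<epsilon> > 0"
      have "\<forall>\<^sub>F t in at_top. A t < \<epsilon>\<^sup>2" by (rule order_tendstoD[OF A_tendsto_top]) (use \<epsilon> in simp)
      then obtain t where t: "A t < \<epsilon>\<^sup>2" by (auto simp: eventually_at_top_linorder)
      obtain e where e: "e > 0" "\<And>w. w \<noteq> z \<Longrightarrow> cmod (w - z) < e \<Longrightarrow> w \<notin> S \<and> V w > t" using V_large_near_S[OF True, of t] by blast
      show "\<forall>\<^sub>F w in at z. dist (N w) 0 < \<epsilon>"
        unfolding eventually_at
      proof (intro exI[of _ e] conjI ballI impI)
        fix w assume "w \<noteq> z \<and> dist w z < e"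
        then have "w \<notin> S" "V w > t" using e(2)[of w] by (auto simp: dist_norm)
        then have "A (V w) < \<epsilon>\<^sup>2" using A_antimono[of t "V w"] t by simp
        then have "sqrt (A (V w)) < \<epsilon>" using \<epsilon> by (simp add: real_less_lsqrt A_nonneg)
        then show "dist (N w) 0 < \<epsilon>" using \<open>w \<notin> S\<close> A_nonneg by (simp add: N_def)
      qed (rule e(1))
    qed
    then show ?thesis using True by (simp add: isCont_def N_def)
  qed
qed

text \<open>The derivative of sqrt(A) is -sqrt(A)/f and |G| = f/sqrt(A), so the gradient has length
  exactly 1.\<close>

lemma N_gradient:
  assumes "N z > 0"
  shows "\<exists>D. GDERIV N z :> D \<and> norm D \<le> 1"
proof -
  have z: "z \<notin> S" and Az: "A (V z) > 0" using assms A_nonneg[of "V z"] by (auto simp: N_def split: if_splits)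
  have fz: "f (V z) > 0" by (rule profile_eq.A_pos_f_pos[OF Az])
  have "DERIV (\<lambda>t. sqrt (A t)) (V z) :> (- (2 * A (V z) / f (V z))) * (inverse (sqrt (A (V z))) / 2)"
    by (rule DERIV_chain2[OF DERIV_real_sqrt[OF Az] profile_eq.A_deriv[OF fz], THEN DERIV_cong]) simp
  moreover have "(- (2 * A (V z) / f (V z))) * (inverse (sqrt (A (V z))) / 2) = - (sqrt (A (V z)) / f (V z))"
  proof -
    have "- (2 * A (V z) / f (V z)) * (inverse (sqrt (A (V z))) / 2) = - (A (V z) / sqrt (A (V z)) / f (V z))"
      by (simp add: field_simps)
    also have "A (V z) / sqrt (A (V z)) = sqrt (A (V z))" using Az by (intro real_div_sqrt) simp
    finally show ?thesis .
  qed
  ultimately have d: "DERIV (\<lambda>t. sqrt (A t)) (V z) :> - (sqrt (A (V z)) / f (V z))" by (rule DERIV_cong)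
  have "GDERIV (\<lambda>z. sqrt (A (V z))) z :> (- (sqrt (A (V z)) / f (V z))) *\<^sub>R G z"
    by (rule GDERIV_DERIV_compose[OF grad'[OF z] d])
  then have "GDERIV N z :> (- (sqrt (A (V z)) / f (V z))) *\<^sub>R G z"
    by (rule GDERIV_cong_open[of _ _ _ "- S"]) (use z open_compl_S in \<open>auto simp: N_def\<close>)
  moreover have "norm ((- (sqrt (A (V z)) / f (V z))) *\<^sub>R G z) = 1"
    using Az fz by (simp add: gradient_norm[OF z Az] lam_def)
  ultimately show ?thesis by auto
qed

lemma N_lipschitz: "N y \<le> N x + cmod (y - x)"
  by (rule lipschitz_of_gradient_off_zeros[OF N_continuous N_nonneg N_gradient])

text \<open>Either a singular point, or a maximum of \<open>V\<close>, which exists since V tends to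
  minus infinity; nothing lies strictly above the maximum.\<close>

lemma N_has_zero: obtains c where "N c = 0"
proof (cases "S = {}")
  case False
  then obtain c where "c \<in> S" by blast
  then show thesis by (intro that[of c]) (simp add: N_def)
next
  case True
  obtain R where R: "R > 0" "\<And>z. R < cmod z \<Longrightarrow> z \<notin> S \<and> V z < V 0" using V_small_far[of "V 0"] by blast
  have cV: "continuous_on (cball 0 R) V" using V_continuous True by (auto intro: continuous_on_subset)
  obtain c where c: "c \<in> cball 0 R" "\<And>z. z \<in> cball 0 R \<Longrightarrow> V z \<le> V c"
    using continuous_attains_sup[OF _ _ cV] R(1) by auto
  have max: "V z \<le> V c" for z
    using c(2)[of z] c(2)[of 0] R by (cases "z \<in> cball 0 R") (auto simp: not_le intro: order_trans less_imp_le)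
  then have "area (V c) = 0" by (simp add: area_def not_less[symmetric] del: not_less)
  then have "A (V c) = 0" by (simp add: A_def)
  then show thesis by (intro that[of c]) (simp add: N_def True)
qed

text \<open>By the Lipschitz bound {N < r} contains the ball of radius \<open>r\<close> around
  \<open>c\<close>. For r = sqrt(A t) both have area pi r^2, so nothing of {N < r} lies outside the
  closed ball; then \<open>t\<close> increases to V(z).\<close>

lemma N_radial:
  assumes c: "N c = 0" and z: "z \<notin> S"
  shows "A (V z) = (cmod (z - c))\<^sup>2"
proof -
  have up: "N w \<le> cmod (w - c)" for w using N_lipschitz[of w c] c by simp
  have step: "cmod (z - c) \<le> sqrt (A t)" if t: "t < V z" for t
  proof -
    define r where "r = sqrt (A t)"
    have At: "A t > 0" by (rule A_pos_below[OF z t])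
    have r: "r > 0" using At by (simp add: r_def)
    define U where "U = {w. N w < r}"
    have U: "open U" unfolding U_def by (intro open_Collect_less continuous_on_const N_continuous)
    have sub: "ball c r \<subseteq> U" using up by (force simp: U_def dist_norm norm_minus_commute intro: le_less_trans)
    have Uz: "z \<in> U"
    proof -
      have "A (V z) < A t"
        using profile_eq.A_strict[OF t] At A_nonneg[of "V z"] by (cases "A (V z) > 0") auto
      then show ?thesis using z by (simp add: U_def N_def r_def)
    qed
    have lev: "w \<in> U \<Longrightarrow> w \<notin> S \<Longrightarrow> V w > t" for w
      using A_antimono[of "V w" t] by (auto simp: U_def N_def r_def not_less[symmetric])
    \<comment> \<open>The closed ball is removed to keep \<open>W\<close> open: an open null set is
      empty.\<close>
    define W where "W = U - cball c r"
    have W: "open W" unfolding W_def by (rule open_Diff[OF U]) simp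
    have [measurable]: "W \<in> sets borel" using W by simp
    have le: "AE w in lborel. indicator W w + indicator (ball c r) w \<le> (indicator {w. V w > t} w :: real)"
      using AE_not_S
    proof eventually_elim
      case (elim w)
      have "V w > t" if "w \<in> U" using lev[OF that elim] .
      then show ?case using sub
        by (cases "w \<in> ball c r"; cases "w \<in> U") (auto simp: W_def indicator_def subset_eq)
    qed
    have iW: "integrable lborel (\<lambda>w. indicator W w :: real)"
    proof (rule Bochner_Integration.integrable_bound[OF level_integrable[of t]])
      show "AE w in lborel. norm (indicator W w :: real) \<le> norm (indicator {w. V w > t} w :: real)"
        using le
      proof eventually_elim
        case (elim w)
        then show ?case by (cases "V w > t"; cases "w \<in> W"; cases "w \<in> ball c r") simp_all
      qed
    qed measurable
    have iB: "integrable lborel (\<lambda>w. indicator (ball c r) w :: real)"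
      by (rule integrable_real_indicator) (use emeasure_bounded_finite[OF bounded_ball] in auto)
    have "(LINT w|lborel. indicator W w) + (LINT w|lborel. indicator (ball c r) w :: real) = (LINT w|lborel. indicator W w + indicator (ball c r) w)"
      by (rule Bochner_Integration.integral_add[OF iW iB, symmetric])
    also have "\<dots> \<le> area t"
      unfolding area_def by (rule integral_mono_AE[OF _ level_integrable le]) (intro Bochner_Integration.integrable_add iW iB)
    also have "area t = pi * r\<^sup>2" using At by (simp add: r_def A_def)
    also have "(LINT w|lborel. indicator (ball c r) w :: real) = pi * r\<^sup>2"
      using r by (simp add: content_ball unit_ball_vol_2)
    finally have "(LINT w|lborel. indicator W w :: real) \<le> 0" by simp
    moreover have "0 \<le> (LINT w|lborel. indicator W w :: real)" by (rule integral_nonneg_AE) auto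
    ultimately have "(LINT w|lborel. indicator W w :: real) = 0" by linarith
    then have "AE w in lborel. indicator W w = (0::real)"
      using integral_nonneg_eq_0_iff_AE[OF iW] by auto
    then have ae: "AE w in lborel. w \<in> W \<longrightarrow> (1::real) = 0" by eventually_elim (auto simp: indicator_def split: if_splits)
    have "z \<notin> W"
    proof
      assume "z \<in> W"
      from open_AE_imp[OF W continuous_on_const ae this] show False by simp
    qed
    then show ?thesis using Uz by (auto simp: W_def r_def dist_norm norm_minus_commute)
  qed
  have "((\<lambda>t. sqrt (A t)) \<longlongrightarrow> sqrt (A (V z))) (at_left (V z))"
    using profile_eq.A_isCont[of "V z"] by (intro tendsto_intros) (simp add: isCont_def filterlim_at_split)
  moreover have "\<forall>\<^sub>F t in at_left (V z). cmod (z - c) \<le> sqrt (A t)"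
    unfolding eventually_at_left_field using step by (intro exI[of _ "V z - 1"]) auto
  ultimately have "cmod (z - c) \<le> sqrt (A (V z))" by (rule tendsto_lowerbound) simp
  moreover have "sqrt (A (V z)) \<le> cmod (z - c)" using up[of z] z by (simp add: N_def)
  ultimately have "sqrt (A (V z)) = cmod (z - c)" by simp
  then show ?thesis using real_sqrt_pow2[OF A_nonneg[of "V z"]] by simp
qed

text \<open>Near a singular point \<open>q\<close> the function N is |w - c|, and by continuity |q -
  c| = N(q) = 0.\<close>

lemma S_at_center:
  assumes c: "N c = 0"
  shows "S \<subseteq> {c}"
proof
  fix q assume q: "q \<in> S"
  obtain e0 where e0: "e0 > 0" "\<And>z. z \<in> S \<Longrightarrow> z \<noteq> q \<Longrightarrow> e0 \<le> cmod (z - q)" by (rule isolated[OF finS]) (rule that)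
  have "\<forall>\<^sub>F w in at q. N w = cmod (w - c)"
    unfolding eventually_at
  proof (intro exI[of _ e0] conjI ballI impI e0(1))
    fix w assume "w \<noteq> q \<and> dist w q < e0"
    then have "w \<notin> S" using e0(2)[of w] by (auto simp: dist_norm)
    then show "N w = cmod (w - c)" using N_radial[OF c] by (simp add: N_def)
  qed
  moreover have "(N \<longlongrightarrow> N q) (at q)" using N_continuous by (simp add: continuous_on_eq_continuous_at isCont_def)
  ultimately have "((\<lambda>w. cmod (w - c)) \<longlongrightarrow> N q) (at q)" by (rule Lim_transform_eventually[rotated])
  moreover have "((\<lambda>w. cmod (w - c)) \<longlongrightarrow> cmod (q - c)) (at q)" by (intro tendsto_intros)
  ultimately have "N q = cmod (q - c)" using tendsto_unique[OF at_neq_bot] by blast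
  then show "q \<in> {c}" using q by (simp add: N_def)
qed

theorem rigidity:
  obtains c r0 where "r0 > 0" "S \<subseteq> {c}"
    "\<And>z. z \<noteq> c \<Longrightarrow> cmod (z - c) \<le> r0 \<Longrightarrow>
       exp (2 * V z) * (cmod (z - c))\<^sup>2 = 4 * (1 + \<alpha>)\<^sup>2 / b * (cmod (z - c) / r0) powr (2 * (1 + \<alpha>)) / (1 + (cmod (z - c) / r0) powr (2 * (1 + \<alpha>)))\<^sup>2"
    "\<And>z. z \<noteq> c \<Longrightarrow> r0 \<le> cmod (z - c) \<Longrightarrow>
       exp (2 * V z) * (cmod (z - c))\<^sup>2 = 4 * (1 + \<beta>)\<^sup>2 / a * (cmod (z - c) / r0) powr (2 * (1 + \<beta>)) / (1 + (cmod (z - c) / r0) powr (2 * (1 + \<beta>)))\<^sup>2"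
proof -
  obtain c where c: "N c = 0" by (rule N_has_zero)
  obtain A1 where A1: "A1 > 0"
    "\<And>t. 0 < A t \<Longrightarrow> A t \<le> A1 \<Longrightarrow> exp (2 * t) * A t = 4 * (1 + \<alpha>)\<^sup>2 / b * (A t / A1) powr (1 + \<alpha>) / (1 + (A t / A1) powr (1 + \<alpha>))\<^sup>2"
    "\<And>t. A1 \<le> A t \<Longrightarrow> exp (2 * t) * A t = 4 * (1 + \<beta>)\<^sup>2 / a * (A t / A1) powr (1 + \<beta>) / (1 + (A t / A1) powr (1 + \<beta>))\<^sup>2"
    by (rule profile_eq.profile) (rule that)
  define r0 where "r0 = sqrt A1"
  have r0: "r0 > 0" "r0\<^sup>2 = A1" using A1(1) by (auto simp: r0_def)
  have pw: "((cmod (z - c))\<^sup>2 / A1) powr x = (cmod (z - c) / r0) powr (2 * x)" if "z \<noteq> c" for z x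
  proof -
    have "(cmod (z - c))\<^sup>2 / A1 = (cmod (z - c) / r0) powr 2"
      using r0 that by (simp add: power_divide flip: r0(2))
    then show ?thesis by (simp add: powr_powr)
  qed
  show thesis
  proof (rule that[OF r0(1) S_at_center[OF c]])
    fix z assume z: "z \<noteq> c"
    have zS: "z \<notin> S" using S_at_center[OF c] z by blast
    have Az: "A (V z) = (cmod (z - c))\<^sup>2" by (rule N_radial[OF c zS])
    show "exp (2 * V z) * (cmod (z - c))\<^sup>2 = 4 * (1 + \<alpha>)\<^sup>2 / b * (cmod (z - c) / r0) powr (2 * (1 + \<alpha>)) / (1 + (cmod (z - c) / r0) powr (2 * (1 + \<alpha>)))\<^sup>2"
      if "cmod (z - c) \<le> r0"
    proof -
      have "(cmod (z - c))\<^sup>2 \<le> r0\<^sup>2" using that by (intro power_mono) auto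
      then show ?thesis using A1(2)[of "V z"] z unfolding Az pw[OF z] r0(2) by simp
    qed
    show "exp (2 * V z) * (cmod (z - c))\<^sup>2 = 4 * (1 + \<beta>)\<^sup>2 / a * (cmod (z - c) / r0) powr (2 * (1 + \<beta>)) / (1 + (cmod (z - c) / r0) powr (2 * (1 + \<beta>)))\<^sup>2"
      if "r0 \<le> cmod (z - c)"
    proof -
      have "r0\<^sup>2 \<le> (cmod (z - c))\<^sup>2" using that r0 by (intro power_mono) auto
      then show ?thesis using A1(3)[of "V z"] unfolding Az pw[OF z] r0(2) by simp
    qed
  qed
qed

end

section \<open>Metrics with Lipschitz gradient\<close>

text \<open>Projection to a ball is a 1-Lipschitz retraction, so it extends Lipschitz functions with
  the same constant; this reduces local statements to global ones.\<close>

lemma lipschitz_on_closest_point: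
  fixes p :: "'a::euclidean_space \<Rightarrow> 'b::metric_space"
  assumes "L-lipschitz_on (cball c r) p" "r \<ge> 0"
  shows "L-lipschitz_on UNIV (\<lambda>x. p (closest_point (cball c r) x))"
proof -
  have ne: "cball c r \<noteq> {}" using assms(2) by simp
  have in_set: "closest_point (cball c r) x \<in> cball c r" for x
    by (rule closest_point_in_set[OF closed_cball ne])
  show ?thesis
  proof (rule lipschitz_onI)
    show "0 \<le> L" using assms(1) by (rule lipschitz_on_nonneg)
    fix x y :: 'a
    have "dist (p (closest_point (cball c r) x)) (p (closest_point (cball c r) y))
        \<le> L * dist (closest_point (cball c r) x) (closest_point (cball c r) y)"
      by (rule lipschitz_onD[OF assms(1) in_set in_set])
    also have "\<dots> \<le> L * dist x y"
      using lipschitz_on_nonneg[OF assms(1)]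
      by (intro mult_left_mono closest_point_lipschitz convex_cball closed_cball ne)
    finally show "dist (p (closest_point (cball c r) x)) (p (closest_point (cball c r) y)) \<le> L * dist x y" .
  qed
qed

text \<open>On each ball the function agrees with a global Lipschitz extension; Lindelof reduces the
  cover to countably many balls.\<close>

lemma locally_lipschitz_directional_differentiable_AE:
  fixes p :: "'a::euclidean_space \<Rightarrow> real"
  assumes loc: "\<And>z. z \<in> U \<Longrightarrow> \<exists>r>0. \<exists>L. L-lipschitz_on (cball z r) p"
  shows "AE z in lborel. z \<in> U \<longrightarrow> (\<lambda>t::real. p (z + t *\<^sub>R d)) differentiable (at 0)"
proof -
  obtain r L where rL: "\<And>z. z \<in> U \<Longrightarrow> r z > 0 \<and> (L z)-lipschitz_on (cball z (r z)) p"
    using loc by metis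
  obtain F where F: "F \<subseteq> (\<lambda>z. ball z (r z)) ` U" "countable F" "\<Union>F = \<Union>((\<lambda>z. ball z (r z)) ` U)"
    by (rule Lindelof[of "(\<lambda>z. ball z (r z)) ` U"]) auto
  obtain Z where Z: "Z \<subseteq> U" "countable Z" "F = (\<lambda>z. ball z (r z)) ` Z"
    using F(1,2) countable_subset_image[of F "\<lambda>z. ball z (r z)" U] by blast
  have "AE w in lborel. w \<in> ball z (r z) \<longrightarrow> (\<lambda>t::real. p (w + t *\<^sub>R d)) differentiable (at 0)" if z: "z \<in> U" for z
  proof -
    have r: "r z > 0" using rL[OF z] by blast
    have "(L z)-lipschitz_on UNIV (\<lambda>x. p (closest_point (cball z (r z)) x))"
      by (rule lipschitz_on_closest_point) (use rL[OF z] in auto)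
    from lipschitz_directional_differentiable_AE[OF this, of d]
    show ?thesis
    proof eventually_elim
      case (elim w)
      show ?case
      proof
        assume w: "w \<in> ball z (r z)"
        from elim obtain D where "((\<lambda>t. p (closest_point (cball z (r z)) (w + t *\<^sub>R d))) has_vector_derivative D) (at 0)"
          by (auto simp: vector_derivative_works)
        then have "((\<lambda>t. p (w + t *\<^sub>R d)) has_vector_derivative D) (at 0)"
          by (rule has_vector_derivative_line_cong[OF _ open_ball w]) (simp add: closest_point_self)
        then show "(\<lambda>t. p (w + t *\<^sub>R d)) differentiable (at 0)"
          by (rule differentiableI_vector)
      qed
    qed
  qed
  then have "AE w in lborel. w \<in> ball z (r z) \<longrightarrow> (\<lambda>t::real. p (w + t *\<^sub>R d)) differentiable (at 0)" if "z \<in> Z" for z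
    using Z(1) that by blast
  then have "AE w in lborel. \<forall>z\<in>Z. w \<in> ball z (r z) \<longrightarrow> (\<lambda>t::real. p (w + t *\<^sub>R d)) differentiable (at 0)"
    by (rule AE_ball_countable'[OF _ Z(2)])
  then show ?thesis
  proof eventually_elim
    case (elim w)
    show ?case
    proof
      assume w: "w \<in> U"
      then have "w \<in> \<Union>((\<lambda>z. ball z (r z)) ` U)" using rL[OF w] by (intro UN_I[OF w]) simp
      then obtain z where "z \<in> Z" "w \<in> ball z (r z)" using F(3) Z(3) by blast
      then show "(\<lambda>t. p (w + t *\<^sub>R d)) differentiable (at 0)" using elim by blast
    qed
  qed
qed

text \<open>The limit along the steps 1/(n+1) is Borel on the whole space and is the derivative
  wherever that exists.\<close>

lemma directional_derivative_borel:
  fixes p :: "'a::euclidean_space \<Rightarrow> real"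
  assumes [measurable]: "p \<in> borel_measurable borel"
  obtains D where "D \<in> borel_measurable borel"
    "\<And>z. (\<lambda>t::real. p (z + t *\<^sub>R d)) differentiable (at 0) \<Longrightarrow> DERIV (\<lambda>t. p (z + t *\<^sub>R d)) 0 :> D z"
proof
  define D where "D z = lim (\<lambda>n::nat. (p (z + inverse (real (Suc n)) *\<^sub>R d) - p z) / inverse (real (Suc n)))" for z
  show "D \<in> borel_measurable borel" unfolding D_def[abs_def] by measurable
  fix z assume "(\<lambda>t::real. p (z + t *\<^sub>R d)) differentiable (at 0)"
  then obtain E where E: "DERIV (\<lambda>t. p (z + t *\<^sub>R d)) 0 :> E" by (auto simp: real_differentiable_def)
  then have "((\<lambda>h. (p (z + h *\<^sub>R d) - p z) / h) \<longlongrightarrow> E) (at 0)" by (simp add: DERIV_def)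
  moreover have "filterlim (\<lambda>n. inverse (real (Suc n))) (at 0) sequentially"
    using LIMSEQ_inverse_real_of_nat by (simp add: filterlim_at)
  ultimately have "(\<lambda>n::nat. (p (z + inverse (real (Suc n)) *\<^sub>R d) - p z) / inverse (real (Suc n))) \<longlonglongrightarrow> E"
    by (rule filterlim_compose)
  then have "D z = E" unfolding D_def by (rule limI)
  then show "DERIV (\<lambda>t. p (z + t *\<^sub>R d)) 0 :> D z" using E by simp
qed

text \<open>Compactness gives one constant on the ball of radius R + 1, and projection extends the
  function. The additional unit of radius ensures that points outside project to where
  \<open>h\<close> vanishes.\<close>

lemma locally_lipschitz_compact_support:
  fixes h :: "'a::euclidean_space \<Rightarrow> real"
  assumes loc: "\<And>z. \<exists>r>0. \<exists>L. L-lipschitz_on (cball z r) h"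
    and supp: "\<And>z. norm z > R \<Longrightarrow> h z = 0" and R: "R > 0"
  obtains L where "L-lipschitz_on UNIV h"
proof -
  define X where "X = cball (0::'a) (R + 1)"
  have ll: "local_lipschitz {0::real} X (\<lambda>_. h)"
  proof (rule local_lipschitzI)
    fix t :: real and x
    obtain r L where rL: "r > 0" "L-lipschitz_on (cball x r) h" using loc by blast
    have "L-lipschitz_on (cball x r \<inter> X) h" by (rule lipschitz_on_subset[OF rL(2)]) auto
    then show "\<exists>u>0. \<exists>L. \<forall>t\<in>cball t u \<inter> {0}. L-lipschitz_on (cball x u \<inter> X) h" using rL(1) by blast
  qed
  have X: "compact X" "compact {0::real}" by (auto simp: X_def)
  obtain L where L: "\<And>t. t \<in> {0::real} \<Longrightarrow> L-lipschitz_on X h"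
    by (rule local_lipschitz_compact_implies_lipschitz[OF ll X]) (rule continuous_on_const, rule that, assumption)
  have "L-lipschitz_on UNIV (\<lambda>x. h (closest_point X x))"
    unfolding X_def by (rule lipschitz_on_closest_point) (use L R in \<open>auto simp: X_def\<close>)
  moreover have "h (closest_point X x) = h x" for x
  proof (cases "x \<in> X")
    case True
    then show ?thesis by (simp add: closest_point_self)
  next
    case False
    have x: "norm x > R + 1" using False by (simp add: X_def)
    \<comment> \<open>The radial comparison point: it shows that the projection of \<open>x\<close>
      has norm at least R + 1.\<close>
    define y where "y = ((R + 1) / norm x) *\<^sub>R x"
    have "y \<in> X" using R x by (simp add: X_def y_def)
    then have cl: "dist x (closest_point X x) \<le> dist x y" by (intro closest_point_le) (simp_all add: X_def)
    have "x - y = (1 - (R + 1) / norm x) *\<^sub>R x" by (simp add: y_def algebra_simps)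
    moreover have "norm x > 0" using x R by linarith
    then have "1 - (R + 1) / norm x \<ge> 0" using x by (simp add: divide_le_eq)
    ultimately have "dist x y = (1 - (R + 1) / norm x) * norm x" by (simp only: dist_norm norm_scaleR abs_of_nonneg)
    then have "dist x y = norm x - (R + 1)" using \<open>norm x > 0\<close> by (simp add: left_diff_distrib)
    moreover have "norm x \<le> norm (closest_point X x) + dist x (closest_point X x)"
      using norm_triangle_sub[of x "closest_point X x"] by (simp add: dist_norm)
    ultimately have "norm (closest_point X x) > R" using cl by linarith
    moreover have "norm x > R" using x by simp
    ultimately show ?thesis using supp by simp
  qed
  ultimately show thesis using that by simp
qed

text \<open>The test function vanishes near \<open>P\<close>, so its product with \<open>p\<close>
  is globally Lipschitz although \<open>p\<close> may be wild at \<open>P\<close>.\<close>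

lemma integral_by_parts_locally_lipschitz:
  fixes p :: "complex \<Rightarrow> real"
  assumes P: "finite P" and phi: "C1c \<phi> \<Phi>" and van: "\<And>q. q \<in> P \<Longrightarrow> \<exists>e>0. \<forall>z\<in>ball q e. \<phi> z = 0"
    and loc: "\<And>z. z \<notin> P \<Longrightarrow> \<exists>r>0. \<exists>L. L-lipschitz_on (cball z r) p"
    and [measurable]: "p \<in> borel_measurable borel" "D \<in> borel_measurable borel"
    and D: "AE z in lborel. z \<notin> P \<longrightarrow> DERIV (\<lambda>t. p (z + t *\<^sub>R d)) 0 :> D z"
  shows "has_bochner_integral lborel (\<lambda>z. \<phi> z * D z + inner d (\<Phi> z) * p z) 0"
proof -
  obtain R where R0: "R > 0" and R: "\<And>z. norm z > R \<Longrightarrow> \<phi> z = 0" "\<And>z. norm z > R \<Longrightarrow> \<Phi> z = 0"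
    by (rule C1cE[OF phi]) (rule that)
  have [measurable]: "\<phi> \<in> borel_measurable borel" "\<Phi> \<in> borel_measurable borel" using C1c_borel[OF phi] by auto
  have "\<exists>r>0. \<exists>L. L-lipschitz_on (cball z r) (\<lambda>w. \<phi> w * p w)" for z
  proof (cases "z \<in> P")
    case True
    then obtain e where e: "e > 0" "\<forall>w\<in>ball z e. \<phi> w = 0" using van by blast
    have l0: "0-lipschitz_on (cball z (e/2)) (\<lambda>w. 0::real)" by (rule lipschitz_on_constant)
    have "0-lipschitz_on (cball z (e/2)) (\<lambda>w. \<phi> w * p w)"
    proof (rule lipschitz_on_transform[OF l0])
      show "\<phi> w * p w = 0" if "w \<in> cball z (e/2)" for w using e that by simp
    qed
    then show ?thesis using e(1) half_gt_zero by blast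
  next
    case False
    then obtain r L where rL: "r > 0" "L-lipschitz_on (cball z r) p" using loc by blast
    define h where "h x = p (closest_point (cball z r) x)" for x
    have hL: "L-lipschitz_on UNIV h" unfolding h_def[abs_def] by (rule lipschitz_on_closest_point) (use rL in auto)
    have "norm (h x) \<le> L * r + norm (p z)" for x
    proof -
      have c: "closest_point (cball z r) x \<in> cball z r" by (rule closest_point_in_set) (use rL in auto)
      have "dist (h x) (p z) \<le> L * dist (closest_point (cball z r) x) z"
        unfolding h_def by (rule lipschitz_onD[OF rL(2) c]) (use rL in simp)
      also have "\<dots> \<le> L * r"
        using c lipschitz_on_nonneg[OF rL(2)] by (intro mult_left_mono) (auto simp: dist_commute)
      finally show ?thesis by (simp add: dist_real_def)
    qed
    then have "blip h" by (rule blipI[OF hL])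
    then have "blip (\<lambda>w. \<phi> w * h w)" by (rule blip_mult[OF C1c_blip[OF phi]])
    then obtain M where "M-lipschitz_on UNIV (\<lambda>w. \<phi> w * h w)" unfolding blip_def by blast
    then have "M-lipschitz_on (cball z r) (\<lambda>w. \<phi> w * h w)" by (rule lipschitz_on_subset) simp
    then have "M-lipschitz_on (cball z r) (\<lambda>w. \<phi> w * p w)"
      by (rule lipschitz_on_transform) (simp add: h_def closest_point_self)
    then show ?thesis using rL(1) by blast
  qed
  moreover have "norm z > R \<Longrightarrow> \<phi> z * p z = 0" for z using R(1) by simp
  ultimately obtain L where L: "L-lipschitz_on UNIV (\<lambda>w. \<phi> w * p w)"
    by (rule locally_lipschitz_compact_support[OF _ _ R0, of "\<lambda>z. \<phi> z * p z"]) (assumption | rule that)+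
  have "AE z in lborel. z \<notin> P"
    using finite_imp_null_set_lborel[OF P] by (rule AE_not_in)
  then have ae: "AE z in lborel. ((\<lambda>t. \<phi> (z + t *\<^sub>R d) * p (z + t *\<^sub>R d)) has_vector_derivative
      (\<phi> z * D z + inner d (\<Phi> z) * p z)) (at 0)"
    using D
  proof eventually_elim
    case (elim z)
    then have 1: "DERIV (\<lambda>t. p (z + t *\<^sub>R d)) 0 :> D z" by blast
    have 2: "DERIV (\<lambda>t. \<phi> (z + t *\<^sub>R d)) 0 :> inner d (\<Phi> z)"
      by (rule GDERIV_directional) (use phi in \<open>simp add: C1c_def\<close>)
    show ?case
      using DERIV_mult[OF 2 1] by (simp add: has_real_derivative_iff_has_vector_derivative[symmetric] add.commute mult.commute)
  qed
  show ?thesis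
    by (rule has_integral_directional_derivative_zero[OF L _ ae]) (use R(1) in auto)
qed

text \<open>The local gradients agree by uniqueness, so one global choice inherits their Lipschitz
  bounds; the value 0 on \<open>P\<close> fixes it for measurability.\<close>

lemma regular_gradient:
  assumes P: "finite P" and reg: "\<And>z. z \<notin> P \<Longrightarrow> regular_at \<rho> z"
  obtains G where "\<And>z. z \<notin> P \<Longrightarrow> \<rho> z > 0" "\<And>z. z \<notin> P \<Longrightarrow> GDERIV (\<lambda>z. ln (\<rho> z)) z :> G z"
    "\<And>z. z \<in> P \<Longrightarrow> G z = 0" "\<And>z. z \<notin> P \<Longrightarrow> \<exists>r>0. \<exists>L. L-lipschitz_on (cball z r) G"
proof
  define G where "G z = (if z \<in> P then 0 else (THE D. GDERIV (\<lambda>z. ln (\<rho> z)) z :> D))" for z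
  have G: "G z = D" if "z \<notin> P" "GDERIV (\<lambda>z. ln (\<rho> z)) z :> D" for z D
    using that GDERIV_unique by (auto simp: G_def intro!: the_equality)
  show "\<rho> z > 0" if "z \<notin> P" for z using reg[OF that] by (auto simp: regular_at_def)
  show "GDERIV (\<lambda>z. ln (\<rho> z)) z :> G z" if z: "z \<notin> P" for z
  proof -
    obtain D where "GDERIV (\<lambda>z. ln (\<rho> z)) z :> D"
      using reg[OF z] unfolding regular_at_def C11_on_def by blast
    then show ?thesis using G[OF z] by simp
  qed
  show "G z = 0" if "z \<in> P" for z using that by (simp add: G_def)
  show "\<exists>r>0. \<exists>L. L-lipschitz_on (cball z r) G" if z: "z \<notin> P" for z
  proof -
    obtain U H where U: "open U" "z \<in> U" "\<And>w. w \<in> U \<Longrightarrow> GDERIV (\<lambda>z. ln (\<rho> z)) w :> H w"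
      and L: "\<And>w. w \<in> U \<Longrightarrow> \<exists>r>0. \<exists>L. L-lipschitz_on (cball w r \<inter> U) H"
      using reg[OF z] unfolding regular_at_def C11_on_def by blast
    obtain r L where rL: "r > 0" "L-lipschitz_on (cball z r \<inter> U) H" using L[OF U(2)] by blast
    have "open (U - P)" "z \<in> U - P" using U z finite_imp_closed[OF P] by auto
    then obtain e where e: "e > 0" "cball z e \<subseteq> U - P" using open_contains_cball by blast
    have "L-lipschitz_on (cball z (min r e)) H"
      by (rule lipschitz_on_subset[OF rL(2)]) (use e in auto)
    moreover have "H w = G w" if "w \<in> cball z (min r e)" for w
      using G[OF _ U(3)] that e(2) by auto
    ultimately have "L-lipschitz_on (cball z (min r e)) G"
      using lipschitz_on_transform[of L "cball z (min r e)" H G] by metis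
    then show ?thesis using rL(1) e(1) by (intro exI[of _ "min r e"]) auto
  qed
qed

text \<open>The second derivatives in the definition of the Laplacian are iterated
  \<open>deriv\<close>; near \<open>z\<close> the inner one is a component of the gradient along the
  line.\<close>

lemma laplacian_eq:
  assumes U: "open U" "z \<in> U" "\<And>w. w \<in> U \<Longrightarrow> GDERIV u w :> G w"
    and D: "DERIV (\<lambda>t. Re (G (z + t *\<^sub>R 1))) 0 :> D1" "DERIV (\<lambda>t. Im (G (z + t *\<^sub>R \<i>))) 0 :> D2"
  shows "laplacian u z = D1 + D2"
proof -
  have 1: "(deriv ^^ 2) (\<lambda>t::real. u (z + t *\<^sub>R d)) 0 = E"
    if d: "DERIV (\<lambda>t. inner d (G (z + t *\<^sub>R d))) 0 :> E" for d E
  proof -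
    have "deriv (\<lambda>t. u (z + t *\<^sub>R d)) s = inner d (G (z + s *\<^sub>R d))" if "z + s *\<^sub>R d \<in> U" for s
    proof -
      have "((\<lambda>t. u ((z + s *\<^sub>R d) + t *\<^sub>R d)) has_real_derivative inner d (G (z + s *\<^sub>R d))) (at 0)"
        by (rule GDERIV_directional[OF U(3)[OF that]])
      then have "((\<lambda>t. (\<lambda>t. u (z + t *\<^sub>R d)) (t + s)) has_real_derivative inner d (G (z + s *\<^sub>R d))) (at 0)"
        by (simp add: scaleR_add_left add_ac)
      then have "DERIV (\<lambda>t. u (z + t *\<^sub>R d)) s :> inner d (G (z + s *\<^sub>R d))"
        using DERIV_shift[of "\<lambda>t. u (z + t *\<^sub>R d)" _ 0 s] by simp
      then show ?thesis by (rule DERIV_imp_deriv)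
    qed
    then have "\<forall>\<^sub>F s in nhds 0. deriv (\<lambda>t. u (z + t *\<^sub>R d)) s = inner d (G (z + s *\<^sub>R d))"
      using line_eventually[OF U(1,2), of d] by (auto elim: eventually_mono)
    then have "deriv (deriv (\<lambda>t. u (z + t *\<^sub>R d))) 0 = deriv (\<lambda>s. inner d (G (z + s *\<^sub>R d))) 0"
      by (rule deriv_cong_ev) simp
    also have "\<dots> = E" using d by (rule DERIV_imp_deriv)
    finally show ?thesis by (simp add: numeral_2_eq_2)
  qed
  have e1: "(\<lambda>t::real. u (z + of_real t)) = (\<lambda>t. u (z + t *\<^sub>R 1))" by (simp add: scaleR_conv_of_real)
  have e2: "(\<lambda>t::real. u (z + \<i> * of_real t)) = (\<lambda>t. u (z + t *\<^sub>R \<i>))" by (simp add: scaleR_conv_of_real mult.commute)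
  have i1: "inner 1 w = Re w" "inner \<i> w = Im w" for w :: complex by (simp_all add: inner_complex_def)
  have "(deriv ^^ 2) (\<lambda>t::real. u (z + t *\<^sub>R 1)) 0 = D1" by (rule 1) (use D(1) in \<open>simp only: i1\<close>)
  moreover have "(deriv ^^ 2) (\<lambda>t::real. u (z + t *\<^sub>R \<i>)) 0 = D2" by (rule 1) (use D(2) in \<open>simp only: i1\<close>)
  ultimately show ?thesis unfolding laplacian_def e1 e2 by simp
qed

text \<open>The weak equation comes from integrating by parts in each component of the gradient of
  ln g, which is differentiable almost everywhere in its own direction; V is half of ln g.\<close>

lemma plane_data:
  assumes P: "finite P" and reg: "\<And>z. z \<notin> P \<Longrightarrow> regular_at (\<lambda>z. g (Some z)) z"
    and a0: "0 < a" and K: "AE z in lborel. a \<le> gauss_curvature g z \<and> gauss_curvature g z \<le> b"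
  obtains V G k where "V \<in> borel_measurable borel" "k \<in> borel_measurable borel"
    "\<And>z. z \<notin> P \<Longrightarrow> g (Some z) = exp (2 * V z)"
    "\<And>z. z \<notin> P \<Longrightarrow> GDERIV V z :> G z" "continuous_on (- P) G" "\<And>z. a \<le> k z" "\<And>z. k z \<le> b"
    "\<And>\<phi> \<Phi>. C1c \<phi> \<Phi> \<Longrightarrow> \<forall>q\<in>P. \<exists>e>0. \<forall>z\<in>ball q e. \<phi> z = 0 \<Longrightarrow>
      integrable lborel (\<lambda>z. k z * exp (2 * V z) * \<phi> z) \<and> integrable lborel (\<lambda>z. \<Phi> z \<bullet> G z) \<and>
      (LINT z|lborel. \<Phi> z \<bullet> G z) = (LINT z|lborel. k z * exp (2 * V z) * \<phi> z)"
proof -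
  obtain H where H: "\<And>z. z \<notin> P \<Longrightarrow> g (Some z) > 0" "\<And>z. z \<notin> P \<Longrightarrow> GDERIV (\<lambda>z. ln (g (Some z))) z :> H z"
    "\<And>z. z \<in> P \<Longrightarrow> H z = 0" "\<And>z. z \<notin> P \<Longrightarrow> \<exists>r>0. \<exists>L. L-lipschitz_on (cball z r) H"
    by (rule regular_gradient[OF P, of "\<lambda>z. g (Some z)"]) (rule reg, assumption, rule that)
  define u where "u z = ln (g (Some z))" for z
  have oP: "open (- P)" using finite_imp_closed[OF P] by auto
  have Hc: "continuous_on (- P) H"
  proof (rule continuous_at_imp_continuous_on, rule ballI)
    fix z assume "z \<in> - P"
    then obtain r L where rL: "r > 0" "L-lipschitz_on (cball z r) H" using H(4) by blast
    have "continuous_on (ball z r) H"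
      by (rule continuous_on_subset[OF lipschitz_on_continuous_on[OF rL(2)]]) auto
    then show "isCont H z" using rL(1) by (simp add: continuous_on_eq_continuous_at)
  qed
  have uc: "continuous_on (- P) u"
  proof (rule continuous_at_imp_continuous_on, rule ballI)
    fix z assume "z \<in> - P"
    then have "(u has_derivative (\<lambda>h. inner h (H z))) (at z)"
      using H(2)[of z] by (simp add: gderiv_def u_def[abs_def])
    then show "isCont u z" by (rule has_derivative_continuous)
  qed
  have Pb: "P \<in> sets borel" using finite_imp_closed[OF P] by (rule borel_closed)
  define V where "V z = (if z \<in> P then 0 else u z / 2)" for z
  have [measurable]: "V \<in> borel_measurable borel"
    unfolding V_def[abs_def]
    by (rule borel_measurable_continuous_on_if[OF Pb]) (intro continuous_intros uc; simp)+
  have "(\<lambda>z. if z \<in> P then 0 else H z) \<in> borel_measurable borel"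
    by (rule borel_measurable_continuous_on_if[OF Pb _ Hc]) simp
  moreover have "(\<lambda>z. if z \<in> P then 0 else H z) = H" using H(3) by (auto simp: fun_eq_iff)
  ultimately have [measurable]: "H \<in> borel_measurable borel" by simp
  have m1: "(\<lambda>z. Re (H z)) \<in> borel_measurable borel" and m2: "(\<lambda>z. Im (H z)) \<in> borel_measurable borel" by measurable
  obtain D1 where [measurable]: "D1 \<in> borel_measurable borel"
    and D1: "\<And>z. (\<lambda>t::real. Re (H (z + t *\<^sub>R 1))) differentiable (at 0) \<Longrightarrow> DERIV (\<lambda>t. Re (H (z + t *\<^sub>R 1))) 0 :> D1 z"
    by (rule directional_derivative_borel[OF m1, of 1]) (rule that)
  obtain D2 where [measurable]: "D2 \<in> borel_measurable borel"
    and D2: "\<And>z. (\<lambda>t::real. Im (H (z + t *\<^sub>R \<i>))) differentiable (at 0) \<Longrightarrow> DERIV (\<lambda>t. Im (H (z + t *\<^sub>R \<i>))) 0 :> D2 z"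
    by (rule directional_derivative_borel[OF m2, of \<i>]) (rule that)
  have lip_Re: "L-lipschitz_on X (\<lambda>z. Re (H z))" and lip_Im: "L-lipschitz_on X (\<lambda>z. Im (H z))"
    if l: "L-lipschitz_on X H" for L X
  proof -
    have "dist (Re (H x)) (Re (H y)) \<le> dist (H x) (H y)" "dist (Im (H x)) (Im (H y)) \<le> dist (H x) (H y)" for x y
      using abs_Re_le_cmod[of "H x - H y"] abs_Im_le_cmod[of "H x - H y"] by (auto simp: dist_norm)
    then show "L-lipschitz_on X (\<lambda>z. Re (H z))" "L-lipschitz_on X (\<lambda>z. Im (H z))"
      using l unfolding lipschitz_on_def by (meson order_trans)+
  qed
  have loc1: "\<exists>r>0. \<exists>L. L-lipschitz_on (cball z r) (\<lambda>z. Re (H z))"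
    and loc2: "\<exists>r>0. \<exists>L. L-lipschitz_on (cball z r) (\<lambda>z. Im (H z))" if "z \<notin> P" for z
    using H(4)[OF that] lip_Re lip_Im by blast+
  have "AE z in lborel. z \<in> - P \<longrightarrow> (\<lambda>t::real. Re (H (z + t *\<^sub>R 1))) differentiable (at 0)"
    by (rule locally_lipschitz_directional_differentiable_AE) (use loc1 in auto)
  then have A1: "AE z in lborel. z \<notin> P \<longrightarrow> DERIV (\<lambda>t. Re (H (z + t *\<^sub>R 1))) 0 :> D1 z"
    by eventually_elim (use D1 in blast)
  have "AE z in lborel. z \<in> - P \<longrightarrow> (\<lambda>t::real. Im (H (z + t *\<^sub>R \<i>))) differentiable (at 0)"
    by (rule locally_lipschitz_directional_differentiable_AE) (use loc2 in auto)
  then have A2: "AE z in lborel. z \<notin> P \<longrightarrow> DERIV (\<lambda>t. Im (H (z + t *\<^sub>R \<i>))) 0 :> D2 z"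
    by eventually_elim (use D2 in blast)
  have notP: "AE z in lborel. z \<notin> P" using finite_imp_null_set_lborel[OF P] by (rule AE_not_in)
  have gV: "g (Some z) = exp (2 * V z)" if "z \<notin> P" for z
    using H(1)[OF that] that by (simp add: V_def u_def)
  have curv: "AE z in lborel. - (D1 z + D2 z) / (2 * exp (2 * V z)) = gauss_curvature g z"
    using notP A1 A2
  proof eventually_elim
    case (elim z)
    have "laplacian (\<lambda>z. ln (g (Some z))) z = D1 z + D2 z"
      by (rule laplacian_eq[OF oP, of _ _ H]) (use elim H(2) in auto)
    then show ?case using gV elim by (simp add: gauss_curvature_def)
  qed
  \<comment> \<open>An almost everywhere inequality is satisfied somewhere, since the plane is not a
    null set.\<close>
  have ab: "a \<le> b"
  proof (rule ccontr)
    assume "\<not> a \<le> b"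
    then have "AE z in lborel. z \<in> (UNIV :: complex set) \<longrightarrow> (1::real) = 0" using K by (auto elim: eventually_mono)
    from open_AE_imp[OF open_UNIV continuous_on_const this] show False by simp
  qed
  \<comment> \<open>Clamping gives a Borel function with the bounds at every point; it equals the
    curvature almost everywhere.\<close>
  define k where "k z = max a (min b (- (D1 z + D2 z) / (2 * exp (2 * V z))))" for z
  have [measurable]: "k \<in> borel_measurable borel" unfolding k_def[abs_def] by measurable
  have kK: "AE z in lborel. k z * exp (2 * V z) = - (D1 z + D2 z) / 2"
    using curv K
  proof eventually_elim
    case (elim z)
    then have "k z = - (D1 z + D2 z) / (2 * exp (2 * V z))" by (simp add: k_def)
    then show ?case by simp
  qed
  have GV: "GDERIV V z :> (1/2) *\<^sub>R H z" if z: "z \<notin> P" for z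
  proof (rule GDERIV_cong_open[OF _ oP])
    show "GDERIV (\<lambda>z. (1/2) *\<^sub>R u z) z :> (1/2) *\<^sub>R H z"
      using has_derivative_scaleR_right[of u "\<lambda>h. h \<bullet> H z" "at z" "1/2"] H(2)[OF z]
      by (simp add: gderiv_def u_def[abs_def])
  qed (use z in \<open>auto simp: V_def\<close>)
  show thesis
  proof (rule that[of V k "\<lambda>z. (1/2) *\<^sub>R H z"])
    show "V \<in> borel_measurable borel" "k \<in> borel_measurable borel" by measurable
    show "continuous_on (- P) (\<lambda>z. (1/2) *\<^sub>R H z)" by (intro continuous_intros Hc)
    show "a \<le> k z" "k z \<le> b" for z using ab by (auto simp: k_def)
    fix \<phi> \<Phi> assume phi: "C1c \<phi> \<Phi>" and "\<forall>q\<in>P. \<exists>e>0. \<forall>z\<in>ball q e. \<phi> z = 0"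
    then have van: "\<And>q. q \<in> P \<Longrightarrow> \<exists>e>0. \<forall>z\<in>ball q e. \<phi> z = 0" by blast
    have I1: "has_bochner_integral lborel (\<lambda>z. \<phi> z * D1 z + inner 1 (\<Phi> z) * Re (H z)) 0"
      by (rule integral_by_parts_locally_lipschitz[OF P phi van loc1 _ _ A1]) measurable
    have I2: "has_bochner_integral lborel (\<lambda>z. \<phi> z * D2 z + inner \<i> (\<Phi> z) * Im (H z)) 0"
      by (rule integral_by_parts_locally_lipschitz[OF P phi van loc2 _ _ A2]) measurable
    have I: "has_bochner_integral lborel (\<lambda>z. \<phi> z * (D1 z + D2 z) + \<Phi> z \<bullet> H z) 0"
      using has_bochner_integral_add[OF I1 I2] by (simp add: inner_complex_def algebra_simps)
    have J: "integrable lborel (\<lambda>z. \<Phi> z \<bullet> H z)"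
      by (rule C1c_inner_integrable_locally_const[OF phi oP Hc]) (use van in blast)
    have "has_bochner_integral lborel (\<lambda>z. \<Phi> z \<bullet> H z) (LINT z|lborel. \<Phi> z \<bullet> H z)"
      using J by (rule has_bochner_integral_integrable)
    from has_bochner_integral_diff[OF this I]
    have "has_bochner_integral lborel (\<lambda>z. - (\<phi> z * (D1 z + D2 z))) (LINT z|lborel. \<Phi> z \<bullet> H z)" by simp
    then have "has_bochner_integral lborel (\<lambda>z. (1/2) * (- (\<phi> z * (D1 z + D2 z)))) ((1/2) * (LINT z|lborel. \<Phi> z \<bullet> H z))"
      by (rule has_bochner_integral_mult_right)
    moreover have "has_bochner_integral lborel (\<lambda>z. (1/2) * (- (\<phi> z * (D1 z + D2 z)))) x
        \<longleftrightarrow> has_bochner_integral lborel (\<lambda>z. k z * exp (2 * V z) * \<phi> z) x" for x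
    proof (rule has_bochner_integral_cong_AE)
      show "AE z in lborel. (1/2) * (- (\<phi> z * (D1 z + D2 z))) = k z * exp (2 * V z) * \<phi> z"
        using kK
      proof eventually_elim
        case (elim z)
        show ?case unfolding elim by (simp add: algebra_simps)
      qed
      show "(\<lambda>z. k z * exp (2 * V z) * \<phi> z) \<in> borel_measurable lborel"
        using C1c_borel(1)[OF phi] by measurable
      show "(\<lambda>z. (1/2) * (- (\<phi> z * (D1 z + D2 z)))) \<in> borel_measurable lborel"
        using C1c_borel(1)[OF phi] by measurable
    qed
    ultimately have *: "has_bochner_integral lborel (\<lambda>z. k z * exp (2 * V z) * \<phi> z) ((1/2) * (LINT z|lborel. \<Phi> z \<bullet> H z))"
      by simp
    show "integrable lborel (\<lambda>z. k z * exp (2 * V z) * \<phi> z) \<and> integrable lborel (\<lambda>z. \<Phi> z \<bullet> ((1/2) *\<^sub>R H z)) \<and>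
      (LINT z|lborel. \<Phi> z \<bullet> ((1/2) *\<^sub>R H z)) = (LINT z|lborel. k z * exp (2 * V z) * \<phi> z)"
      using * J by (simp add: has_bochner_integral_iff)
  qed (use gV GV in auto)
qed

section \<open>Inversion and conic points\<close>

text \<open>The change of variables formula is applied on \<open>real^2\<close>; this isomorphism
  carries it, together with Lebesgue measure, to the complex plane.\<close>

definition complex_of_vec :: "real^2 \<Rightarrow> complex" where "complex_of_vec x = Complex (x$1) (x$2)"

definition vec_of_complex :: "complex \<Rightarrow> real^2" where "vec_of_complex z = (\<chi> i. if i = 1 then Re z else Im z)"

lemma vec_of_complex_nth [simp]: "vec_of_complex z $ 1 = Re z" "vec_of_complex z $ 2 = Im z"
  by (simp_all add: vec_of_complex_def)

lemma complex_of_vec_inverse [simp]: "complex_of_vec (vec_of_complex z) = z" "vec_of_complex (complex_of_vec x) = x"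
  by (simp_all add: complex_of_vec_def vec_eq_iff forall_2)

lemma bounded_linear_complex_of_vec: "bounded_linear complex_of_vec"
  unfolding linear_conv_bounded_linear[symmetric]
  by (rule linearI) (auto simp: complex_of_vec_def complex_eq_iff)

lemma bounded_linear_vec_of_complex: "bounded_linear vec_of_complex"
  unfolding linear_conv_bounded_linear[symmetric]
  by (rule linearI) (auto simp: vec_eq_iff forall_2)

lemma complex_of_vec_borel [measurable]: "complex_of_vec \<in> borel_measurable borel"
  by (intro borel_measurable_continuous_onI linear_continuous_on bounded_linear_complex_of_vec)

lemma Basis_vec_2: "(Basis :: (real^2) set) = {axis 1 1, axis 2 1}"
  by (auto simp: Basis_vec_def exhaust_2) (metis exhaust_2)+

lemma lborel_complex_eq_distr: "(lborel :: complex measure) = distr lborel borel complex_of_vec"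
proof (rule lborel_eqI)
  fix l u :: complex assume lu: "\<And>b. b \<in> Basis \<Longrightarrow> l \<bullet> b \<le> u \<bullet> b"
  have ax: "axis 1 1 \<noteq> (axis 2 1 :: real^2)" by (simp add: axis_eq_axis)
  have lu': "Re l \<le> Re u" "Im l \<le> Im u" using lu[of 1] lu[of \<i>] by (auto simp: Basis_complex_def)
  have "complex_of_vec -` box l u = box (vec_of_complex l) (vec_of_complex u)"
    by (auto simp: box_def Basis_complex_def Basis_vec_2 complex_of_vec_def inner_axis)
  then have "emeasure (distr lborel borel complex_of_vec) (box l u) = emeasure lborel (box (vec_of_complex l) (vec_of_complex u))"
    by (subst emeasure_distr) auto
  also have "\<dots> = ennreal (\<Prod>b\<in>Basis. (vec_of_complex u - vec_of_complex l) \<bullet> b)"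
    using lu' by (subst emeasure_lborel_box) (auto simp: Basis_vec_2 inner_axis)
  also have "\<dots> = ennreal (\<Prod>b\<in>Basis. (u - l) \<bullet> b)"
    using ax by (simp add: Basis_vec_2 inner_axis Basis_complex_def complex_eq_iff)
  finally show "emeasure (distr lborel borel complex_of_vec) (box l u) = ennreal (\<Prod>b\<in>Basis. (u - l) \<bullet> b)" .
qed simp

text \<open>The inversion has complex derivative -1/w^2, hence Jacobian |w|^{-4}.\<close>

lemma integral_inversion_0:
  fixes F :: "complex \<Rightarrow> real"
  assumes F: "integrable lborel F"
  shows "integrable lborel (\<lambda>w. F (1 / w) / cmod w ^ 4)" "(LINT w|lborel. F (1 / w) / cmod w ^ 4) = (LINT z|lborel. F z)"
proof -
  have [measurable]: "F \<in> borel_measurable borel" using borel_measurable_integrable[OF F] by simp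
  \<comment> \<open>Values in \<open>real^1\<close> fit the change of variables formula for vector
    valued functions.\<close>
  define f where "f x = (vec (F (complex_of_vec x)) :: real^1)" for x :: "real^2"
  define f1 where "f1 x = F (complex_of_vec x)" for x :: "real^2"
  define h where "h x = vec_of_complex (1 / complex_of_vec x)" for x :: "real^2"
  define h' where "h' x v = vec_of_complex (- (1 / (complex_of_vec x)\<^sup>2) * complex_of_vec v)" for x v :: "real^2"
  define X where "X = - {0 :: real^2}"
  have nz: "complex_of_vec x \<noteq> 0" if "x \<in> X" for x
  proof
    assume "complex_of_vec x = 0"
    then have "x = vec_of_complex 0" by (metis complex_of_vec_inverse(2))
    then show False using that by (auto simp: X_def vec_eq_iff forall_2)
  qed
  have der: "(h has_derivative h' x) (at x within X)" if x: "x \<in> X" for x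
  proof -
    have "((\<lambda>w. 1 / w) has_field_derivative (- (1 / (complex_of_vec x)\<^sup>2))) (at (complex_of_vec x))"
      using nz[OF x] by (auto intro!: derivative_eq_intros simp: power2_eq_square)
    then have 1: "((\<lambda>w. 1 / w) has_derivative (*) (- (1 / (complex_of_vec x)\<^sup>2))) (at (complex_of_vec x))"
      by (simp add: has_field_derivative_def)
    have "(complex_of_vec has_derivative complex_of_vec) (at x)"
      by (rule bounded_linear_imp_has_derivative[OF bounded_linear_complex_of_vec])
    from has_derivative_compose[OF this 1]
    have "((\<lambda>x. 1 / complex_of_vec x) has_derivative (\<lambda>v. - (1 / (complex_of_vec x)\<^sup>2) * complex_of_vec v)) (at x)" .
    from bounded_linear.has_derivative[OF bounded_linear_vec_of_complex this]
    show ?thesis unfolding h_def[abs_def] h'_def[abs_def] by (rule has_derivative_at_withinI)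
  qed
  have hh: "h (h x) = x" for x by (simp add: h_def)
  have hX: "h x \<in> X" if "x \<in> X" for x
  proof -
    have "h x \<noteq> 0"
    proof
      assume "h x = 0"
      then have "complex_of_vec (h x) = complex_of_vec 0" by simp
      then have "1 / complex_of_vec x = 0" by (simp add: h_def) (simp add: complex_of_vec_def complex_eq_iff)
      then show False using nz[OF that] by simp
    qed
    then show ?thesis by (simp add: X_def)
  qed
  have img: "h ` X = X" using hh hX by (metis image_eqI subsetI subset_antisym image_subsetI)
  have inj: "inj_on h X" by (metis hh inj_onI)
  have det: "\<bar>det (matrix (h' x))\<bar> = 1 / cmod (complex_of_vec x) ^ 4" for x
  proof -
    define m where "m = - (1 / (complex_of_vec x)\<^sup>2)"
    have e: "complex_of_vec (axis 1 1) = 1" "complex_of_vec (axis 2 1) = \<i>"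
      by (auto simp: complex_of_vec_def complex_eq_iff axis_def)
    have "h' x = (\<lambda>v. vec_of_complex (m * complex_of_vec v))" by (simp only: h'_def[abs_def] m_def)
    then have "det (matrix (h' x)) = (Re m)\<^sup>2 + (Im m)\<^sup>2"
      unfolding det_2 by (simp add: matrix_def e power2_eq_square)
    also have "\<dots> = (cmod m)\<^sup>2" by (simp add: cmod_power2)
    also have "\<dots> = 1 / cmod (complex_of_vec x) ^ 4"
      by (simp add: m_def norm_divide norm_power power_divide flip: power_mult)
    finally show ?thesis by simp
  qed
  have if1: "integrable lborel f1"
    using F unfolding f1_def[abs_def] lborel_complex_eq_distr by (subst (asm) integrable_distr_eq) auto
  have Xb: "X \<in> sets borel" by (simp add: X_def)
  have ae: "AE x in lborel. x \<in> X" unfolding X_def using AE_lborel_singleton[of "0 :: real^2"] by simp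
  have tr: "integrable lborel (\<lambda>x. indicator X x *\<^sub>R q x) \<longleftrightarrow> integrable lborel q" "(LINT x|lborel. indicator X x *\<^sub>R q x) = (LINT x|lborel. q x)"
    if [measurable]: "q \<in> borel_measurable borel" for q :: "real^2 \<Rightarrow> real"
  proof -
    have [measurable]: "X \<in> sets borel" by (rule Xb)
    have e: "AE x in lborel. indicator X x *\<^sub>R q x = q x" using ae by eventually_elim simp
    show "integrable lborel (\<lambda>x. indicator X x *\<^sub>R q x) \<longleftrightarrow> integrable lborel q"
      by (rule integrable_cong_AE[OF _ _ e]) measurable
    show "(LINT x|lborel. indicator X x *\<^sub>R q x) = (LINT x|lborel. q x)"
      by (rule integral_cong_AE[OF _ _ e]) measurable
  qed
  have HK: "q absolutely_integrable_on X" "integral X q = (LINT x|lborel. q x)"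
    if q: "q \<in> borel_measurable borel" "integrable lborel q" for q :: "real^2 \<Rightarrow> real"
  proof -
    have qm: "(\<lambda>x. indicator X x *\<^sub>R q x) \<in> borel_measurable lborel" using q(1) Xb by measurable
    show "q absolutely_integrable_on X"
      unfolding set_integrable_def using integrable_completion[OF qm] tr(1)[OF q(1)] q(2) by simp
    from set_lebesgue_integral_eq_integral(2)[OF this]
    show "integral X q = (LINT x|lborel. q x)"
      unfolding set_lebesgue_integral_def using integral_completion[OF qm] tr(2)[OF q(1)] by simp
  qed
  have f1m: "f1 \<in> borel_measurable borel" unfolding f1_def[abs_def] by measurable
  define q where "q x = F (1 / complex_of_vec x) / cmod (complex_of_vec x) ^ 4" for x
  have qm: "q \<in> borel_measurable borel" unfolding q_def[abs_def] by measurable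
  have cv: "(\<lambda>x. \<bar>det (matrix (h' x))\<bar> *\<^sub>R f (h x)) absolutely_integrable_on X \<and>
      integral X (\<lambda>x. \<bar>det (matrix (h' x))\<bar> *\<^sub>R f (h x)) = vec (LINT x|lborel. f1 x)
      \<longleftrightarrow> f absolutely_integrable_on X \<and> integral X f = vec (LINT x|lborel. f1 x)"
    using has_absolute_integral_change_of_variables[OF _ der inj, of f] Xb unfolding img by simp
  have ff: "(\<lambda>x. f x $ 1) = f1" by (simp add: f_def f1_def fun_eq_iff)
  have gg: "(\<lambda>x. (\<bar>det (matrix (h' x))\<bar> *\<^sub>R f (h x)) $ 1) = q"
    by (simp add: det f_def q_def h_def fun_eq_iff)
  have "f absolutely_integrable_on X \<and> integral X f = vec (LINT x|lborel. f1 x)"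
    unfolding absolutely_integrable_on_1_iff integral_on_1_eq ff using HK[OF f1m if1] by simp
  then have "q absolutely_integrable_on X \<and> (vec (integral X q) :: real^1) = vec (LINT x|lborel. f1 x)"
    using cv unfolding absolutely_integrable_on_1_iff integral_on_1_eq gg by simp
  then have q: "q absolutely_integrable_on X" "integral X q = (LINT x|lborel. f1 x)"
    by (auto simp: vec_eq_iff)
  have qi: "integrable lborel q"
    using q(1) unfolding set_integrable_def
    by (subst (asm) integrable_completion) (use tr(1)[OF qm] Xb qm in auto)
  then show "integrable lborel (\<lambda>w. F (1 / w) / cmod w ^ 4)"
    unfolding lborel_complex_eq_distr q_def[abs_def] by (subst integrable_distr_eq) auto
  have "(LINT x|lborel. q x) = (LINT x|lborel. f1 x)" using HK(2)[OF qm qi] q(2) by simp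
  moreover have "(LINT w|lborel. F (1 / w) / cmod w ^ 4) = (LINT x|lborel. q x)"
    unfolding lborel_complex_eq_distr q_def[abs_def] by (rule integral_distr) measurable
  moreover have "(LINT z|lborel. F z) = (LINT x|lborel. f1 x)"
    unfolding lborel_complex_eq_distr f1_def[abs_def] by (rule integral_distr) measurable
  ultimately show "(LINT w|lborel. F (1 / w) / cmod w ^ 4) = (LINT z|lborel. F z)" by simp
qed

lemma integral_inversion:
  fixes F :: "complex \<Rightarrow> real"
  assumes F: "integrable lborel F"
  shows "integrable lborel (\<lambda>w. F (c + 1 / w) / cmod w ^ 4)"
    "(LINT w|lborel. F (c + 1 / w) / cmod w ^ 4) = (LINT z|lborel. F z)"
proof -
  have [measurable]: "F \<in> borel_measurable borel" using borel_measurable_integrable[OF F] by simp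
  have i: "integrable lborel (\<lambda>z. F (z + c))" using F by (rule integrable_lborel_shift)
  show "integrable lborel (\<lambda>w. F (c + 1 / w) / cmod w ^ 4)" "(LINT w|lborel. F (c + 1 / w) / cmod w ^ 4) = (LINT z|lborel. F z)"
    using integral_inversion_0[OF i] integral_lborel_shift[of F c] by (simp_all add: add.commute)
qed

text \<open>A pointwise notion, stable under holomorphic changes of coordinate, so that regularity
  can be checked in a different chart at each point.\<close>

definition C1_at :: "(complex \<Rightarrow> real) \<Rightarrow> complex \<Rightarrow> bool" where
  "C1_at f z \<longleftrightarrow> (\<exists>U H. open U \<and> z \<in> U \<and> (\<forall>w\<in>U. GDERIV f w :> H w) \<and> continuous_on U H)"

lemma C1_atI: "open U \<Longrightarrow> z \<in> U \<Longrightarrow> (\<And>w. w \<in> U \<Longrightarrow> GDERIV f w :> H w) \<Longrightarrow> continuous_on U H \<Longrightarrow> C1_at f z"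
  unfolding C1_at_def by blast

lemma C1_at_isCont: "C1_at f z \<Longrightarrow> isCont f z"
  unfolding C1_at_def gderiv_def by (meson has_derivative_continuous)

lemma C1_at_cong:
  assumes "C1_at f z" "open N" "z \<in> N" "\<And>w. w \<in> N \<Longrightarrow> f w = h w"
  shows "C1_at h z"
proof -
  obtain U H where U: "open U" "z \<in> U" "\<And>w. w \<in> U \<Longrightarrow> GDERIV f w :> H w" "continuous_on U H"
    using assms(1) unfolding C1_at_def by blast
  show ?thesis
  proof (rule C1_atI[of "U \<inter> N" _ _ H])
    show "GDERIV h w :> H w" if "w \<in> U \<inter> N" for w
      by (rule GDERIV_cong_open[of f _ _ N]) (use that U assms in auto)
  qed (use U assms in \<open>auto intro: continuous_on_subset\<close>)
qed

lemma C1_at_lincomb: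
  assumes "C1_at f z" "C1_at h z"
  shows "C1_at (\<lambda>w. s * f w + t * h w) z"
proof -
  obtain U H where U: "open U" "z \<in> U" "\<And>w. w \<in> U \<Longrightarrow> GDERIV f w :> H w" "continuous_on U H"
    using assms(1) unfolding C1_at_def by blast
  obtain U' H' where U': "open U'" "z \<in> U'" "\<And>w. w \<in> U' \<Longrightarrow> GDERIV h w :> H' w" "continuous_on U' H'"
    using assms(2) unfolding C1_at_def by blast
  show ?thesis
  proof (rule C1_atI[of "U \<inter> U'" _ _ "\<lambda>w. s *\<^sub>R H w + t *\<^sub>R H' w"])
    show "GDERIV (\<lambda>w. s * f w + t * h w) w :> s *\<^sub>R H w + t *\<^sub>R H' w" if "w \<in> U \<inter> U'" for w
      using GDERIV_add[OF GDERIV_mult[OF GDERIV_const[of s] U(3)] GDERIV_mult[OF GDERIV_const[of t] U'(3)]] that by simp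
    show "continuous_on (U \<inter> U') (\<lambda>w. s *\<^sub>R H w + t *\<^sub>R H' w)"
      by (intro continuous_intros continuous_on_subset[OF U(4)] continuous_on_subset[OF U'(4)]) auto
  qed (use U U' in auto)
qed

text \<open>Multiplication by f' has multiplication by its conjugate as adjoint for the real inner
  product.\<close>

lemma GDERIV_compose_holomorphic:
  assumes "GDERIV W (f z) :> D" "(f has_field_derivative f') (at z)"
  shows "GDERIV (\<lambda>z. W (f z)) z :> cnj f' * D"
proof -
  have "((\<lambda>z. W (f z)) has_derivative (\<lambda>h. (f' * h) \<bullet> D)) (at z)"
    using has_derivative_compose[of f "(*) f'" z UNIV W "\<lambda>h. h \<bullet> D"] assms
    by (simp add: gderiv_def has_field_derivative_def)
  moreover have "(f' * h) \<bullet> D = h \<bullet> (cnj f' * D)" for h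
    by (simp add: inner_conv_cnj mult_ac)
  ultimately show ?thesis by (simp add: gderiv_def)
qed

lemma C1_at_compose_holomorphic:
  assumes "C1_at W (f z)" "f holomorphic_on N" "open N" "z \<in> N"
  shows "C1_at (\<lambda>w. W (f w)) z"
proof -
  obtain U H where U: "open U" "f z \<in> U" "\<And>w. w \<in> U \<Longrightarrow> GDERIV W w :> H w" "continuous_on U H"
    using assms(1) unfolding C1_at_def by blast
  have fc: "continuous_on N f" using assms(2) by (rule holomorphic_on_imp_continuous_on)
  have dc: "continuous_on N (deriv f)"
    using holomorphic_deriv[OF assms(2,3)] by (rule holomorphic_on_imp_continuous_on)
  show ?thesis
  proof (rule C1_atI[of "N \<inter> f -` U" _ _ "\<lambda>w. cnj (deriv f w) * H (f w)"])
    show "open (N \<inter> f -` U)" by (rule continuous_open_preimage[OF fc assms(3) U(1)])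
    show "GDERIV (\<lambda>w. W (f w)) w :> cnj (deriv f w) * H (f w)" if "w \<in> N \<inter> f -` U" for w
      by (rule GDERIV_compose_holomorphic) (use that U(3) holomorphic_derivI[OF assms(2,3)] in auto)
    show "continuous_on (N \<inter> f -` U) (\<lambda>w. cnj (deriv f w) * H (f w))"
      by (intro continuous_intros continuous_on_compose2[OF U(4)] continuous_on_subset[OF fc] continuous_on_subset[OF dc]) auto
  qed (use assms U in auto)
qed

lemma C1_at_ln_cmod:
  assumes "f holomorphic_on N" "open N" "z \<in> N" "f z \<noteq> 0"
  shows "C1_at (\<lambda>w. ln (cmod (f w))) z"
proof -
  have "C1_at (\<lambda>w. ln (cmod w)) (f z)"
  proof (rule C1_atI[of "- {0}" _ _ "\<lambda>w. 1 / cnj w"])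
    show "GDERIV (\<lambda>w. ln (cmod w)) w :> 1 / cnj w" if "w \<in> - {0}" for w
      using GDERIV_ln_norm[of w 0] that by simp
    show "continuous_on (- {0}) (\<lambda>w. 1 / cnj w)" by (intro continuous_intros) auto
  qed (use assms in auto)
  then show ?thesis by (rule C1_at_compose_holomorphic[OF _ assms(1-3)])
qed

lemma C1_at_gradient:
  assumes "\<And>z. z \<in> X \<Longrightarrow> C1_at f z"
  obtains G where "\<And>z. z \<in> X \<Longrightarrow> GDERIV f z :> G z" "continuous_on X G"
proof
  define G where "G z = (THE D. GDERIV f z :> D)" for z
  have G: "G z = D" if "GDERIV f z :> D" for z D
    using that GDERIV_unique by (auto simp: G_def intro!: the_equality)
  show "GDERIV f z :> G z" if z: "z \<in> X" for z
  proof -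
    obtain D where "GDERIV f z :> D" using assms[OF z] unfolding C1_at_def by blast
    then show ?thesis using G by simp
  qed
  show "continuous_on X G"
  proof (rule continuous_at_imp_continuous_on, rule ballI)
    fix z assume z: "z \<in> X"
    obtain U H where U: "open U" "z \<in> U" "\<And>w. w \<in> U \<Longrightarrow> GDERIV f w :> H w" "continuous_on U H"
      using assms[OF z] unfolding C1_at_def by blast
    have "continuous_on U G" by (subst continuous_on_cong[OF refl G[OF U(3)]]) (use U(4) in auto)
    then show "isCont G z" using U by (simp add: continuous_on_eq_continuous_at)
  qed
qed

lemma regular_at_C1:
  assumes "regular_at \<rho> c"
  shows "C1_at (\<lambda>z. ln (\<rho> z) / 2) c"
proof -
  obtain U H where U: "open U" "c \<in> U" "\<And>w. w \<in> U \<Longrightarrow> GDERIV (\<lambda>z. ln (\<rho> z)) w :> H w"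
    and L: "\<And>w. w \<in> U \<Longrightarrow> \<exists>r>0. \<exists>L. L-lipschitz_on (cball w r \<inter> U) H"
    using assms unfolding regular_at_def C11_on_def by blast
  have "continuous_on U H"
  proof (rule continuous_at_imp_continuous_on, rule ballI)
    fix w assume w: "w \<in> U"
    obtain r L where rL: "r > 0" "L-lipschitz_on (cball w r \<inter> U) H" using L[OF w] by blast
    have "continuous_on (ball w r \<inter> U) H"
      by (rule continuous_on_subset[OF lipschitz_on_continuous_on[OF rL(2)]]) auto
    then show "isCont H w" using rL(1) w U(1) by (simp add: continuous_on_eq_continuous_at open_Int)
  qed
  then have "C1_at (\<lambda>z. ln (\<rho> z)) c" using U by (intro C1_atI) auto
  from C1_at_lincomb[OF this this, of "1/2" 0] show ?thesis by simp
qed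

text \<open>The quotient \<zeta>(z)/(z - c) tends to \<zeta>'(c), which is nonzero by injectivity.
  So the given holomorphic coordinate can be exchanged for the standard one at the cost of a
  convergent term; only continuity of \<open>u\<close> enters.\<close>

lemma log_density_limit:
  assumes reg: "D = 0 \<Longrightarrow> regular_at \<rho> c" and con: "D \<noteq> 0 \<Longrightarrow> conic_at \<rho> c D"
  shows "\<exists>L. ((\<lambda>z. ln (\<rho> z) / 2 - D * ln (cmod (z - c))) \<longlongrightarrow> L) (at c)"
proof (cases "D = 0")
  case True
  then show ?thesis using C1_at_isCont[OF regular_at_C1[OF reg]] by (auto simp: isCont_def)
next
  case False
  obtain U \<zeta> u where U: "open U" "c \<in> U" "\<zeta> holomorphic_on U" "inj_on \<zeta> U" "\<zeta> c = 0" "continuous_on U u"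
    and \<rho>: "\<And>z. z \<in> U - {c} \<Longrightarrow> \<rho> z = exp (2 * u z) * cmod (\<zeta> z) powr (2 * D) * (cmod (deriv \<zeta> z))\<^sup>2"
    using con[OF False] unfolding conic_at_def by blast
  have d0: "deriv \<zeta> z \<noteq> 0" if "z \<in> U" for z
    using holomorphic_injective_imp_regular[OF U(3,1,4) that] .
  have uc: "(u \<longlongrightarrow> u c) (at c)" using U by (simp add: continuous_on_eq_continuous_at isCont_def)
  have "continuous_on U (deriv \<zeta>)"
    using holomorphic_deriv[OF U(3,1)] by (rule holomorphic_on_imp_continuous_on)
  then have dc: "(deriv \<zeta> \<longlongrightarrow> deriv \<zeta> c) (at c)" using U by (simp add: continuous_on_eq_continuous_at isCont_def)
  have "(\<zeta> has_field_derivative deriv \<zeta> c) (at c)" by (rule holomorphic_derivI[OF U(3,1,2)])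
  then have q: "((\<lambda>z. \<zeta> z / (z - c)) \<longlongrightarrow> deriv \<zeta> c) (at c)" using U(5) by (simp add: has_field_derivative_iff)
  have "((\<lambda>z. u z + D * ln (cmod (\<zeta> z / (z - c))) + ln (cmod (deriv \<zeta> z))) \<longlongrightarrow>
      u c + D * ln (cmod (deriv \<zeta> c)) + ln (cmod (deriv \<zeta> c))) (at c)"
    by (intro tendsto_intros uc dc q) (use d0[OF U(2)] in auto)
  moreover have "\<forall>\<^sub>F z in at c. u z + D * ln (cmod (\<zeta> z / (z - c))) + ln (cmod (deriv \<zeta> z)) = ln (\<rho> z) / 2 - D * ln (cmod (z - c))"
    using eventually_at_in_open[OF U(1,2)]
  proof eventually_elim
    case (elim z)
    then have z: "z \<in> U" "z \<noteq> c" by auto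
    have "\<zeta> z \<noteq> 0" using inj_onD[OF U(4), of z c] z U(2,5) by auto
    then have pos: "cmod (\<zeta> z) > 0" "cmod (deriv \<zeta> z) > 0" "cmod (z - c) > 0" using d0[OF z(1)] z by auto
    have "ln (\<rho> z) = ln (exp (2 * u z)) + ln (cmod (\<zeta> z) powr (2 * D)) + ln ((cmod (deriv \<zeta> z))\<^sup>2)"
      unfolding \<rho>[OF elim] using pos by (simp add: ln_mult)
    also have "\<dots> = 2 * u z + 2 * D * ln (cmod (\<zeta> z)) + 2 * ln (cmod (deriv \<zeta> z))"
      using pos by (simp add: ln_powr ln_realpow)
    finally show ?case using pos by (simp add: norm_divide ln_div right_diff_distrib)
  qed
  ultimately have "((\<lambda>z. ln (\<rho> z) / 2 - D * ln (cmod (z - c))) \<longlongrightarrow>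
      u c + D * ln (cmod (deriv \<zeta> c)) + ln (cmod (deriv \<zeta> c))) (at c)"
    by (rule Lim_transform_eventually)
  then show ?thesis by blast
qed

section \<open>Planar form of a conic sphere\<close>

text \<open>The parameter is chosen such that \<open>p\<close> corresponds to \<open>\<infinity>\<close>; for \<open>p = c\<close> the
  translation keeps the conformal factor \<open>|w|\<^sup>-\<^sup>4\<close> the same for all \<open>c\<close>.\<close>

definition mchart :: "sphere \<Rightarrow> complex \<Rightarrow> sphere" where
  "mchart p w = (case p of None \<Rightarrow> Some w | Some c \<Rightarrow> if w = 0 then None else Some (c + 1 / w))"

definition mdens :: "metric_coeff \<Rightarrow> sphere \<Rightarrow> complex \<Rightarrow> real" where
  "mdens g p w = (case p of None \<Rightarrow> g (Some w)
     | Some c \<Rightarrow> if w = 0 then g None else g (Some (c + 1 / w)) / cmod w ^ 4)"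

lemma mchart_inj: "inj (mchart p)"
  by (rule injI) (auto simp: mchart_def split: option.splits if_splits)

lemma mchart_range: "range (mchart p) = - {p}"
proof (cases p)
  case None
  then show ?thesis by (auto simp: mchart_def) (metis option.exhaust rangeI)
next
  case (Some c)
  have "q \<in> range (mchart p)" if "q \<noteq> p" for q
  proof (cases q)
    case None
    then have "q = mchart p 0" using Some by (simp add: mchart_def)
    then show ?thesis by simp
  next
    case (Some z)
    then have "q = mchart p (1 / (z - c))" using \<open>p = Some c\<close> that by (simp add: mchart_def)
    then show ?thesis by simp
  qed
  moreover have "mchart p w \<noteq> p" for w using Some by (simp add: mchart_def)
  ultimately show ?thesis by auto
qed

text \<open>The chart misses only \<open>p\<close>, so the orders seen in the plane add up to the
  total degree minus that of \<open>p\<close>; for a point of least order this is \<alpha>.\<close>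

lemma sum_mchart:
  fixes D :: "sphere \<Rightarrow> real"
  assumes fin: "finite {q. D q \<noteq> 0}" "finite Q" and Q: "\<And>w. D (mchart p w) \<noteq> 0 \<Longrightarrow> w \<in> Q"
  shows "(\<Sum>w\<in>Q. D (mchart p w)) = (\<Sum>q | D q \<noteq> 0. D q) - D p"
proof -
  have "(\<Sum>w\<in>Q. D (mchart p w)) = sum D (mchart p ` Q)"
    by (subst sum.reindex) (auto intro: inj_on_subset[OF mchart_inj])
  also have "\<dots> = sum D ({q. D q \<noteq> 0} - {p})"
  proof (rule sum.mono_neutral_right)
    show "{q. D q \<noteq> 0} - {p} \<subseteq> mchart p ` Q"
    proof
      fix q assume q: "q \<in> {q. D q \<noteq> 0} - {p}"
      then obtain w where "q = mchart p w" using mchart_range[of p] by blast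
      then show "q \<in> mchart p ` Q" using q Q by auto
    qed
    show "\<forall>q\<in>mchart p ` Q - ({q. D q \<noteq> 0} - {p}). D q = 0"
      using mchart_range[of p] by auto
  qed (use fin in auto)
  also have "\<dots> = (\<Sum>q | D q \<noteq> 0. D q) - D p"
    using fin(1) by (cases "D p = 0") (auto simp: sum_diff1)
  finally show ?thesis .
qed

lemma filterlim_shifted_inverse:
  fixes c :: complex
  shows "filterlim (\<lambda>w. c + 1 / w) (at c) at_infinity"
    "w0 \<noteq> 0 \<Longrightarrow> filterlim (\<lambda>w. c + 1 / w) (at (c + 1 / w0)) (at w0)"
proof -
  have eq: "(\<lambda>w::complex. 1 / w) = inverse" by (simp add: fun_eq_iff inverse_eq_divide)
  have "((\<lambda>w. 1 / w) \<longlongrightarrow> 0) (at_infinity :: complex filter)"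
    unfolding eq by (rule tendsto_inverse_0)
  then have "((\<lambda>w. c + 1 / w) \<longlongrightarrow> c + 0) (at_infinity :: complex filter)" by (intro tendsto_intros)
  moreover have "\<forall>\<^sub>F w :: complex in at_infinity. c + 1 / w \<noteq> c"
    using eventually_not_equal_at_infinity[of "0::complex"] by eventually_elim simp
  ultimately show "filterlim (\<lambda>w. c + 1 / w) (at c) at_infinity" by (auto simp: filterlim_at)
  assume w0: "w0 \<noteq> 0"
  have "((\<lambda>w. c + 1 / w) \<longlongrightarrow> c + 1 / w0) (at w0)" using w0 by (intro tendsto_intros)
  moreover have "\<forall>\<^sub>F w in at w0. c + 1 / w \<noteq> c + 1 / w0"
    using eventually_neq_at_within[of w0 w0 UNIV] eventually_neq_at_within[of 0 w0 UNIV]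
    by eventually_elim (use w0 in \<open>auto simp: field_simps\<close>)
  ultimately show "filterlim (\<lambda>w. c + 1 / w) (at (c + 1 / w0)) (at w0)" by (auto simp: filterlim_at)
qed

text \<open>Inversion exchanges the two ends: vanishing near 0 becomes compact support, and compact
  support becomes vanishing near \<open>c\<close>.\<close>

lemma C1c_inversion:
  assumes psi: "C1c \<psi> \<Psi>" and e: "e > 0" "\<And>w. w \<in> ball 0 e \<Longrightarrow> \<psi> w = 0"
  shows "C1c (\<lambda>z. if z = c then 0 else \<psi> (1 / (z - c)))
     (\<lambda>z. if z = c then 0 else cnj (- 1 / (z - c)\<^sup>2) * \<Psi> (1 / (z - c)))"
    and "\<exists>r>0. \<forall>z\<in>ball c r. (if z = c then 0 else \<psi> (1 / (z - c))) = 0"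
proof -
  define \<phi> where "\<phi> z = (if z = c then 0 else \<psi> (1 / (z - c)))" for z
  define \<Phi> where "\<Phi> z = (if z = c then 0 else cnj (- 1 / (z - c)\<^sup>2) * \<Psi> (1 / (z - c)))" for z
  obtain R where R: "R > 0" "\<And>z. norm z > R \<Longrightarrow> \<psi> z = 0" "\<And>z. norm z > R \<Longrightarrow> \<Psi> z = 0"
    by (rule C1cE[OF psi]) (rule that)
  have far: "norm (1 / (z - c)) > R" if "z \<in> ball c (1 / R)" "z \<noteq> c" for z
  proof -
    have "cmod (z - c) < 1 / R" "cmod (z - c) > 0" using that by (auto simp: dist_norm norm_minus_commute)
    then show ?thesis using R(1) by (simp add: norm_divide field_simps)
  qed
  have near: "\<phi> z = 0" "\<Phi> z = 0" if "z \<in> ball c (1 / R)" for z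
    using far[OF that] R(2,3) by (auto simp: \<phi>_def \<Phi>_def)
  have oc: "open (- {c})" by auto
  have "GDERIV \<phi> z :> \<Phi> z" for z
  proof (cases "z = c")
    case True
    have "GDERIV (\<lambda>z. 0) z :> 0" by (rule GDERIV_const)
    then have "GDERIV \<phi> z :> 0"
      by (rule GDERIV_cong_open[of _ _ _ "ball c (1 / R)"]) (use near True R in auto)
    then show ?thesis using True by (simp add: \<Phi>_def)
  next
    case False
    have "GDERIV \<psi> (1 / (z - c)) :> \<Psi> (1 / (z - c))" using psi by (simp add: C1c_def)
    moreover have "((\<lambda>z. 1 / (z - c)) has_field_derivative (- 1 / (z - c)\<^sup>2)) (at z)"
      using False by (auto intro!: derivative_eq_intros simp: power2_eq_square)
    ultimately have "GDERIV (\<lambda>z. \<psi> (1 / (z - c))) z :> cnj (- 1 / (z - c)\<^sup>2) * \<Psi> (1 / (z - c))"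
      by (rule GDERIV_compose_holomorphic)
    then have "GDERIV (\<lambda>z. \<psi> (1 / (z - c))) z :> \<Phi> z" using False by (simp add: \<Phi>_def)
    then show ?thesis by (rule GDERIV_cong_open[OF _ oc]) (use False in \<open>auto simp: \<phi>_def\<close>)
  qed
  moreover have "continuous_on UNIV \<Phi>"
  proof -
    have \<Psi>c: "continuous_on UNIV \<Psi>" using psi by (simp add: C1c_def)
    have "continuous_on (- {c}) (\<lambda>z. cnj (- 1 / (z - c)\<^sup>2) * \<Psi> (1 / (z - c)))"
      by (intro continuous_intros continuous_on_compose2[OF \<Psi>c]) auto
    then have 1: "continuous_on (- {c}) \<Phi>"
      by (rule continuous_on_eq) (simp add: \<Phi>_def)
    have 2: "continuous_on (ball c (1 / R)) \<Phi>"
      by (rule continuous_on_eq[OF continuous_on_const[of _ 0]]) (simp add: near)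
    have U: "- {c} \<union> ball c (1 / R) = UNIV" using R(1) by auto
    show ?thesis using continuous_on_open_Un[OF oc open_ball 1 2] unfolding U .
  qed
  moreover have "\<phi> z = 0" if "norm z > norm c + 1 / e" for z
  proof -
    have "cmod (z - c) > 1 / e" using that norm_triangle_ineq2[of z c] by linarith
    moreover then have "cmod (z - c) > 0" using e(1) by (meson divide_pos_pos less_trans zero_less_one)
    ultimately have "1 / (z - c) \<in> ball 0 e" using e(1) by (simp add: norm_divide field_simps)
    then show ?thesis using e(2) by (simp add: \<phi>_def)
  qed
  ultimately have "C1c \<phi> \<Phi>" unfolding C1c_def by blast
  then show "C1c (\<lambda>z. if z = c then 0 else \<psi> (1 / (z - c)))
     (\<lambda>z. if z = c then 0 else cnj (- 1 / (z - c)\<^sup>2) * \<Psi> (1 / (z - c)))"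
    by (simp add: \<phi>_def[abs_def] \<Phi>_def[abs_def])
  show "\<exists>r>0. \<forall>z\<in>ball c r. (if z = c then 0 else \<psi> (1 / (z - c))) = 0"
    using near(1) R(1) unfolding \<phi>_def by (intro exI[of _ "1 / R"]) auto
qed

lemma finite_not_at: "finite P \<Longrightarrow> \<forall>\<^sub>F z in at (q :: complex). z \<notin> P"
proof -
  assume P: "finite P"
  have o: "open (- (P - {q}))" using P by (intro open_Compl finite_imp_closed) auto
  show ?thesis using eventually_at_in_open[OF o, of q] by (rule eventually_mono) auto
qed

text \<open>The divisor is treated as a function with finite support, independently of an
  enumeration of its points.\<close>

locale conic_metric =
  fixes D :: "sphere \<Rightarrow> real" and g :: metric_coeff and a b :: real
  assumes conic: "conic_sphere D g" and fin: "finite {q. D q \<noteq> 0}"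
    and D_nonpos: "\<And>q. D q \<le> 0" and D_gt: "\<And>q. -1 < D q"
    and a_pos: "0 < a" and curvature: "AE z in lborel. a \<le> gauss_curvature g z \<and> gauss_curvature g z \<le> b"
begin

definition P :: "complex set" where "P = {z. D (Some z) \<noteq> 0}"

lemma finP: "finite P"
proof -
  have "Some ` P \<subseteq> {q. D q \<noteq> 0}" by (auto simp: P_def)
  then have "finite (Some ` P)" using fin by (rule finite_subset)
  then show ?thesis by (rule finite_imageD) simp
qed

lemma density_simps:
  "Defs.density g (Some q) = (\<lambda>w. g (Some w))"
  "v \<noteq> 0 \<Longrightarrow> Defs.density g None v = g (Some (1 / v)) / cmod v ^ 4"
  "Defs.density g None 0 = g None"
  by (auto simp: Defs.density_def)

lemma regular: "z \<notin> P \<Longrightarrow> regular_at (\<lambda>w. g (Some w)) z"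
  using conic density_simps(1)[of z] unfolding conic_sphere_def P_def by (force simp: coord_def)

lemma regular_inf: "D None = 0 \<Longrightarrow> regular_at (Defs.density g None) 0"
  using conic unfolding conic_sphere_def by (force simp: coord_def)

lemma limit_at_point: "\<exists>L. ((\<lambda>z. ln (g (Some z)) / 2 - D (Some q) * ln (cmod (z - q))) \<longlongrightarrow> L) (at q)"
  using log_density_limit[of "D (Some q)" "\<lambda>w. g (Some w)" q] conic[unfolded conic_sphere_def, rule_format, of "Some q"]
  by (simp add: coord_def density_simps(1))

lemma limit_at_inf: "\<exists>L. ((\<lambda>v. ln (Defs.density g None v) / 2 - D None * ln (cmod v)) \<longlongrightarrow> L) (at 0)"
proof -
  have "coord None None = 0" by (simp add: coord_def)
  then show ?thesis
    using log_density_limit[of "D None" "Defs.density g None" 0] conic[unfolded conic_sphere_def, rule_format, of None] by simp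
qed


text \<open>For p = \<infinity> the plane data serve as they are. For a finite point
  \<open>c\<close> everything is transported by z = c + 1/w; the weak equation survives because the
  gradient pairing is conformally invariant.\<close>

theorem planar_form:
  assumes gt: "-1 < (\<Sum>q | D q \<noteq> 0. D q) - D p"
  obtains V G k Q where "conf_football V G k Q (\<lambda>w. D (mchart p w)) (D p) a b"
    "\<And>w. D (mchart p w) \<noteq> 0 \<Longrightarrow> w \<in> Q" "\<And>w. D (mchart p w) = 0 \<Longrightarrow> mdens g p w = exp (2 * V w)"
proof -
  obtain V0 G0 k0 where k0: "\<And>z. a \<le> k0 z" "\<And>z. k0 z \<le> b"
    and g0: "\<And>z. z \<notin> P \<Longrightarrow> g (Some z) = exp (2 * V0 z)"
    and grad0: "\<And>z. z \<notin> P \<Longrightarrow> GDERIV V0 z :> G0 z" "continuous_on (- P) G0"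
    and m0: "V0 \<in> borel_measurable borel" "k0 \<in> borel_measurable borel"
    and weak0: "\<And>\<phi> \<Phi>. C1c \<phi> \<Phi> \<Longrightarrow> \<forall>q\<in>P. \<exists>e>0. \<forall>z\<in>ball q e. \<phi> z = 0 \<Longrightarrow>
      integrable lborel (\<lambda>z. k0 z * exp (2 * V0 z) * \<phi> z) \<and> integrable lborel (\<lambda>z. \<Phi> z \<bullet> G0 z) \<and>
      (LINT z|lborel. \<Phi> z \<bullet> G0 z) = (LINT z|lborel. k0 z * exp (2 * V0 z) * \<phi> z)"
    by (rule plane_data[OF finP _ a_pos curvature]) (rule regular, assumption, rule that)
  note [measurable] = m0
  have oP: "open (- P)" using finite_imp_closed[OF finP] by auto
  have C0: "C1_at V0 z" if "z \<notin> P" for z by (rule C1_atI[OF oP _ grad0]) (use that in auto)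
  have lnV0: "ln (g (Some z)) / 2 = V0 z" if "z \<notin> P" for z by (simp add: g0[OF that])
  have lim0: "\<exists>L. ((\<lambda>z. V0 z - D (Some q) * ln (cmod (z - q))) \<longlongrightarrow> L) (at q)" for q
  proof -
    obtain L where L: "((\<lambda>z. ln (g (Some z)) / 2 - D (Some q) * ln (cmod (z - q))) \<longlongrightarrow> L) (at q)"
      using limit_at_point by blast
    have "\<forall>\<^sub>F z in at q. ln (g (Some z)) / 2 - D (Some q) * ln (cmod (z - q)) = V0 z - D (Some q) * ln (cmod (z - q))"
      using finite_not_at[OF finP] by eventually_elim (simp add: lnV0)
    from Lim_transform_eventually[OF L this] show ?thesis by blast
  qed
  obtain Li where Li: "((\<lambda>v. ln (Defs.density g None v) / 2 - D None * ln (cmod v)) \<longlongrightarrow> Li) (at 0)"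
    using limit_at_inf by blast
  have dens: "ln (Defs.density g None v) / 2 = V0 (1 / v) - 2 * ln (cmod v)" if "v \<noteq> 0" "1 / v \<notin> P" for v
  proof -
    have "ln (Defs.density g None v) = ln (exp (2 * V0 (1 / v))) - ln (cmod v ^ 4)"
      unfolding density_simps(2)[OF that(1)] g0[OF that(2)] using that(1) by (simp add: ln_div)
    then show ?thesis using that(1) by (simp add: ln_realpow)
  qed
  show thesis
  proof (cases p)
    case None
    have mc: "mchart p = Some" "mdens g p = (\<lambda>w. g (Some w))" by (auto simp: None mchart_def mdens_def fun_eq_iff)
    have inP: "z \<in> P" if "D (mchart p z) \<noteq> 0" for z using that by (simp add: mc P_def)
    have "conf_football V0 G0 k0 P (\<lambda>w. D (mchart p w)) (D p) a b"
    proof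
      show "finite P" by (rule finP)
      show "GDERIV V0 z :> G0 z" if "z \<notin> P \<or> D (mchart p z) = 0" for z
        using that by (intro grad0) (auto simp: P_def mc)
      have "{z. z \<notin> P \<or> D (mchart p z) = 0} = - P" by (auto simp: P_def mc)
      then show "continuous_on {z. z \<notin> P \<or> D (mchart p z) = 0} G0" using grad0(2) by simp
      show "\<exists>L. ((\<lambda>z. V0 z - D (mchart p q) * ln (cmod (z - q))) \<longlongrightarrow> L) (at q)" for q using lim0 by (simp add: mc)
      have "\<forall>\<^sub>F z in at_infinity. ln (Defs.density g None (0 + 1 / z)) / 2 - D None * ln (cmod (0 + 1 / z)) = V0 z + (2 + D p) * ln (cmod z)"
      proof -
        obtain R where R: "\<And>z. z \<in> P \<Longrightarrow> norm z \<le> R" using finite_imp_bounded[OF finP] unfolding bounded_iff by blast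
        have "\<forall>\<^sub>F z in at_infinity. norm z \<ge> max (R + 1) 1" unfolding eventually_at_infinity by blast
        then show ?thesis
        proof eventually_elim
          case (elim z)
          then have z: "z \<noteq> 0" "z \<notin> P" using R[of z] by auto
          have "ln (Defs.density g None (1 / z)) / 2 = V0 z - 2 * ln (cmod (1 / z))"
            using dens[of "1 / z"] z by simp
          then show ?case using z None by (simp add: norm_divide ln_div algebra_simps)
        qed
      qed
      from Lim_transform_eventually[OF filterlim_compose[OF Li filterlim_shifted_inverse(1)] this]
      show "\<exists>L. ((\<lambda>z. V0 z + (2 + D p) * ln (cmod z)) \<longlongrightarrow> L) at_infinity" by blast
      show "integrable lborel (\<lambda>z. k0 z * exp (2 * V0 z) * \<phi> z) \<and> (LINT z|lborel. \<Phi> z \<bullet> G0 z) = (LINT z|lborel. k0 z * exp (2 * V0 z) * \<phi> z)"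
        if "C1c \<phi> \<Phi>" "\<And>q. q \<in> P \<Longrightarrow> \<exists>e>0. \<forall>z\<in>ball q e. \<phi> z = 0" for \<phi> \<Phi>
        using weak0[OF that(1)] that(2) by blast
      show "-1 < (\<Sum>w\<in>P. D (mchart p w))" using sum_mchart[OF fin finP inP] gt by simp
    qed (use m0 k0 a_pos D_nonpos D_gt in auto)
    moreover have "mdens g p w = exp (2 * V0 w)" if "D (mchart p w) = 0" for w
      using that by (simp add: mc g0 P_def)
    ultimately show ?thesis using that inP by blast
  next
    case (Some c)
    define \<omega> where "\<omega> w = D (mchart p w)" for w
    have \<omega>0: "\<omega> 0 = D None" and \<omega>1: "w \<noteq> 0 \<Longrightarrow> \<omega> w = D (Some (c + 1 / w))" for w
      by (auto simp: \<omega>_def Some mchart_def)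
    \<comment> \<open>The point 0 stands for the old \<infinity> and is included even when regular,
      because the weak equation is known only for compact support in the old coordinate.\<close>
    define Q where "Q = insert 0 ((\<lambda>q. 1 / (q - c)) ` (P - {c}))"
    have finQ: "finite Q" using finP by (simp add: Q_def)
    have Q0: "0 \<in> Q" by (simp add: Q_def)
    have notP: "c + 1 / w \<notin> P" if "w \<noteq> 0" "w \<notin> Q \<or> \<omega> w = 0" for w
    proof
      assume P: "c + 1 / w \<in> P"
      then have "\<omega> w \<noteq> 0" using \<omega>1[OF that(1)] by (simp add: P_def)
      moreover have "w = 1 / ((c + 1 / w) - c)" by simp
      then have "w \<in> Q" using P that(1) unfolding Q_def by (intro insertI2 image_eqI[of _ _ "c + 1 / w"]) auto
      ultimately show False using that(2) by blast
    qed
    have inQ: "w \<in> Q" if "D (mchart p w) \<noteq> 0" for w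
    proof (rule ccontr)
      assume w: "w \<notin> Q"
      then have "w \<noteq> 0" using Q0 by blast
      then show False using notP[of w] w \<omega>1[of w] that by (simp add: P_def \<omega>_def)
    qed
    \<comment> \<open>The factor |w|^{-4} of |dz|^2 gives the term -2 ln|w| after taking half the
      logarithm.\<close>
    define V where "V w = (if w = 0 then ln (g None) / 2 else V0 (c + 1 / w) - 2 * ln (cmod w))" for w
    define k where "k w = k0 (c + 1 / w)" for w
    have V_meas: "V \<in> borel_measurable borel" unfolding V_def[abs_def] by measurable
    have k_meas: "k \<in> borel_measurable borel" unfolding k_def[abs_def] by measurable
    have o0: "open (- {0 :: complex})" by auto
    \<comment> \<open>Near the old \<infinity> the standard coordinate 1/z equals w/(1 + c w), which
      is holomorphic at 0 with derivative 1; this shows that V extends with the required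
      regularity.\<close>
    have near0: "ln (Defs.density g None (w / (1 + c * w))) / 2 - 2 * ln (cmod (1 + c * w)) = V w"
      if w: "w \<noteq> 0" "1 + c * w \<noteq> 0" "c + 1 / w \<notin> P" for w
    proof -
      have e: "1 / (w / (1 + c * w)) = c + 1 / w" using w by (simp add: field_simps)
      have "ln (Defs.density g None (w / (1 + c * w))) / 2 = V0 (c + 1 / w) - 2 * ln (cmod (w / (1 + c * w)))"
        using dens[of "w / (1 + c * w)"] w unfolding e by simp
      moreover have "ln (cmod (w / (1 + c * w))) = ln (cmod w) - ln (cmod (1 + c * w))"
        using w by (simp add: norm_divide ln_div)
      ultimately show ?thesis using w(1) by (simp only: V_def if_False) (simp add: algebra_simps)
    qed
    define N where "N = {w. 1 + c * w \<noteq> 0} \<inter> - (Q - {0})"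
    have oN: "open {w. 1 + c * w \<noteq> 0}" "open N"
    proof -
      show 1: "open {w. 1 + c * w \<noteq> 0}" by (intro open_Collect_neq continuous_intros)
      show "open N" unfolding N_def using finQ by (intro open_Int 1 open_Compl finite_imp_closed) auto
    qed
    have N0: "0 \<in> N" by (simp add: N_def)
    have C: "C1_at V w" if "w \<notin> Q \<or> \<omega> w = 0" for w
    proof (cases "w = 0")
      case False
      have "C1_at (\<lambda>w. V0 (c + 1 / w)) w"
        by (rule C1_at_compose_holomorphic[where f = "\<lambda>w. c + 1 / w", OF C0[OF notP[OF False that]] _ o0]) (use False in \<open>auto intro!: holomorphic_intros\<close>)
      from C1_at_lincomb[OF this C1_at_ln_cmod[of "\<lambda>w. w", OF holomorphic_on_ident o0], of 1 "-2"] False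
      have "C1_at (\<lambda>w. 1 * V0 (c + 1 / w) + -2 * ln (cmod w)) w" by blast
      then show ?thesis by (rule C1_at_cong[OF _ o0]) (use False in \<open>auto simp: V_def\<close>)
    next
      case True
      then have "D None = 0" using that Q0 \<omega>0 by auto
      then have "C1_at (\<lambda>v. ln (Defs.density g None v) / 2) 0" by (intro regular_at_C1 regular_inf)
      then have c1: "C1_at (\<lambda>v. ln (Defs.density g None v) / 2) ((\<lambda>w. w / (1 + c * w)) 0)" by simp
      have "C1_at (\<lambda>w. ln (Defs.density g None (w / (1 + c * w))) / 2) 0"
        by (rule C1_at_compose_holomorphic[where f = "\<lambda>w. w / (1 + c * w)", OF c1 _ oN(1)]) (auto intro!: holomorphic_intros)
      moreover have "C1_at (\<lambda>w. ln (cmod (1 + c * w))) 0"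
        by (rule C1_at_ln_cmod[OF _ oN(1)]) (auto intro!: holomorphic_intros)
      ultimately have "C1_at (\<lambda>w. 1 * (ln (Defs.density g None (w / (1 + c * w))) / 2) + -2 * ln (cmod (1 + c * w))) 0"
        by (rule C1_at_lincomb)
      then have "C1_at V 0"
      proof (rule C1_at_cong[OF _ oN(2) N0])
        fix w assume w: "w \<in> N"
        show "1 * (ln (Defs.density g None (w / (1 + c * w))) / 2) + -2 * ln (cmod (1 + c * w)) = V w"
        proof (cases "w = 0")
          case True
          then show ?thesis by (simp add: V_def density_simps(3))
        next
          case False
          then show ?thesis using near0[OF False] notP[OF False] w by (auto simp: N_def)
        qed
      qed
      then show ?thesis using True by simp
    qed
    obtain G where G: "\<And>w. w \<in> {w. w \<notin> Q \<or> \<omega> w = 0} \<Longrightarrow> GDERIV V w :> G w" "continuous_on {w. w \<notin> Q \<or> \<omega> w = 0} G"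
      by (rule C1_at_gradient[of "{w. w \<notin> Q \<or> \<omega> w = 0}" V]) (rule C, simp, rule that)
    have G_eq: "G w = cnj (- 1 / w\<^sup>2) * G0 (c + 1 / w) - 2 *\<^sub>R (1 / cnj w)" if w: "w \<notin> Q" for w
    proof -
      have w0: "w \<noteq> 0" using w Q0 by blast
      have z: "c + 1 / w \<notin> P" using notP[OF w0] w by blast
      have "((\<lambda>w. c + 1 / w) has_field_derivative (- 1 / w\<^sup>2)) (at w)"
        using w0 by (auto intro!: derivative_eq_intros simp: power2_eq_square)
      from GDERIV_compose_holomorphic[OF grad0(1)[OF z] this]
      have 1: "GDERIV (\<lambda>w. V0 (c + 1 / w)) w :> cnj (- 1 / w\<^sup>2) * G0 (c + 1 / w)" .
      have 2: "GDERIV (\<lambda>w. 2 * ln (cmod w)) w :> 2 *\<^sub>R (1 / cnj w)"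
        using GDERIV_mult[OF GDERIV_const[of 2] GDERIV_ln_norm[OF w0]] by simp
      have "GDERIV V w :> cnj (- 1 / w\<^sup>2) * G0 (c + 1 / w) - 2 *\<^sub>R (1 / cnj w)"
        by (rule GDERIV_cong_open[OF GDERIV_diff[OF 1 2] o0]) (use w0 in \<open>auto simp: V_def\<close>)
      then show ?thesis using G(1)[of w] w GDERIV_unique by blast
    qed
    have football: "conf_football V G k Q \<omega> (D p) a b"
    proof
      show "finite Q" by (rule finQ)
      show "GDERIV V z :> G z" if "z \<notin> Q \<or> \<omega> z = 0" for z using G(1) that by blast
      show "continuous_on {z. z \<notin> Q \<or> \<omega> z = 0} G" by (rule G(2))
      show "V \<in> borel_measurable borel" "k \<in> borel_measurable borel" by (fact V_meas, fact k_meas)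
      show "0 < a" "a \<le> k z" "k z \<le> b" for z using a_pos k0 by (auto simp: k_def)
      show "\<omega> q \<le> 0" for q by (simp add: \<omega>_def D_nonpos)
      show "-1 < D p" by (rule D_gt)
      show "-1 < (\<Sum>w\<in>Q. \<omega> w)" using sum_mchart[OF fin finQ inQ] gt by (simp add: \<omega>_def)
      show "\<exists>L. ((\<lambda>z. V z - \<omega> w0 * ln (cmod (z - w0))) \<longlongrightarrow> L) (at w0)" if w0: "w0 \<in> Q" "\<omega> w0 \<noteq> 0" for w0
      proof (cases "w0 = 0")
        case True
        have m: "filterlim (\<lambda>w. w / (1 + c * w)) (at 0) (at 0)"
        proof -
          have "((\<lambda>w. w / (1 + c * w)) \<longlongrightarrow> 0 / (1 + c * 0)) (at 0)" by (intro tendsto_intros) auto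
          moreover have "\<forall>\<^sub>F w in at 0. w / (1 + c * w) \<noteq> 0"
            using eventually_at_in_open[OF oN(1), of 0] by (auto elim: eventually_mono)
          ultimately show ?thesis by (simp add: filterlim_at)
        qed
        have "((\<lambda>w. ln (cmod (1 + c * w))) \<longlongrightarrow> ln (cmod (1 + c * 0))) (at 0)" by (intro tendsto_intros) auto
        then have l: "((\<lambda>w. (2 + D None) * ln (cmod (1 + c * w))) \<longlongrightarrow> (2 + D None) * 0) (at 0)"
          by (intro tendsto_mult_left) simp
        have "\<forall>\<^sub>F w in at 0. (ln (Defs.density g None (w / (1 + c * w))) / 2 - D None * ln (cmod (w / (1 + c * w)))) - (2 + D None) * ln (cmod (1 + c * w))
            = V w - \<omega> w0 * ln (cmod (w - w0))"
          using eventually_at_in_open[OF oN(2) N0]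
        proof eventually_elim
          case (elim w)
          then have w: "w \<noteq> 0" "1 + c * w \<noteq> 0" "c + 1 / w \<notin> P" using notP[of w] by (auto simp: N_def)
          show ?case
            using near0[OF w] w True \<omega>0 by (simp add: norm_divide ln_div algebra_simps)
        qed
        from Lim_transform_eventually[OF tendsto_diff[OF filterlim_compose[OF Li m] l] this]
        show ?thesis using True by blast
      next
        case False
        define q where "q = c + 1 / w0"
        obtain L where L: "((\<lambda>z. V0 z - D (Some q) * ln (cmod (z - q))) \<longlongrightarrow> L) (at q)" using lim0 by blast
        have D: "\<omega> w0 = D (Some q)" using \<omega>1[OF False] by (simp add: q_def)
        have f: "filterlim (\<lambda>w. c + 1 / w) (at q) (at w0)" unfolding q_def by (rule filterlim_shifted_inverse(2)[OF False])
        have l: "((\<lambda>w. (2 + D (Some q)) * ln (cmod w) + D (Some q) * ln (cmod w0)) \<longlongrightarrow>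
            (2 + D (Some q)) * ln (cmod w0) + D (Some q) * ln (cmod w0)) (at w0)"
          using False by (intro tendsto_intros) auto
        have "\<forall>\<^sub>F w in at w0. (V0 (c + 1 / w) - D (Some q) * ln (cmod (c + 1 / w - q)))
            - ((2 + D (Some q)) * ln (cmod w) + D (Some q) * ln (cmod w0)) = V w - \<omega> w0 * ln (cmod (w - w0))"
          using eventually_neq_at_within[of w0 w0 UNIV] eventually_neq_at_within[of 0 w0 UNIV]
        proof eventually_elim
          case (elim w)
          have "c + 1 / w - q = (w0 - w) / (w * w0)" using elim False by (simp add: q_def field_simps)
          then have "cmod (c + 1 / w - q) = cmod (w - w0) / (cmod w * cmod w0)"
            by (simp add: norm_divide norm_mult norm_minus_commute)
          then have "ln (cmod (c + 1 / w - q)) = ln (cmod (w - w0)) - (ln (cmod w) + ln (cmod w0))"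
            using elim False by (simp add: ln_div ln_mult)
          then show ?case using elim(2) by (simp only: D V_def if_False) (simp only: algebra_simps)
        qed
        from Lim_transform_eventually[OF tendsto_diff[OF filterlim_compose[OF L f] l] this]
        show ?thesis by blast
      qed
      obtain L where L: "((\<lambda>z. V0 z - D (Some c) * ln (cmod (z - c))) \<longlongrightarrow> L) (at c)" using lim0 by blast
      have "\<forall>\<^sub>F w in at_infinity. V0 (c + 1 / w) - D (Some c) * ln (cmod (c + 1 / w - c)) = V w + (2 + D p) * ln (cmod w)"
        using eventually_not_equal_at_infinity[of "0::complex"]
        by eventually_elim (auto simp: V_def Some norm_divide ln_div algebra_simps)
      from Lim_transform_eventually[OF filterlim_compose[OF L filterlim_shifted_inverse(1)] this]
      show "\<exists>L. ((\<lambda>z. V z + (2 + D p) * ln (cmod z)) \<longlongrightarrow> L) at_infinity" by blast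
      show "integrable lborel (\<lambda>z. k z * exp (2 * V z) * \<psi> z) \<and> (LINT z|lborel. \<Psi> z \<bullet> G z) = (LINT z|lborel. k z * exp (2 * V z) * \<psi> z)"
        if psi: "C1c \<psi> \<Psi>" and van: "\<And>q. q \<in> Q \<Longrightarrow> \<exists>e>0. \<forall>z\<in>ball q e. \<psi> z = 0" for \<psi> \<Psi>
      proof -
        obtain e where e: "e > 0" "\<And>w. w \<in> ball 0 e \<Longrightarrow> \<psi> w = 0" using van[OF Q0] by blast
        define \<phi> where "\<phi> z = (if z = c then 0 else \<psi> (1 / (z - c)))" for z
        define \<Phi> where "\<Phi> z = (if z = c then 0 else cnj (- 1 / (z - c)\<^sup>2) * \<Psi> (1 / (z - c)))" for z
        have phi: "C1c \<phi> \<Phi>" unfolding \<phi>_def[abs_def] \<Phi>_def[abs_def] by (rule C1c_inversion(1)[OF psi e])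
        have van': "\<exists>r>0. \<forall>z\<in>ball q r. \<phi> z = 0" if q: "q \<in> P" for q
        proof (cases "q = c")
          case True
          then show ?thesis unfolding \<phi>_def using C1c_inversion(2)[OF psi e, of c] by simp
        next
          case False
          then have "1 / (q - c) \<in> Q" using q by (auto simp: Q_def)
          then obtain d where d: "d > 0" "\<forall>w\<in>ball (1 / (q - c)) d. \<psi> w = 0" using van by blast
          have "open (- {c} \<inter> (\<lambda>z. 1 / (z - c)) -` ball (1 / (q - c)) d)"
            by (intro continuous_open_preimage continuous_intros) auto
          moreover have "q \<in> - {c} \<inter> (\<lambda>z. 1 / (z - c)) -` ball (1 / (q - c)) d" using False d by simp
          ultimately obtain r where r: "r > 0" "ball q r \<subseteq> - {c} \<inter> (\<lambda>z. 1 / (z - c)) -` ball (1 / (q - c)) d"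
            using open_contains_ball by blast
          then show ?thesis using d(2) by (intro exI[of _ r]) (auto simp: \<phi>_def)
        qed
        have W: "integrable lborel (\<lambda>z. k0 z * exp (2 * V0 z) * \<phi> z) \<and> integrable lborel (\<lambda>z. \<Phi> z \<bullet> G0 z) \<and>
            (LINT z|lborel. \<Phi> z \<bullet> G0 z) = (LINT z|lborel. k0 z * exp (2 * V0 z) * \<phi> z)"
          by (rule weak0[OF phi]) (use van' in blast)
        have notQ: "AE w in lborel. w \<notin> Q" using finite_imp_null_set_lborel[OF finQ] by (rule AE_not_in)
        define F1 where "F1 z = \<Phi> z \<bullet> G0 z" for z
        define F2 where "F2 z = k0 z * exp (2 * V0 z) * \<phi> z" for z
        have iF: "integrable lborel F1" "integrable lborel F2" and eqF: "(LINT z|lborel. F1 z) = (LINT z|lborel. F2 z)"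
          using W by (auto simp: F1_def[abs_def] F2_def[abs_def])
        note inv1 = integral_inversion[OF iF(1), of c]
        note inv2 = integral_inversion[OF iF(2), of c]
        \<comment> \<open>The term -2 ln|w| in V is harmonic away from 0, where the test function
          vanishes, so it adds no flux.\<close>
        have fl: "(LINT z|lborel. \<Psi> z \<bullet> (1 / cnj (z - 0))) = 0" "integrable lborel (\<lambda>z. \<Psi> z \<bullet> (1 / cnj (z - 0)))"
          using flux_ln[OF psi e(1), of 0] e by auto
        \<comment> \<open>Conformal invariance: both gradients pick up a factor of modulus |w|^{-2}
          under the inversion, and together these are the Jacobian |w|^{-4}.\<close>
        have p1: "\<Psi> w \<bullet> G w = F1 (c + 1 / w) / cmod w ^ 4 - 2 * (\<Psi> w \<bullet> (1 / cnj (w - 0)))" if w: "w \<notin> Q" for w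
        proof -
          have w0: "w \<noteq> 0" using w Q0 by blast
          have \<Phi>w: "\<Phi> (c + 1 / w) = cnj (- (w\<^sup>2)) * \<Psi> w" using w0 by (simp add: \<Phi>_def power_divide)
          have "F1 (c + 1 / w) / cmod w ^ 4 = Re (cnj (- (w\<^sup>2)) * \<Psi> w * cnj (G0 (c + 1 / w))) / cmod w ^ 4"
            by (simp only: F1_def \<Phi>w inner_conv_cnj)
          also have "\<dots> = Re (cnj (- (w\<^sup>2)) * \<Psi> w * cnj (G0 (c + 1 / w)) / of_real (cmod w ^ 4))"
            by (simp only: Re_divide_of_real)
          also have "complex_of_real (cmod w ^ 4) = w\<^sup>2 * cnj (w\<^sup>2)"
          proof -
            have "complex_of_real (cmod w ^ 4) = complex_of_real ((cmod w)\<^sup>2) ^ 2" by (simp flip: power_mult)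
            also have "\<dots> = (w * cnj w)\<^sup>2" by (simp only: complex_norm_square)
            finally show ?thesis by (simp add: power_mult_distrib)
          qed
          also have "cnj (- (w\<^sup>2)) * \<Psi> w * cnj (G0 (c + 1 / w)) / (w\<^sup>2 * cnj (w\<^sup>2)) = \<Psi> w * cnj (cnj (- 1 / w\<^sup>2) * G0 (c + 1 / w))"
            using w0 by (simp add: field_simps)
          also have "Re \<dots> = \<Psi> w \<bullet> (cnj (- 1 / w\<^sup>2) * G0 (c + 1 / w))" by (simp only: inner_conv_cnj)
          finally show ?thesis unfolding G_eq[OF w] by (simp add: inner_diff_right)
        qed
        have G_ae: "AE w in lborel. \<Psi> w \<bullet> G w = F1 (c + 1 / w) / cmod w ^ 4 - 2 * (\<Psi> w \<bullet> (1 / cnj (w - 0)))"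
          using notQ by eventually_elim (rule p1)
        have "has_bochner_integral lborel (\<lambda>w. F1 (c + 1 / w) / cmod w ^ 4 - 2 * (\<Psi> w \<bullet> (1 / cnj (w - 0)))) ((LINT z|lborel. F1 z) - 2 * 0)"
          using inv1 fl by (intro has_bochner_integral_diff has_bochner_integral_mult_right) (auto simp: has_bochner_integral_iff)
        then have I: "(LINT w|lborel. F1 (c + 1 / w) / cmod w ^ 4 - 2 * (\<Psi> w \<bullet> (1 / cnj (w - 0)))) = (LINT z|lborel. F1 z)"
          by (simp add: has_bochner_integral_iff)
        have Gm: "(\<lambda>w. \<Psi> w \<bullet> G w) \<in> borel_measurable lborel"
        proof -
          have "open {w. w \<notin> Q \<or> \<omega> w = 0}"
          proof -
            have "{w. w \<notin> Q \<or> \<omega> w = 0} = - {w \<in> Q. \<omega> w \<noteq> 0}" by auto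
            then show ?thesis using finQ by (simp add: open_Compl finite_imp_closed)
          qed
          then have "integrable lborel (\<lambda>w. \<Psi> w \<bullet> G w)"
            by (rule C1c_inner_integrable_locally_const[OF psi _ G(2)]) (use van in blast)
          then show ?thesis by (rule borel_measurable_integrable)
        qed
        have "(LINT w|lborel. \<Psi> w \<bullet> G w) = (LINT w|lborel. F1 (c + 1 / w) / cmod w ^ 4 - 2 * (\<Psi> w \<bullet> (1 / cnj (w - 0))))"
          by (rule integral_cong_AE[OF Gm _ G_ae]) (intro borel_measurable_integrable Bochner_Integration.integrable_diff inv1(1) integrable_mult_right fl(2))
        also have "\<dots> = (LINT w|lborel. F2 (c + 1 / w) / cmod w ^ 4)" using I eqF inv2(2) by simp
        finally have eqF2: "(LINT w|lborel. \<Psi> w \<bullet> G w) = (LINT w|lborel. F2 (c + 1 / w) / cmod w ^ 4)" .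
        have ae: "AE w in lborel. F2 (c + 1 / w) / cmod w ^ 4 = k w * exp (2 * V w) * \<psi> w"
          using notQ
        proof eventually_elim
          case (elim w)
          then have w0: "w \<noteq> 0" using Q0 by blast
          have "exp (2 * V w) = exp (2 * V0 (c + 1 / w)) / exp (4 * ln (cmod w))" using w0 by (simp add: V_def exp_diff)
          also have "exp (4 * ln (cmod w)) = cmod w ^ 4" using w0 exp_of_nat_mult[of 4 "ln (cmod w)"] by simp
          finally show ?case using w0 by (simp add: F2_def k_def \<phi>_def)
        qed
        have m: "(\<lambda>w. F2 (c + 1 / w) / cmod w ^ 4) \<in> borel_measurable lborel" "(\<lambda>w. k w * exp (2 * V w) * \<psi> w) \<in> borel_measurable lborel"
          by (rule borel_measurable_integrable[OF inv2(1)]) (use V_meas k_meas C1c_borel(1)[OF psi] in measurable)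
        show ?thesis
          unfolding eqF2 using integral_cong_AE[OF m ae] integrable_cong_AE[OF m ae] inv2(1) by simp
      qed
    qed
    have "mdens g p w = exp (2 * V w)" if w: "D (mchart p w) = 0" for w
    proof (cases "w = 0")
      case True
      then have "D None = 0" using w by (simp add: Some mchart_def)
      then have "g None > 0" using regular_inf unfolding regular_at_def by (metis density_simps(3))
      then show ?thesis using True Some by (simp add: mdens_def V_def)
    next
      case False
      have "c + 1 / w \<notin> P" using notP[OF False] w by (simp add: \<omega>_def)
      moreover have "exp (4 * ln (cmod w)) = cmod w ^ 4" using False exp_of_nat_mult[of 4 "ln (cmod w)"] by simp
      ultimately show ?thesis using False Some by (simp add: mdens_def V_def g0 exp_diff)
    qed
    then show ?thesis using that football[unfolded \<omega>_def] inQ by blast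
  qed
qed

end

section \<open>Isometries with the model\<close>

text \<open>The plane is Hausdorff, so the closedness demanded along with compactness in the
  one-point compactification is automatic.\<close>

lemma sphere_open:
  "openin sphere_top V \<longleftrightarrow> (\<exists>U. open U \<and> V = Some ` U) \<or> (\<exists>C. compact C \<and> V = insert None (Some ` (- C)))"
  unfolding sphere_top_def openin_Alexandroff_compactification
  by (auto simp: Compl_eq_Diff_UNIV compact_imp_closed)

lemma topspace_sphere [simp]: "topspace sphere_top = UNIV"
  unfolding sphere_top_def by (auto simp: image_iff)

lemma continuous_map_sphereI:
  assumes "\<And>U. open U \<Longrightarrow> openin sphere_top (f -` (Some ` U))"
    and "\<And>C. compact C \<Longrightarrow> openin sphere_top (f -` (insert None (Some ` (- C))))"
  shows "continuous_map sphere_top sphere_top f"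
  unfolding continuous_map_def
proof (intro conjI allI impI)
  fix V assume "openin sphere_top V"
  then have "openin sphere_top (f -` V)" using assms unfolding sphere_open[of V] by blast
  moreover have "{x \<in> topspace sphere_top. f x \<in> V} = f -` V" by auto
  ultimately show "openin sphere_top {x \<in> topspace sphere_top. f x \<in> V}" by simp
qed simp

lemma sphere_open_Some: "open U \<Longrightarrow> openin sphere_top (Some ` U)"
  using sphere_open by blast

lemma sphere_open_None: "compact C \<Longrightarrow> openin sphere_top (insert None (Some ` (- C)))"
  using sphere_open by blast

text \<open>At \<infinity> continuity needs compact preimages of compact sets; these are images
  under the continuous inverse.\<close>

lemma homeomorphic_map_option:
  assumes "continuous_on UNIV f" "continuous_on UNIV h" "\<And>z. h (f z) = z" "\<And>z. f (h z) = z"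
  shows "homeomorphic_map sphere_top sphere_top (map_option f)"
proof -
  have c: "continuous_map sphere_top sphere_top (map_option f)"
    if f: "continuous_on UNIV f" and h: "continuous_on UNIV h" "\<And>z. h (f z) = z" "\<And>z. f (h z) = z" for f h :: "complex \<Rightarrow> complex"
  proof (rule continuous_map_sphereI)
    fix U :: "complex set" assume "open U"
    moreover have "map_option f -` (Some ` U) = Some ` (f -` U)" by (auto simp: image_iff)
    ultimately show "openin sphere_top (map_option f -` (Some ` U))"
      using f by (auto intro!: sphere_open_Some open_vimage)
  next
    fix C :: "complex set" assume C: "compact C"
    have "f -` C = h ` C" using h by (auto simp: image_iff) metis
    then have "compact (f -` C)" using compact_continuous_image[OF continuous_on_subset[OF h(1)] C] by simp
    moreover have "map_option f -` (insert None (Some ` (- C))) = insert None (Some ` (- (f -` C)))"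
    proof (rule set_eqI)
      fix x show "x \<in> map_option f -` (insert None (Some ` (- C))) \<longleftrightarrow> x \<in> insert None (Some ` (- (f -` C)))"
        by (cases x) auto
    qed
    ultimately show "openin sphere_top (map_option f -` (insert None (Some ` (- C))))"
      using sphere_open_None by simp
  qed
  have "homeomorphic_maps sphere_top sphere_top (map_option f) (map_option h)"
    unfolding homeomorphic_maps_def using c[OF assms] c[OF assms(2,1,4,3)] assms(3,4)
    by (auto simp: option.map_comp o_def option.map_id0[unfolded id_def])
  then show ?thesis using homeomorphic_map_maps by blast
qed

definition inv0 :: "sphere \<Rightarrow> sphere" where
  "inv0 q = (case q of None \<Rightarrow> Some 0 | Some z \<Rightarrow> if z = 0 then None else Some (1 / z))"

lemma inv0_inv0: "inv0 (inv0 q) = q"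
  by (auto simp: inv0_def split: option.splits)

text \<open>As an involution the map only has to be continuous. Whether 0 lies in the given open or
  compact set decides on which side the preimage contains \<infinity>.\<close>

lemma homeomorphic_map_inv0: "homeomorphic_map sphere_top sphere_top inv0"
proof (rule homeomorphic_map_involution)
  show "inv0 (inv0 q) = q" for q by (rule inv0_inv0)
  have op: "open (- {0} \<inter> (\<lambda>z::complex. 1 / z) -` U)" if "open U" for U
    using that by (intro continuous_open_preimage continuous_intros) auto
  show "continuous_map sphere_top sphere_top inv0"
  proof (rule continuous_map_sphereI)
    fix U :: "complex set" assume U: "open U"
    show "openin sphere_top (inv0 -` (Some ` U))"
    proof (cases "0 \<in> U")
      case False
      have "inv0 -` (Some ` U) = Some ` (- {0} \<inter> (\<lambda>z. 1 / z) -` U)"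
      proof (rule set_eqI)
        fix x show "x \<in> inv0 -` (Some ` U) \<longleftrightarrow> x \<in> Some ` (- {0} \<inter> (\<lambda>z. 1 / z) -` U)"
          by (cases x) (use False in \<open>auto simp: inv0_def\<close>)
      qed
      then show ?thesis using sphere_open_Some[OF op[OF U]] by simp
    next
      case True
      obtain e where e: "e > 0" "ball 0 e \<subseteq> U" using U True open_contains_ball by blast
      define C where "C = - (- {0} \<inter> (\<lambda>z. 1 / z) -` U)"
      have "C \<subseteq> cball 0 (1 / e)"
      proof
        fix z assume z: "z \<in> C"
        show "z \<in> cball 0 (1 / e)"
        proof (cases "z = 0")
          case False
          then have "1 / z \<notin> ball 0 e" using z e by (auto simp: C_def)
          then show ?thesis using False e(1) by (simp add: norm_divide field_simps)
        qed (use e in simp)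
      qed
      then have "bounded C" by (rule bounded_subset[OF bounded_cball])
      moreover have "closed C" unfolding C_def by (intro closed_Compl op U)
      ultimately have "compact C" by (simp add: compact_eq_bounded_closed)
      moreover have "inv0 -` (Some ` U) = insert None (Some ` (- C))"
      proof (rule set_eqI)
        fix x show "x \<in> inv0 -` (Some ` U) \<longleftrightarrow> x \<in> insert None (Some ` (- C))"
          by (cases x) (use True in \<open>auto simp: inv0_def C_def\<close>)
      qed
      ultimately show ?thesis using sphere_open_None by simp
    qed
  next
    fix C :: "complex set" assume C: "compact C"
    then have oC: "open (- C)" by (simp add: compact_imp_closed open_Compl)
    show "openin sphere_top (inv0 -` (insert None (Some ` (- C))))"
    proof (cases "0 \<in> C")
      case True
      obtain R where R: "R > 0" "\<And>z. z \<in> C \<Longrightarrow> norm z < R"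
        using compact_imp_bounded[OF C] bounded_pos_less by blast
      have "open (ball 0 (1 / R) \<union> (- {0} \<inter> (\<lambda>z::complex. 1 / z) -` (- C)))" using op[OF oC] by auto
      moreover have "inv0 -` (insert None (Some ` (- C))) = Some ` (ball 0 (1 / R) \<union> (- {0} \<inter> (\<lambda>z. 1 / z) -` (- C)))"
      proof (rule set_eqI)
        have *: "1 / z \<notin> C" if "cmod z < 1 / R" "z \<noteq> 0" for z
          using R(2)[of "1 / z"] R(1) that by (auto simp: norm_divide field_simps)
        fix x show "x \<in> inv0 -` (insert None (Some ` (- C))) \<longleftrightarrow> x \<in> Some ` (ball 0 (1 / R) \<union> (- {0} \<inter> (\<lambda>z. 1 / z) -` (- C)))"
          by (cases x) (use True R(1) * in \<open>auto simp: inv0_def\<close>)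
      qed
      ultimately show ?thesis using sphere_open_Some by simp
    next
      case False
      have "compact ((\<lambda>z. 1 / z) ` C)"
        using False by (intro compact_continuous_image C continuous_intros) auto
      moreover have "inv0 -` (insert None (Some ` (- C))) = insert None (Some ` (- ((\<lambda>z. 1 / z) ` C)))"
      proof (rule set_eqI)
        have *: "z \<in> (\<lambda>z. 1 / z) ` C \<longleftrightarrow> z \<noteq> 0 \<and> 1 / z \<in> C" for z
          using False by (auto simp: image_iff intro!: bexI[of _ "1 / z"])
        fix x show "x \<in> inv0 -` (insert None (Some ` (- C))) \<longleftrightarrow> x \<in> insert None (Some ` (- ((\<lambda>z. 1 / z) ` C)))"
          by (cases x) (use False in \<open>auto simp: inv0_def *\<close>)
      qed
      ultimately show ?thesis using sphere_open_None by simp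
    qed
  qed
qed

text \<open>The inverse of \<open>mchart p\<close>, extended by sending \<open>p\<close> to
  \<infinity>.\<close>

definition pinv :: "sphere \<Rightarrow> sphere \<Rightarrow> sphere" where
  "pinv p q = (case p of None \<Rightarrow> q | Some c \<Rightarrow> inv0 (map_option (\<lambda>z. z - c) q))"

lemma pinv_mchart: "pinv p (mchart p w) = Some w" "pinv p p = None"
  by (auto simp: pinv_def mchart_def inv0_def split: option.splits)

lemma homeomorphic_map_pinv: "homeomorphic_map sphere_top sphere_top (pinv p)"
proof (cases p)
  case None
  then have "pinv p = id" by (auto simp: pinv_def fun_eq_iff)
  then show ?thesis by simp
next
  case (Some c)
  have "homeomorphic_map sphere_top sphere_top (map_option (\<lambda>z. z - c))"
    by (rule homeomorphic_map_option[of _ "\<lambda>z. z + c"]) (auto intro!: continuous_intros)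
  from homeomorphic_map_compose[OF this homeomorphic_map_inv0]
  show ?thesis using Some by (simp add: pinv_def[abs_def] o_def)
qed

text \<open>The inverse chart is holomorphic in the standard coordinate at \<open>q\<close>, and the
  squared modulus of its derivative is the ratio of the two densities. For finite \<open>p\<close>
  and q = \<infinity> it reads z/(1 - c z).\<close>

lemma pinv_local:
  assumes q: "q = mchart p w0"
  obtains U m m' where "open U" "coord q q \<in> U" "\<And>z. z \<in> U \<Longrightarrow> pinv p (param q z) = Some (m z)"
    "\<And>z. z \<in> U \<Longrightarrow> (m has_field_derivative m' z) (at z)" "continuous_on U m'"
    "mdens g p w0 * (cmod (m' (coord q q)))\<^sup>2 = g q"
proof (cases p)
  case None
  show thesis
    by (rule that[of UNIV "\<lambda>z. z" "\<lambda>z. 1"]) (auto simp: None q mchart_def pinv_def param_def mdens_def)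
next
  case (Some c)
  show thesis
  proof (cases "w0 = 0")
    case False
    have q': "q = Some (c + 1 / w0)" "coord q q = c + 1 / w0" using False by (auto simp: Some q mchart_def coord_def)
    show thesis
    proof (rule that[of "- {c}" "\<lambda>z. 1 / (z - c)" "\<lambda>z. - 1 / (z - c)\<^sup>2"])
      show "pinv p (param q z) = Some (1 / (z - c))" if "z \<in> - {c}" for z
        using that by (auto simp: pinv_def param_def q' Some inv0_def)
      show "((\<lambda>z. 1 / (z - c)) has_field_derivative - 1 / (z - c)\<^sup>2) (at z)" if "z \<in> - {c}" for z
        using that by (auto intro!: derivative_eq_intros simp: power2_eq_square)
      show "continuous_on (- {c}) (\<lambda>z. - 1 / (z - c)\<^sup>2)" by (intro continuous_intros) auto
      have "(cmod (- 1 / (coord q q - c)\<^sup>2))\<^sup>2 = cmod w0 ^ 4"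
        unfolding q'(2) by (simp add: norm_divide norm_power power_divide flip: power_mult)
      then show "mdens g p w0 * (cmod (- 1 / (coord q q - c)\<^sup>2))\<^sup>2 = g q"
        using False by (simp add: mdens_def Some q'(1))
    qed (use False q' in auto)
  next
    case True
    have q': "q = None" "coord q q = 0" using True by (auto simp: Some q mchart_def coord_def)
    show thesis
    proof (rule that[of "{z. 1 - c * z \<noteq> 0}" "\<lambda>z. z / (1 - c * z)" "\<lambda>z. 1 / (1 - c * z)\<^sup>2"])
      show "open {z. 1 - c * z \<noteq> 0}" by (intro open_Collect_neq continuous_intros)
      show "pinv p (param q z) = Some (z / (1 - c * z))" if "z \<in> {z. 1 - c * z \<noteq> 0}" for z
      proof (cases "z = 0")
        case True
        then show ?thesis by (simp add: pinv_def param_def q' Some inv0_def)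
      next
        case False
        have "1 / z - c = (1 - c * z) / z" using False by (simp add: field_simps)
        then show ?thesis using False that by (simp add: pinv_def param_def q' Some inv0_def)
      qed
      show "((\<lambda>z. z / (1 - c * z)) has_field_derivative 1 / (1 - c * z)\<^sup>2) (at z)" if "z \<in> {z. 1 - c * z \<noteq> 0}" for z
        using that by (auto intro!: derivative_eq_intros simp: power2_eq_square field_simps)
      show "continuous_on {z. 1 - c * z \<noteq> 0} (\<lambda>z. 1 / (1 - c * z)\<^sup>2)" by (intro continuous_intros) auto
      show "mdens g p w0 * (cmod (1 / (1 - c * coord q q)\<^sup>2))\<^sup>2 = g q"
        using True unfolding q'(2) by (simp add: mdens_def Some q'(1))
    qed (use q' in auto)
  qed
qed

text \<open>The isometry is the inverse chart followed by the similarity that moves \<open>c\<close>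
  to 0 and the circle of radius \<open>r\<close> to the unit circle.\<close>

lemma isometry_of_affine_chart:
  assumes r: "r > 0"
    and div: "\<And>w. D (mchart p w) = (if w = c then \<alpha> else 0)"
    and met: "\<And>w. D (mchart p w) = 0 \<Longrightarrow> model_metric a b \<alpha> (D p) (Some ((w - c) / of_real r)) = r\<^sup>2 * mdens g p w"
    and Dp: "D p \<noteq> 0"
  shows "isometric D g (model_divisor \<alpha> (D p)) (model_metric a b \<alpha> (D p))"
proof -
  define A where "A w = (w - c) / of_real r" for w :: complex
  define F where "F = map_option A \<circ> pinv p"
  have Fp: "F p = None" by (simp add: F_def pinv_mchart)
  have Fm: "F (mchart p w) = Some (A w)" for w by (simp add: F_def pinv_mchart)
  have "homeomorphic_map sphere_top sphere_top (map_option A)"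
    by (rule homeomorphic_map_option[of _ "\<lambda>z. of_real r * z + c"])
       (use r in \<open>auto simp: A_def intro!: continuous_intros\<close>)
  then have homeo: "homeomorphic_map sphere_top sphere_top F"
    unfolding F_def by (rule homeomorphic_map_compose[OF homeomorphic_map_pinv])
  have cases: "q = p \<or> (\<exists>w. q = mchart p w)" for q using mchart_range[of p] by blast
  have "model_divisor \<alpha> (D p) (F q) = D q" for q
  proof (cases "q = p")
    case True
    then show ?thesis by (simp add: Fp model_divisor_def)
  next
    case False
    then obtain w where w: "q = mchart p w" using cases by blast
    have "A w = 0 \<longleftrightarrow> w = c" using r by (simp add: A_def)
    then show ?thesis by (simp add: w Fm model_divisor_def div)
  qed
  moreover have "\<exists>U L. open U \<and> coord q q \<in> U \<and>
           (\<forall>z\<in>U. ((\<lambda>z. coord (F q) (F (param q z))) has_derivative blinfun_apply (L z)) (at z)) \<and>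
           continuous_on U L \<and>
           (\<forall>v. model_metric a b \<alpha> (D p) (F q) * (cmod (blinfun_apply (L (coord q q)) v))\<^sup>2 = g q * (cmod v)\<^sup>2)"
    if Dq: "D q = 0" for q
  proof -
    \<comment> \<open>The point sent to \<infinity> is conic, so the differential condition concerns
      only points inside the chart.\<close>
    have "q \<noteq> p" using Dq Dp by auto
    then obtain w where w: "q = mchart p w" using cases by blast
    obtain U m m' where U: "open U" "coord q q \<in> U" and m: "\<And>z. z \<in> U \<Longrightarrow> pinv p (param q z) = Some (m z)"
      and m': "\<And>z. z \<in> U \<Longrightarrow> (m has_field_derivative m' z) (at z)" "continuous_on U m'"
      and dens: "mdens g p w * (cmod (m' (coord q q)))\<^sup>2 = g q"
      by (rule pinv_local[OF w]) (rule that)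
    have Fq: "F q = Some (A w)" by (simp add: w Fm)
    define L where "L z = blinfun_mult_right (m' z / of_real r)" for z
    have "((\<lambda>z. coord (F q) (F (param q z))) has_derivative blinfun_apply (L z)) (at z)" if z: "z \<in> U" for z
    proof -
      have "((\<lambda>z. A (m z)) has_field_derivative m' z / of_real r) (at z)"
        unfolding A_def using m'(1)[OF z] r by (auto intro!: derivative_eq_intros)
      then have "((\<lambda>z. A (m z)) has_derivative blinfun_apply (L z)) (at z)"
        by (simp add: L_def has_field_derivative_def)
      then show ?thesis
        by (rule has_derivative_transform_within_open[OF _ U(1) z])
           (simp only: Fq, simp add: F_def m coord_def)
    qed
    moreover have "continuous_on U L" unfolding L_def
      by (intro bounded_linear.continuous_on[OF bounded_linear_blinfun_mult_right] continuous_intros m'(2)) (use r in auto)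
    moreover have "model_metric a b \<alpha> (D p) (F q) * (cmod (blinfun_apply (L (coord q q)) v))\<^sup>2 = g q * (cmod v)\<^sup>2" for v
    proof -
      have "model_metric a b \<alpha> (D p) (F q) = r\<^sup>2 * mdens g p w" using met[of w] Dq by (simp add: w Fm A_def)
      moreover have "(cmod (blinfun_apply (L (coord q q)) v))\<^sup>2 = (cmod (m' (coord q q)))\<^sup>2 * (cmod v)\<^sup>2 / r\<^sup>2"
        using r by (simp add: L_def norm_mult norm_divide power_mult_distrib power_divide)
      ultimately show ?thesis using r by (simp add: dens[symmetric])
    qed
    ultimately show ?thesis using U by blast
  qed
  ultimately have "conic_isometry D g (model_divisor \<alpha> (D p)) (model_metric a b \<alpha> (D p)) F"
    unfolding conic_isometry_def using homeo by blast
  then show ?thesis unfolding isometric_def by blast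
qed

text \<open>Multiplication by the square of y = R/r turns the exponent 2 \<alpha> into 2 (1 +
  \<alpha>), the form delivered by rigidity. Positivity of y also makes the two conventions for
  \<alpha> = 0 agree.\<close>

lemma model_metric_inside:
  assumes R: "R > 0" "r > 0" "R \<le> r" and z: "cmod z = R / r"
    and E: "E * R\<^sup>2 = 4 * (1 + \<alpha>)\<^sup>2 / b * (R / r) powr (2 * (1 + \<alpha>)) / (1 + (R / r) powr (2 * (1 + \<alpha>)))\<^sup>2"
  shows "model_metric a b \<alpha> \<beta> (Some z) = r\<^sup>2 * E"
proof -
  define y where "y = R / r"
  have y: "0 < y" "y \<le> 1" using R by (auto simp: y_def)
  have p: "y powr (2 * (1 + \<alpha>)) = y powr (2 * \<alpha>) * y\<^sup>2"
    using y by (simp add: powr_add distrib_left)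
  have i: "(if \<alpha> = 0 then 1 else y powr (2 * \<alpha>)) = y powr (2 * \<alpha>)" using y by simp
  have Ry: "R\<^sup>2 = y\<^sup>2 * r\<^sup>2" using R by (simp add: y_def power_divide)
  have "(r\<^sup>2 * E) * y\<^sup>2 = 4 * (1 + \<alpha>)\<^sup>2 / b * (y powr (2 * \<alpha>) * y\<^sup>2) / (1 + y powr (2 * (1 + \<alpha>)))\<^sup>2"
    using E unfolding Ry y_def[symmetric] p by (simp add: mult_ac)
  also have "\<dots> = model_metric a b \<alpha> \<beta> (Some z) * y\<^sup>2"
    using y z i by (simp add: model_metric_def y_def[symmetric])
  finally show ?thesis using y by simp
qed

lemma model_metric_outside:
  assumes R: "R > 0" "r > 0" "r < R" and z: "cmod z = R / r"
    and E: "E * R\<^sup>2 = 4 * (1 + \<beta>)\<^sup>2 / a * (R / r) powr (2 * (1 + \<beta>)) / (1 + (R / r) powr (2 * (1 + \<beta>)))\<^sup>2"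
  shows "model_metric a b \<alpha> \<beta> (Some z) = r\<^sup>2 * E"
proof -
  define y where "y = R / r"
  have y: "1 < y" using R by (auto simp: y_def)
  define Y where "Y = y powr (2 + 2 * \<beta>)"
  have Y: "Y > 0" using y by (simp add: Y_def)
  have Y': "y powr (2 * (1 + \<beta>)) = Y" by (simp add: Y_def distrib_left)
  have p: "y powr (4 + 2 * \<beta>) = Y * y\<^sup>2"
  proof -
    have "y powr (4 + 2 * \<beta>) = y powr ((2 + 2 * \<beta>) + 2)" by simp
    also have "\<dots> = Y * y powr 2" unfolding Y_def by (rule powr_add)
    finally show ?thesis using y by simp
  qed
  have Ry: "R\<^sup>2 = y\<^sup>2 * r\<^sup>2" using R by (simp add: y_def power_divide)
  have "(1 + 1 / Y)\<^sup>2 * (Y * y\<^sup>2) = (1 + Y)\<^sup>2 * y\<^sup>2 / Y"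
    using Y by (simp add: field_simps power2_eq_square)
  then have m: "model_metric a b \<alpha> \<beta> (Some z) = 1 / a * (4 * (1 + \<beta>)\<^sup>2 / ((1 + Y)\<^sup>2 * y\<^sup>2 / Y))"
    using y z p by (simp add: model_metric_def y_def[symmetric] Y_def[symmetric])
  have "(r\<^sup>2 * E) * y\<^sup>2 = 4 * (1 + \<beta>)\<^sup>2 / a * Y / (1 + Y)\<^sup>2"
    using E unfolding Ry y_def[symmetric] Y' by (simp add: mult_ac)
  also have "\<dots> = model_metric a b \<alpha> \<beta> (Some z) * y\<^sup>2"
    unfolding m using y Y by (simp add: field_simps)
  finally show ?thesis using y by simp
qed

section \<open>Both directions of the equality statement for a conic metric\<close>

context conic_metric
begin

lemma pinching_at:
  assumes gt: "-1 < (\<Sum>q | D q \<noteq> 0. D q) - D p"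
  shows "0 < b" "(1 + ((\<Sum>q | D q \<noteq> 0. D q) - D p))\<^sup>2 / b \<le> (1 + D p)\<^sup>2 / a"
proof -
  obtain V G k Q where f: "conf_football V G k Q (\<lambda>w. D (mchart p w)) (D p) a b"
    and Q: "\<And>w. D (mchart p w) \<noteq> 0 \<Longrightarrow> w \<in> Q"
    by (rule planar_form[OF gt]) (rule that)
  interpret f: conf_football V G k Q "\<lambda>w. D (mchart p w)" "D p" a b by (rule f)
  show "0 < b" using f.k_bounds(1) order_trans[OF f.k_bounds(2) f.k_bounds(3)] by linarith
  show "(1 + ((\<Sum>q | D q \<noteq> 0. D q) - D p))\<^sup>2 / b \<le> (1 + D p)\<^sup>2 / a"
    using f.profile.pinching sum_mchart[OF fin f.finQ Q] by (simp add: f.\<alpha>_def)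
qed

text \<open>Rigidity makes the metric radial about \<open>c\<close> in the chart with
  \<open>p\<close> at \<infinity>; it remains to identify the order at \<open>c\<close> and, if
  \<open>c\<close> is regular, the value there.\<close>

lemma isometric_if_equality:
  assumes \<alpha>: "\<alpha> = (\<Sum>q | D q \<noteq> 0. D q) - D p" "-1 < \<alpha>" and Dp: "D p \<noteq> 0"
    and eq: "(1 + \<alpha>)\<^sup>2 / b = (1 + D p)\<^sup>2 / a"
  shows "isometric D g (model_divisor \<alpha> (D p)) (model_metric a b \<alpha> (D p))"
proof -
  have gt: "-1 < (\<Sum>q | D q \<noteq> 0. D q) - D p" using \<alpha> by simp
  obtain V G k Q where f: "conf_football V G k Q (\<lambda>w. D (mchart p w)) (D p) a b"
    and Q: "\<And>w. D (mchart p w) \<noteq> 0 \<Longrightarrow> w \<in> Q"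
    and dens: "\<And>w. D (mchart p w) = 0 \<Longrightarrow> mdens g p w = exp (2 * V w)"
    by (rule planar_form[OF gt]) (rule that)
  interpret f: conf_football V G k Q "\<lambda>w. D (mchart p w)" "D p" a b by (rule f)
  have sum: "(\<Sum>w\<in>Q. D (mchart p w)) = \<alpha>" using sum_mchart[OF fin f.finQ Q] \<alpha> by simp
  interpret f: conf_football_eq V G k Q "\<lambda>w. D (mchart p w)" "D p" a b
    by unfold_locales (use sum eq in simp)
  have f\<alpha>: "f.\<alpha> = \<alpha>" by (simp add: f.\<alpha>_def sum)
  obtain c r where r: "r > 0" and S: "f.S \<subseteq> {c}"
    and ins: "\<And>z. z \<noteq> c \<Longrightarrow> cmod (z - c) \<le> r \<Longrightarrow> exp (2 * V z) * (cmod (z - c))\<^sup>2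
        = 4 * (1 + \<alpha>)\<^sup>2 / b * (cmod (z - c) / r) powr (2 * (1 + \<alpha>)) / (1 + (cmod (z - c) / r) powr (2 * (1 + \<alpha>)))\<^sup>2"
    and out: "\<And>z. z \<noteq> c \<Longrightarrow> r \<le> cmod (z - c) \<Longrightarrow> exp (2 * V z) * (cmod (z - c))\<^sup>2
        = 4 * (1 + D p)\<^sup>2 / a * (cmod (z - c) / r) powr (2 * (1 + D p)) / (1 + (cmod (z - c) / r) powr (2 * (1 + D p)))\<^sup>2"
    by (rule f.rigidity[unfolded f\<alpha>]) (rule that)
  have off: "D (mchart p w) = 0" if "w \<noteq> c" for w
    using S that Q[of w] by (auto simp: f.S_def)
  \<comment> \<open>The orders in the plane add up to \<alpha> and vanish away from
    \<open>c\<close>. If \<open>c\<close> is not listed in \<open>Q\<close>, both its order and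
    \<alpha> are 0.\<close>
  have at_c: "D (mchart p c) = \<alpha>"
  proof (cases "c \<in> Q")
    case True
    have "(\<Sum>w\<in>Q. D (mchart p w)) = D (mchart p c) + (\<Sum>w\<in>Q - {c}. D (mchart p w))"
      using f.finQ True by (rule sum.remove)
    then show ?thesis using sum off by simp
  next
    case False
    then have "(\<Sum>w\<in>Q. D (mchart p w)) = 0" using off by (intro sum.neutral) metis
    then show ?thesis using sum Q[of c] False by auto
  qed
  have m_off: "model_metric a b \<alpha> (D p) (Some ((w - c) / of_real r)) = r\<^sup>2 * exp (2 * V w)" if w: "w \<noteq> c" for w
  proof -
    have z: "cmod ((w - c) / of_real r) = cmod (w - c) / r" using r by (simp add: norm_divide)
    show ?thesis
    proof (cases "cmod (w - c) \<le> r")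
      case True
      show ?thesis by (rule model_metric_inside[OF _ r True z ins[OF w True]]) (use w in simp)
    next
      case False
      then have lt: "r < cmod (w - c)" by simp
      show ?thesis by (rule model_metric_outside[OF _ r lt z out[OF w]]) (use w lt in auto)
    qed
  qed
  \<comment> \<open>For \<alpha> = 0 the centre is a regular point that the isometry must respect,
    but the radial formula excludes it; continuity of V fills in the value.\<close>
  have m_c: "model_metric a b \<alpha> (D p) (Some 0) = r\<^sup>2 * exp (2 * V c)" if \<alpha>0: "\<alpha> = 0"
  proof -
    have "GDERIV V c :> G c" by (rule f.grad) (use at_c \<alpha>0 in simp)
    then have "isCont V c" unfolding gderiv_def by (rule has_derivative_continuous)
    then have "(V \<longlongrightarrow> V c) (at c)" by (simp add: isCont_def)
    then have l1: "((\<lambda>w. r\<^sup>2 * exp (2 * V w)) \<longlongrightarrow> r\<^sup>2 * exp (2 * V c)) (at c)" by (intro tendsto_intros)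
    have "((\<lambda>w. 1 / b * (4 / (1 + (cmod (w - c) / r)\<^sup>2)\<^sup>2)) \<longlongrightarrow> 1 / b * (4 / (1 + (cmod (c - c) / r)\<^sup>2)\<^sup>2)) (at c)"
      using r by (intro tendsto_intros) auto
    moreover have "\<forall>\<^sub>F w in at c. 1 / b * (4 / (1 + (cmod (w - c) / r)\<^sup>2)\<^sup>2) = r\<^sup>2 * exp (2 * V w)"
      unfolding eventually_at
    proof (intro exI[of _ r] conjI r ballI impI)
      fix w assume w: "w \<noteq> c \<and> dist w c < r"
      then have y: "0 < cmod (w - c) / r" "cmod (w - c) / r \<le> 1" using r by (auto simp: dist_norm)
      have "r\<^sup>2 * exp (2 * V w) = model_metric a b \<alpha> (D p) (Some ((w - c) / of_real r))" using m_off w by simp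
      also have "\<dots> = 1 / b * (4 / (1 + (cmod (w - c) / r)\<^sup>2)\<^sup>2)"
        using y r \<alpha>0 by (simp add: model_metric_def norm_divide)
      finally show "1 / b * (4 / (1 + (cmod (w - c) / r)\<^sup>2)\<^sup>2) = r\<^sup>2 * exp (2 * V w)" ..
    qed
    ultimately have "((\<lambda>w. r\<^sup>2 * exp (2 * V w)) \<longlongrightarrow> 1 / b * (4 / (1 + (cmod (c - c) / r)\<^sup>2)\<^sup>2)) (at c)"
      by (rule Lim_transform_eventually)
    from tendsto_unique[OF _ l1 this] show ?thesis using \<alpha>0 by (simp add: model_metric_def)
  qed
  show ?thesis
  proof (rule isometry_of_affine_chart[where D = D and p = p and c = c and \<alpha> = \<alpha>, OF r _ _ Dp])
    show "D (mchart p w) = (if w = c then \<alpha> else 0)" for w using off at_c by auto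
    show "model_metric a b \<alpha> (D p) (Some ((w - c) / of_real r)) = r\<^sup>2 * mdens g p w" if "D (mchart p w) = 0" for w
      using m_off[of w] m_c at_c dens[OF that] that by (cases "w = c") auto
  qed
qed

lemma metric_isCont:
  assumes "z \<notin> P"
  shows "isCont (\<lambda>w. g (Some w)) z" "g (Some z) > 0"
proof -
  obtain U where U: "open U" "z \<in> U" "\<And>w. w \<in> U \<Longrightarrow> g (Some w) > 0"
    using regular[OF assms] unfolding regular_at_def by blast
  define v where "v w = ln (g (Some w)) / 2" for w
  have "isCont v z" unfolding v_def[abs_def] by (rule C1_at_isCont[OF regular_at_C1[OF regular[OF assms]]])
  then have "isCont (\<lambda>w. exp (2 * v w)) z" by (intro continuous_intros)
  moreover have "\<forall>\<^sub>F w in nhds z. exp (2 * v w) = g (Some w)"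
    using eventually_nhds_in_open[OF U(1,2)] by eventually_elim (simp add: U(3) v_def)
  ultimately show "isCont (\<lambda>w. g (Some w)) z" by (simp only: isCont_cong)
  show "g (Some z) > 0" using U by blast
qed

text \<open>The model metric jumps across the unit circle unless equality holds, while an isometry
  expresses it through continuous data.\<close>

lemma equality_if_isometric:
  assumes iso: "isometric D g (model_divisor \<alpha> \<beta>) (model_metric a b \<alpha> \<beta>)"
  shows "(1 + \<alpha>)\<^sup>2 / b = (1 + \<beta>)\<^sup>2 / a"
proof -
  define M where "M = model_metric a b \<alpha> \<beta>"
  obtain F where homeo: "homeomorphic_map sphere_top sphere_top F"
    and div: "\<And>q. model_divisor \<alpha> \<beta> (F q) = D q"
    and loc: "\<And>q. D q = 0 \<Longrightarrow> \<exists>U L. open U \<and> coord q q \<in> U \<and>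
           (\<forall>z\<in>U. ((\<lambda>z. coord (F q) (F (param q z))) has_derivative blinfun_apply (L z)) (at z)) \<and>
           continuous_on U L \<and> (\<forall>v. M (F q) * (cmod (blinfun_apply (L (coord q q)) v))\<^sup>2 = g q * (cmod v)\<^sup>2)"
    using iso unfolding isometric_def conic_isometry_def M_def by blast
  obtain h where h: "continuous_map sphere_top sphere_top h" "\<And>q. h (F q) = q" "\<And>q. F (h q) = q"
    using homeo unfolding homeomorphic_map_maps homeomorphic_maps_def by auto
  \<comment> \<open>By injectivity the inverse cannot send both 1 and -1 to \<infinity>; a finite
    preimage allows the coordinate z on the source.\<close>
  have "\<exists>y. cmod y = 1 \<and> h (Some y) \<noteq> None"
  proof (rule ccontr)
    assume "\<not> ?thesis"
    then have "h (Some 1) = h (Some (-1))" by (metis norm_minus_cancel norm_one)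
    then show False using h(3)[of "Some 1"] h(3)[of "Some (-1)"] by simp
  qed
  then obtain y z0 where y: "cmod y = 1" and z0: "h (Some y) = Some z0" by auto
  have F0: "F (Some z0) = Some y" using h(3)[of "Some y"] z0 by simp
  have "y \<noteq> 0" using y by auto
  then have z0P: "z0 \<notin> P" using div[of "Some z0"] by (auto simp: F0 P_def model_divisor_def)
  have oP: "open (- P)" using finite_imp_closed[OF finP] by auto
  define f where "f z = coord (Some 0) (F (Some z))" for z
  have fder: "\<exists>U L. open U \<and> z \<in> U \<and> (\<forall>w\<in>U. (f has_derivative blinfun_apply (L w)) (at w)) \<and>
      continuous_on U L \<and> (\<forall>v. M (F (Some z)) * (cmod (blinfun_apply (L z) v))\<^sup>2 = g (Some z) * (cmod v)\<^sup>2)"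
    if z: "z \<notin> P" "F (Some z) \<noteq> None" for z
  proof -
    have "(\<lambda>w. coord (F (Some z)) (F (param (Some z) w))) = f"
      using z(2) by (auto simp: f_def coord_def param_def fun_eq_iff)
    moreover have "coord (Some z) (Some z) = z" by (simp add: coord_def)
    moreover have "D (Some z) = 0" using z(1) by (simp add: P_def)
    ultimately show ?thesis using loc[of "Some z"] by simp
  qed
  obtain U L where U: "open U" "z0 \<in> U" and L: "\<And>w. w \<in> U \<Longrightarrow> (f has_derivative blinfun_apply (L w)) (at w)"
    and Lc: "continuous_on U L"
    and L0: "\<And>v. M (Some y) * (cmod (blinfun_apply (L z0) v))\<^sup>2 = g (Some z0) * (cmod v)\<^sup>2"
    using fder[OF z0P] unfolding F0 by blast
  define N where "N z = cmod (blinfun_apply (L z) 1)" for z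
  \<comment> \<open>The differential \<open>L\<close> was obtained for the base point only.
    Uniqueness of the derivative identifies it at nearby points with their own witness, so the
    metric identity holds with the continuous scale factor \<open>N\<close>.\<close>
  have key: "M (F (Some z)) * (N z)\<^sup>2 = g (Some z)" if z: "z \<in> U" "z \<notin> P" "F (Some z) \<noteq> None" for z
  proof -
    obtain U' L' where U': "z \<in> U'" "\<And>w. w \<in> U' \<Longrightarrow> (f has_derivative blinfun_apply (L' w)) (at w)"
      and eq: "\<And>v. M (F (Some z)) * (cmod (blinfun_apply (L' z) v))\<^sup>2 = g (Some z) * (cmod v)\<^sup>2"
      using fder[OF z(2,3)] by blast
    have "blinfun_apply (L z) = blinfun_apply (L' z)"
      using L[OF z(1)] U'(2)[OF U'(1)] by (rule has_derivative_unique)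
    then show ?thesis using eq[of 1] by (simp add: N_def)
  qed
  have Nc: "isCont N z0"
  proof -
    have "isCont L z0" using Lc U by (simp add: continuous_on_eq_continuous_at)
    then show ?thesis unfolding N_def[abs_def] by (intro continuous_intros)
  qed
  \<comment> \<open>Preimage of the ray through \<open>y\<close> as it approaches the unit circle
    from outside, where the outer formula of the model holds; the default 0 is eventually
    irrelevant.\<close>
  define Z where "Z t = (case h (Some (of_real t * y)) of Some z \<Rightarrow> z | None \<Rightarrow> 0)" for t
  have yt: "((\<lambda>t. of_real t * y) \<longlongrightarrow> y) (at_right 1)"
  proof -
    have "((\<lambda>t. of_real t * y) \<longlongrightarrow> of_real 1 * y) (at_right 1)" by (intro tendsto_intros)
    then show ?thesis by simp
  qed
  have near: "\<forall>\<^sub>F t in at_right 1. h (Some (of_real t * y)) \<in> Some ` B" if B: "open B" "z0 \<in> B" for B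
  proof -
    have "openin sphere_top {q \<in> topspace sphere_top. h q \<in> Some ` B}"
      by (rule openin_continuous_map_preimage[OF h(1) sphere_open_Some[OF B(1)]])
    then have o: "openin sphere_top {q. h q \<in> Some ` B}" by simp
    have "open {w. h (Some w) \<in> Some ` B}"
    proof -
      from o consider V where "open V" "{q. h q \<in> Some ` B} = Some ` V"
        | C where "compact C" "{q. h q \<in> Some ` B} = insert None (Some ` (- C))" unfolding sphere_open by blast
      then show ?thesis
      proof cases
        case 1
        then have "{w. h (Some w) \<in> Some ` B} = V" by auto
        then show ?thesis using 1 by simp
      next
        case 2
        then have "{w. h (Some w) \<in> Some ` B} = - C" by auto
        then show ?thesis using 2 by (simp add: compact_imp_closed open_Compl)
      qed
    qed
    from topological_tendstoD[OF yt this] show ?thesis using z0 B by simp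
  qed
  have Zh: "h (Some (of_real t * y)) = Some (Z t) \<and> Z t \<in> B" if "h (Some (of_real t * y)) \<in> Some ` B" for t B
    using that by (auto simp: Z_def)
  have Zt: "(Z \<longlongrightarrow> z0) (at_right 1)"
  proof (rule topological_tendstoI)
    fix B assume "open B" "z0 \<in> B"
    from near[OF this] show "\<forall>\<^sub>F t in at_right 1. Z t \<in> B" by eventually_elim (use Zh in blast)
  qed
  have ev: "\<forall>\<^sub>F t in at_right 1. M (Some (of_real t * y)) * (N (Z t))\<^sup>2 = g (Some (Z t))"
  proof (rule eventually_mono)
    show "\<forall>\<^sub>F t in at_right 1. h (Some (of_real t * y)) \<in> Some ` (U \<inter> - P)"
      by (rule near) (use U z0P oP in auto)
    show "M (Some (of_real t * y)) * (N (Z t))\<^sup>2 = g (Some (Z t))" if "h (Some (of_real t * y)) \<in> Some ` (U \<inter> - P)" for t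
    proof -
      have 1: "h (Some (of_real t * y)) = Some (Z t)" "Z t \<in> U" "Z t \<notin> P" using Zh[OF that] by auto
      then have "F (Some (Z t)) = Some (of_real t * y)" using h(3)[of "Some (of_real t * y)"] by simp
      then show ?thesis using key[OF 1(2,3)] by simp
    qed
  qed
  have evM: "\<forall>\<^sub>F t in at_right 1. 1 / a * (4 * (1 + \<beta>)\<^sup>2 / ((1 + 1 / t powr (2 + 2 * \<beta>))\<^sup>2 * t powr (4 + 2 * \<beta>))) = M (Some (of_real t * y))"
    using eventually_at_right_less[of "1::real"]
    by eventually_elim (use y in \<open>auto simp: M_def model_metric_def norm_mult\<close>)
  \<comment> \<open>At t = 1 the fraction 4/(1 + 1)^2 is 1, so the outer limit is (1 + \<beta>)^2 /
    a; on the circle itself the inner formula gives (1 + \<alpha>)^2 / b.\<close>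
  have "((\<lambda>t::real. 1 / a * (4 * (1 + \<beta>)\<^sup>2 / ((1 + 1 / t powr (2 + 2 * \<beta>))\<^sup>2 * t powr (4 + 2 * \<beta>)))) \<longlongrightarrow>
      1 / a * (4 * (1 + \<beta>)\<^sup>2 / ((1 + 1 / 1 powr (2 + 2 * \<beta>))\<^sup>2 * 1 powr (4 + 2 * \<beta>)))) (at_right 1)"
    by (intro tendsto_intros) auto
  from Lim_transform_eventually[OF this evM]
  have Ml: "((\<lambda>t. M (Some (of_real t * y))) \<longlongrightarrow> (1 + \<beta>)\<^sup>2 / a) (at_right 1)" by simp
  have "((\<lambda>t. M (Some (of_real t * y)) * (N (Z t))\<^sup>2) \<longlongrightarrow> (1 + \<beta>)\<^sup>2 / a * (N z0)\<^sup>2) (at_right 1)"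
    by (intro tendsto_intros Ml isCont_tendsto_compose[OF Nc] Zt)
  from Lim_transform_eventually[OF this ev]
  have l1: "((\<lambda>t. g (Some (Z t))) \<longlongrightarrow> (1 + \<beta>)\<^sup>2 / a * (N z0)\<^sup>2) (at_right 1)" .
  have l2: "((\<lambda>t. g (Some (Z t))) \<longlongrightarrow> g (Some z0)) (at_right 1)"
    by (rule isCont_tendsto_compose[OF metric_isCont(1)[OF z0P] Zt])
  have "(1 + \<beta>)\<^sup>2 / a * (N z0)\<^sup>2 = g (Some z0)" by (rule tendsto_unique[OF _ l1 l2]) simp
  moreover have "M (Some y) * (N z0)\<^sup>2 = g (Some z0)" using L0[of 1] by (simp add: N_def)
  moreover have "M (Some y) = (1 + \<alpha>)\<^sup>2 / b" using y by (simp add: M_def model_metric_def)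
  moreover have "N z0 \<noteq> 0" using calculation(1) metric_isCont(2)[OF z0P] by auto
  ultimately have "(1 + \<alpha>)\<^sup>2 / b * (N z0)\<^sup>2 = (1 + \<beta>)\<^sup>2 / a * (N z0)\<^sup>2" by (simp only:)
  then show ?thesis using \<open>N z0 \<noteq> 0\<close> by (simp only: mult_cancel_right power_eq_0_iff) simp
qed

end

text \<open>Monotonicity makes \<open>p 1\<close> a point of least order, and it is the one placed
  at \<infinity>. Supercriticality says \<alpha> > \<beta>, which yields both \<alpha> > -1 and
  \<beta> < 0.\<close>

theorem corollary1p7:
  fixes n :: nat and \<beta>s :: "nat \<Rightarrow> real" and p :: "nat \<Rightarrow> sphere"
    and g :: metric_coeff and a b \<alpha> \<beta> :: real
  assumes "n \<ge> 1"
    and "inj_on p {1..n}"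
    and "-1 < \<beta>s 1" and "mono_on {1..n} \<beta>s" and "\<beta>s n \<le> 0"
    and "supercritical n \<beta>s"
    and "conic_sphere (divisor n \<beta>s p) g"
    and "\<beta> = Min (\<beta>s ` {1..n})"
    and "\<alpha> = (\<Sum>i\<in>{1..n}. \<beta>s i) - Min (\<beta>s ` {1..n})"
    and "0 < a"
    and "AE z in lborel. a \<le> gauss_curvature g z \<and> gauss_curvature g z \<le> b"
  shows "a / b \<le> (\<beta> + 1)\<^sup>2 / (\<alpha> + 1)\<^sup>2 \<and>
    (a / b = (\<beta> + 1)\<^sup>2 / (\<alpha> + 1)\<^sup>2 \<longleftrightarrow>
      isometric (divisor n \<beta>s p) g (model_divisor \<alpha> \<beta>) (model_metric a b \<alpha> \<beta>))"
proof -
  define D where "D = divisor n \<beta>s p"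
  have mono: "\<beta>s i \<le> \<beta>s j" if "1 \<le> i" "i \<le> j" "j \<le> n" for i j
    using mono_onD[OF assms(4), of i j] that by simp
  have bounds: "\<beta>s 1 \<le> \<beta>s i" "\<beta>s i \<le> 0" if "i \<in> {1..n}" for i
    using mono[of 1 i] mono[of i n] assms(5) that by auto
  have "Min (\<beta>s ` {1..n}) = \<beta>s 1" by (rule Min_eqI) (use bounds assms(1) in auto)
  then have \<beta>: "\<beta> = \<beta>s 1" and \<alpha>: "\<alpha> = (\<Sum>i\<in>{1..n}. \<beta>s i) - \<beta>s 1" and sup: "\<alpha> > \<beta>"
    using assms(6,8,9) by (auto simp: supercritical_def)
  \<comment> \<open>If the least order were 0, all orders would vanish and \<alpha> = \<beta> = 0,
    against supercriticality. So \<open>p 1\<close> is a true cone point, as the construction of the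
    isometry requires.\<close>
  have \<beta>neg: "\<beta> < 0"
  proof (rule ccontr)
    assume "\<not> \<beta> < 0"
    then have "\<beta>s i = 0" if "i \<in> {1..n}" for i using bounds[OF that] \<beta> by simp
    then have "(\<Sum>i\<in>{1..n}. \<beta>s i) = 0" "\<beta> = 0" using \<beta> assms(1) by (auto intro: sum.neutral)
    then show False using sup \<alpha> \<beta> by simp
  qed
  have Dp: "D (p i) = \<beta>s i" if i: "i \<in> {1..n}" for i
  proof -
    have "D (p i) = (\<Sum>j\<in>{1..n}. if j = i then \<beta>s j else 0)"
      unfolding D_def divisor_def by (rule sum.cong) (use inj_onD[OF assms(2)] i in auto)
    then show ?thesis using i by simp
  qed
  have D0: "D q = 0" if "q \<notin> p ` {1..n}" for q
    unfolding D_def divisor_def by (rule sum.neutral) (use that in auto)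
  have Dcases: "D q = 0 \<or> (\<exists>i\<in>{1..n}. D q = \<beta>s i)" for q using Dp D0 by (cases "q \<in> p ` {1..n}") auto
  have sub: "{q. D q \<noteq> 0} \<subseteq> p ` {1..n}" using D0 by auto
  have "(\<Sum>q | D q \<noteq> 0. D q) = sum D (p ` {1..n})"
    by (rule sum.mono_neutral_left) (use sub in auto)
  also have "\<dots> = (\<Sum>i\<in>{1..n}. \<beta>s i)" by (subst sum.reindex[OF assms(2)]) (auto intro!: sum.cong Dp)
  finally have sumD: "(\<Sum>q | D q \<noteq> 0. D q) = (\<Sum>i\<in>{1..n}. \<beta>s i)" .
  interpret conic_metric D g a b
  proof
    show "conic_sphere D g" using assms(7) by (simp add: D_def)
    show "finite {q. D q \<noteq> 0}" by (rule finite_subset[OF sub]) simp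
    show "D q \<le> 0" "-1 < D q" for q
      using Dcases[of q] bounds assms(3) by (auto intro: less_le_trans)
  qed (use assms(10,11) in auto)
  have Dp1: "D (p 1) = \<beta>" using Dp[of 1] assms(1) \<beta> by simp
  have \<alpha>D: "\<alpha> = (\<Sum>q | D q \<noteq> 0. D q) - D (p 1)" using \<alpha> sumD Dp1 \<beta> by simp
  have gt: "-1 < \<alpha>" using sup assms(3) \<beta> by simp
  note pinch = pinching_at[of "p 1", folded \<alpha>D, OF gt, unfolded Dp1]
  have pos: "(\<alpha> + 1)\<^sup>2 > 0" using gt by simp
  have "a / b \<le> (\<beta> + 1)\<^sup>2 / (\<alpha> + 1)\<^sup>2"
    using pinch assms(10) pos by (simp add: field_simps)
  moreover have "a / b = (\<beta> + 1)\<^sup>2 / (\<alpha> + 1)\<^sup>2 \<longleftrightarrow> (1 + \<alpha>)\<^sup>2 / b = (1 + \<beta>)\<^sup>2 / a"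
    using pinch(1) assms(10) gt by (auto simp: field_simps)
  moreover have "(1 + \<alpha>)\<^sup>2 / b = (1 + \<beta>)\<^sup>2 / a \<longleftrightarrow> isometric D g (model_divisor \<alpha> \<beta>) (model_metric a b \<alpha> \<beta>)"
    using isometric_if_equality[OF \<alpha>D gt] Dp1 \<beta>neg equality_if_isometric by auto
  ultimately show ?thesis unfolding D_def by blast
qed

end
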